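(* Let $N\ge1$, $p\in(1,\infty)$, let $\Omega\subseteq\mathbb{R}^N$ be a bounded domain with Lipschitz boundary, let $\mu\in(0,\frac{p^2}{N})$, and let $g:\Omega\times\mathbb{R}\to\mathbb{R}$ be a Carathéodory function satisfying, with $h(t):=|t|^{p-2}t$: ($g_1$) $g\in L^\infty(\Omega\times K)$ for every compact $K\subset\mathbb{R}$; ($g_2$) $\lim_{|t|\to\infty}\frac{g(x,t)}{h(t)\ln|t|}=0$ uniformly in $\Omega$; ($g_3$) there exists $f\in L^\infty(\Omega)$ with $\lim_{t\to0}\frac{g(x,t)}{h(t)}=f(x)$ uniformly in $\Omega$; ($g_4$) $g(x,\cdot)\in C^1(\mathbb{R})$ for a.e. $x\in\Omega$ and there is a constant $\delta<\mu$ such that $t^2g'(x,t)+\delta|t|^p-(p-1)t\,g(x,t)\ge0$ for all $t\in\mathbb{R}$ and a.e. $x\in\Omega$, where $g'=\partial_t g$; ($g_5$) $\lim_{|t|\to\infty}\frac{t\,g'(x,t)}{h(t)\ln|t|}=0$ uniformly in $\Omega$. Then the problem $$L_{\Delta_p}u=g(x,u)+\mu|u|^{p-2}u\ln|u|\ \text{ in }\Omega,\qquad u=0\ \text{ in }\mathbb{R}^N\setminus\Omega,$$ has a nontrivial least energy (weak) solution. Moreover, if $G(x,t)\le G(x,|t|)$ for all $t\in\mathbb{R}$ and a.e. $x\in\Omega$, where $G(x,t):=\int_0^tg(x,\tau)\,d\tau$, then every least energy solution of this problem has constant sign in $\Omega$.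
   Context: Convention: $|t|^{p}\ln|t|=0$ and $h(t)\ln|t|=0$ at $t=0$. Functions on $\Omega$ are extended by $0$ to $\mathbb{R}^N$. $C_{N,p}:=\frac{p\,\Gamma(N/2)}{2\pi^{N/2}}$, $\;[u]_{X_{L_{\Delta_p}}(\Omega)}^p:=C_{N,p}\iint_{x,y\in\mathbb{R}^N,\,|x-y|\le 1}\frac{|u(x)-u(y)|^p}{|x-y|^N}\,dx\,dy$, and $X_{L_{\Delta_p}}(\Omega):=\{u\in L^p(\Omega): [u]_{X_{L_{\Delta_p}}(\Omega)}<\infty,\ u=0\text{ in }\mathbb{R}^N\setminus\Omega\}$ with norm $(\|u\|_{L^p(\Omega)}^p+[u]_{X_{L_{\Delta_p}}(\Omega)}^p)^{1/p}$. Let $\Upsilon(z_1,z_2,t_1,t_2):=h(z_1-z_2)(t_1-t_2)-h(z_1)t_1-h(z_2)t_2$. For $u,v\in X_{L_{\Delta_p}}(\Omega)$, $$\mathcal{E}_{L_{\Delta_p}}(u,v):=\frac{C_{N,p}}{2}\iint_{|x-y|\le1}\frac{h(u(x)-u(y))(v(x)-v(y))}{|x-y|^N}dxdy+\frac{C_{N,p}}{2}\iint_{|x-y|\ge1}\frac{\Upsilon(u(x),u(y),v(x),v(y))}{|x-y|^N}dxdy+\rho_N\int_{\mathbb{R}^N}h(u)v\,dx,$$ where $\rho_N:=2\ln2-\gamma_E+\frac p2\psi_0(\frac N2)$, $\gamma_E=-\Gamma'(1)$, $\psi_0=\Gamma'/\Gamma$. A weak solution of the problem is a $u\in X_{L_{\Delta_p}}(\Omega)$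 with $\mathcal{E}_{L_{\Delta_p}}(u,v)=\int_\Omega g(x,u)v\,dx+\mu\int_\Omega h(u)\ln|u|\,v\,dx$ for all $v\in X_{L_{\Delta_p}}(\Omega)$. The energy functional is $$J_{L_{\Delta_p}}(u):=\frac1p\mathcal{E}_{L_{\Delta_p}}(u,u)-\int_\Omega G(x,u)\,dx-\frac{\mu}{p^2}\int_\Omega|u|^p(\ln|u|^p-1)\,dx,$$ and the Nehari manifold is $\mathcal{N}_{L_{\Delta_p}}:=\{u\in X_{L_{\Delta_p}}(\Omega)\setminus\{0\}:\mathcal{E}_{L_{\Delta_p}}(u,u)=\int_\Omega g(x,u)u\,dx+\mu\int_\Omega|u|^p\ln|u|\,dx\}$. A weak solution $u$ is of least energy if $J_{L_{\Delta_p}}(u)=\inf_{v\in\mathcal{N}_{L_{\Delta_p}}}J_{L_{\Delta_p}}(v)$. "Constant sign" means $u\ge0$ a.e. in $\Omega$ or $u\le0$ a.e. in $\Omega$. *)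

theory Defs
  imports "HOL-Analysis.Analysis"
begin

section \<open>Domains, essential boundedness, uniform limits\<close>

text \<open>Near each boundary point, after a rotation making \<open>e\<close> the vertical direction, the set is the
  strict epigraph of a Lipschitz function \<open>\<gamma>\<close> defined on the hyperplane orthogonal to \<open>e\<close>.\<close>

definition lipschitz_boundary :: "'a::euclidean_space set \<Rightarrow> bool" where
  "lipschitz_boundary S \<longleftrightarrow>
     (\<forall>z\<in>frontier S. \<exists>r>0. \<exists>e L \<gamma>. norm e = 1 \<and> L-lipschitz_on {y. y \<bullet> e = 0} \<gamma> \<and>
        S \<inter> ball z r = {x \<in> ball z r. \<gamma> (x - (x \<bullet> e) *\<^sub>R e) < x \<bullet> e})"

definition bounded_lipschitz_domain :: "'a::euclidean_space set \<Rightarrow> bool" where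
  "bounded_lipschitz_domain S \<longleftrightarrow>
     S \<noteq> {} \<and> open S \<and> connected S \<and> bounded S \<and> lipschitz_boundary S"

definition L_infty :: "'a measure \<Rightarrow> ('a \<Rightarrow> real) \<Rightarrow> bool" where
  "L_infty M f \<longleftrightarrow> f \<in> borel_measurable M \<and> (\<exists>C. AE x in M. \<bar>f x\<bar> \<le> C)"

text \<open>Nonlinearities are only determined for almost every \<open>x\<close>, so a limit in \<open>t\<close> that is uniform in
  \<open>x\<close> is understood as uniform off one null set, which does not depend on \<open>t\<close>.\<close>

definition uniform_limit_AE ::
    "'a measure \<Rightarrow> ('t \<Rightarrow> 'a \<Rightarrow> real) \<Rightarrow> ('a \<Rightarrow> real) \<Rightarrow> 't filter \<Rightarrow> bool" where
  "uniform_limit_AE M f l F \<longleftrightarrow> (\<exists>Z\<in>null_sets M. uniform_limit (space M - Z) f l F)"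

definition caratheodory :: "'a::euclidean_space set \<Rightarrow> ('a \<Rightarrow> real \<Rightarrow> real) \<Rightarrow> bool" where
  "caratheodory \<Omega> g \<longleftrightarrow>
     (\<forall>t. (\<lambda>x. g x t) \<in> borel_measurable (lebesgue_on \<Omega>)) \<and>
     (AE x in lebesgue_on \<Omega>. continuous_on UNIV (g x))"


section \<open>The logarithmic \<open>p\<close>-Laplacian\<close>

text \<open>Since \<open>0 powr a = 0\<close> and the logarithm is total, \<open>h 0 = 0\<close> and the conventions
  \<open>\<bar>t\<bar>\<^sup>p ln \<bar>t\<bar> = 0\<close>, \<open>h t ln \<bar>t\<bar> = 0\<close> at \<open>t = 0\<close> hold automatically.\<close>

definition h :: "real \<Rightarrow> real \<Rightarrow> real" where
  "h p t = \<bar>t\<bar> powr (p - 2) * t"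

definition C_const :: "nat \<Rightarrow> real \<Rightarrow> real" where
  "C_const N p = p * Gamma (real N / 2) / (2 * pi powr (real N / 2))"

definition rho_const :: "nat \<Rightarrow> real \<Rightarrow> real" where
  "rho_const N p = 2 * ln 2 - euler_mascheroni + p / 2 * Digamma (real N / 2)"

definition Upsilon :: "real \<Rightarrow> real \<Rightarrow> real \<Rightarrow> real \<Rightarrow> real \<Rightarrow> real" where
  "Upsilon p z1 z2 t1 t2 = h p (z1 - z2) * (t1 - t2) - h p z1 * t1 - h p z2 * t2"

text \<open>The \<open>p\<close>-th power of the seminorm, with value \<open>\<infinity>\<close> allowed.\<close>

definition X_seminorm_pow :: "real \<Rightarrow> (real ^ 'n \<Rightarrow> real) \<Rightarrow> ennreal" where
  "X_seminorm_pow p u = ennreal (C_const CARD('n) p) *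
     (\<integral>\<^sup>+ (x, y). ennreal (\<bar>u x - u y\<bar> powr p / norm (x - y) ^ CARD('n))
                  * indicator {(x, y). norm (x - y) \<le> 1} (x, y)
       \<partial>(lebesgue \<Otimes>\<^sub>M lebesgue))"

text \<open>Elements are representatives, defined on the whole space, of classes modulo equality almost
  everywhere; accordingly \<open>u \<noteq> 0\<close> means that \<open>u\<close> does not vanish almost everywhere.\<close>

definition X_space :: "real \<Rightarrow> (real ^ 'n) set \<Rightarrow> (real ^ 'n \<Rightarrow> real) set" where
  "X_space p \<Omega> = {u. u \<in> borel_measurable lebesgue \<and>
     integrable (lebesgue_on \<Omega>) (\<lambda>x. \<bar>u x\<bar> powr p) \<and>
     X_seminorm_pow p u < \<infinity> \<and>
     (AE x in lebesgue. x \<notin> \<Omega> \<longrightarrow> u x = 0)}"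

definition nontrivial :: "(real ^ 'n \<Rightarrow> real) \<Rightarrow> bool" where
  "nontrivial u \<longleftrightarrow> \<not> (AE x in lebesgue. u x = 0)"

definition E_form :: "real \<Rightarrow> (real ^ 'n \<Rightarrow> real) \<Rightarrow> (real ^ 'n \<Rightarrow> real) \<Rightarrow> real" where
  "E_form p u v =
     C_const CARD('n) p / 2 *
       set_lebesgue_integral (lebesgue \<Otimes>\<^sub>M lebesgue) {(x, y). norm (x - y) \<le> 1}
         (\<lambda>(x, y). h p (u x - u y) * (v x - v y) / norm (x - y) ^ CARD('n))
   + C_const CARD('n) p / 2 *
       set_lebesgue_integral (lebesgue \<Otimes>\<^sub>M lebesgue) {(x, y). norm (x - y) \<ge> 1}
         (\<lambda>(x, y). Upsilon p (u x) (u y) (v x) (v y) / norm (x - y) ^ CARD('n))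
   + rho_const CARD('n) p * (LINT x|lebesgue. h p (u x) * v x)"


section \<open>The boundary value problem\<close>

definition weak_solution ::
    "real \<Rightarrow> real \<Rightarrow> (real ^ 'n) set \<Rightarrow> (real ^ 'n \<Rightarrow> real \<Rightarrow> real) \<Rightarrow> (real ^ 'n \<Rightarrow> real) \<Rightarrow> bool" where
  "weak_solution p \<mu> \<Omega> g u \<longleftrightarrow> u \<in> X_space p \<Omega> \<and>
     (\<forall>v\<in>X_space p \<Omega>.
        E_form p u v = (LINT x|lebesgue_on \<Omega>. g x (u x) * v x)
                       + \<mu> * (LINT x|lebesgue_on \<Omega>. h p (u x) * ln \<bar>u x\<bar> * v x))"

definition primitive :: "('a \<Rightarrow> real \<Rightarrow> real) \<Rightarrow> 'a \<Rightarrow> real \<Rightarrow> real" where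
  "primitive g x t = (LBINT \<tau>=ereal 0..ereal t. g x \<tau>)"

definition J_energy ::
    "real \<Rightarrow> real \<Rightarrow> (real ^ 'n) set \<Rightarrow> (real ^ 'n \<Rightarrow> real \<Rightarrow> real) \<Rightarrow> (real ^ 'n \<Rightarrow> real) \<Rightarrow> real" where
  "J_energy p \<mu> \<Omega> g u =
     1 / p * E_form p u u
     - (LINT x|lebesgue_on \<Omega>. primitive g x (u x))
     - \<mu> / p\<^sup>2 * (LINT x|lebesgue_on \<Omega>. \<bar>u x\<bar> powr p * (ln (\<bar>u x\<bar> powr p) - 1))"

definition nehari ::
    "real \<Rightarrow> real \<Rightarrow> (real ^ 'n) set \<Rightarrow> (real ^ 'n \<Rightarrow> real \<Rightarrow> real) \<Rightarrow> (real ^ 'n \<Rightarrow> real) set" where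
  "nehari p \<mu> \<Omega> g = {u \<in> X_space p \<Omega>. nontrivial u \<and>
     E_form p u u = (LINT x|lebesgue_on \<Omega>. g x (u x) * u x)
                    + \<mu> * (LINT x|lebesgue_on \<Omega>. \<bar>u x\<bar> powr p * ln \<bar>u x\<bar>)}"

text \<open>The infimum is taken in the extended reals, so that it is meaningful without knowing in advance
  that the Nehari manifold is nonempty and the energy is bounded below on it.\<close>

definition least_energy_solution ::
    "real \<Rightarrow> real \<Rightarrow> (real ^ 'n) set \<Rightarrow> (real ^ 'n \<Rightarrow> real \<Rightarrow> real) \<Rightarrow> (real ^ 'n \<Rightarrow> real) \<Rightarrow> bool" where
  "least_energy_solution p \<mu> \<Omega> g u \<longleftrightarrow> weak_solution p \<mu> \<Omega> g u \<and>
     ereal (J_energy p \<mu> \<Omega> g u) = (INF v\<in>nehari p \<mu> \<Omega> g. ereal (J_energy p \<mu> \<Omega> g v))"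

definition constant_sign :: "(real ^ 'n) set \<Rightarrow> (real ^ 'n \<Rightarrow> real) \<Rightarrow> bool" where
  "constant_sign \<Omega> u \<longleftrightarrow>
     (AE x in lebesgue_on \<Omega>. u x \<ge> 0) \<or> (AE x in lebesgue_on \<Omega>. u x \<le> 0)"

end

theory Submission
  imports Defs "HOL-Complex_Analysis.Great_Picard" "HOL-Real_Asymp.Real_Asymp"
begin

text \<open>
  For functions vanishing outside \<open>\<Omega>\<close> the far interaction contributes a bounded potential, so
  \<open>E(u,v) = A(u,v) - \<integral> \<kappa> h(u) v\<close> with \<open>A\<close> given by a nonnegative kernel, and \<open>\<kappa> h\<close> is absorbed into the
  nonlinearity. The bound on \<open>\<mu>\<close> enters through an elementary logarithmic Sobolev estimate: if
  \<open>\<parallel>u\<parallel>\<^sub>p \<le> R\<close> then \<open>{|u| \<ge> e |u(x)|}\<close> has measure at most \<open>R\<^sup>p (e |u(x)|)\<close> to the power \<open>- p\<close>, so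
  integrating the kernel over the rest of the unit ball around \<open>x\<close> produces \<open>p\<^sup>2/N ln |u(x)|\<close> up to a
  factor \<open>(1 - e)\<^sup>p\<close> and a constant. The two orderings of a pair of points are counted separately, which
  makes the constant sharp.

  Condition \<open>(g\<^sub>4)\<close> makes \<open>J\<close> maximal along each ray exactly at its Nehari point. Rescale a minimizing
  sequence to unit \<open>L\<^sup>p\<close> norm; the energies on the rays stay bounded, so the sequence is bounded in the
  energy space and, averaging against a truncated kernel of large mass, has a subsequence converging
  almost everywhere. The estimate gives uniform integrability of \<open>|u|\<^sup>p\<close> (the limit is nonzero) and lower
  semicontinuity of \<open>J\<close> (the region where \<open>|u|\<close> is large contributes nonnegatively), so the Nehari point
  on the ray of the limit is a minimizer. A one-sided variation along Nehari points shows that it is a weak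
  solution. Finally \<open>|u|\<close> has strictly smaller energy than a sign-changing \<open>u\<close> on the whole ray.
\<close>

subsection \<open>The power nonlinearity\<close>

text \<open>The singularity |x - y|^(-N) is the borderline one: the energy gains a single logarithm,
  the same order as the critical term |u|^p ln|u|. Bounded energy therefore bounds the integral of
  that term but does not make its tails uniformly small, so lower semicontinuity of - \<integral> H
  cannot be had separately. Energy and nonlinearity are compared on the same superlevel set, for
  each function of the sequence, before any limit is taken. Since h(t) ln|t| is not differentiable
  at 0 when p \<le> 2, the constraint functional \<open>Nh\<close> is used only through continuity
  and the intermediate value theorem, and no Lagrange multiplier occurs. The gap between \<delta>
  and \<mu> replaces differentiability: it gives a strict logarithmic decrease along every ray.
  Compactness rests on the infinite mass of the kernel near the diagonal: averaging against a
  truncation of mass c approximates a function up to an error of order energy / c. The hypotheses on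
  g hold only off null sets, whereas the variational part asks for them at every point; g is
  therefore replaced by 0 on one exceptional null set.\<close>

lemma h_zero [simp]: "h p 0 = 0"
  by (simp add: h_def)

lemma h_minus [simp]: "h p (- t) = - h p t"
  by (simp add: h_def)

lemma h_mult_self: "h p t * t = \<bar>t\<bar> powr p"
proof (cases "t = 0")
  case False
  then have "\<bar>t\<bar> powr (p - 2) * \<bar>t\<bar> powr 2 = \<bar>t\<bar> powr p"
    by (simp only: powr_add [symmetric]) simp
  then show ?thesis using False by (simp add: h_def power2_eq_square)
qed (simp add: h_def)

lemma abs_h: "\<bar>h p t\<bar> = \<bar>t\<bar> powr (p - 1)"
proof (cases "t = 0")
  case False
  then have "\<bar>t\<bar> powr (p - 2) * \<bar>t\<bar> powr 1 = \<bar>t\<bar> powr (p - 1)"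
    by (simp only: powr_add [symmetric]) simp
  then show ?thesis using False by (simp add: h_def abs_mult)
qed (simp add: h_def)

lemma h_scale: "0 < t \<Longrightarrow> h p (t * s) = t powr (p - 1) * h p s"
  by (simp add: h_def abs_mult powr_mult powr_diff powr_numeral power2_eq_square field_simps)

text \<open>Zero is the one point where the algebraic formulas give no continuity. If the modulus of
  \<open>f t\<close> depends on \<open>\<bar>t\<bar>\<close> alone, continuity there is a one-sided
  limit of an explicit function, which asymptotic expansion decides.\<close>

lemma isCont_zero_abs:
  fixes f :: "real \<Rightarrow> real"
  assumes "f 0 = 0" "\<And>t. \<bar>f t\<bar> = F \<bar>t\<bar>" "(F \<longlongrightarrow> 0) (at_right 0)"
  shows "isCont f 0"
proof -
  have "((\<lambda>t. F \<bar>t\<bar>) \<longlongrightarrow> 0) (at (0::real))"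
  proof (rule filterlim_compose[OF assms(3)])
    show "filterlim (\<lambda>t::real. \<bar>t\<bar>) (at_right 0) (at 0)"
      unfolding filterlim_at by (auto intro!: tendsto_eq_intros simp: eventually_at_filter)
  qed
  then have "(f \<longlongrightarrow> 0) (at 0)"
    using tendsto_rabs_zero_iff[of f "at 0"] assms(2) by simp
  then show ?thesis using assms(1) by (simp add: isCont_def)
qed

lemma isCont_h:
  assumes "1 < p" shows "isCont (h p) t"
proof (cases "t = 0")
  case False
  then show ?thesis unfolding h_def by (intro continuous_intros) auto
next
  case True
  have "((\<lambda>t::real. t powr (p - 1)) \<longlongrightarrow> 0) (at_right 0)"
    using assms by real_asymp
  then show ?thesis
    using isCont_zero_abs[of "h p" "\<lambda>t. t powr (p - 1)"] True by (simp add: abs_h)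
qed

lemma isCont_h_ln:
  assumes "1 < p" shows "isCont (\<lambda>t. h p t * ln \<bar>t\<bar>) t"
proof (cases "t = 0")
  case False
  then show ?thesis using assms
    by (intro continuous_intros isCont_h) auto
next
  case True
  have "((\<lambda>t::real. t powr (p - 1) * \<bar>ln t\<bar>) \<longlongrightarrow> 0) (at_right 0)"
    using assms by real_asymp
  then show ?thesis
    using isCont_zero_abs[of "\<lambda>t. h p t * ln \<bar>t\<bar>" "\<lambda>t. t powr (p - 1) * \<bar>ln t\<bar>"] True
    by (simp add: abs_mult abs_h)
qed

text \<open>Since \<open>0 / 0 = 0\<close>, the quotient \<open>f t / t\<close> takes the value 0 at
  0, and its continuity there says that the difference quotient of \<open>f\<close> at 0 tends to
  0.\<close>

lemma DERIV_zero_of_isCont: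
  fixes f :: "real \<Rightarrow> real"
  assumes "f 0 = 0" "isCont (\<lambda>t. f t / t) 0"
  shows "(f has_real_derivative 0) (at 0)"
  using assms by (simp add: DERIV_def isCont_def)

lemma DERIV_abs_nonzero:
  fixes t :: real
  assumes "t \<noteq> 0" shows "(abs has_real_derivative sgn t) (at t)"
proof (cases "0 < t")
  case True
  show ?thesis
    by (rule has_field_derivative_transform_within_open[of "\<lambda>x. x" _ _ "{0<..}"]) (use True in auto)
next
  case False
  show ?thesis
    by (rule has_field_derivative_transform_within_open[of "\<lambda>x. - x" _ _ "{..<0}"])
       (use False assms in \<open>auto intro!: derivative_eq_intros\<close>)
qed

lemma DERIV_abs_powr:
  assumes "1 < p"
  shows "((\<lambda>t. \<bar>t\<bar> powr p) has_real_derivative p * h p t) (at t)"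
proof (cases "t = 0")
  case False
  then show ?thesis
    by (auto intro!: derivative_eq_intros DERIV_abs_nonzero simp: h_def powr_diff powr_numeral power2_eq_square sgn_if field_simps)
next
  case True
  have "(\<lambda>t. \<bar>t\<bar> powr p / t) = h p"
    by (auto simp: fun_eq_iff h_mult_self[symmetric])
  then show ?thesis
    using DERIV_zero_of_isCont[of "\<lambda>t. \<bar>t\<bar> powr p"] isCont_h[OF assms, of 0] True by simp
qed

text \<open>The \<open>- 1\<close> cancels the term that comes from differentiating the logarithm.
  At 0 the quotient by \<open>t\<close> is a combination of \<open>h p t\<close> and
  \<open>h p t * ln \<bar>t\<bar>\<close>, both already known to be continuous there.\<close>

lemma DERIV_abs_powr_ln:
  assumes "1 < p"
  shows "((\<lambda>t. \<bar>t\<bar> powr p * (ln (\<bar>t\<bar> powr p) - 1)) has_real_derivative p\<^sup>2 * (h p t * ln \<bar>t\<bar>)) (at t)"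
proof (cases "t = 0")
  case False
  have "((\<lambda>t. \<bar>t\<bar> powr p * (p * ln \<bar>t\<bar> - 1)) has_real_derivative p\<^sup>2 * (h p t * ln \<bar>t\<bar>)) (at t)"
    using False
    by (auto intro!: derivative_eq_intros DERIV_abs_nonzero simp: h_def powr_diff powr_numeral power2_eq_square sgn_if field_simps)
  then show ?thesis
    by (rule DERIV_cong_ev[THEN iffD1, rotated -1])
       (use False in \<open>auto simp: ln_powr intro!: eventually_mono[OF t1_space_nhds[OF False]]\<close>)
next
  case True
  have "(\<lambda>t. (\<bar>t\<bar> powr p * (ln (\<bar>t\<bar> powr p) - 1)) / t) = (\<lambda>t. p * (h p t * ln \<bar>t\<bar>) - h p t)"
  proof
    fix t
    have "\<bar>t\<bar> powr p * (ln (\<bar>t\<bar> powr p) - 1) = t * (p * (h p t * ln \<bar>t\<bar>) - h p t)"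
      using h_mult_self[of p t] by (cases "t = 0") (auto simp: ln_powr algebra_simps)
    then show "(\<bar>t\<bar> powr p * (ln (\<bar>t\<bar> powr p) - 1)) / t = p * (h p t * ln \<bar>t\<bar>) - h p t"
      by (cases "t = 0") auto
  qed
  then show ?thesis
    using DERIV_zero_of_isCont[of "\<lambda>t. \<bar>t\<bar> powr p * (ln (\<bar>t\<bar> powr p) - 1)"] 
      isCont_h[OF assms, of 0]  isCont_h_ln[OF assms, of 0] True by simp
qed

lemma borel_measurable_h [measurable]: "h p \<in> borel_measurable borel"
  unfolding h_def by measurable

section \<open>Elementary inequalities and logarithmic growth functions\<close>

lemma powr_add_le:
  fixes a b :: real
  assumes "0 \<le> p" "0 \<le> a" "0 \<le> b"
  shows "(a + b) powr p \<le> 2 powr p * (a powr p + b powr p)"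
proof -
  have "(a + b) powr p \<le> (2 * max a b) powr p"
    using assms by (intro powr_mono2) auto
  also have "\<dots> = 2 powr p * (max a b) powr p" using assms by (simp add: powr_mult)
  also have "\<dots> \<le> 2 powr p * (a powr p + b powr p)"
    by (intro mult_left_mono) (auto simp: max_def)
  finally show ?thesis .
qed

lemma abs_diff_powr_le:
  fixes a b :: real
  assumes "0 \<le> p"
  shows "\<bar>a - b\<bar> powr p \<le> 2 powr p * (\<bar>a\<bar> powr p + \<bar>b\<bar> powr p)"
proof -
  have "\<bar>a - b\<bar> powr p \<le> (\<bar>a\<bar> + \<bar>b\<bar>) powr p"
    using assms by (intro powr_mono2) auto
  also have "\<dots> \<le> 2 powr p * (\<bar>a\<bar> powr p + \<bar>b\<bar> powr p)"
    using assms by (intro powr_add_le) auto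
  finally show ?thesis .
qed

text \<open>The positive part of \<open>ln \<bar>t\<bar>\<close>. The negative part becomes bounded
  once it is multiplied by a positive power of \<open>\<bar>t\<bar>\<close>, so all growth bounds
  are stated with this nonnegative monotone substitute.\<close>

definition lnp :: "real \<Rightarrow> real" where
  "lnp t = ln (max 1 \<bar>t\<bar>)"

definition llog :: "real \<Rightarrow> real \<Rightarrow> real" where
  "llog p t = \<bar>t\<bar> powr p * lnp t"

lemma lnp_nonneg [simp]: "0 \<le> lnp t"
  by (simp add: lnp_def)

lemma lnp_abs [simp]: "lnp \<bar>t\<bar> = lnp t"
  by (simp add: lnp_def)

lemma lnp_mono: "\<bar>s\<bar> \<le> \<bar>t\<bar> \<Longrightarrow> lnp s \<le> lnp t"
  by (simp add: lnp_def)

lemma lnp_eq: "1 \<le> \<bar>t\<bar> \<Longrightarrow> lnp t = ln \<bar>t\<bar>"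
  by (simp add: lnp_def max_def)

lemma lnp_eq_0: "\<bar>t\<bar> \<le> 1 \<Longrightarrow> lnp t = 0"
  by (simp add: lnp_def max_def)

lemma borel_measurable_lnp [measurable]: "lnp \<in> borel_measurable borel"
  unfolding lnp_def by measurable

lemma borel_measurable_llog [measurable]: "llog p \<in> borel_measurable borel"
  unfolding llog_def by measurable

lemma llog_nonneg [simp]: "0 \<le> llog p t"
  by (simp add: llog_def)

lemma llog_mono: "0 \<le> p \<Longrightarrow> \<bar>s\<bar> \<le> \<bar>t\<bar> \<Longrightarrow> llog p s \<le> llog p t"
  unfolding llog_def by (intro mult_mono powr_mono2 lnp_mono) auto

text \<open>Below 1 the constant comes from \<open>x * (- ln x) \<le> 1\<close> for
  \<open>x = \<bar>t\<bar> powr (p - 1)\<close>, because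
  \<open>ln x = (p - 1) * ln \<bar>t\<bar>\<close>.\<close>

lemma abs_h_ln_le:
  assumes "1 < p"
  shows "\<bar>h p t * ln \<bar>t\<bar>\<bar> \<le> 1 / (p - 1) + \<bar>t\<bar> powr (p - 1) * lnp t"
proof (cases "1 \<le> \<bar>t\<bar>")
  case True
  then show ?thesis using assms by (simp add: abs_mult abs_h lnp_eq)
next
  case False
  show ?thesis
  proof (cases "t = 0")
    case f: False
    define x where "x = \<bar>t\<bar> powr (p - 1)"
    have x: "0 < x" "x \<le> 1" using f False assms by (auto simp: x_def intro!: powr_le1)
    have "- ln x = ln (1 / x)" using x by (simp add: ln_div)
    also have "\<dots> \<le> 1 / x" using x ln_le_minus_one[of "1/x"] by simp
    finally have "x * (- ln x) \<le> 1" using x by (simp add: field_simps)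
    moreover have "ln x = (p - 1) * ln \<bar>t\<bar>" using f by (simp add: x_def ln_powr)
    ultimately have "x * (- ln \<bar>t\<bar>) \<le> 1 / (p - 1)" using assms by (simp add: field_simps)
    moreover have "\<bar>ln \<bar>t\<bar>\<bar> = - ln \<bar>t\<bar>" using False f by simp
    ultimately show ?thesis using False f by (simp add: abs_mult abs_h x_def lnp_eq_0)
  qed (use assms in \<open>auto simp: lnp_eq_0\<close>)
qed

lemma le_one_add_powr:
  fixes m :: real
  assumes "1 \<le> p" "0 \<le> m" shows "m \<le> 1 + m powr p"
proof (cases "m \<le> 1")
  case False
  then have "m powr 1 \<le> m powr p" using assms by (intro powr_mono) auto
  then show ?thesis using False by simp
qed (simp add: add_increasing2)

section \<open>Product integration over pairs of points\<close>

lemma sigma_finite_lebesgue: "sigma_finite_measure (lebesgue :: 'a::euclidean_space measure)"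
proof
  obtain A :: "'a set set" where A: "countable A" "A \<subseteq> sets lborel" "\<Union>A = space lborel"
     "\<forall>a\<in>A. emeasure lborel a \<noteq> \<infinity>"
    using lborel.sigma_finite_countable by blast
  then show "\<exists>A :: 'a set set. countable A \<and> A \<subseteq> sets lebesgue \<and> \<Union>A = space lebesgue \<and> (\<forall>a\<in>A. emeasure lebesgue a \<noteq> \<infinity>)"
    by (intro exI[of _ A]) (auto simp: emeasure_completion subset_iff)
qed

interpretation lebesgue: sigma_finite_measure "lebesgue :: 'a::euclidean_space measure"
  by (rule sigma_finite_lebesgue)

interpretation lebesgue_pair: pair_sigma_finite "lebesgue :: 'a::euclidean_space measure" "lebesgue :: 'b::euclidean_space measure" ..

subsection \<open>Lower bounds for the singular kernel\<close>

definition annulus :: "'a::real_normed_vector \<Rightarrow> real \<Rightarrow> real \<Rightarrow> 'a set" where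
  "annulus x a b = {y. a < norm (x - y) \<and> norm (x - y) \<le> b}"

lemma annulus_eq: "annulus x a b = cball x b - cball x a"
  by (auto simp: annulus_def dist_norm)

lemma sets_annulus [measurable]: "annulus (x::'a::euclidean_space) a b \<in> sets lebesgue"
  unfolding annulus_eq by (intro sets.Diff) auto

lemma emeasure_annulus:
  assumes "0 \<le> a" "a \<le> b"
  shows "emeasure lebesgue (annulus (x::'a::euclidean_space) a b) =
    ennreal (unit_ball_vol DIM('a) * (b ^ DIM('a) - a ^ DIM('a)))"
proof -
  have "emeasure lebesgue (annulus x a b) = emeasure lebesgue (cball x b) - emeasure lebesgue (cball x a)"
    unfolding annulus_eq
    by (rule emeasure_Diff) (use assms in \<open>auto simp: emeasure_cball emeasure_completion\<close>)
  also have "\<dots> = ennreal (unit_ball_vol DIM('a) * (b ^ DIM('a) - a ^ DIM('a)))"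
    using assms by (simp add: emeasure_cball right_diff_distrib ennreal_minus)
  finally show ?thesis .
qed

text \<open>On the diagonal the value is 0, as division by zero gives 0. Upper bounds by this kernel
  therefore need distinct points or a factor that vanishes on the diagonal.\<close>

definition inv_kernel :: "'a::euclidean_space \<Rightarrow> 'a \<Rightarrow> real" where
  "inv_kernel x y = 1 / norm (x - y) ^ DIM('a)"

lemma inv_kernel_nonneg [simp]: "0 \<le> inv_kernel x y"
  by (simp add: inv_kernel_def)

text \<open>The projections are measurable into the completed \<sigma>-algebra; composing them with
  the identity from \<open>lebesgue\<close> to \<open>borel\<close> makes continuous functions of a
  pair measurable for the product of the completed measures.\<close>

lemma borel_measurable_norm_diff [measurable]:
  "(\<lambda>z. norm (fst z - snd z)) \<in> borel_measurable (lebesgue \<Otimes>\<^sub>M (lebesgue :: 'a::euclidean_space measure))"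
proof -
  have id: "(\<lambda>x. x) \<in> borel_measurable (lebesgue :: 'a measure)"
    by (rule measurable_completion) simp
  have 1: "fst \<in> borel_measurable ((lebesgue :: 'a measure) \<Otimes>\<^sub>M (lebesgue :: 'a measure))"
    using measurable_compose[OF measurable_fst[of lebesgue "lebesgue :: 'a measure"] id] by simp
  have 2: "snd \<in> borel_measurable ((lebesgue :: 'a measure) \<Otimes>\<^sub>M (lebesgue :: 'a measure))"
    using measurable_compose[OF measurable_snd[of "lebesgue :: 'a measure" lebesgue] id] by simp
  show ?thesis using 1 2 by measurable
qed

lemma borel_measurable_norm_diff_Pair [measurable]:
  "(\<lambda>y. norm (x - y)) \<in> borel_measurable (lebesgue :: 'a::euclidean_space measure)"
  by (intro measurable_completion) simp

lemma borel_measurable_inv_kernel [measurable]: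
  "(\<lambda>z. inv_kernel (fst z) (snd z)) \<in> borel_measurable (lebesgue \<Otimes>\<^sub>M (lebesgue :: 'a::euclidean_space measure))"
  unfolding inv_kernel_def by measurable

lemma borel_measurable_inv_kernel_Pair [measurable]:
  "inv_kernel x \<in> borel_measurable (lebesgue :: 'a::euclidean_space measure)"
  unfolding inv_kernel_def by measurable

text \<open>On the shell the kernel is at least its value at the outer radius \<open>b\<close>; that
  value times the volume of the shell is the bound.\<close>

lemma nn_integral_annulus_shell:
  fixes x :: "'a::euclidean_space"
  assumes "0 < a" "a \<le> b"
  shows "ennreal (unit_ball_vol DIM('a) * (1 - (a / b) ^ DIM('a)))
    \<le> (\<integral>\<^sup>+ y. ennreal (inv_kernel x y) * indicator (annulus x a b) y \<partial>lebesgue)"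
proof -
  have "ennreal (unit_ball_vol DIM('a) * (1 - (a / b) ^ DIM('a)))
      = ennreal (1 / b ^ DIM('a)) * emeasure lebesgue (annulus x a b)"
    using assms by (subst emeasure_annulus) (auto simp: power_divide field_simps simp flip: ennreal_mult')
  also have "\<dots> = (\<integral>\<^sup>+ y. ennreal (1 / b ^ DIM('a)) * indicator (annulus x a b) y \<partial>lebesgue)"
    by (simp add: nn_integral_cmult_indicator)
  also have "\<dots> \<le> (\<integral>\<^sup>+ y. ennreal (inv_kernel x y) * indicator (annulus x a b) y \<partial>lebesgue)"
    using assms
    by (intro nn_integral_mono)
       (auto simp: indicator_def annulus_def inv_kernel_def intro!: ennreal_leI divide_left_mono power_mono mult_pos_pos zero_less_power)
  finally show ?thesis .
qed

text \<open>The kernel is scale invariant, so every shell of ratio \<open>q\<close> contributes at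
  least the same amount, and the \<open>K\<close> shells between the radii \<open>b * q ^ K\<close>
  and \<open>b\<close> are disjoint.\<close>

lemma nn_integral_annulus_shells:
  fixes x :: "'a::euclidean_space"
  assumes "0 < q" "q \<le> 1" "0 < b"
  shows "ennreal (real K * (unit_ball_vol DIM('a) * (1 - q ^ DIM('a))))
    \<le> (\<integral>\<^sup>+ y. ennreal (inv_kernel x y) * indicator (annulus x (b * q ^ K) b) y \<partial>lebesgue)"
proof (induction K)
  case (Suc K)
  have "ennreal (real (Suc K) * (unit_ball_vol DIM('a) * (1 - q ^ DIM('a)))) =
     ennreal (real K * (unit_ball_vol DIM('a) * (1 - q ^ DIM('a)))) + ennreal (unit_ball_vol DIM('a) * (1 - q ^ DIM('a)))"
  proof -
    have "0 \<le> unit_ball_vol DIM('a) * (1 - q ^ DIM('a))" using assms by (simp add: power_le_one)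
    then show ?thesis by (subst ennreal_plus [symmetric]) (auto simp: distrib_right)
  qed
  also have "\<dots> \<le> (\<integral>\<^sup>+ y. ennreal (inv_kernel x y) * indicator (annulus x (b * q ^ K) b) y \<partial>lebesgue)
     + (\<integral>\<^sup>+ y. ennreal (inv_kernel x y) * indicator (annulus x (b * q ^ Suc K) (b * q ^ K)) y \<partial>lebesgue)"
    using nn_integral_annulus_shell[of "b * q ^ Suc K" "b * q ^ K" x] assms
    by (intro add_mono Suc) (auto simp: mult_left_le_one_le)
  also have "\<dots> = (\<integral>\<^sup>+ y. ennreal (inv_kernel x y) * indicator (annulus x (b * q ^ K) b) y
      + ennreal (inv_kernel x y) * indicator (annulus x (b * q ^ Suc K) (b * q ^ K)) y \<partial>lebesgue)"
    by (rule nn_integral_add [symmetric]) auto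
  also have "\<dots> \<le> (\<integral>\<^sup>+ y. ennreal (inv_kernel x y) * indicator (annulus x (b * q ^ Suc K) b) y \<partial>lebesgue)"
  proof (intro nn_integral_mono)
    fix y
    have 1: "b * q ^ K \<le> b" "b * q ^ Suc K \<le> b * q ^ K"
      using assms by (auto simp: mult_left_le power_le_one mult_left_le_one_le)
    show "ennreal (inv_kernel x y) * indicator (annulus x (b * q ^ K) b) y
      + ennreal (inv_kernel x y) * indicator (annulus x (b * q ^ Suc K) (b * q ^ K)) y
      \<le> ennreal (inv_kernel x y) * indicator (annulus x (b * q ^ Suc K) b) y"
      using 1 unfolding indicator_def annulus_def by auto
  qed
  finally show ?case .
qed simp

text \<open>The logarithm appears without polar coordinates: with K + 1 geometric shells the ratio
  is the root of \<open>a / b\<close> of order K + 1, and (K + 1) (1 - exp (- c / (K + 1))) tends to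
  \<open>c = DIM('a) * ln (b / a)\<close>.\<close>

lemma nn_integral_annulus_ge:
  fixes x :: "'a::euclidean_space"
  assumes "0 < a" "a \<le> b"
  shows "ennreal (DIM('a) * unit_ball_vol DIM('a) * ln (b / a))
    \<le> (\<integral>\<^sup>+ y. ennreal (inv_kernel x y) * indicator (annulus x a b) y \<partial>lebesgue)" (is "_ \<le> ?I")
proof (rule LIMSEQ_le_const2)
  define c where "c = DIM('a) * ln (b / a)"
  have "(\<lambda>K. real (Suc K) * (1 - exp (- c / real (Suc K)))) \<longlonglongrightarrow> c"
    by real_asymp
  then have "(\<lambda>K. unit_ball_vol DIM('a) * (real (Suc K) * (1 - exp (- c / real (Suc K))))) \<longlonglongrightarrow> unit_ball_vol DIM('a) * c"
    by (intro tendsto_mult_left)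
  then show "(\<lambda>K. ennreal (real (Suc K) * (unit_ball_vol DIM('a) * (1 - exp (- c / real (Suc K))))))
     \<longlonglongrightarrow> ennreal (DIM('a) * unit_ball_vol DIM('a) * ln (b / a))"
    by (intro tendsto_ennrealI) (simp add: c_def mult_ac)
  show "\<exists>N. \<forall>K\<ge>N. ennreal (real (Suc K) * (unit_ball_vol DIM('a) * (1 - exp (- c / real (Suc K))))) \<le> ?I"
  proof (intro exI allI impI)
    fix K :: nat
    define q where "q = exp (- ln (b / a) / real (Suc K))"
    have q: "0 < q" "q \<le> 1" using assms by (auto simp: q_def)
    have "q ^ Suc K = exp (real (Suc K) * (- ln (b / a) / real (Suc K)))"
      unfolding q_def by (rule exp_of_nat_mult [symmetric])
    also have "\<dots> = a / b" using assms by (simp add: exp_minus)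
    finally have "b * q ^ Suc K = a" using assms by simp
    moreover have "q ^ DIM('a) = exp (- c / real (Suc K))"
      unfolding q_def c_def exp_of_nat_mult [symmetric] by (simp add: field_simps)
    ultimately show "ennreal (real (Suc K) * (unit_ball_vol DIM('a) * (1 - exp (- c / real (Suc K))))) \<le> ?I"
      using nn_integral_annulus_shells[OF q, of b "Suc K" x] assms by simp
  qed
qed

text \<open>No rearrangement inequality is used. Outside the ball of radius \<open>r\<close> the
  kernel is at most \<open>1 / r ^ DIM('a)\<close>, so deleting \<open>B\<close> from the annulus
  with radii \<open>r\<close> and 1 removes at most the volume of the unit ball; this is the
  additive loss in the bound.\<close>

lemma nn_integral_cball_minus_ge:
  fixes x :: "'a::euclidean_space"
  assumes B [measurable]: "B \<in> sets lebesgue" and r: "0 < r"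
    and le: "emeasure lebesgue B \<le> ennreal (unit_ball_vol DIM('a) * r ^ DIM('a))"
  shows "ennreal (DIM('a) * unit_ball_vol DIM('a) * ln (1 / r) - unit_ball_vol DIM('a))
    \<le> (\<integral>\<^sup>+ y. ennreal (inv_kernel x y) * indicator (cball x 1 - B) y \<partial>lebesgue)" (is "_ \<le> ?I")
proof (cases "r \<le> 1")
  have [measurable]: "cball x 1 \<in> sets lebesgue" by simp
  case True
  have "ennreal (DIM('a) * unit_ball_vol DIM('a) * ln (1 / r))
    \<le> (\<integral>\<^sup>+ y. ennreal (inv_kernel x y) * indicator (annulus x r 1) y \<partial>lebesgue)"
    using nn_integral_annulus_ge[OF r True, of x] by simp
  also have "\<dots> \<le> (\<integral>\<^sup>+ y. ennreal (inv_kernel x y) * indicator (cball x 1 - B) y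
      + ennreal (1 / r ^ DIM('a)) * indicator B y \<partial>lebesgue)"
    using r
    by (intro nn_integral_mono)
       (auto simp: indicator_def annulus_def inv_kernel_def dist_norm intro!: ennreal_leI divide_left_mono power_mono mult_pos_pos zero_less_power)
  also have "\<dots> = ?I + ennreal (1 / r ^ DIM('a)) * emeasure lebesgue B"
    by (subst nn_integral_add) (auto simp: nn_integral_cmult_indicator)
  also have "\<dots> \<le> ?I + ennreal (1 / r ^ DIM('a)) * ennreal (unit_ball_vol DIM('a) * r ^ DIM('a))"
    by (intro add_mono mult_mono le) auto
  also have "ennreal (1 / r ^ DIM('a)) * ennreal (unit_ball_vol DIM('a) * r ^ DIM('a)) = ennreal (unit_ball_vol DIM('a))"
    using r by (simp flip: ennreal_mult')
  finally show ?thesis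
    using True r by (simp add: ennreal_minus [symmetric] ennreal_minus_le_iff add.commute)
next
  \<comment> \<open>For \<open>r > 1\<close> the real bound is at most 0 and becomes 0 as an
    \<open>ennreal\<close>.\<close>
  case False
  then have "ln (1 / r) < 0" using r by (simp add: ln_div)
  then have "DIM('a) * unit_ball_vol DIM('a) * ln (1 / r) - unit_ball_vol DIM('a) \<le> 0"
    using mult_nonneg_nonpos[of "DIM('a) * unit_ball_vol DIM('a)" "ln (1/r)"] unit_ball_vol_nonneg[of "DIM('a)"]
    by (smt (verit) mult_nonneg_nonneg of_nat_0_le_iff)
  then show ?thesis by (simp add: ennreal_neg)
qed

lemma C_const_pos: "0 < p \<Longrightarrow> 0 < N \<Longrightarrow> 0 < C_const N p"
  unfolding C_const_def by (intro divide_pos_pos mult_pos_pos Gamma_real_pos) auto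

text \<open>The normalising constant of the operator cancels the Gamma factor of the unit ball
  volume. Multiplied by the \<open>p * ln \<bar>u x\<bar>\<close> that stems from a radius of order
  \<open>\<bar>u x\<bar> powr (- p / N)\<close>, the quotient \<open>p / N\<close> becomes the
  threshold.\<close>

lemma C_const_mult_vol:
  assumes "0 < N" shows "C_const N p * unit_ball_vol N = p / N"
proof -
  have "Gamma (real N / 2 + 1) = real N / 2 * Gamma (real N / 2)"
    using assms Gamma_plus1[of "real N / 2"] by (auto simp: nonpos_Ints_def) 
  moreover have "Gamma (real N / 2) \<noteq> 0" using assms by (simp add: less_imp_neq[OF Gamma_real_pos, symmetric])
  ultimately show ?thesis using assms by (simp add: C_const_def unit_ball_vol_def field_simps)
qed

subsection \<open>A logarithmic Sobolev estimate on superlevel sets\<close>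

definition near_density :: "real \<Rightarrow> ('a::euclidean_space \<Rightarrow> real) \<Rightarrow> 'a \<times> 'a \<Rightarrow> real" where
  "near_density p u z = C_const DIM('a) p / 2 * (\<bar>u (fst z) - u (snd z)\<bar> powr p * inv_kernel (fst z) (snd z))"

lemma near_density_nonneg [simp]: "0 < p \<Longrightarrow> 0 \<le> near_density p (u :: 'a::euclidean_space \<Rightarrow> real) z"
  using C_const_pos[of p "DIM('a)"] by (simp add: near_density_def)

lemma borel_measurable_near_density [measurable]:
  assumes [measurable]: "u \<in> borel_measurable lebesgue"
  shows "near_density p u \<in> borel_measurable (lebesgue \<Otimes>\<^sub>M lebesgue)"
  unfolding near_density_def[abs_def] by measurable

lemma near_density_swap: "near_density p u (y, x) = near_density p u (x, y)"
  by (simp add: near_density_def inv_kernel_def norm_minus_commute abs_minus_commute)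

text \<open>The pairs whose energy pays for large values. Off this region a pair at distance at most
  1 has both values bounded by \<open>M\<close>, and the limit passage is made there.\<close>

definition tail_region :: "real \<Rightarrow> ('a::real_normed_vector \<Rightarrow> real) \<Rightarrow> ('a \<times> 'a) set" where
  "tail_region M u = {z. norm (fst z - snd z) \<le> 1 \<and> (M < \<bar>u (fst z)\<bar> \<or> M < \<bar>u (snd z)\<bar>)}"

lemma sets_tail_region [measurable]:
  assumes [measurable]: "u \<in> borel_measurable lebesgue"
  shows "tail_region M u \<in> sets (lebesgue \<Otimes>\<^sub>M (lebesgue :: 'a::euclidean_space measure))"
proof -
  have "{z \<in> space (lebesgue \<Otimes>\<^sub>M (lebesgue :: 'a measure)).
      norm (fst z - snd z) \<le> 1 \<and> (M < \<bar>u (fst z)\<bar> \<or> M < \<bar>u (snd z)\<bar>)} \<in> sets (lebesgue \<Otimes>\<^sub>M lebesgue)"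
    by measurable
  then show ?thesis by (simp add: tail_region_def space_pair_measure)
qed

text \<open>Off the set where \<open>u\<close> is comparable with \<open>u x\<close> the increment
  is at least \<open>(1 - e) * \<bar>u x\<bar>\<close>, and the excluded set is small by Markov's
  inequality. The final \<open>- 1\<close> is the loss from excluding a set of arbitrary shape; the
  factor 2 undoes the half in \<open>near_density\<close>.\<close>

lemma inner_log_bound:
  fixes u :: "'a::euclidean_space \<Rightarrow> real"
  assumes p: "1 < p" and u [measurable]: "u \<in> borel_measurable lebesgue"
    and R: "(\<integral>\<^sup>+ x. ennreal (\<bar>u x\<bar> powr p) \<partial>lebesgue) \<le> ennreal R" "0 < R"
    and e: "0 < e" "e < 1" and x: "u x \<noteq> 0"
  shows "ennreal ((1 - e) powr p * \<bar>u x\<bar> powr p * (p\<^sup>2 / DIM('a) * ln \<bar>u x\<bar>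
            + p / DIM('a) * (ln (unit_ball_vol DIM('a)) + p * ln e - ln R - 1)))
    \<le> 2 * (\<integral>\<^sup>+ y. ennreal (near_density p u (x, y)) * indicator {y. norm (x - y) \<le> 1 \<and> \<bar>u y\<bar> < e * \<bar>u x\<bar>} y \<partial>lebesgue)"
proof -
  define N where "N = real DIM('a)"
  define V where "V = unit_ball_vol N"
  define C where "C = C_const DIM('a) p"
  define t where "t = \<bar>u x\<bar>"
  define B where "B = {y. e * t \<le> \<bar>u y\<bar>}"
  \<comment> \<open>\<open>m\<close> is the Markov bound on the measure of \<open>B\<close>, and
    \<open>r\<close> is the radius of the ball of volume \<open>m\<close>, so that the kernel
    estimate applies to \<open>B\<close>.\<close>
  define m where "m = R / (e * t) powr p"
  define r where "r = (m / V) powr (1 / N)"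
  have pos: "0 < N" "0 < V" "0 < C" "0 < t" "0 < m"
    using p R e x by (auto simp: N_def V_def C_def t_def m_def intro!: C_const_pos)
  have r: "0 < r" using pos by (simp add: r_def)
  have rN: "r ^ DIM('a) = m / V"
  proof -
    have "r ^ DIM('a) = r powr N" using r by (simp add: powr_realpow N_def)
    also have "\<dots> = m / V" using pos by (simp add: r_def powr_powr)
    finally show ?thesis .
  qed
  have [measurable]: "B \<in> sets lebesgue"
  proof -
    have "{y \<in> space lebesgue. e * t \<le> \<bar>u y\<bar>} \<in> sets lebesgue" by measurable
    then show ?thesis by (simp add: B_def)
  qed
  define c where "c = 1 / (e * t) powr p"
  have B_sub: "B \<subseteq> {y \<in> UNIV. 1 \<le> ennreal c * ennreal (\<bar>u y\<bar> powr p)}"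
  proof
    fix y assume "y \<in> B"
    then have "(e * t) powr p \<le> \<bar>u y\<bar> powr p"
      using e pos p by (intro powr_mono2) (auto simp: B_def)
    moreover have "0 < (e * t) powr p" using e pos by simp
    ultimately have "1 \<le> c * \<bar>u y\<bar> powr p" by (simp add: c_def field_simps)
    then have "ennreal 1 \<le> ennreal (c * \<bar>u y\<bar> powr p)" by (rule ennreal_leI)
    also have "\<dots> = ennreal c * ennreal (\<bar>u y\<bar> powr p)" by (rule ennreal_mult') (simp add: c_def)
    finally show "y \<in> {y \<in> UNIV. 1 \<le> ennreal c * ennreal (\<bar>u y\<bar> powr p)}" by simp
  qed
  have "{y \<in> space lebesgue. 1 \<le> ennreal c * ennreal (\<bar>u y\<bar> powr p)} \<in> sets lebesgue" by measurable
  then have "emeasure lebesgue B \<le> emeasure lebesgue {y \<in> UNIV. 1 \<le> ennreal c * ennreal (\<bar>u y\<bar> powr p)}"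
    by (intro emeasure_mono[OF B_sub]) simp
  also have "\<dots> \<le> ennreal c * (\<integral>\<^sup>+ y. ennreal (\<bar>u y\<bar> powr p) * indicator UNIV y \<partial>lebesgue)"
    by (rule nn_integral_Markov_inequality) simp_all
  also have "\<dots> \<le> ennreal c * ennreal R"
    using R(1) by (intro mult_left_mono) simp_all
  also have "\<dots> = ennreal m"
    by (subst ennreal_mult' [symmetric]) (use R(2) in \<open>simp_all add: m_def c_def\<close>)
  also have "m = V * r ^ DIM('a)" using pos by (simp add: rN)
  finally have mB: "emeasure lebesgue B \<le> ennreal (V * r ^ DIM('a))" .
  have key: "ennreal (N * V * ln (1 / r) - V)
     \<le> (\<integral>\<^sup>+ y. ennreal (inv_kernel x y) * indicator (cball x 1 - B) y \<partial>lebesgue)"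
    using nn_integral_cball_minus_ge[OF _ r, of B x] mB by (simp add: N_def V_def)
  have ln_r: "N * ln (1 / r) = ln V + p * ln e + p * ln t - ln R"
  proof -
    have "N * ln (1 / r) = - ln (m / V)" using pos r by (simp add: ln_div r_def ln_powr)
    also have "ln (m / V) = ln m - ln V" using pos by (simp add: ln_div)
    also have "ln m = ln R - ln ((e * t) powr p)" unfolding m_def using pos(4) R(2) e(1) by (subst ln_div) auto
    also have "ln ((e * t) powr p) = p * (ln e + ln t)" using pos e by (simp add: ln_powr ln_mult)
    finally show ?thesis by (simp add: algebra_simps)
  qed
  have CV: "C * V = p / N" by (simp add: C_def V_def N_def C_const_mult_vol)
  define w where "w = (1 - e) powr p * t powr p"
  have "w * (p\<^sup>2 / N * ln t + p / N * (ln V + p * ln e - ln R - 1)) = C * w * (N * V * ln (1 / r) - V)"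
  proof -
    have "C * w * (N * V * ln (1 / r) - V) = w * (C * V * (N * ln (1 / r)) - C * V)" by (simp add: algebra_simps)
    also have "\<dots> = w * (p\<^sup>2 / N * ln t + p / N * (ln V + p * ln e - ln R - 1))"
      unfolding CV ln_r using pos by (simp add: field_simps power2_eq_square)
    finally show ?thesis by (rule sym)
  qed
  then have "ennreal (w * (p\<^sup>2 / N * ln t + p / N * (ln V + p * ln e - ln R - 1)))
    = ennreal (C * w) * ennreal (N * V * ln (1 / r) - V)"
    by (simp only:) (rule ennreal_mult', use pos in \<open>simp add: w_def\<close>)
  also have "\<dots> \<le> ennreal (C * w) * (\<integral>\<^sup>+ y. ennreal (inv_kernel x y) * indicator (cball x 1 - B) y \<partial>lebesgue)"
    by (intro mult_left_mono key) simp
  also have "\<dots> = (\<integral>\<^sup>+ y. ennreal (C * w) * (ennreal (inv_kernel x y) * indicator (cball x 1 - B) y) \<partial>lebesgue)"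
  proof -
    have [measurable]: "cball x 1 \<in> sets lebesgue" by simp
    show ?thesis by (rule nn_integral_cmult [symmetric]) measurable
  qed
  also have "\<dots> \<le> (\<integral>\<^sup>+ y. 2 * (ennreal (near_density p u (x, y)) * indicator {y. norm (x - y) \<le> 1 \<and> \<bar>u y\<bar> < e * \<bar>u x\<bar>} y) \<partial>lebesgue)"
  proof (intro nn_integral_mono)
    fix y
    show "ennreal (C * w) * (ennreal (inv_kernel x y) * indicator (cball x 1 - B) y)
      \<le> 2 * (ennreal (near_density p u (x, y)) * indicator {y. norm (x - y) \<le> 1 \<and> \<bar>u y\<bar> < e * \<bar>u x\<bar>} y)"
    proof (cases "y \<in> cball x 1 - B")
      case True
      then have *: "norm (x - y) \<le> 1" "\<bar>u y\<bar> < e * t" by (auto simp: B_def dist_norm)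
      have "w \<le> \<bar>u x - u y\<bar> powr p"
      proof -
        have "(1 - e) * t \<le> \<bar>u x - u y\<bar>" using *(2) by (simp add: t_def algebra_simps)
        then have "((1 - e) * t) powr p \<le> \<bar>u x - u y\<bar> powr p"
          using e pos p by (intro powr_mono2) auto
        then show ?thesis using e pos by (simp add: w_def powr_mult)
      qed
      then have "C * w * inv_kernel x y \<le> C * \<bar>u x - u y\<bar> powr p * inv_kernel x y"
        using pos by (intro mult_right_mono mult_left_mono) auto
      also have "\<dots> = 2 * near_density p u (x, y)" by (simp add: near_density_def C_def)
      finally have "ennreal (C * w * inv_kernel x y) \<le> 2 * ennreal (near_density p u (x, y))"
        using p ennreal_leI[of _ "2 * near_density p u (x, y)"] by (simp add: ennreal_mult')
      then show ?thesis using True * pos by (simp add: t_def w_def flip: ennreal_mult')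
    qed auto
  qed
  also have "\<dots> = 2 * (\<integral>\<^sup>+ y. ennreal (near_density p u (x, y)) * indicator {y. norm (x - y) \<le> 1 \<and> \<bar>u y\<bar> < e * \<bar>u x\<bar>} y \<partial>lebesgue)"
  proof (rule nn_integral_cmult)
    have "{y \<in> space lebesgue. norm (x - y) \<le> 1 \<and> \<bar>u y\<bar> < e * \<bar>u x\<bar>} \<in> sets lebesgue" by measurable
    then have [measurable]: "{y. norm (x - y) \<le> 1 \<and> \<bar>u y\<bar> < e * \<bar>u x\<bar>} \<in> sets lebesgue" by simp
    have [measurable]: "(\<lambda>y. near_density p u (x, y)) \<in> borel_measurable lebesgue"
      unfolding near_density_def by simp
    show "(\<lambda>y. ennreal (near_density p u (x, y)) * indicator {y. norm (x - y) \<le> 1 \<and> \<bar>u y\<bar> < e * \<bar>u x\<bar>} y) \<in> borel_measurable lebesgue"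
      by measurable
  qed
  finally show ?thesis by (simp add: w_def t_def V_def N_def)
qed

lemma log_sobolev_tail_aux:
  fixes u :: "'a::euclidean_space \<Rightarrow> real"
  assumes p: "1 < p" and u [measurable]: "u \<in> borel_measurable lebesgue"
    and R: "(\<integral>\<^sup>+ x. ennreal (\<bar>u x\<bar> powr p) \<partial>lebesgue) \<le> ennreal R" "0 < R"
    and e: "0 < e" "e < 1" and M: "0 < M"
  shows "(\<integral>\<^sup>+ x. ennreal ((1 - e) powr p * \<bar>u x\<bar> powr p * (p\<^sup>2 / DIM('a) * ln \<bar>u x\<bar>
            + p / DIM('a) * (ln (unit_ball_vol DIM('a)) + p * ln e - ln R - 1))) * indicator {x. M < \<bar>u x\<bar>} x \<partial>lebesgue)
    \<le> (\<integral>\<^sup>+ z. ennreal (near_density p u z) * indicator (tail_region M u) z \<partial>(lebesgue \<Otimes>\<^sub>M lebesgue))"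
    (is "?L \<le> ?R")
proof -
  let ?P = "lebesgue \<Otimes>\<^sub>M (lebesgue :: 'a measure)"
  define T where "T = {z. norm (fst z - snd z) \<le> 1 \<and> M < \<bar>u (fst z)\<bar> \<and> \<bar>u (snd z)\<bar> < e * \<bar>u (fst z)\<bar>}"
  have "{z \<in> space ?P. norm (fst z - snd z) \<le> 1 \<and> M < \<bar>u (fst z)\<bar> \<and> \<bar>u (snd z)\<bar> < e * \<bar>u (fst z)\<bar>} \<in> sets ?P"
    by measurable
  then have T [measurable]: "T \<in> sets ?P" by (simp add: T_def space_pair_measure)
  define F where "F z = ennreal (near_density p u z) * indicator T z" for z
  have F [measurable]: "F \<in> borel_measurable ?P" unfolding F_def by measurable
  have "?L \<le> (\<integral>\<^sup>+ x. 2 * (\<integral>\<^sup>+ y. F (x, y) \<partial>lebesgue) \<partial>lebesgue)"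
  proof (intro nn_integral_mono)
    fix x
    show "ennreal ((1 - e) powr p * \<bar>u x\<bar> powr p * (p\<^sup>2 / DIM('a) * ln \<bar>u x\<bar>
            + p / DIM('a) * (ln (unit_ball_vol DIM('a)) + p * ln e - ln R - 1))) * indicator {x. M < \<bar>u x\<bar>} x
       \<le> 2 * (\<integral>\<^sup>+ y. F (x, y) \<partial>lebesgue)"
    proof (cases "M < \<bar>u x\<bar>")
      case True
      then have "F (x, y) = ennreal (near_density p u (x, y)) * indicator {y. norm (x - y) \<le> 1 \<and> \<bar>u y\<bar> < e * \<bar>u x\<bar>} y" for y
        by (auto simp: F_def T_def indicator_def)
      then show ?thesis using inner_log_bound[OF p u R e, of x] True M by simp
    qed auto
  qed
  also have "\<dots> = 2 * (\<integral>\<^sup>+ x. (\<integral>\<^sup>+ y. F (x, y) \<partial>lebesgue) \<partial>lebesgue)"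
    by (rule nn_integral_cmult) measurable
  also have "\<dots> = (\<integral>\<^sup>+ x. (\<integral>\<^sup>+ y. F (x, y) \<partial>lebesgue) \<partial>lebesgue) + (\<integral>\<^sup>+ x. (\<integral>\<^sup>+ y. F (x, y) \<partial>lebesgue) \<partial>lebesgue)"
    by (simp add: mult_2)
  also have "\<dots> = (\<integral>\<^sup>+ z. F z \<partial>?P) + (\<integral>\<^sup>+ z. F (snd z, fst z) \<partial>?P)"
  proof -
    have "(\<integral>\<^sup>+ x. (\<integral>\<^sup>+ y. F (x, y) \<partial>lebesgue) \<partial>lebesgue) = (\<integral>\<^sup>+ z. F z \<partial>?P)"
      by (rule lebesgue.nn_integral_fst) (rule F)
    moreover have "(\<integral>\<^sup>+ x. (\<integral>\<^sup>+ y. F (x, y) \<partial>lebesgue) \<partial>lebesgue) = (\<integral>\<^sup>+ z. F (snd z, fst z) \<partial>?P)"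
      using lebesgue_pair.nn_integral_snd[of "\<lambda>z. F (snd z, fst z)"] by simp
    ultimately show ?thesis by simp
  qed
  also have "\<dots> = (\<integral>\<^sup>+ z. F z + F (snd z, fst z) \<partial>?P)"
    by (rule nn_integral_add [symmetric]) measurable
  also have "\<dots> \<le> ?R"
  proof (intro nn_integral_mono)
    fix z :: "'a \<times> 'a"
    obtain x y where z: "z = (x, y)" by force
    \<comment> \<open>Two numbers cannot each be smaller than \<open>e < 1\<close> times the other,
      so \<open>T\<close> and its reflection are disjoint. The two copies of the integral live on
      disjoint subsets of the tail region and add up to at most one integral over it.\<close>
    have "\<not> ((x, y) \<in> T \<and> (y, x) \<in> T)"
    proof
      assume "(x, y) \<in> T \<and> (y, x) \<in> T"
      then have *: "\<bar>u y\<bar> < e * \<bar>u x\<bar>" "\<bar>u x\<bar> < e * \<bar>u y\<bar>" by (auto simp: T_def)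
      have "e * \<bar>u y\<bar> \<le> \<bar>u y\<bar>" "e * \<bar>u x\<bar> \<le> \<bar>u x\<bar>" using e by (auto intro!: mult_left_le_one_le)
      then show False using * by linarith
    qed
    moreover have "(x, y) \<in> T \<Longrightarrow> z \<in> tail_region M u" "(y, x) \<in> T \<Longrightarrow> z \<in> tail_region M u"
      by (auto simp: T_def tail_region_def z norm_minus_commute)
    ultimately show "F z + F (snd z, fst z) \<le> ennreal (near_density p u z) * indicator (tail_region M u) z"
      by (auto simp: F_def z near_density_swap[of p u y x] indicator_def)
  qed
  finally show ?thesis .
qed

text \<open>Where \<open>u\<close> has the value \<open>t\<close>, the set \<open>{|u| \<ge> e t}\<close> is no larger than a ball of radius of order
  \<open>t\<close> to the power \<open>- p / N\<close>. Integrating the kernel over the rest of the unit ball gives the logarithm of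
  that radius, which is where the threshold \<open>p\<^sup>2 / N\<close> comes from.\<close>

lemma log_sobolev_tail:
  assumes p: "1 < p" and R: "0 < R" and m: "m < p\<^sup>2 / DIM('a::euclidean_space)"
  obtains M0 where "1 \<le> M0" "\<And>M (u :: 'a \<Rightarrow> real). M0 \<le> M \<Longrightarrow> u \<in> borel_measurable lebesgue \<Longrightarrow>
     (\<integral>\<^sup>+ x. ennreal (\<bar>u x\<bar> powr p) \<partial>lebesgue) \<le> ennreal R \<Longrightarrow>
     (\<integral>\<^sup>+ x. ennreal (m * (\<bar>u x\<bar> powr p * ln \<bar>u x\<bar>)) * indicator {x. M < \<bar>u x\<bar>} x \<partial>lebesgue)
    \<le> (\<integral>\<^sup>+ z. ennreal (near_density p u z) * indicator (tail_region M u) z \<partial>(lebesgue \<Otimes>\<^sub>M lebesgue))"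
proof -
  define N where "N = real DIM('a)"
  have N: "0 < N" by (simp add: N_def)
  \<comment> \<open>The loss factor tends to 1 as \<open>e\<close> tends to 0, so the strict
    inequality assumed for \<open>m\<close> leaves room for some positive \<open>e\<close>.\<close>
  have "((\<lambda>e. (1 - e) powr p * (p\<^sup>2 / N)) \<longlongrightarrow> (1 - 0) powr p * (p\<^sup>2 / N)) (at_right 0)"
    by (intro tendsto_intros) auto
  then have "eventually (\<lambda>e. m < (1 - e) powr p * (p\<^sup>2 / N)) (at_right 0)"
    using m by (intro order_tendstoD) (auto simp: N_def)
  moreover have "eventually (\<lambda>e::real. e \<in> {0<..<1}) (at_right 0)"
    by (rule eventually_at_right_real) simp
  ultimately have "eventually (\<lambda>e. m < (1 - e) powr p * (p\<^sup>2 / N) \<and> e \<in> {0<..<1}) (at_right (0::real))"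
    by (rule eventually_conj)
  then obtain e where e: "m < (1 - e) powr p * (p\<^sup>2 / N)" "0 < e" "e < 1"
    by (force dest: eventually_happens)
  define q where "q = (1 - e) powr p"
  define c where "c = p / N * (ln (unit_ball_vol DIM('a)) + p * ln e - ln R - 1)"
  define d where "d = q * (p\<^sup>2 / N) - m"
  have d: "0 < d" using e by (simp add: d_def q_def)
  \<comment> \<open>Above \<open>M0\<close> the surplus \<open>d * ln \<bar>u x\<bar>\<close> is at
    least \<open>\<bar>q * c\<bar>\<close> and absorbs the additive constant of the pointwise
    bound.\<close>
  define M0 where "M0 = exp (\<bar>q * c\<bar> / d)"
  show ?thesis
  proof
    show "1 \<le> M0" using d by (simp add: M0_def)
    fix M and u :: "'a \<Rightarrow> real"
    assume M: "M0 \<le> M" and u: "u \<in> borel_measurable lebesgue"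
      "(\<integral>\<^sup>+ x. ennreal (\<bar>u x\<bar> powr p) \<partial>lebesgue) \<le> ennreal R"
    have M0: "0 < M" using M \<open>1 \<le> M0\<close> by simp
    have "(\<integral>\<^sup>+ x. ennreal (m * (\<bar>u x\<bar> powr p * ln \<bar>u x\<bar>)) * indicator {x. M < \<bar>u x\<bar>} x \<partial>lebesgue)
      \<le> (\<integral>\<^sup>+ x. ennreal ((1 - e) powr p * \<bar>u x\<bar> powr p * (p\<^sup>2 / DIM('a) * ln \<bar>u x\<bar>
            + p / DIM('a) * (ln (unit_ball_vol DIM('a)) + p * ln e - ln R - 1))) * indicator {x. M < \<bar>u x\<bar>} x \<partial>lebesgue)"
    proof (intro nn_integral_mono)
      fix x
      show "ennreal (m * (\<bar>u x\<bar> powr p * ln \<bar>u x\<bar>)) * indicator {x. M < \<bar>u x\<bar>} x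
        \<le> ennreal ((1 - e) powr p * \<bar>u x\<bar> powr p * (p\<^sup>2 / DIM('a) * ln \<bar>u x\<bar>
            + p / DIM('a) * (ln (unit_ball_vol DIM('a)) + p * ln e - ln R - 1))) * indicator {x. M < \<bar>u x\<bar>} x"
      proof (cases "M < \<bar>u x\<bar>")
        case True
        have "\<bar>q * c\<bar> / d = ln M0" by (simp add: M0_def)
        also have "\<dots> \<le> ln \<bar>u x\<bar>" using True M \<open>1 \<le> M0\<close> by (intro ln_mono) auto
        finally have "\<bar>q * c\<bar> \<le> d * ln \<bar>u x\<bar>" using d by (simp add: field_simps)
        then have "m * ln \<bar>u x\<bar> \<le> q * (p\<^sup>2 / N * ln \<bar>u x\<bar> + c)" by (simp add: d_def algebra_simps)
        then have "\<bar>u x\<bar> powr p * (m * ln \<bar>u x\<bar>) \<le> \<bar>u x\<bar> powr p * (q * (p\<^sup>2 / N * ln \<bar>u x\<bar> + c))"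
          by (intro mult_left_mono) auto
        then show ?thesis using True
          by (auto simp: q_def c_def N_def mult_ac intro!: ennreal_leI)
      qed auto
    qed
    also have "\<dots> \<le> (\<integral>\<^sup>+ z. ennreal (near_density p u z) * indicator (tail_region M u) z \<partial>(lebesgue \<Otimes>\<^sub>M lebesgue))"
      by (rule log_sobolev_tail_aux[OF p u R e(2,3) M0])
    finally show "(\<integral>\<^sup>+ x. ennreal (m * (\<bar>u x\<bar> powr p * ln \<bar>u x\<bar>)) * indicator {x. M < \<bar>u x\<bar>} x \<partial>lebesgue)
    \<le> (\<integral>\<^sup>+ z. ennreal (near_density p u z) * indicator (tail_region M u) z \<partial>(lebesgue \<Otimes>\<^sub>M lebesgue))" .
  qed
qed

subsection \<open>Compactness\<close>

text \<open>Along indices with successive distances at most \<open>(1/2)^k\<close> the telescoping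
  series of absolute values has a finite integral, hence converges almost everywhere.\<close>

lemma L1_Cauchy_AE_subseq:
  fixes f :: "nat \<Rightarrow> 'a \<Rightarrow> real"
  assumes f [measurable]: "\<And>n. f n \<in> borel_measurable M"
    and Cauchy: "\<And>e. 0 < e \<Longrightarrow> \<exists>K. \<forall>n\<ge>K. \<forall>m\<ge>K. (\<integral>\<^sup>+ x. ennreal \<bar>f n x - f m x\<bar> \<partial>M) \<le> ennreal e"
  obtains r :: "nat \<Rightarrow> nat" where "strict_mono r" "AE x in M. convergent (\<lambda>n. f (r n) x)"
proof -
  have "\<exists>K. \<forall>n\<ge>K. \<forall>m\<ge>K. (\<integral>\<^sup>+ x. ennreal \<bar>f n x - f m x\<bar> \<partial>M) \<le> ennreal ((1/2)^k)" for k :: nat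
    by (rule Cauchy) simp
  then obtain K where K: "\<And>k n m. K k \<le> n \<Longrightarrow> K k \<le> m \<Longrightarrow> (\<integral>\<^sup>+ x. ennreal \<bar>f n x - f m x\<bar> \<partial>M) \<le> ennreal ((1/2)^k)"
    by metis
  \<comment> \<open>The recursion makes \<open>r\<close> strictly increasing and keeps
    \<open>r k\<close> beyond \<open>K k\<close>.\<close>
  define r where "r = rec_nat (K 0) (\<lambda>k s. Suc (max s (K (Suc k))))"
  have r_Suc: "r (Suc k) = Suc (max (r k) (K (Suc k)))" for k by (simp add: r_def)
  have "strict_mono r" by (rule strict_monoI_Suc) (simp add: r_Suc)
  have rK: "K k \<le> r k" for k by (cases k) (simp_all add: r_Suc, simp add: r_def)
  have le: "(\<integral>\<^sup>+ x. ennreal \<bar>f (r (Suc k)) x - f (r k) x\<bar> \<partial>M) \<le> ennreal ((1/2)^k)" for k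
    by (rule K) (use rK[of k] in \<open>auto simp: r_Suc\<close>)
  have "(\<integral>\<^sup>+ x. (\<Sum>k. ennreal \<bar>f (r (Suc k)) x - f (r k) x\<bar>) \<partial>M)
      = (\<Sum>k. \<integral>\<^sup>+ x. ennreal \<bar>f (r (Suc k)) x - f (r k) x\<bar> \<partial>M)"
    by (rule nn_integral_suminf) measurable
  also have "\<dots> \<le> (\<Sum>k. ennreal ((1/2)^k))"
    by (intro suminf_le le summableI)
  also have "\<dots> = ennreal (\<Sum>k. (1/2)^k)"
    by (rule suminf_ennreal2) (auto intro: summable_geometric)
  also have "\<dots> < \<infinity>" by simp
  finally have "AE x in M. (\<Sum>k. ennreal \<bar>f (r (Suc k)) x - f (r k) x\<bar>) \<noteq> \<infinity>"
    by (intro nn_integral_noteq_infinite) auto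
  then have "AE x in M. convergent (\<lambda>n. f (r n) x)"
  proof eventually_elim
    case (elim x)
    then have "summable (\<lambda>k. \<bar>f (r (Suc k)) x - f (r k) x\<bar>)"
      by (intro summable_suminf_not_top) auto
    then have "summable (\<lambda>k. f (r (Suc k)) x - f (r k) x)"
      by (rule summable_rabs_cancel)
    then have "convergent (\<lambda>n. \<Sum>k<n. f (r (Suc k)) x - f (r k) x)"
      by (simp add: summable_iff_convergent)
    then have "convergent (\<lambda>n. f (r n) x - f (r 0) x)"
      by (simp only: sum_lessThan_telescope[of "\<lambda>k. f (r k) x"])
    then have "convergent (\<lambda>n. (f (r n) x - f (r 0) x) + f (r 0) x)"
      by (intro convergent_add convergent_const)
    then show ?case by simp
  qed
  then show ?thesis using that \<open>strict_mono r\<close> by blast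
qed

text \<open>A truncation of \<open>inv_kernel\<close> that is bounded and continuous, while its mass tends to infinity
  as \<open>j\<close> does.\<close>

definition cut_kernel :: "nat \<Rightarrow> 'a::euclidean_space \<Rightarrow> 'a \<Rightarrow> real" where
  "cut_kernel j x y = (1 - min 1 (norm (x - y))) / (max (1 / (1 + real j)) (min 1 (norm (x - y)))) ^ DIM('a)"

lemma cut_kernel_nonneg [simp]: "0 \<le> cut_kernel j x y"
  unfolding cut_kernel_def by (intro divide_nonneg_nonneg zero_le_power max.coboundedI1) auto

lemma cut_kernel_le: "cut_kernel j (x::'a::euclidean_space) y \<le> (1 + real j) ^ DIM('a)"
proof -
  have "cut_kernel j x y \<le> 1 / (1 / (1 + real j)) ^ DIM('a)"
    unfolding cut_kernel_def by (intro frac_le power_mono zero_less_power) auto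
  also have "(1 / (1 + real j)) ^ DIM('a) = 1 / (1 + real j) ^ DIM('a)" by (simp add: power_divide)
  finally show ?thesis by simp
qed

lemma cut_kernel_eq_0: "1 \<le> norm (x - y) \<Longrightarrow> cut_kernel j x y = 0"
  unfolding cut_kernel_def by (subst min_absorb1) auto

lemma cut_kernel_le_inv_kernel:
  assumes "x \<noteq> y" shows "cut_kernel j x y \<le> inv_kernel x y"
proof (cases "norm (x - y) \<le> 1")
  case True
  then show ?thesis
    unfolding cut_kernel_def inv_kernel_def using assms
    by (intro frac_le power_mono zero_less_power) auto
next
  case False
  then have "cut_kernel j x y = 0" by (intro cut_kernel_eq_0) simp
  then show ?thesis by simp
qed

lemma borel_measurable_cut_kernel [measurable]:
  "(\<lambda>z. cut_kernel j (fst z) (snd z)) \<in> borel_measurable (lebesgue \<Otimes>\<^sub>M (lebesgue :: 'a::euclidean_space measure))"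
  unfolding cut_kernel_def by measurable

lemma borel_measurable_cut_kernel_Pair [measurable]:
  "cut_kernel j x \<in> borel_measurable (lebesgue :: 'a::euclidean_space measure)"
  unfolding cut_kernel_def by measurable

lemma integrable_cut_kernel_mult:
  assumes w: "integrable lebesgue w"
  shows "integrable lebesgue (\<lambda>y. cut_kernel j (x::'a::euclidean_space) y * w y)"
proof (rule Bochner_Integration.integrable_bound)
  show "integrable lebesgue (\<lambda>y. (1 + real j) ^ DIM('a) * \<bar>w y\<bar>)" using w by simp
  show "(\<lambda>y. cut_kernel j x y * w y) \<in> borel_measurable lebesgue" using w by measurable
  show "AE y in lebesgue. norm (cut_kernel j x y * w y) \<le> norm ((1 + real j) ^ DIM('a) * \<bar>w y\<bar>)"
  proof (rule AE_I2)
    fix y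
    have "cut_kernel j x y * \<bar>w y\<bar> \<le> (1 + real j) ^ DIM('a) * \<bar>w y\<bar>"
      by (intro mult_right_mono cut_kernel_le) simp
    then show "norm (cut_kernel j x y * w y) \<le> norm ((1 + real j) ^ DIM('a) * \<bar>w y\<bar>)"
      by (simp add: abs_mult)
  qed
qed

lemma integrable_cut_kernel: "integrable lebesgue (cut_kernel j (x::'a::euclidean_space))"
proof -
  have "integrable lebesgue (\<lambda>y. cut_kernel j x y * indicator (cball x 1) y)"
    by (intro integrable_cut_kernel_mult integrable_real_indicator) (simp_all add: emeasure_lborel_cball_finite[simplified])
  moreover have "cut_kernel j x y * indicator (cball x 1) y = cut_kernel j x y" for y
    by (auto simp: indicator_def dist_norm cut_kernel_eq_0)
  ultimately show ?thesis by simp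
qed

text \<open>Between the radii \<open>1 / (1 + real j)\<close> and \<open>1 / 2\<close> the
  truncation is inactive and the factor \<open>1 - norm (x - y)\<close> is at least one half, so
  half of the logarithmic mass of that annulus survives.\<close>

lemma integral_cut_kernel_ge:
  assumes "1 \<le> j"
  shows "DIM('a) * unit_ball_vol DIM('a) * ln ((1 + real j) / 2) / 2
     \<le> (\<integral>y. cut_kernel j (x::'a::euclidean_space) y \<partial>lebesgue)"
proof -
  have a: "0 < 1 / (1 + real j)" "1 / (1 + real j) \<le> 1 / 2" using assms by (auto simp: field_simps)
  have "ennreal (1 / 2) * ennreal (DIM('a) * unit_ball_vol DIM('a) * ln ((1 / 2) / (1 / (1 + real j))))
     \<le> ennreal (1 / 2) * (\<integral>\<^sup>+ y. ennreal (inv_kernel x y) * indicator (annulus x (1 / (1 + real j)) (1 / 2)) y \<partial>lebesgue)"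
    by (intro mult_left_mono nn_integral_annulus_ge a) simp
  also have "\<dots> = (\<integral>\<^sup>+ y. ennreal (1 / 2) * (ennreal (inv_kernel x y) * indicator (annulus x (1 / (1 + real j)) (1 / 2)) y) \<partial>lebesgue)"
    by (rule nn_integral_cmult [symmetric]) measurable
  also have "\<dots> \<le> (\<integral>\<^sup>+ y. ennreal (cut_kernel j x y) \<partial>lebesgue)"
  proof (intro nn_integral_mono)
    fix y
    show "ennreal (1 / 2) * (ennreal (inv_kernel x y) * indicator (annulus x (1 / (1 + real j)) (1 / 2)) y)
      \<le> ennreal (cut_kernel j x y)"
    proof (cases "y \<in> annulus x (1 / (1 + real j)) (1 / 2)")
      case True
      then have y: "1 / (1 + real j) < norm (x - y)" "norm (x - y) \<le> 1 / 2" by (auto simp: annulus_def)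
      have "cut_kernel j x y = (1 - norm (x - y)) * inv_kernel x y"
        using y by (simp add: cut_kernel_def inv_kernel_def max_def)
      moreover have "1 / 2 * inv_kernel x y \<le> (1 - norm (x - y)) * inv_kernel x y"
        using y by (intro mult_right_mono) auto
      ultimately have "1 / 2 * inv_kernel x y \<le> cut_kernel j x y" by simp
      then have "ennreal (1 / 2 * inv_kernel x y) \<le> ennreal (cut_kernel j x y)" by (rule ennreal_leI)
      then show ?thesis using True by (subst (asm) ennreal_mult') auto
    qed auto
  qed
  also have "\<dots> = ennreal (\<integral>y. cut_kernel j x y \<partial>lebesgue)"
    by (rule nn_integral_eq_integral[OF integrable_cut_kernel]) auto
  also have "ennreal (1 / 2) * ennreal (DIM('a) * unit_ball_vol DIM('a) * ln ((1 / 2) / (1 / (1 + real j))))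
    = ennreal (1 / 2 * (DIM('a) * unit_ball_vol DIM('a) * ln ((1 / 2) / (1 / (1 + real j)))))"
    by (rule ennreal_mult' [symmetric]) simp
  finally show ?thesis
    by (subst (asm) ennreal_le_iff) (auto intro!: integral_nonneg_AE)
qed

text \<open>The kernel is a continuous function \<open>F\<close> of
  \<open>min 1 (norm (x - y))\<close>, which ranges over a compact interval and is 1-Lipschitz in
  \<open>x\<close>; the modulus of continuity is therefore uniform in \<open>y\<close> too.\<close>

lemma cut_kernel_uniformly_continuous:
  assumes "0 < e"
  obtains d where "0 < d" "\<And>x x' y::'a::euclidean_space. norm (x - x') < d \<Longrightarrow> \<bar>cut_kernel j x y - cut_kernel j x' y\<bar> < e"
proof -
  define F where "F s = (1 - s) / (max (1 / (1 + real j)) s) ^ DIM('a)" for s :: real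
  have "continuous_on {0..1} F"
    unfolding F_def by (intro continuous_intros) (auto simp: max_def)
  then have "uniformly_continuous_on {0..1} F"
    by (intro compact_uniformly_continuous) auto
  then obtain d where d: "0 < d" "\<And>s s'. s \<in> {0..1} \<Longrightarrow> s' \<in> {0..1} \<Longrightarrow> dist s' s < d \<Longrightarrow> dist (F s') (F s) < e"
    using assms unfolding uniformly_continuous_on_def by metis
  show ?thesis
  proof (rule that[OF d(1)])
    fix x x' y :: 'a
    assume x: "norm (x - x') < d"
    have "\<bar>norm (x - y) - norm (x' - y)\<bar> \<le> norm (x - x')"
      using norm_triangle_ineq3[of "x - y" "x' - y"] by simp
    then have "dist (min 1 (norm (x - y))) (min 1 (norm (x' - y))) < d"
      using x by (auto simp: dist_real_def)
    then show "\<bar>cut_kernel j x y - cut_kernel j x' y\<bar> < e"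
      using d(2)[of "min 1 (norm (x' - y))" "min 1 (norm (x - y))"]
      by (simp add: dist_real_def F_def cut_kernel_def)
  qed
qed

text \<open>If \<open>l * d \<le> 1\<close> the second summand suffices; otherwise
  \<open>(l * d) powr (p - 1) \<ge> 1\<close> and the first one does. This trades a first power for
  the \<open>p\<close>-th power that the energy controls, at the cost of a constant that is small
  for large \<open>l\<close>.\<close>

lemma le_powr_scaled:
  fixes d l :: real
  assumes "1 < p" "0 < l" "0 \<le> d"
  shows "d \<le> l powr (p - 1) * d powr p + 1 / l"
proof (cases "l * d \<le> 1")
  case True
  then have "d \<le> 1 / l" using assms by (simp add: pos_le_divide_eq mult.commute)
  then show ?thesis by (simp add: add_increasing)
next
  case False
  then have d: "0 < d" using assms by (cases "d = 0") auto
  have "1 powr (p - 1) \<le> (l * d) powr (p - 1)" using False assms by (intro powr_mono2) auto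
  then have "d * 1 \<le> d * (l powr (p - 1) * d powr (p - 1))"
    using assms d by (intro mult_left_mono) (auto simp: powr_mult)
  also have "\<dots> = l powr (p - 1) * d powr p" using d by (simp add: powr_diff)
  finally show ?thesis using assms by (simp add: add_increasing2)
qed

text \<open>The integrand may change sign. Both sides discard negative parts, but on the left this
  happens only after positive and negative values have cancelled.\<close>

lemma ennreal_integral_le_nn_integral:
  fixes f :: "'a \<Rightarrow> real"
  assumes "integrable M f"
  shows "ennreal (\<integral>x. f x \<partial>M) \<le> (\<integral>\<^sup>+ x. ennreal (f x) \<partial>M)"
proof -
  have "ennreal (\<integral>x. f x \<partial>M) \<le> ennreal (\<integral>x. max 0 (f x) \<partial>M)"
    using assms by (intro ennreal_leI integral_mono) auto
  also have "\<dots> = (\<integral>\<^sup>+ x. ennreal (max 0 (f x)) \<partial>M)"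
    using assms by (intro nn_integral_eq_integral [symmetric]) auto
  also have "\<dots> = (\<integral>\<^sup>+ x. ennreal (f x) \<partial>M)" by (intro nn_integral_cong) (auto simp: max_def ennreal_neg)
  finally show ?thesis .
qed

text \<open>Put \<open>w = u - v\<close>. The kernel mass times \<open>w x\<close> is the integral
  of the kernel against \<open>w x - w y\<close> plus that against \<open>w y\<close>. The first is
  bounded by the two energy densities through \<open>le_powr_scaled\<close>, whose two constants
  \<open>1 / l\<close> are the subtracted \<open>2 / l\<close>; the second is the difference of the
  averages of \<open>u\<close> and \<open>v\<close>.\<close>

lemma cut_average_pointwise:
  fixes u v :: "'a::euclidean_space \<Rightarrow> real"
  assumes p: "1 < p" and l: "0 < l" and u: "integrable lebesgue u" and v: "integrable lebesgue v"
  shows "ennreal ((\<integral>y. cut_kernel j x y \<partial>lebesgue) * (\<bar>u x - v x\<bar> - 2 / l))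
    \<le> (\<integral>\<^sup>+ y. ennreal (l powr (p - 1) * (cut_kernel j x y * (\<bar>u x - u y\<bar> powr p + \<bar>v x - v y\<bar> powr p))) \<partial>lebesgue)
      + ennreal \<bar>(\<integral>y. cut_kernel j x y * u y \<partial>lebesgue) - (\<integral>y. cut_kernel j x y * v y \<partial>lebesgue)\<bar>"
proof -
  define w where "w y = u y - v y" for y
  define k where "k = cut_kernel j x"
  have w: "integrable lebesgue w" using u v by (simp add: w_def[abs_def])
  have k: "integrable lebesgue k" by (simp add: k_def integrable_cut_kernel)
  have kw: "integrable lebesgue (\<lambda>y. k y * w y)"
    unfolding k_def by (rule integrable_cut_kernel_mult[OF w])
  have k0: "0 \<le> k y" for y by (simp add: k_def)
  have i1: "integrable lebesgue (\<lambda>y. k y * (w x - w y))"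
    using k kw by (simp add: right_diff_distrib)
  have i1': "integrable lebesgue (\<lambda>y. k y * \<bar>w x - w y\<bar>)"
    using integrable_abs[OF i1] k0 by (simp add: abs_mult)
  have i2: "integrable lebesgue (\<lambda>y. k y * (\<bar>w x - w y\<bar> - 2 / l))"
    using i1' k by (simp add: right_diff_distrib)
  have "(\<integral>y. k y \<partial>lebesgue) * w x = (\<integral>y. k y * w x \<partial>lebesgue)" using k by simp
  also have "\<dots> = (\<integral>y. k y * (w x - w y) + k y * w y \<partial>lebesgue)"
    by (rule Bochner_Integration.integral_cong) (auto simp: algebra_simps)
  also have "\<dots> = (\<integral>y. k y * (w x - w y) \<partial>lebesgue) + (\<integral>y. k y * w y \<partial>lebesgue)"
    by (rule Bochner_Integration.integral_add[OF i1 kw])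
  finally have eq: "(\<integral>y. k y \<partial>lebesgue) * w x = \<dots>" .
  have k_int: "0 \<le> (\<integral>y. k y \<partial>lebesgue)" using k0 by simp
  have "(\<integral>y. k y \<partial>lebesgue) * \<bar>w x\<bar> = \<bar>(\<integral>y. k y \<partial>lebesgue) * w x\<bar>" using k_int by (simp add: abs_mult)
  also have "\<dots> \<le> \<bar>\<integral>y. k y * (w x - w y) \<partial>lebesgue\<bar> + \<bar>\<integral>y. k y * w y \<partial>lebesgue\<bar>"
    unfolding eq by (rule abs_triangle_ineq)
  also have "\<bar>\<integral>y. k y * (w x - w y) \<partial>lebesgue\<bar> \<le> (\<integral>y. k y * \<bar>w x - w y\<bar> \<partial>lebesgue)"
    using integral_abs_bound[of lebesgue "\<lambda>y. k y * (w x - w y)"] k0 by (simp add: abs_mult)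
  finally have "(\<integral>y. k y \<partial>lebesgue) * (\<bar>w x\<bar> - 2 / l)
      \<le> (\<integral>y. k y * \<bar>w x - w y\<bar> \<partial>lebesgue) - (\<integral>y. k y * (2 / l) \<partial>lebesgue) + \<bar>\<integral>y. k y * w y \<partial>lebesgue\<bar>"
    using k by (simp add: right_diff_distrib)
  also have "(\<integral>y. k y * \<bar>w x - w y\<bar> \<partial>lebesgue) - (\<integral>y. k y * (2 / l) \<partial>lebesgue)
      = (\<integral>y. k y * (\<bar>w x - w y\<bar> - 2 / l) \<partial>lebesgue)"
    using i1' k by (subst Bochner_Integration.integral_diff [symmetric]) (auto simp: right_diff_distrib)
  finally have "ennreal ((\<integral>y. k y \<partial>lebesgue) * (\<bar>w x\<bar> - 2 / l))
     \<le> ennreal ((\<integral>y. k y * (\<bar>w x - w y\<bar> - 2 / l) \<partial>lebesgue) + \<bar>\<integral>y. k y * w y \<partial>lebesgue\<bar>)"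
    by (rule ennreal_leI)
  also have "\<dots> \<le> ennreal (\<integral>y. k y * (\<bar>w x - w y\<bar> - 2 / l) \<partial>lebesgue) + ennreal \<bar>\<integral>y. k y * w y \<partial>lebesgue\<bar>"
  proof (cases "0 \<le> (\<integral>y. k y * (\<bar>w x - w y\<bar> - 2 / l) \<partial>lebesgue)")
    case False
    then have "ennreal ((\<integral>y. k y * (\<bar>w x - w y\<bar> - 2 / l) \<partial>lebesgue) + \<bar>\<integral>y. k y * w y \<partial>lebesgue\<bar>)
      \<le> ennreal \<bar>\<integral>y. k y * w y \<partial>lebesgue\<bar>" by (intro ennreal_leI) simp
    then show ?thesis by (simp add: add_increasing)
  qed simp
  also have "ennreal (\<integral>y. k y * (\<bar>w x - w y\<bar> - 2 / l) \<partial>lebesgue)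
      \<le> (\<integral>\<^sup>+ y. ennreal (k y * (\<bar>w x - w y\<bar> - 2 / l)) \<partial>lebesgue)"
    by (rule ennreal_integral_le_nn_integral[OF i2])
  also have "\<dots> \<le> (\<integral>\<^sup>+ y. ennreal (l powr (p - 1) * (k y * (\<bar>u x - u y\<bar> powr p + \<bar>v x - v y\<bar> powr p))) \<partial>lebesgue)"
  proof (intro nn_integral_mono ennreal_leI)
    fix y
    have "\<bar>w x - w y\<bar> \<le> \<bar>u x - u y\<bar> + \<bar>v x - v y\<bar>" by (simp add: w_def)
    also have "\<dots> \<le> (l powr (p - 1) * \<bar>u x - u y\<bar> powr p + 1 / l) + (l powr (p - 1) * \<bar>v x - v y\<bar> powr p + 1 / l)"
      using p l by (intro add_mono le_powr_scaled) auto
    finally have "\<bar>w x - w y\<bar> - 2 / l \<le> l powr (p - 1) * (\<bar>u x - u y\<bar> powr p + \<bar>v x - v y\<bar> powr p)"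
      by (simp add: algebra_simps)
    then have "k y * (\<bar>w x - w y\<bar> - 2 / l) \<le> k y * (l powr (p - 1) * (\<bar>u x - u y\<bar> powr p + \<bar>v x - v y\<bar> powr p))"
      using k0 by (rule mult_left_mono)
    then show "k y * (\<bar>w x - w y\<bar> - 2 / l) \<le> l powr (p - 1) * (k y * (\<bar>u x - u y\<bar> powr p + \<bar>v x - v y\<bar> powr p))"
      by (simp add: mult_ac)
  qed
  also have "(\<integral>y. k y * w y \<partial>lebesgue) = (\<integral>y. k y * u y \<partial>lebesgue) - (\<integral>y. k y * v y \<partial>lebesgue)"
    using integrable_cut_kernel_mult[OF u, of j x] integrable_cut_kernel_mult[OF v, of j x]
    by (subst Bochner_Integration.integral_diff [symmetric]) (auto simp: w_def k_def right_diff_distrib)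
  finally show ?thesis by (simp add: w_def k_def add_mono)
qed

definition near_region :: "('a::real_normed_vector \<times> 'a) set" where
  "near_region = {z. norm (fst z - snd z) \<le> 1}"

lemma sets_near_region [measurable]:
  "near_region \<in> sets (lebesgue \<Otimes>\<^sub>M (lebesgue :: 'a::euclidean_space measure))"
proof -
  have "{z \<in> space (lebesgue \<Otimes>\<^sub>M (lebesgue :: 'a measure)). norm (fst z - snd z) \<le> 1} \<in> sets (lebesgue \<Otimes>\<^sub>M lebesgue)"
    by measurable
  then show ?thesis by (simp add: near_region_def space_pair_measure)
qed

text \<open>Half the \<open>p\<close>-th power of the seminorm of the energy space, taken in
  \<open>ennreal\<close> so that it makes sense for functions of infinite energy.\<close>

definition near_energy :: "real \<Rightarrow> ('a::euclidean_space \<Rightarrow> real) \<Rightarrow> ennreal" where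
  "near_energy p u = (\<integral>\<^sup>+ z. ennreal (near_density p u z) * indicator near_region z \<partial>(lebesgue \<Otimes>\<^sub>M lebesgue))"

lemma cut_kernel_powr_le_near_density:
  fixes x y :: "'a::euclidean_space"
  assumes p: "1 < p"
  shows "cut_kernel j x y * \<bar>u x - u y\<bar> powr p \<le> 2 / C_const DIM('a) p * (near_density p u (x, y) * indicator near_region (x, y))"
proof -
  have C: "0 < C_const DIM('a) p" using p by (intro C_const_pos) auto
  show ?thesis
  \<comment> \<open>On the diagonal the two kernels are not ordered as required, but there the
    difference of \<open>u\<close> vanishes.\<close>
  proof (cases "x = y \<or> (x, y) \<notin> near_region")
    case True
    then have "cut_kernel j x y * \<bar>u x - u y\<bar> powr p = 0"
      using cut_kernel_eq_0[of x y j] by (auto simp: near_region_def)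
    moreover have "0 \<le> 2 / C_const DIM('a) p * (near_density p u (x, y) * indicator near_region (x, y))"
      using C p by (intro mult_nonneg_nonneg) auto
    ultimately show ?thesis by linarith
  next
    case False
    have "cut_kernel j x y * \<bar>u x - u y\<bar> powr p \<le> inv_kernel x y * \<bar>u x - u y\<bar> powr p"
      using False by (intro mult_right_mono cut_kernel_le_inv_kernel) auto
    also have "\<dots> = 2 / C_const DIM('a) p * near_density p u (x, y)"
      using C by (simp add: near_density_def)
    finally show ?thesis using False by simp
  qed
qed

text \<open>Dividing the pointwise bound by a lower bound \<open>c\<close> of the kernel mass leaves
  three terms: one small for large \<open>l\<close>, one small for large \<open>c\<close> once
  \<open>l\<close> is fixed, and the distance between averages, which is small along a subsequence
  once the kernel is fixed. The parameters are later chosen in this order.\<close>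

lemma L1_cut_average_bound:
  fixes u v :: "'a::euclidean_space \<Rightarrow> real"
  assumes p: "1 < p" and l: "0 < l" and u: "integrable lebesgue u" and v: "integrable lebesgue v"
    and \<Omega> [measurable]: "\<Omega> \<in> sets lebesgue" and m: "emeasure lebesgue \<Omega> = ennreal m" "0 \<le> m"
    and Ru: "near_energy p u \<le> ennreal R"
    and Rv: "near_energy p v \<le> ennreal R"
    and R: "0 \<le> R" and c: "1 \<le> c" "\<And>x::'a. c \<le> (\<integral>y. cut_kernel j x y \<partial>lebesgue)"
  shows "(\<integral>\<^sup>+ x. ennreal \<bar>u x - v x\<bar> * indicator \<Omega> x \<partial>lebesgue)
    \<le> ennreal (2 / l * m + 1 / c * (l powr (p - 1) * (2 / C_const DIM('a) p)) * (R + R))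
     + (\<integral>\<^sup>+ x. ennreal \<bar>(\<integral>y. cut_kernel j x y * u y \<partial>lebesgue) - (\<integral>y. cut_kernel j x y * v y \<partial>lebesgue)\<bar> * indicator \<Omega> x \<partial>lebesgue)"
proof -
  let ?P = "lebesgue \<Otimes>\<^sub>M (lebesgue :: 'a measure)"
  define K where "K = 1 / c * (l powr (p - 1) * (2 / C_const DIM('a) p))"
  have C: "0 < C_const DIM('a) p" using p by (intro C_const_pos) auto
  have K: "0 \<le> K" using c C by (simp add: K_def)
  have [measurable]: "u \<in> borel_measurable lebesgue" "v \<in> borel_measurable lebesgue" using u v by auto
  define F where "F z = ennreal (near_density p u z) * indicator near_region z + ennreal (near_density p v z) * indicator near_region z" for z :: "'a \<times> 'a"
  have F [measurable]: "F \<in> borel_measurable ?P" unfolding F_def[abs_def] by measurable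
  have F_fst [measurable]: "(\<lambda>x. \<integral>\<^sup>+ y. F (x, y) \<partial>lebesgue) \<in> borel_measurable lebesgue"
    by (rule lebesgue.borel_measurable_nn_integral_fst[OF F])
  define D where "D x = \<bar>(\<integral>y. cut_kernel j x y * u y \<partial>lebesgue) - (\<integral>y. cut_kernel j x y * v y \<partial>lebesgue)\<bar>" for x :: 'a
  have D [measurable]: "D \<in> borel_measurable lebesgue"
  proof -
    have 1: "(\<lambda>z. cut_kernel j (fst z) (snd z) * u (snd z)) \<in> borel_measurable ?P" by measurable
    have 2: "(\<lambda>z. cut_kernel j (fst z) (snd z) * v (snd z)) \<in> borel_measurable ?P" by measurable
    have "(\<lambda>x. \<integral>y. cut_kernel j x y * u y \<partial>lebesgue) \<in> borel_measurable lebesgue"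
      using 1 by (intro lebesgue.borel_measurable_lebesgue_integral) (simp add: case_prod_beta')
    moreover have "(\<lambda>x. \<integral>y. cut_kernel j x y * v y \<partial>lebesgue) \<in> borel_measurable lebesgue"
      using 2 by (intro lebesgue.borel_measurable_lebesgue_integral) (simp add: case_prod_beta')
    ultimately show ?thesis unfolding D_def[abs_def] by measurable
  qed
  have pt: "ennreal \<bar>u x - v x\<bar> \<le> ennreal (2 / l) + (ennreal K * (\<integral>\<^sup>+ y. F (x, y) \<partial>lebesgue) + ennreal (D x))" for x
  proof -
    define d where "d = \<bar>u x - v x\<bar> - 2 / l"
    have S: "(\<integral>\<^sup>+ y. ennreal (l powr (p - 1) * (cut_kernel j x y * (\<bar>u x - u y\<bar> powr p + \<bar>v x - v y\<bar> powr p))) \<partial>lebesgue)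
        \<le> (\<integral>\<^sup>+ y. ennreal (c * K) * F (x, y) \<partial>lebesgue)"
    proof (intro nn_integral_mono)
      fix y
      have "l powr (p - 1) * (cut_kernel j x y * (\<bar>u x - u y\<bar> powr p + \<bar>v x - v y\<bar> powr p))
        = l powr (p - 1) * (cut_kernel j x y * \<bar>u x - u y\<bar> powr p + cut_kernel j x y * \<bar>v x - v y\<bar> powr p)"
        by (simp add: algebra_simps)
      also have "\<dots> \<le> l powr (p - 1) * (2 / C_const DIM('a) p * (near_density p u (x, y) * indicator near_region (x, y))
          + 2 / C_const DIM('a) p * (near_density p v (x, y) * indicator near_region (x, y)))"
        using p by (intro mult_left_mono add_mono cut_kernel_powr_le_near_density) auto
      also have "\<dots> = c * K * (near_density p u (x, y) * indicator near_region (x, y) + near_density p v (x, y) * indicator near_region (x, y))"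
        using c by (simp add: K_def algebra_simps)
      finally have "ennreal (l powr (p - 1) * (cut_kernel j x y * (\<bar>u x - u y\<bar> powr p + \<bar>v x - v y\<bar> powr p)))
         \<le> ennreal (c * K * (near_density p u (x, y) * indicator near_region (x, y) + near_density p v (x, y) * indicator near_region (x, y)))"
        by (rule ennreal_leI)
      also have "\<dots> = ennreal (c * K) * ennreal (near_density p u (x, y) * indicator near_region (x, y) + near_density p v (x, y) * indicator near_region (x, y))"
        using c K by (intro ennreal_mult') simp
      also have "\<dots> = ennreal (c * K) * F (x, y)"
        using p by (auto simp: F_def indicator_def)
      finally show "ennreal (l powr (p - 1) * (cut_kernel j x y * (\<bar>u x - u y\<bar> powr p + \<bar>v x - v y\<bar> powr p)))
         \<le> ennreal (c * K) * F (x, y)" .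
    qed
    also have "\<dots> = ennreal (c * K) * (\<integral>\<^sup>+ y. F (x, y) \<partial>lebesgue)"
    proof (rule nn_integral_cmult)
      show "(\<lambda>y. F (x, y)) \<in> borel_measurable lebesgue"
        by (rule measurable_compose[OF measurable_Pair1' F]) simp
    qed
    finally have S': "(\<integral>\<^sup>+ y. ennreal (l powr (p - 1) * (cut_kernel j x y * (\<bar>u x - u y\<bar> powr p + \<bar>v x - v y\<bar> powr p))) \<partial>lebesgue)
        \<le> ennreal (c * K) * (\<integral>\<^sup>+ y. F (x, y) \<partial>lebesgue)" .
    have main: "ennreal d \<le> ennreal K * (\<integral>\<^sup>+ y. F (x, y) \<partial>lebesgue) + ennreal (D x)"
    proof (cases "0 \<le> d")
      case True
      have "ennreal (c * d) \<le> ennreal ((\<integral>y. cut_kernel j x y \<partial>lebesgue) * d)"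
        using True c(2)[of x] by (intro ennreal_leI mult_right_mono)
      also have "\<dots> \<le> ennreal (c * K) * (\<integral>\<^sup>+ y. F (x, y) \<partial>lebesgue) + ennreal (D x)"
        using cut_average_pointwise[OF p l u v, of j x] S' unfolding D_def d_def
        by (meson add_right_mono order_trans)
      finally have "ennreal (1 / c) * ennreal (c * d) \<le> ennreal (1 / c) * (ennreal (c * K) * (\<integral>\<^sup>+ y. F (x, y) \<partial>lebesgue) + ennreal (D x))"
        by (intro mult_left_mono) auto
      also have "\<dots> = ennreal (1 / c) * ennreal (c * K) * (\<integral>\<^sup>+ y. F (x, y) \<partial>lebesgue) + ennreal (1 / c) * ennreal (D x)"
        by (simp add: distrib_left mult.assoc)
      also have "ennreal (1 / c) * ennreal (c * K) = ennreal K"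
        using c by (subst ennreal_mult' [symmetric]) auto
      also have "ennreal (1 / c) * ennreal (c * d) = ennreal d"
        using c by (subst ennreal_mult' [symmetric]) auto
      also have "ennreal (1 / c) * ennreal (D x) \<le> 1 * ennreal (D x)"
        using c by (intro mult_right_mono) auto
      finally show ?thesis by (simp add: add_left_mono)
    qed (simp add: ennreal_neg)
    have "ennreal \<bar>u x - v x\<bar> \<le> ennreal (2 / l + max 0 d)" by (intro ennreal_leI) (simp add: d_def)
    also have "\<dots> = ennreal (2 / l) + ennreal d" using l by (auto simp: max_def ennreal_neg)
    also have "\<dots> \<le> ennreal (2 / l) + (ennreal K * (\<integral>\<^sup>+ y. F (x, y) \<partial>lebesgue) + ennreal (D x))"
      by (intro add_left_mono main)
    finally show ?thesis .
  qed
  have "(\<integral>\<^sup>+ x. ennreal \<bar>u x - v x\<bar> * indicator \<Omega> x \<partial>lebesgue)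
    \<le> (\<integral>\<^sup>+ x. ennreal (2 / l) * indicator \<Omega> x + (ennreal K * (\<integral>\<^sup>+ y. F (x, y) \<partial>lebesgue) + ennreal (D x) * indicator \<Omega> x) \<partial>lebesgue)"
    using pt by (intro nn_integral_mono) (auto simp: indicator_def)
  also have "\<dots> = (\<integral>\<^sup>+ x. ennreal (2 / l) * indicator \<Omega> x \<partial>lebesgue)
     + ((\<integral>\<^sup>+ x. ennreal K * (\<integral>\<^sup>+ y. F (x, y) \<partial>lebesgue) \<partial>lebesgue) + (\<integral>\<^sup>+ x. ennreal (D x) * indicator \<Omega> x \<partial>lebesgue))"
  proof -
    have "(\<integral>\<^sup>+ x. ennreal K * (\<integral>\<^sup>+ y. F (x, y) \<partial>lebesgue) + ennreal (D x) * indicator \<Omega> x \<partial>lebesgue)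
       = (\<integral>\<^sup>+ x. ennreal K * (\<integral>\<^sup>+ y. F (x, y) \<partial>lebesgue) \<partial>lebesgue) + (\<integral>\<^sup>+ x. ennreal (D x) * indicator \<Omega> x \<partial>lebesgue)"
      by (rule nn_integral_add) auto
    then show ?thesis by (subst nn_integral_add) auto
  qed
  also have "(\<integral>\<^sup>+ x. ennreal (2 / l) * indicator \<Omega> x \<partial>lebesgue) = ennreal (2 / l * m)"
    using l m(2) by (simp add: nn_integral_cmult_indicator m(1) ennreal_mult'' [symmetric])
  also have "(\<integral>\<^sup>+ x. ennreal K * (\<integral>\<^sup>+ y. F (x, y) \<partial>lebesgue) \<partial>lebesgue) = ennreal K * (\<integral>\<^sup>+ x. \<integral>\<^sup>+ y. F (x, y) \<partial>lebesgue \<partial>lebesgue)"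
    by (rule nn_integral_cmult) (rule F_fst)
  also have "(\<integral>\<^sup>+ x. \<integral>\<^sup>+ y. F (x, y) \<partial>lebesgue \<partial>lebesgue) = (\<integral>\<^sup>+ z. F z \<partial>?P)"
    by (rule lebesgue.nn_integral_fst[OF F])
  also have "\<dots> = near_energy p u + near_energy p v"
    unfolding F_def near_energy_def by (rule nn_integral_add) measurable
  also have "\<dots> \<le> ennreal R + ennreal R" by (intro add_mono Ru Rv)
  also have "\<dots> = ennreal (R + R)" by (rule ennreal_plus[OF R R, symmetric])
  also have "ennreal K * ennreal (R + R) = ennreal (K * (R + R))" using K by (simp only: ennreal_mult')
  finally have "(\<integral>\<^sup>+ x. ennreal \<bar>u x - v x\<bar> * indicator \<Omega> x \<partial>lebesgue)
    \<le> ennreal (2 / l * m) + (ennreal (K * (R + R)) + (\<integral>\<^sup>+ x. ennreal (D x) * indicator \<Omega> x \<partial>lebesgue))"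
    by (simp add: add_left_mono add_right_mono mult_left_mono)
  also have "\<dots> = ennreal (2 / l * m + K * (R + R)) + (\<integral>\<^sup>+ x. ennreal (D x) * indicator \<Omega> x \<partial>lebesgue)"
    using l m K R by (subst ennreal_plus) (auto simp: add.assoc)
  finally show ?thesis by (simp add: K_def D_def)
qed

text \<open>The functions are bounded in L1, as the domain has finite measure, so their averages
  against each fixed cut kernel are bounded and equicontinuous. Hence the averages converge
  everywhere along a subsequence, and \<open>L1_cut_average_bound\<close> turns this into a Cauchy
  property in L1 on the domain.\<close>

lemma AE_convergent_subsequence:
  fixes u :: "nat \<Rightarrow> 'a::euclidean_space \<Rightarrow> real"
  assumes p: "1 < p" and \<Omega> [measurable]: "\<Omega> \<in> sets lebesgue" and fin: "emeasure lebesgue \<Omega> < \<infinity>"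
    and u [measurable]: "\<And>n. u n \<in> borel_measurable lebesgue"
    and zero: "\<And>n. AE x in lebesgue. x \<notin> \<Omega> \<longrightarrow> u n x = 0"
    and norm: "\<And>n. (\<integral>\<^sup>+ x. ennreal (\<bar>u n x\<bar> powr p) \<partial>lebesgue) \<le> ennreal R" 
    and near: "\<And>n. near_energy p (u n) \<le> ennreal R"
    and R: "0 < R"
  obtains r v where "strict_mono (r :: nat \<Rightarrow> nat)" "v \<in> borel_measurable lebesgue"
    "AE x in lebesgue. (\<lambda>n. u (r n) x) \<longlonglongrightarrow> v x"
proof -
  define m where "m = measure lebesgue \<Omega>"
  have m: "emeasure lebesgue \<Omega> = ennreal m" "0 \<le> m"
    using fin emeasure_eq_ennreal_measure[of lebesgue \<Omega>] by (simp_all add: m_def less_top)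
  define A where "A = R + m"
  have A: "0 < A" using R m by (simp add: A_def)
  have nn: "(\<integral>\<^sup>+ x. ennreal \<bar>u n x\<bar> \<partial>lebesgue) \<le> ennreal A" for n
  proof -
    have "(\<integral>\<^sup>+ x. ennreal \<bar>u n x\<bar> \<partial>lebesgue) \<le> (\<integral>\<^sup>+ x. ennreal (\<bar>u n x\<bar> powr p) + indicator \<Omega> x \<partial>lebesgue)"
    proof (rule nn_integral_mono_AE)
      show "AE x in lebesgue. ennreal \<bar>u n x\<bar> \<le> ennreal (\<bar>u n x\<bar> powr p) + indicator \<Omega> x"
        using zero[of n]
      proof eventually_elim
        case (elim x)
        show ?case
        proof (cases "x \<in> \<Omega>")
          case True
          have "ennreal \<bar>u n x\<bar> \<le> ennreal (\<bar>u n x\<bar> powr p + 1)"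
            using le_one_add_powr[of p "\<bar>u n x\<bar>"] p by (intro ennreal_leI) simp
          then show ?thesis using True by (subst (asm) ennreal_plus) auto
        qed (use elim in auto)
      qed
    qed
    also have "\<dots> = (\<integral>\<^sup>+ x. ennreal (\<bar>u n x\<bar> powr p) \<partial>lebesgue) + emeasure lebesgue \<Omega>"
      by (subst nn_integral_add) auto
    also have "\<dots> \<le> ennreal R + ennreal m" using norm[of n] m by (simp add: add_right_mono)
    also have "\<dots> = ennreal A" unfolding A_def by (rule ennreal_plus [symmetric]) (use R m in auto)
    finally show ?thesis .
  qed
  have int: "integrable lebesgue (u n)" for n
    using le_less_trans[OF nn[of n]] by (intro integrableI_bounded) auto
  have intA: "(\<integral>x. \<bar>u n x\<bar> \<partial>lebesgue) \<le> A" for n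
  proof -
    have "ennreal (\<integral>x. \<bar>u n x\<bar> \<partial>lebesgue) = (\<integral>\<^sup>+ x. ennreal \<bar>u n x\<bar> \<partial>lebesgue)"
      using int[of n] by (intro nn_integral_eq_integral [symmetric]) auto
    then have "ennreal (\<integral>x. \<bar>u n x\<bar> \<partial>lebesgue) \<le> ennreal A" using nn[of n] by simp
    then show ?thesis using A by (subst (asm) ennreal_le_iff) auto
  qed
  define T where "T j n x = (\<integral>y. cut_kernel j x y * u n y \<partial>lebesgue)" for j n and x :: 'a
  define B where "B j = (1 + real j) ^ DIM('a) * A" for j
  have B: "0 < B j" for j using A by (simp add: B_def)
  have ik: "integrable lebesgue (\<lambda>y. cut_kernel j x y * u n y)" for j x n
    by (rule integrable_cut_kernel_mult[OF int])
  have T_bound: "\<bar>T j n x\<bar> \<le> B j" for j n x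
  proof -
    have "\<bar>T j n x\<bar> \<le> (\<integral>y. \<bar>cut_kernel j x y * u n y\<bar> \<partial>lebesgue)"
      unfolding T_def by (rule integral_abs_bound)
    also have "\<dots> \<le> (\<integral>y. (1 + real j) ^ DIM('a) * \<bar>u n y\<bar> \<partial>lebesgue)"
    proof (rule integral_mono)
      show "\<bar>cut_kernel j x y * u n y\<bar> \<le> (1 + real j) ^ DIM('a) * \<bar>u n y\<bar>" for y
        using cut_kernel_le[of j x y] by (simp add: abs_mult mult_right_mono)
    qed (use ik[of j x n] int[of n] in auto)
    also have "\<dots> \<le> B j" using intA[of n] by (simp add: B_def)
    finally show ?thesis .
  qed
  have T_cont: "\<bar>T j n x - T j n x'\<bar> \<le> e * A" if "\<And>y. \<bar>cut_kernel j x y - cut_kernel j x' y\<bar> \<le> e" "0 \<le> e" for j n x x' e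
  proof -
    have "T j n x - T j n x' = (\<integral>y. (cut_kernel j x y - cut_kernel j x' y) * u n y \<partial>lebesgue)"
      unfolding T_def using ik[of j x n] ik[of j x' n]
      by (subst Bochner_Integration.integral_diff [symmetric]) (auto simp: left_diff_distrib)
    then have "\<bar>T j n x - T j n x'\<bar> \<le> (\<integral>y. \<bar>(cut_kernel j x y - cut_kernel j x' y) * u n y\<bar> \<partial>lebesgue)"
      using integral_abs_bound[of lebesgue] by simp
    also have "\<dots> \<le> (\<integral>y. e * \<bar>u n y\<bar> \<partial>lebesgue)"
    proof (rule integral_mono)
      have "integrable lebesgue (\<lambda>y. cut_kernel j x y * u n y - cut_kernel j x' y * u n y)"
        using ik[of j x n] ik[of j x' n] by (rule Bochner_Integration.integrable_diff)
      then show "integrable lebesgue (\<lambda>y. \<bar>(cut_kernel j x y - cut_kernel j x' y) * u n y\<bar>)"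
        by (intro integrable_abs) (simp add: left_diff_distrib)
      show "\<bar>(cut_kernel j x y - cut_kernel j x' y) * u n y\<bar> \<le> e * \<bar>u n y\<bar>" for y
        using that(1)[of y] by (simp add: abs_mult mult_right_mono)
    qed (use int[of n] in simp)
    also have "\<dots> \<le> e * A" using intA[of n] that(2) by (simp add: mult_left_mono)
    finally show ?thesis .
  qed
  obtain D :: "'a set" where D: "countable D" "\<And>X. open X \<Longrightarrow> X \<noteq> {} \<Longrightarrow> \<exists>d\<in>D. d \<in> X"
    using countable_dense_exists by blast
  \<comment> \<open>One diagonal argument runs over all pairs of a kernel index and a point of a
    countable dense set; dividing by \<open>B\<close> supplies the common bound 1 that it
    requires.\<close>
  obtain k :: "nat \<Rightarrow> nat" where k: "strict_mono k"
    "\<And>z. z \<in> UNIV \<times> D \<Longrightarrow> \<exists>l. (\<lambda>n. T (fst z) (k n) (snd z) / B (fst z)) \<longlonglongrightarrow> l"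
  proof (rule function_convergent_subsequence[of "UNIV \<times> D" "\<lambda>n z. T (fst z) n (snd z) / B (fst z)" 1])
    show "countable (UNIV \<times> D :: (nat \<times> 'a) set)" using D(1) by simp
    show "norm (T (fst z) n (snd z) / B (fst z)) \<le> 1" for n z
      using T_bound[of "fst z" n "snd z"] B[of "fst z"] by (simp add: divide_le_eq)
  qed blast
  have conv: "convergent (\<lambda>n. T j (k n) x)" for j x
  proof (rule Cauchy_convergent, rule metric_CauchyI)
    fix e :: real assume e: "0 < e"
    then have "0 < e / (3 * A)" using A by simp
    then obtain d where d: "0 < d" "\<And>x x' y::'a. norm (x - x') < d \<Longrightarrow> \<bar>cut_kernel j x y - cut_kernel j x' y\<bar> < e / (3 * A)"
      by (rule cut_kernel_uniformly_continuous[of _ j]) blast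
    obtain q where q: "q \<in> D" "q \<in> ball x d" using D(2)[of "ball x d"] d(1) by auto
    have close: "\<bar>T j n x - T j n q\<bar> \<le> e / 3" for n
      using T_cont[of j x q "e / (3 * A)" n] d(2)[of x q] q(2) e A by (simp add: dist_norm less_imp_le)
    obtain l where "(\<lambda>n. T j (k n) q / B j) \<longlonglongrightarrow> l" using k(2)[of "(j, q)"] q(1) by auto
    then have "(\<lambda>n. (T j (k n) q / B j) * B j) \<longlonglongrightarrow> l * B j" by (rule tendsto_mult_right)
    then have "(\<lambda>n. T j (k n) q) \<longlonglongrightarrow> l * B j" using B[of j] by simp
    then have "Cauchy (\<lambda>n. T j (k n) q)" using convergent_Cauchy convergentI by blast
    then obtain K where K: "\<And>m n. K \<le> m \<Longrightarrow> K \<le> n \<Longrightarrow> dist (T j (k m) q) (T j (k n) q) < e / 3"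
      using e unfolding Cauchy_def by (metis divide_pos_pos zero_less_numeral)
    show "\<exists>K. \<forall>m\<ge>K. \<forall>n\<ge>K. dist (T j (k m) x) (T j (k n) x) < e"
    proof (intro exI allI impI)
      fix m n assume "K \<le> m" "K \<le> n"
      then show "dist (T j (k m) x) (T j (k n) x) < e"
        using K[of m n] close[of "k m"] close[of "k n"] unfolding dist_real_def by linarith
    qed
  qed
  define L where "L j x = lim (\<lambda>n. T j (k n) x)" for j x
  have L: "(\<lambda>n. T j (k n) x) \<longlonglongrightarrow> L j x" for j x
    using conv[of j x] by (simp add: L_def convergent_LIMSEQ_iff)
  have T_meas [measurable]: "T j n \<in> borel_measurable lebesgue" for j n
  proof -
    have 1: "(\<lambda>z. cut_kernel j (fst z) (snd z) * u n (snd z)) \<in> borel_measurable (lebesgue \<Otimes>\<^sub>M (lebesgue :: 'a measure))" by measurable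
    show ?thesis unfolding T_def[abs_def]
      using 1 by (intro lebesgue.borel_measurable_lebesgue_integral) (simp add: case_prod_beta')
  qed
  have L_meas [measurable]: "L j \<in> borel_measurable lebesgue" for j
    unfolding L_def[abs_def] by measurable
  have L_bound: "\<bar>L j x\<bar> \<le> B j" for j x
    by (rule LIMSEQ_le_const2[OF tendsto_rabs[OF L]]) (use T_bound in blast)
  define f where "f n x = indicator \<Omega> x * u (k n) x" for n x
  have f_meas [measurable]: "f n \<in> borel_measurable lebesgue" for n
    unfolding f_def[abs_def] by measurable
  have I\<Omega>: "integrable lebesgue (indicator \<Omega> :: 'a \<Rightarrow> real)"
    using fin by (intro integrable_real_indicator) auto
  have Cauchy: "\<exists>K. \<forall>n\<ge>K. \<forall>n'\<ge>K. (\<integral>\<^sup>+ x. ennreal \<bar>f n x - f n' x\<bar> \<partial>lebesgue) \<le> ennreal e" if e: "0 < e" for e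
  proof -
    \<comment> \<open>Chosen so that \<open>2 / l * m\<close> is at most \<open>e / 3\<close>; the
      \<open>m + 1\<close> keeps \<open>l\<close> positive when \<open>m = 0\<close>.\<close>
    define l where "l = 6 * (m + 1) / e"
    have l: "0 < l" using m e by (simp add: l_def)
    have l2: "2 / l * m \<le> e / 3" using m e by (simp add: l_def field_simps)
    define K1 where "K1 = (l powr (p - 1) * (2 / C_const DIM('a) p)) * (R + R)"
    define c where "c j = real DIM('a) * unit_ball_vol DIM('a) * ln (real (Suc j) / 2) / 2" for j
    have c_alt: "c j = real DIM('a) * unit_ball_vol DIM('a) / 2 * ln (real (Suc j) / 2)" for j
      by (simp add: c_def)
    \<comment> \<open>The kernel mass grows without bound in \<open>j\<close>, so it eventually
      exceeds \<open>3 * K1 / e\<close>, where \<open>K1\<close> depends on \<open>l\<close> and the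
      energy bound only.\<close>
    have "filterlim (\<lambda>j. ln (real (Suc j) / 2)) at_top sequentially" by real_asymp
    then have "filterlim c at_top sequentially"
      unfolding c_alt by (intro filterlim_tendsto_pos_mult_at_top[OF tendsto_const]) auto
    then have "eventually (\<lambda>j. max 1 (3 * K1 / e) \<le> c j) sequentially"
      unfolding filterlim_at_top by blast
    then obtain j where j: "1 \<le> j" "max 1 (3 * K1 / e) \<le> c j"
      using eventually_conj[OF eventually_ge_at_top[of "1::nat"]] eventually_happens' sequentially_bot by (smt (verit))
    have c1: "1 \<le> c j" "3 * K1 / e \<le> c j" using j by auto
    have c2: "1 / c j * K1 \<le> e / 3" using c1 e by (simp add: field_simps)
    have c3: "c j \<le> (\<integral>y. cut_kernel j x y \<partial>lebesgue)" for x :: 'a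
      using integral_cut_kernel_ge[OF j(1), of x] by (simp add: c_def)
    have "(\<lambda>n. \<integral>x. indicator \<Omega> x * \<bar>T j (k n) x - L j x\<bar> \<partial>lebesgue) \<longlonglongrightarrow> (\<integral>x. 0 \<partial>(lebesgue :: 'a measure))"
    proof (rule integral_dominated_convergence[where w = "\<lambda>x. (2 * B j) * indicator \<Omega> x"])
      show "AE x in lebesgue. (\<lambda>n. indicator \<Omega> x * \<bar>T j (k n) x - L j x\<bar>) \<longlonglongrightarrow> 0"
      proof (rule AE_I2)
        fix x
        have "(\<lambda>n. indicator \<Omega> x * \<bar>T j (k n) x - L j x\<bar>) \<longlonglongrightarrow> indicator \<Omega> x * \<bar>L j x - L j x\<bar>"
          by (intro tendsto_intros L)
        then show "(\<lambda>n. indicator \<Omega> x * \<bar>T j (k n) x - L j x\<bar>) \<longlonglongrightarrow> 0" by simp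
      qed
      show "AE x in lebesgue. norm (indicator \<Omega> x * \<bar>T j (k n) x - L j x\<bar>) \<le> 2 * B j * indicator \<Omega> x" for n
      proof (rule AE_I2)
        fix x
        show "norm (indicator \<Omega> x * \<bar>T j (k n) x - L j x\<bar>) \<le> 2 * B j * indicator \<Omega> x"
          using T_bound[of j "k n" x] L_bound[of j x] by (auto simp: indicator_def)
      qed
      show "integrable lebesgue (\<lambda>x. (2 * B j) * indicator \<Omega> x)" using I\<Omega> by (rule integrable_mult_right)
    qed auto
    then have "eventually (\<lambda>n. (\<integral>x. indicator \<Omega> x * \<bar>T j (k n) x - L j x\<bar> \<partial>lebesgue) < e / 6) sequentially"
      using e by (intro order_tendstoD(2)) auto
    then obtain K where K: "\<And>n. K \<le> n \<Longrightarrow> (\<integral>x. indicator \<Omega> x * \<bar>T j (k n) x - L j x\<bar> \<partial>lebesgue) < e / 6"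
      by (auto simp: eventually_sequentially)
    have iT: "integrable lebesgue (\<lambda>x. indicator \<Omega> x * \<bar>T j (k n) x - L j x\<bar>)" for n
    proof (rule Bochner_Integration.integrable_bound[OF integrable_mult_right[OF I\<Omega>, of "2 * B j"]])
      show "AE x in lebesgue. norm (indicator \<Omega> x * \<bar>T j (k n) x - L j x\<bar>) \<le> norm (2 * B j * indicator \<Omega> x)"
      proof (rule AE_I2)
        fix x
        show "norm (indicator \<Omega> x * \<bar>T j (k n) x - L j x\<bar>) \<le> norm (2 * B j * indicator \<Omega> x)"
          using T_bound[of j "k n" x] L_bound[of j x] by (auto simp: indicator_def)
      qed
    qed measurable
    have TK: "(\<integral>\<^sup>+ x. ennreal \<bar>T j (k n) x - T j (k n') x\<bar> * indicator \<Omega> x \<partial>lebesgue) \<le> ennreal (e / 3)"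
      if "K \<le> n" "K \<le> n'" for n n'
    proof -
      have "(\<integral>\<^sup>+ x. ennreal \<bar>T j (k n) x - T j (k n') x\<bar> * indicator \<Omega> x \<partial>lebesgue)
        \<le> (\<integral>\<^sup>+ x. ennreal (indicator \<Omega> x * \<bar>T j (k n) x - L j x\<bar> + indicator \<Omega> x * \<bar>T j (k n') x - L j x\<bar>) \<partial>lebesgue)"
        by (intro nn_integral_mono) (auto simp: indicator_def simp del: ennreal_plus intro!: ennreal_leI)
      also have "\<dots> = ennreal (\<integral>x. indicator \<Omega> x * \<bar>T j (k n) x - L j x\<bar> + indicator \<Omega> x * \<bar>T j (k n') x - L j x\<bar> \<partial>lebesgue)"
        using iT by (intro nn_integral_eq_integral) auto
      also have "\<dots> \<le> ennreal (e / 3)"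
      proof (rule ennreal_leI)
        have "(\<integral>x. indicator \<Omega> x * \<bar>T j (k n) x - L j x\<bar> + indicator \<Omega> x * \<bar>T j (k n') x - L j x\<bar> \<partial>lebesgue)
          = (\<integral>x. indicator \<Omega> x * \<bar>T j (k n) x - L j x\<bar> \<partial>lebesgue) + (\<integral>x. indicator \<Omega> x * \<bar>T j (k n') x - L j x\<bar> \<partial>lebesgue)"
          by (rule Bochner_Integration.integral_add[OF iT iT])
        then show "(\<integral>x. indicator \<Omega> x * \<bar>T j (k n) x - L j x\<bar> + indicator \<Omega> x * \<bar>T j (k n') x - L j x\<bar> \<partial>lebesgue) \<le> e / 3"
          using K[OF that(1)] K[OF that(2)] by simp
      qed
      finally show ?thesis .
    qed
    show ?thesis
    proof (intro exI allI impI)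
      fix n n' assume n: "K \<le> n" "K \<le> n'"
      have "(\<integral>\<^sup>+ x. ennreal \<bar>f n x - f n' x\<bar> \<partial>lebesgue) = (\<integral>\<^sup>+ x. ennreal \<bar>u (k n) x - u (k n') x\<bar> * indicator \<Omega> x \<partial>lebesgue)"
        by (intro nn_integral_cong) (auto simp: f_def indicator_def)
      also have "\<dots> \<le> ennreal (2 / l * m + 1 / c j * (l powr (p - 1) * (2 / C_const DIM('a) p)) * (R + R))
         + (\<integral>\<^sup>+ x. ennreal \<bar>T j (k n) x - T j (k n') x\<bar> * indicator \<Omega> x \<partial>lebesgue)"
        unfolding T_def
        by (rule L1_cut_average_bound[OF p l int int \<Omega> m near near _ c1(1) c3]) (use R in simp)
      also have "\<dots> \<le> ennreal (e / 3 + e / 3) + ennreal (e / 3)"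
        using l2 c2 by (intro add_mono ennreal_leI TK n) (auto simp: K1_def mult.assoc)
      also have "\<dots> = ennreal e" using e by (subst ennreal_plus [symmetric]) auto
      finally show "(\<integral>\<^sup>+ x. ennreal \<bar>f n x - f n' x\<bar> \<partial>lebesgue) \<le> ennreal e" .
    qed
  qed
  obtain s :: "nat \<Rightarrow> nat" where s: "strict_mono s" "AE x in lebesgue. convergent (\<lambda>n. f (s n) x)"
    by (rule L1_Cauchy_AE_subseq[of f lebesgue]) (use f_meas Cauchy in auto)
  define v where "v x = lim (\<lambda>n. f (s n) x)" for x
  have "AE x in lebesgue. \<forall>n. x \<notin> \<Omega> \<longrightarrow> u n x = 0" unfolding AE_all_countable using zero by simp
  with s(2) have "AE x in lebesgue. (\<lambda>n. u ((k \<circ> s) n) x) \<longlonglongrightarrow> v x"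
  proof eventually_elim
    case (elim x)
    have "f n x = u (k n) x" for n using elim(2) by (auto simp: f_def indicator_def)
    then show ?case using elim(1) by (simp add: v_def convergent_LIMSEQ_iff)
  qed
  moreover have "v \<in> borel_measurable lebesgue" unfolding v_def[abs_def] by measurable
  moreover have "strict_mono (k \<circ> s)" using k(1) s(1) by (rule strict_mono_o)
  ultimately show ?thesis using that by blast
qed

section \<open>A nonzero function of finite energy\<close>

lemma nn_integral_inv_kernel_norm_le:
  fixes x :: "'a::euclidean_space"
  shows "(\<integral>\<^sup>+ y. ennreal (norm (x - y) * inv_kernel x y) * indicator (cball x 1) y \<partial>lebesgue)
    \<le> ennreal (2 ^ DIM('a) * unit_ball_vol DIM('a) * 2)"
proof -
  define N where "N = DIM('a)"
  have [measurable]: "cball x r \<in> sets lebesgue" for r by simp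
  \<comment> \<open>A point at distance between \<open>(1/2)^Suc k\<close> and
    \<open>(1/2)^k\<close> is charged to the ball of radius \<open>(1/2)^k\<close>. There the
    integrand is at most \<open>(1/2)^k * (2 ^ Suc k) ^ N\<close>, and the volume of the ball leaves
    \<open>2 ^ N * unit_ball_vol N * (1/2)^k\<close>, a geometric series.\<close>
  have pt: "ennreal (norm (x - y) * inv_kernel x y) * indicator (cball x 1) y
      \<le> (\<Sum>k. ennreal ((1/2)^k * (2 ^ Suc k) ^ N) * indicator (cball x ((1/2)^k)) y)" (is "?l \<le> (\<Sum>k. ?F k)") for y
  proof (cases "y = x \<or> y \<notin> cball x 1")
    case False
    define r where "r = norm (x - y)"
    have r: "0 < r" "r \<le> 1" using False by (auto simp: r_def dist_norm)
    define k where "k = (LEAST n. (1/2)^Suc n < r)"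
    obtain n0 where "(1/2)^n0 < r" using real_arch_pow_inv[of r "1/2"] r by auto
    then have "(1/2)^Suc n0 < r" by (simp add: mult.commute) (use zero_less_power[of "1/2::real" n0] in linarith)
    then have k1: "(1/2)^Suc k < r" unfolding k_def by (rule LeastI)
    have k2: "r \<le> (1/2)^k"
    proof (cases k)
      case (Suc j)
      then have "\<not> (1/2)^Suc j < r" unfolding k_def by (intro not_less_Least) simp
      then show ?thesis using Suc by simp
    qed (use r in simp)
    have "r * inv_kernel x y = r * (1 / r) ^ N"
      by (simp add: inv_kernel_def r_def N_def power_divide)
    also have "\<dots> \<le> (1/2)^k * (2 ^ Suc k) ^ N"
    proof (intro mult_mono power_mono k2)
      have "1 / r \<le> 1 / (1/2)^Suc k" using k1 r by (intro divide_left_mono) auto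
      then show "1 / r \<le> 2 ^ Suc k" by (simp add: power_divide)
    qed (use r in auto)
    finally have "ennreal (norm (x - y) * inv_kernel x y) \<le> ennreal ((1/2)^k * (2 ^ Suc k) ^ N)"
      unfolding r_def by (rule ennreal_leI)
    then have "?l \<le> ?F k" using k2 False by (auto simp: r_def dist_norm)
    also have "?F k \<le> (\<Sum>k. ?F k)"
      using sum_le_suminf[of ?F "{k}"] by (simp only: sum.insert sum.empty finite.intros empty_iff if_False not_False_eq_True add_0_right summableI zero_le)
    finally show ?thesis .
  qed auto
  have "(\<integral>\<^sup>+ y. ennreal (norm (x - y) * inv_kernel x y) * indicator (cball x 1) y \<partial>lebesgue)
    \<le> (\<integral>\<^sup>+ y. (\<Sum>k. ennreal ((1/2)^k * (2 ^ Suc k) ^ N) * indicator (cball x ((1/2)^k)) y) \<partial>lebesgue)"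
    by (intro nn_integral_mono pt)
  also have "\<dots> = (\<Sum>k. \<integral>\<^sup>+ y. ennreal ((1/2)^k * (2 ^ Suc k) ^ N) * indicator (cball x ((1/2)^k)) y \<partial>lebesgue)"
    by (rule nn_integral_suminf) measurable
  also have "\<dots> = (\<Sum>k. ennreal (2 ^ N * unit_ball_vol N * (1/2)^k))"
  proof (rule suminf_cong)
    fix k
    have "(\<integral>\<^sup>+ y. ennreal ((1/2)^k * (2 ^ Suc k) ^ N) * indicator (cball x ((1/2)^k)) y \<partial>lebesgue)
      = ennreal ((1/2)^k * (2 ^ Suc k) ^ N) * ennreal (unit_ball_vol N * ((1/2)^k) ^ N)"
      by (subst nn_integral_cmult_indicator) (simp_all add: emeasure_cball N_def)
    also have "\<dots> = ennreal ((1/2)^k * (2 ^ Suc k) ^ N * (unit_ball_vol N * ((1/2)^k) ^ N))"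
      by (rule ennreal_mult' [symmetric]) simp
    also have "(1/2)^k * (2 ^ Suc k) ^ N * (unit_ball_vol N * ((1/2)^k) ^ N)
       = (1/2)^k * unit_ball_vol N * (2 ^ Suc k * (1/2)^k) ^ N" unfolding power_mult_distrib by (simp add: mult_ac)
    also have "(2::real) ^ Suc k * (1/2)^k = 2" by (simp add: power_divide)
    finally show "(\<integral>\<^sup>+ y. ennreal ((1/2)^k * (2 ^ Suc k) ^ N) * indicator (cball x ((1/2)^k)) y \<partial>lebesgue) = ennreal (2 ^ N * unit_ball_vol N * (1/2)^k)"
      by (simp add: mult_ac)
  qed
  also have "\<dots> = ennreal (\<Sum>k. 2 ^ N * unit_ball_vol N * (1/2)^k)"
    by (rule suminf_ennreal2) (auto intro!: summable_mult summable_geometric)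
  also have "(\<Sum>k. 2 ^ N * unit_ball_vol N * (1/2)^k) = 2 ^ N * unit_ball_vol N * 2"
    by (subst suminf_mult) (auto intro!: summable_geometric simp: suminf_geometric)
  finally show ?thesis by (simp add: N_def)
qed

text \<open>The cone \<open>max 0 (r - dist x0 x)\<close> is 1-Lipschitz. For pairs at distance at
  most 1 the \<open>p\<close>-th power of its increment is at most the distance, which takes one
  power off the singularity. It supplies the nonzero element from which a Nehari point is
  obtained.\<close>

lemma bump_function:
  fixes \<Omega> :: "'a::euclidean_space set"
  assumes p: "1 < p" and \<Omega>: "open \<Omega>" "\<Omega> \<noteq> {}"
  obtains u :: "'a \<Rightarrow> real" and c where "u \<in> borel_measurable lebesgue" "\<And>x. \<bar>u x\<bar> \<le> c" "\<And>x. x \<notin> \<Omega> \<Longrightarrow> u x = 0"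
    "\<not> (AE x in lebesgue. u x = 0)"
    "near_energy p u < \<infinity>"
proof -
  obtain x0 r where r: "0 < r" "ball x0 r \<subseteq> \<Omega>" using \<Omega> open_contains_ball by blast
  define u where "u x = max 0 (r - dist x0 x)" for x
  have [measurable]: "u \<in> borel_measurable lebesgue"
    unfolding u_def[abs_def] by (intro measurable_completion) (simp add: borel_measurable_continuous_onI continuous_intros)
  have C: "0 < C_const DIM('a) p" using p by (intro C_const_pos) auto
  \<comment> \<open>If \<open>x\<close> lies outside this ball, then \<open>u\<close> vanishes at
    \<open>x\<close> and at every point within distance 1 of \<open>x\<close>, so the outer integral
    extends over a bounded set.\<close>
  define B where "B = cball x0 (r + 1)"
  have [measurable]: "B \<in> sets lebesgue" by (simp add: B_def)
  define c where "c = C_const DIM('a) p / 2"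
  have inner: "(\<integral>\<^sup>+ y. ennreal (near_density p u (x, y)) * indicator near_region (x, y) \<partial>lebesgue)
     \<le> ennreal c * ennreal (2 ^ DIM('a) * unit_ball_vol DIM('a) * 2) * indicator B x" for x
  proof -
    have "(\<integral>\<^sup>+ y. ennreal (near_density p u (x, y)) * indicator near_region (x, y) \<partial>lebesgue)
      \<le> (\<integral>\<^sup>+ y. (ennreal c * indicator B x) * (ennreal (norm (x - y) * inv_kernel x y) * indicator (cball x 1) y) \<partial>lebesgue)"
    proof (intro nn_integral_mono)
      fix y
      show "ennreal (near_density p u (x, y)) * indicator near_region (x, y)
        \<le> (ennreal c * indicator B x) * (ennreal (norm (x - y) * inv_kernel x y) * indicator (cball x 1) y)"
      proof (cases "norm (x - y) \<le> 1 \<and> u x \<noteq> u y")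
        case True
        have "x \<in> B"
        proof (rule ccontr)
          assume "x \<notin> B"
          then have "r + 1 < dist x0 x" by (simp add: B_def)
          moreover have "dist x0 x \<le> dist x0 y + dist y x" by (rule dist_triangle)
          moreover have "dist y x \<le> 1" using True by (simp add: dist_norm norm_minus_commute)
          ultimately have "u x = 0" "u y = 0" by (auto simp: u_def)
          then show False using True by simp
        qed
        have "\<bar>u x - u y\<bar> \<le> \<bar>dist x0 x - dist x0 y\<bar>" by (auto simp: u_def max_def)
        also have "\<dots> \<le> dist x y"
          using dist_triangle[of x0 x y] dist_triangle[of x0 y x] by (simp add: dist_commute abs_le_iff)
        also have "dist x y = norm (x - y)" by (rule dist_norm)
        finally have d: "\<bar>u x - u y\<bar> \<le> norm (x - y)" .
        then have "\<bar>u x - u y\<bar> powr p \<le> \<bar>u x - u y\<bar> powr 1"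
          using True p by (intro powr_mono') auto
        then have "\<bar>u x - u y\<bar> powr p \<le> norm (x - y)" using d by simp
        then have "near_density p u (x, y) \<le> c * (norm (x - y) * inv_kernel x y)"
          unfolding near_density_def c_def using C by (intro mult_left_mono) (auto intro!: mult_right_mono)
        then have "ennreal (near_density p u (x, y)) \<le> ennreal (c * (norm (x - y) * inv_kernel x y))" by (rule ennreal_leI)
        also have "\<dots> = ennreal c * ennreal (norm (x - y) * inv_kernel x y)"
          using C by (intro ennreal_mult') (simp add: c_def)
        finally show ?thesis using True \<open>x \<in> B\<close> by (simp add: near_region_def dist_norm)
      next
        case False
        then have "ennreal (near_density p u (x, y)) * indicator near_region (x, y) = 0"
          by (auto simp: near_region_def near_density_def)
        then show ?thesis by (simp only: zero_le)
      qed
    qed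
    also have "\<dots> = (ennreal c * indicator B x) * (\<integral>\<^sup>+ y. ennreal (norm (x - y) * inv_kernel x y) * indicator (cball x 1) y \<partial>lebesgue)"
    proof (rule nn_integral_cmult)
      have [measurable]: "cball x 1 \<in> sets lebesgue" by simp
      show "(\<lambda>y. ennreal (norm (x - y) * inv_kernel x y) * indicator (cball x 1) y) \<in> borel_measurable lebesgue" by measurable
    qed
    also have "\<dots> \<le> (ennreal c * indicator B x) * ennreal (2 ^ DIM('a) * unit_ball_vol DIM('a) * 2)"
      by (intro mult_left_mono nn_integral_inv_kernel_norm_le) simp
    finally show ?thesis by (simp add: mult_ac)
  qed
  have "near_energy p u
    = (\<integral>\<^sup>+ x. \<integral>\<^sup>+ y. ennreal (near_density p u (x, y)) * indicator near_region (x, y) \<partial>lebesgue \<partial>lebesgue)"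
    unfolding near_energy_def by (rule lebesgue.nn_integral_fst [symmetric]) measurable
  also have "\<dots> \<le> (\<integral>\<^sup>+ x. ennreal c * ennreal (2 ^ DIM('a) * unit_ball_vol DIM('a) * 2) * indicator B x \<partial>lebesgue)"
    by (intro nn_integral_mono inner)
  also have "\<dots> = ennreal c * ennreal (2 ^ DIM('a) * unit_ball_vol DIM('a) * 2) * emeasure lebesgue B"
    by (rule nn_integral_cmult_indicator) simp
  also have "\<dots> < \<infinity>"
    using emeasure_lborel_cball_finite[of x0 "r + 1"] by (simp add: B_def ennreal_mult_less_top)
  finally have fin: "near_energy p u < \<infinity>" .
  have "\<not> (AE x in lebesgue. u x = 0)"
  proof
    assume "AE x in lebesgue. u x = 0"
    then have "AE x in lebesgue. x \<notin> ball x0 r" by eventually_elim (auto simp: u_def)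
    then have "ball x0 r \<in> null_sets lebesgue" by (subst (asm) AE_iff_null_sets [symmetric]) auto
    then show False using open_not_negligible[of "ball x0 r"] r(1) by (simp add: negligible_iff_null_sets)
  qed
  show ?thesis
  proof (rule that[of u r])
    show "\<bar>u x\<bar> \<le> r" for x using r by (auto simp: u_def)
    show "u x = 0" if "x \<notin> \<Omega>" for x
    proof -
      have "r \<le> dist x0 x" using that r by (auto simp: not_less [symmetric])
      then show ?thesis by (simp add: u_def)
    qed
  qed fact+
qed

section \<open>Mean values and difference quotients\<close>

lemma difference_quotient:
  fixes F :: "real \<Rightarrow> real"
  assumes "\<And>t. (F has_real_derivative f t) (at t)"
  shows "\<exists>c. \<bar>c - a\<bar> \<le> \<bar>s * b\<bar> \<and> F (a + s * b) - F a = f c * (s * b)"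
proof (cases "s * b" "0 :: real" rule: linorder_cases)
  case equal
  then show ?thesis by (intro exI[of _ a]) auto
next
  case greater
  then obtain c where "a < c" "c < a + s * b" "F (a + s * b) - F a = (a + s * b - a) * f c"
    using MVT2[of a "a + s * b" F f] assms by auto
  then show ?thesis by (intro exI[of _ c]) auto
next
  case less
  then obtain c where "a + s * b < c" "c < a" "F a - F (a + s * b) = (a - (a + s * b)) * f c"
    using MVT2[of "a + s * b" a F f] assms by auto
  then show ?thesis by (intro exI[of _ c]) (auto simp: algebra_simps)
qed

text \<open>The base point \<open>al n\<close> moves with \<open>n\<close>, since the scaling
  factors of Nehari points do. Continuity of \<open>f\<close> at the limit \<open>a\<close> is
  enough, because the mean value points converge to \<open>a\<close>.\<close>

lemma difference_quotient_tendsto: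
  fixes F :: "real \<Rightarrow> real"
  assumes F: "\<And>t. (F has_real_derivative f t) (at t)" and f: "isCont f a"
    and s: "s \<longlonglongrightarrow> 0" and al: "al \<longlonglongrightarrow> a" and s0: "\<And>n. s n \<noteq> 0"
  shows "(\<lambda>n. (F (al n + s n * b) - F (al n)) / s n) \<longlonglongrightarrow> f a * b"
proof -
  have "\<exists>c. \<forall>n. \<bar>c n - al n\<bar> \<le> \<bar>s n * b\<bar> \<and> F (al n + s n * b) - F (al n) = f (c n) * (s n * b)"
    using difference_quotient[OF F] by (intro choice) blast
  then obtain c where c: "\<And>n. \<bar>c n - al n\<bar> \<le> \<bar>s n * b\<bar>" "\<And>n. F (al n + s n * b) - F (al n) = f (c n) * (s n * b)"
    by blast
  have "(\<lambda>n. \<bar>s n * b\<bar>) \<longlonglongrightarrow> \<bar>0 * b\<bar>" by (intro tendsto_intros s)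
  then have lim: "(\<lambda>n. \<bar>s n * b\<bar>) \<longlonglongrightarrow> 0" by (simp only: mult_zero_left abs_zero)
  have "(\<lambda>n. c n - al n) \<longlonglongrightarrow> 0"
  proof (rule Lim_null_comparison[OF _ lim])
    show "\<forall>\<^sub>F n in sequentially. norm (c n - al n) \<le> \<bar>s n * b\<bar>"
      by (rule always_eventually, rule allI, unfold real_norm_def, rule c(1))
  qed
  then have "(\<lambda>n. (c n - al n) + al n) \<longlonglongrightarrow> 0 + a" by (intro tendsto_add al)
  then have "(\<lambda>n. f (c n) * b) \<longlonglongrightarrow> f a * b"
    by (intro tendsto_mult_right isCont_tendsto_compose[OF f]) (simp only: diff_add_cancel add_0_left)
  also have "(\<lambda>n. f (c n) * b) = (\<lambda>n. (F (al n + s n * b) - F (al n)) / s n)"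
  proof
    fix n
    show "f (c n) * b = (F (al n + s n * b) - F (al n)) / s n"
      using s0[of n] by (subst c(2)) simp
  qed
  finally show ?thesis .
qed

subsection \<open>Superposition operators\<close>

text \<open>The inner function is rounded down to multiples of \<open>1 / real (Suc n)\<close>. It
  then has countably many values, so measurability of the sections suffices, and continuity in the
  second variable carries the result to the limit.\<close>

lemma borel_measurable_caratheodory:
  fixes f :: "'a \<Rightarrow> real \<Rightarrow> real"
  assumes f: "\<And>t. (\<lambda>x. f x t) \<in> borel_measurable M" and cont: "\<And>x t. x \<in> space M \<Longrightarrow> isCont (f x) t"
    and w [measurable]: "w \<in> borel_measurable M"
  shows "(\<lambda>x. f x (w x)) \<in> borel_measurable M"
proof (rule borel_measurable_LIMSEQ_real)
  fix n :: nat
  show "(\<lambda>x. f x (real_of_int \<lfloor>real (Suc n) * w x\<rfloor> / real (Suc n))) \<in> borel_measurable M"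
  proof (rule measurable_compose_countable[where f = "\<lambda>i x. f x (real_of_int i / real (Suc n))"])
    show "(\<lambda>x. \<lfloor>real (Suc n) * w x\<rfloor>) \<in> measurable M (count_space UNIV)" by measurable
  qed (rule f)
next
  fix x assume x: "x \<in> space M"
  have "(\<lambda>n. real_of_int \<lfloor>real (Suc n) * w x\<rfloor> / real (Suc n)) \<longlonglongrightarrow> w x"
  proof (rule tendsto_sandwich)
    show "\<forall>\<^sub>F n in sequentially. w x - 1 / real (Suc n) \<le> real_of_int \<lfloor>real (Suc n) * w x\<rfloor> / real (Suc n)"
    proof (intro always_eventually allI)
      fix n
      have "real (Suc n) * w x - 1 \<le> real_of_int \<lfloor>real (Suc n) * w x\<rfloor>" by linarith
      then have "(real (Suc n) * w x - 1) / real (Suc n) \<le> real_of_int \<lfloor>real (Suc n) * w x\<rfloor> / real (Suc n)"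
        by (rule divide_right_mono) simp
      then show "w x - 1 / real (Suc n) \<le> real_of_int \<lfloor>real (Suc n) * w x\<rfloor> / real (Suc n)"
        by (simp add: diff_divide_distrib del: of_nat_Suc)
    qed
    show "\<forall>\<^sub>F n in sequentially. real_of_int \<lfloor>real (Suc n) * w x\<rfloor> / real (Suc n) \<le> w x"
    proof (intro always_eventually allI)
      fix n
      have "real_of_int \<lfloor>real (Suc n) * w x\<rfloor> / real (Suc n) \<le> (real (Suc n) * w x) / real (Suc n)"
        by (intro divide_right_mono) auto
      then show "real_of_int \<lfloor>real (Suc n) * w x\<rfloor> / real (Suc n) \<le> w x" by (simp del: of_nat_Suc)
    qed
    have "(\<lambda>n. w x - 1 / real (Suc n)) \<longlonglongrightarrow> w x - 0"
      by (intro tendsto_diff tendsto_const) real_asymp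
    then show "(\<lambda>n. w x - 1 / real (Suc n)) \<longlonglongrightarrow> w x" by (simp only: diff_zero)
  qed (rule tendsto_const)
  then show "(\<lambda>n. f x (real_of_int \<lfloor>real (Suc n) * w x\<rfloor> / real (Suc n))) \<longlonglongrightarrow> f x (w x)"
    by (rule isCont_tendsto_compose[OF cont[OF x]])
qed

lemma convergent_abs_bound:
  assumes "(a :: nat \<Rightarrow> real) \<longlonglongrightarrow> l" obtains K where "1 \<le> K" "\<And>n. \<bar>a n\<bar> \<le> K"
proof -
  obtain K where "\<forall>n. norm (a n) \<le> K" using convergent_imp_Bseq[OF convergentI[OF assms]] BseqE by blast
  then show ?thesis using that[of "max 1 K"] by (auto simp: le_max_iff_disj)
qed

lemma abs_lincomb_le:
  fixes a b u v K :: real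
  assumes "\<bar>a\<bar> \<le> K" "\<bar>b\<bar> \<le> K"
  shows "\<bar>a * u + b * v\<bar> \<le> K * (\<bar>u\<bar> + \<bar>v\<bar>)"
proof -
  have "\<bar>a * u + b * v\<bar> \<le> \<bar>a\<bar> * \<bar>u\<bar> + \<bar>b\<bar> * \<bar>v\<bar>" by (metis abs_mult abs_triangle_ineq)
  also have "\<dots> \<le> K * \<bar>u\<bar> + K * \<bar>v\<bar>" using assms by (intro add_mono mult_right_mono) auto
  finally show ?thesis by (simp add: distrib_left)
qed

text \<open>A common frame for the two integrals to be differentiated: the kernel form on pairs of
  points and the nonlinearity on the domain. The majorant \<open>w\<close> depends only on
  \<open>K\<close>, so one majorant serves all combinations of \<open>u\<close> and \<open>v\<close>
  with coefficients of bounded size.\<close>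

locale superposition =
  fixes M :: "'a measure" and \<phi> :: "'a \<Rightarrow> real \<Rightarrow> real" and u v :: "'a \<Rightarrow> real"
  assumes u_meas [measurable]: "u \<in> borel_measurable M" and v_meas [measurable]: "v \<in> borel_measurable M"
    and \<phi>_meas: "\<And>t. (\<lambda>x. \<phi> x t) \<in> borel_measurable M"
    and \<phi>_cont: "\<And>x t. x \<in> space M \<Longrightarrow> isCont (\<phi> x) t"
    and dominated: "\<And>K. 1 \<le> K \<Longrightarrow> \<exists>w. integrable M w \<and>
      (\<forall>x\<in>space M. \<forall>s r. \<bar>s\<bar> \<le> K * (\<bar>u x\<bar> + \<bar>v x\<bar>) \<longrightarrow> \<bar>r\<bar> \<le> K * (\<bar>u x\<bar> + \<bar>v x\<bar>) \<longrightarrow> \<bar>\<phi> x s * r\<bar> \<le> w x)"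
begin

lemma meas: "(\<lambda>x. \<phi> x (a * u x + b * v x)) \<in> borel_measurable M"
  by (rule borel_measurable_caratheodory[OF \<phi>_meas \<phi>_cont]) auto

lemma integrable: "integrable M (\<lambda>x. \<phi> x (a * u x + b * v x) * (c * u x + d * v x))"
proof -
  define K where "K = 1 + \<bar>a\<bar> + \<bar>b\<bar> + \<bar>c\<bar> + \<bar>d\<bar>"
  have K: "1 \<le> K" "\<bar>a\<bar> \<le> K" "\<bar>b\<bar> \<le> K" "\<bar>c\<bar> \<le> K" "\<bar>d\<bar> \<le> K" unfolding K_def by simp_all
  obtain w where w: "integrable M w"
    "\<And>x s r. x \<in> space M \<Longrightarrow> \<bar>s\<bar> \<le> K * (\<bar>u x\<bar> + \<bar>v x\<bar>) \<Longrightarrow> \<bar>r\<bar> \<le> K * (\<bar>u x\<bar> + \<bar>v x\<bar>) \<Longrightarrow> \<bar>\<phi> x s * r\<bar> \<le> w x"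
    using dominated[OF K(1)] by blast
  show ?thesis
  proof (rule Bochner_Integration.integrable_bound[OF w(1)])
    show "(\<lambda>x. \<phi> x (a * u x + b * v x) * (c * u x + d * v x)) \<in> borel_measurable M"
      using meas by measurable
    show "AE x in M. norm (\<phi> x (a * u x + b * v x) * (c * u x + d * v x)) \<le> norm (w x)"
    proof (rule AE_I2)
      fix x assume x: "x \<in> space M"
      have "\<bar>\<phi> x (a * u x + b * v x) * (c * u x + d * v x)\<bar> \<le> w x"
        by (rule w(2)[OF x abs_lincomb_le[OF K(2,3)] abs_lincomb_le[OF K(4,5)]])
      then show "norm (\<phi> x (a * u x + b * v x) * (c * u x + d * v x)) \<le> norm (w x)"
        unfolding real_norm_def by (rule order_trans[OF _ abs_ge_self])
    qed
  qed
qed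

lemma tendsto:
  assumes a: "a \<longlonglongrightarrow> a0" and b: "b \<longlonglongrightarrow> b0" and c: "c \<longlonglongrightarrow> c0" and d: "d \<longlonglongrightarrow> d0"
  shows "(\<lambda>n. \<integral>x. \<phi> x (a n * u x + b n * v x) * (c n * u x + d n * v x) \<partial>M)
    \<longlonglongrightarrow> (\<integral>x. \<phi> x (a0 * u x + b0 * v x) * (c0 * u x + d0 * v x) \<partial>M)"
proof -
  obtain Ka where Ka: "1 \<le> Ka" "\<And>n. \<bar>a n\<bar> \<le> Ka" using convergent_abs_bound[OF a] by blast
  obtain Kb where Kb: "1 \<le> Kb" "\<And>n. \<bar>b n\<bar> \<le> Kb" using convergent_abs_bound[OF b] by blast
  obtain Kc where Kc: "1 \<le> Kc" "\<And>n. \<bar>c n\<bar> \<le> Kc" using convergent_abs_bound[OF c] by blast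
  obtain Kd where Kd: "1 \<le> Kd" "\<And>n. \<bar>d n\<bar> \<le> Kd" using convergent_abs_bound[OF d] by blast
  define K where "K = Ka + Kb + Kc + Kd"
  have K: "1 \<le> K" "\<bar>a n\<bar> \<le> K" "\<bar>b n\<bar> \<le> K" "\<bar>c n\<bar> \<le> K" "\<bar>d n\<bar> \<le> K" for n
    using Ka(1) Kb(1) Kc(1) Kd(1) Ka(2)[of n] Kb(2)[of n] Kc(2)[of n] Kd(2)[of n] unfolding K_def by linarith+
  obtain w where w: "integrable M w"
    "\<And>x s r. x \<in> space M \<Longrightarrow> \<bar>s\<bar> \<le> K * (\<bar>u x\<bar> + \<bar>v x\<bar>) \<Longrightarrow> \<bar>r\<bar> \<le> K * (\<bar>u x\<bar> + \<bar>v x\<bar>) \<Longrightarrow> \<bar>\<phi> x s * r\<bar> \<le> w x"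
    using dominated[OF K(1)] by blast
  show ?thesis
  proof (rule integral_dominated_convergence[where w = w])
    show "AE x in M. (\<lambda>n. \<phi> x (a n * u x + b n * v x) * (c n * u x + d n * v x))
       \<longlonglongrightarrow> \<phi> x (a0 * u x + b0 * v x) * (c0 * u x + d0 * v x)"
    proof (rule AE_I2)
      fix x assume x: "x \<in> space M"
      have "(\<lambda>n. \<phi> x (a n * u x + b n * v x)) \<longlonglongrightarrow> \<phi> x (a0 * u x + b0 * v x)"
        by (intro isCont_tendsto_compose[OF \<phi>_cont[OF x]] tendsto_intros a b)
      then show "(\<lambda>n. \<phi> x (a n * u x + b n * v x) * (c n * u x + d n * v x))
         \<longlonglongrightarrow> \<phi> x (a0 * u x + b0 * v x) * (c0 * u x + d0 * v x)"
        by (intro tendsto_intros c d)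
    qed
    show "AE x in M. norm (\<phi> x (a n * u x + b n * v x) * (c n * u x + d n * v x)) \<le> w x" for n
    proof (rule AE_I2)
      fix x assume x: "x \<in> space M"
      show "norm (\<phi> x (a n * u x + b n * v x) * (c n * u x + d n * v x)) \<le> w x"
        unfolding real_norm_def by (rule w(2)[OF x abs_lincomb_le[OF K(2,3)] abs_lincomb_le[OF K(4,5)]])
    qed
  qed (use meas w in \<open>auto intro!: borel_measurable_times\<close>)
qed

text \<open>The mean value point lies between two combinations of \<open>u\<close> and
  \<open>v\<close>, hence in the range where the majorant is valid, and dominated convergence
  applies. The factor \<open>t n\<close> in front of \<open>u\<close> may vary with
  \<open>n\<close>.\<close>

lemma quotient_tendsto:
  assumes F: "\<And>x t. x \<in> space M \<Longrightarrow> (F x has_real_derivative \<phi> x t) (at t)"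
    and F_int: "\<And>a b. integrable M (\<lambda>x. F x (a * u x + b * v x))"
    and t: "t \<longlonglongrightarrow> t0" and s: "s \<longlonglongrightarrow> 0" and s0: "\<And>n. s n \<noteq> 0"
  shows "(\<lambda>n. ((\<integral>x. F x (t n * u x + s n * v x) \<partial>M) - (\<integral>x. F x (t n * u x) \<partial>M)) / s n)
    \<longlonglongrightarrow> (\<integral>x. \<phi> x (t0 * u x) * v x \<partial>M)"
proof -
  obtain Ka where Ka: "1 \<le> Ka" "\<And>n. \<bar>t n\<bar> \<le> Ka" using convergent_abs_bound[OF t] by blast
  obtain Kb where Kb: "1 \<le> Kb" "\<And>n. \<bar>s n\<bar> \<le> Kb" using convergent_abs_bound[OF s] by blast
  define K where "K = Ka + Kb"
  have K: "1 \<le> K" "\<bar>t n\<bar> \<le> K" "\<bar>s n\<bar> \<le> K" for n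
    using Ka(1) Kb(1) Ka(2)[of n] Kb(2)[of n] unfolding K_def by linarith+
  obtain w where w: "integrable M w"
    "\<And>x s r. x \<in> space M \<Longrightarrow> \<bar>s\<bar> \<le> K * (\<bar>u x\<bar> + \<bar>v x\<bar>) \<Longrightarrow> \<bar>r\<bar> \<le> K * (\<bar>u x\<bar> + \<bar>v x\<bar>) \<Longrightarrow> \<bar>\<phi> x s * r\<bar> \<le> w x"
    using dominated[OF K(1)] by blast
  have F_int': "integrable M (\<lambda>x. F x (t n * u x))" for n using F_int[of "t n" 0] by simp
  have "(\<lambda>n. \<integral>x. (F x (t n * u x + s n * v x) - F x (t n * u x)) / s n \<partial>M) \<longlonglongrightarrow> (\<integral>x. \<phi> x (t0 * u x) * v x \<partial>M)"
  proof (rule integral_dominated_convergence[where w = w])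
    show "AE x in M. (\<lambda>n. (F x (t n * u x + s n * v x) - F x (t n * u x)) / s n) \<longlonglongrightarrow> \<phi> x (t0 * u x) * v x"
    proof (rule AE_I2)
      fix x assume x: "x \<in> space M"
      show "(\<lambda>n. (F x (t n * u x + s n * v x) - F x (t n * u x)) / s n) \<longlonglongrightarrow> \<phi> x (t0 * u x) * v x"
        by (rule difference_quotient_tendsto[OF F[OF x] \<phi>_cont[OF x] s _ s0]) (intro tendsto_intros t)
    qed
    show "AE x in M. norm ((F x (t n * u x + s n * v x) - F x (t n * u x)) / s n) \<le> w x" for n
    proof (rule AE_I2)
      fix x assume x: "x \<in> space M"
      obtain c where c: "\<bar>c - t n * u x\<bar> \<le> \<bar>s n * v x\<bar>" "F x (t n * u x + s n * v x) - F x (t n * u x) = \<phi> x c * (s n * v x)"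
        using difference_quotient[OF F[OF x]] by blast
      have "\<bar>c\<bar> \<le> \<bar>t n\<bar> * \<bar>u x\<bar> + \<bar>s n\<bar> * \<bar>v x\<bar>" using c(1) by (simp flip: abs_mult)
      also have "\<dots> \<le> K * \<bar>u x\<bar> + K * \<bar>v x\<bar>" using K by (intro add_mono mult_right_mono) auto
      finally have 1: "\<bar>c\<bar> \<le> K * (\<bar>u x\<bar> + \<bar>v x\<bar>)" by (simp add: distrib_left)
      have "\<bar>0 * u x + 1 * v x\<bar> \<le> K * (\<bar>u x\<bar> + \<bar>v x\<bar>)" using K(1) by (intro abs_lincomb_le) auto
      then have "\<bar>\<phi> x c * v x\<bar> \<le> w x" by (intro w(2)[OF x 1]) simp
      moreover have "(F x (t n * u x + s n * v x) - F x (t n * u x)) / s n = \<phi> x c * v x"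
        using s0[of n] by (subst c(2)) simp
      ultimately show "norm ((F x (t n * u x + s n * v x) - F x (t n * u x)) / s n) \<le> w x"
        by (simp only: real_norm_def)
    qed
    show "(\<lambda>x. \<phi> x (t0 * u x) * v x) \<in> borel_measurable M"
      using meas[of t0 0] by simp
    show "(\<lambda>x. (F x (t n * u x + s n * v x) - F x (t n * u x)) / s n) \<in> borel_measurable M" for n
      using F_int[of "t n" "s n"] F_int'[of n] by (intro borel_measurable_divide borel_measurable_diff) auto
  qed (rule w(1))
  also have "(\<lambda>n. \<integral>x. (F x (t n * u x + s n * v x) - F x (t n * u x)) / s n \<partial>M)
    = (\<lambda>n. ((\<integral>x. F x (t n * u x + s n * v x) \<partial>M) - (\<integral>x. F x (t n * u x) \<partial>M)) / s n)"
  proof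
    fix n
    show "(\<integral>x. (F x (t n * u x + s n * v x) - F x (t n * u x)) / s n \<partial>M)
      = ((\<integral>x. F x (t n * u x + s n * v x) \<partial>M) - (\<integral>x. F x (t n * u x) \<partial>M)) / s n"
      using Bochner_Integration.integral_diff[OF F_int[of "t n" "s n"] F_int'[of n]] by simp
  qed
  finally show ?thesis .
qed

end

section \<open>Restriction to the domain and growth majorants\<close>

lemma nn_integral_eq_restrict_space:
  assumes "\<Omega> \<in> sets lebesgue" "AE x in lebesgue. x \<notin> \<Omega> \<longrightarrow> g x = 0"
  shows "(\<integral>\<^sup>+ x. g x \<partial>lebesgue) = (\<integral>\<^sup>+ x. g x \<partial>lebesgue_on \<Omega>)"
proof -
  have "(\<integral>\<^sup>+ x. g x \<partial>lebesgue) = (\<integral>\<^sup>+ x. g x * indicator \<Omega> x \<partial>lebesgue)"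
    using assms(2) by (intro nn_integral_cong_AE) (auto simp: indicator_def)
  also have "\<dots> = (\<integral>\<^sup>+ x. g x \<partial>lebesgue_on \<Omega>)"
    using assms(1) by (subst nn_integral_restrict_space) auto
  finally show ?thesis .
qed

definition gdom :: "real \<Rightarrow> real \<Rightarrow> real" where
  "gdom p t = 1 + \<bar>t\<bar> powr p + llog p t"

lemma gdom_nonneg [simp]: "0 \<le> gdom p t"
  by (simp add: gdom_def)

text \<open>The sum of the moduli is at most twice the larger one, and monotonicity makes one of the
  two summands sufficient.\<close>

lemma gdom_add_le:
  assumes "0 \<le> p" "0 \<le> K"
  shows "gdom p (K * (\<bar>a\<bar> + \<bar>b\<bar>)) \<le> gdom p (2 * K * a) + gdom p (2 * K * b)"
proof -
  have mono: "gdom p s \<le> gdom p t" if "\<bar>s\<bar> \<le> \<bar>t\<bar>" for s t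
    using that assms unfolding gdom_def by (intro add_mono powr_mono2 llog_mono) auto
  show ?thesis
  proof (cases "\<bar>a\<bar> \<le> \<bar>b\<bar>")
    case True
    have "\<bar>K * (\<bar>a\<bar> + \<bar>b\<bar>)\<bar> \<le> \<bar>2 * K * b\<bar>"
      using True assms mult_left_mono[of "\<bar>a\<bar> + \<bar>b\<bar>" "2 * \<bar>b\<bar>" K] by (simp add: abs_mult mult_ac)
    from mono[OF this] show ?thesis by (simp add: add_increasing)
  next
    case False
    have "\<bar>K * (\<bar>a\<bar> + \<bar>b\<bar>)\<bar> \<le> \<bar>2 * K * a\<bar>"
      using False assms mult_left_mono[of "\<bar>a\<bar> + \<bar>b\<bar>" "2 * \<bar>a\<bar>" K] by (simp add: abs_mult mult_ac)
    from mono[OF this] show ?thesis by (simp add: add_increasing2)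
  qed
qed

lemma growth_le_gdom:
  assumes p: "1 < p" and y: "y \<le> C * (1 + \<bar>s\<bar> powr (p - 1) * (1 + lnp s))" and C: "0 \<le> C"
    and s: "\<bar>s\<bar> \<le> m" and r: "\<bar>r\<bar> \<le> m" and y0: "0 \<le> y"
  shows "y * \<bar>r\<bar> \<le> 2 * C * gdom p m"
proof -
  have m: "0 \<le> m" using s by simp
  have "lnp s \<le> lnp m" using s by (intro lnp_mono) simp
  then have "y \<le> C * (1 + m powr (p - 1) * (1 + lnp m))"
    using p s m by (intro order_trans[OF y] mult_left_mono[OF _ C] add_mono mult_mono powr_mono2) auto
  then have "y * \<bar>r\<bar> \<le> C * (1 + m powr (p - 1) * (1 + lnp m)) * m"
    using y0 r C m by (intro mult_mono) (auto intro!: mult_nonneg_nonneg add_nonneg_nonneg)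
  also have "\<dots> = C * (m + m powr (p - 1) * m * (1 + lnp m))" by (simp add: algebra_simps)
  also have "m powr (p - 1) * m = m powr p"
    using m by (cases "m = 0") (auto simp: powr_diff)
  also have "C * (m + m powr p * (1 + lnp m)) \<le> C * (2 * gdom p m)"
  proof (rule mult_left_mono[OF _ C])
    have "m \<le> 1 + m powr p" using le_one_add_powr[of p m] p m by simp
    moreover have "0 \<le> lnp m * m powr p" by simp
    ultimately show "m + m powr p * (1 + lnp m) \<le> 2 * gdom p m"
      using m unfolding gdom_def llog_def by (simp add: algebra_simps del: lnp_nonneg)
  qed
  finally show ?thesis by simp
qed

subsection \<open>The variational problem\<close>

definition du :: "('a \<Rightarrow> real) \<Rightarrow> 'a \<times> 'a \<Rightarrow> real" where
  "du u z = u (fst z) - u (snd z)"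

lemma borel_measurable_du [measurable]:
  assumes [measurable]: "u \<in> borel_measurable lebesgue"
  shows "du u \<in> borel_measurable (lebesgue \<Otimes>\<^sub>M lebesgue)"
  unfolding du_def[abs_def] by measurable

lemma du_lincomb: "du (\<lambda>x. a * u x + b * v x) z = a * du u z + b * du v z"
  by (simp add: du_def algebra_simps)

lemma du_scale: "du (\<lambda>x. a * u x) z = a * du u z"
  by (simp add: du_def algebra_simps)

lemma abs_lincomb_powr_le:
  fixes a b u v :: real
  assumes "0 \<le> p"
  shows "\<bar>a * u + b * v\<bar> powr p \<le> 2 powr p * \<bar>a\<bar> powr p * \<bar>u\<bar> powr p + 2 powr p * \<bar>b\<bar> powr p * \<bar>v\<bar> powr p"
proof -
  have "\<bar>a * u + b * v\<bar> powr p \<le> (\<bar>a * u\<bar> + \<bar>b * v\<bar>) powr p"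
    using assms by (intro powr_mono2) auto
  also have "\<dots> \<le> 2 powr p * (\<bar>a * u\<bar> powr p + \<bar>b * v\<bar> powr p)"
    using assms by (intro powr_add_le) auto
  finally show ?thesis by (simp add: abs_mult powr_mult distrib_left mult.assoc)
qed

text \<open>The variational problem with energy \<open>Q u / p - \<integral> H(x,u)\<close>, where \<open>Q\<close> is the \<open>p\<close>-homogeneous form
  of a kernel \<open>k\<close> that dominates the one of the logarithmic \<open>p\<close>-Laplacian. The lower order terms of
  the operator are absorbed into the nonlinearity \<open>f\<close>.\<close>

locale log_variational =
  fixes p :: real and \<Omega> :: "'a::euclidean_space set" and k :: "'a \<times> 'a \<Rightarrow> real"
    and f H :: "'a \<Rightarrow> real \<Rightarrow> real"
  assumes p: "1 < p"
    and \<Omega>_sets [measurable]: "\<Omega> \<in> sets lebesgue" and \<Omega>_fin: "emeasure lebesgue \<Omega> < \<infinity>"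
    and k_meas [measurable]: "k \<in> borel_measurable (lebesgue \<Otimes>\<^sub>M lebesgue)" and k_nonneg [simp]: "\<And>z. 0 \<le> k z"
    and k_near: "\<And>z. z \<in> near_region \<Longrightarrow> C_const DIM('a) p / 2 * inv_kernel (fst z) (snd z) \<le> k z"
    and k_pos: "\<And>x y. x \<in> \<Omega> \<Longrightarrow> y \<in> \<Omega> \<Longrightarrow> x \<noteq> y \<Longrightarrow> 0 < k (x, y)"
    and f_meas: "\<And>t. (\<lambda>x. f x t) \<in> borel_measurable (lebesgue_on \<Omega>)"
    and H_meas: "\<And>t. (\<lambda>x. H x t) \<in> borel_measurable (lebesgue_on \<Omega>)"
    and f_cont: "\<And>x t. x \<in> \<Omega> \<Longrightarrow> isCont (f x) t"
    and H_deriv: "\<And>x t. x \<in> \<Omega> \<Longrightarrow> (H x has_real_derivative f x t) (at t)"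
    and H_zero: "\<And>x. x \<in> \<Omega> \<Longrightarrow> H x 0 = 0"
    and f_growth: "\<exists>C\<ge>0. \<forall>x\<in>\<Omega>. \<forall>t. \<bar>f x t\<bar> \<le> C * (1 + \<bar>t\<bar> powr (p - 1) * (1 + lnp t))"
    and H_growth: "\<exists>m>0. \<exists>M1\<ge>1. m < p\<^sup>2 / DIM('a) \<and>
       (\<forall>x\<in>\<Omega>. \<forall>t. M1 \<le> \<bar>t\<bar> \<longrightarrow> 0 \<le> H x t \<and> H x t \<le> m / p * (\<bar>t\<bar> powr p * ln \<bar>t\<bar>))"
    and f_mono: "\<exists>\<theta>>0. \<forall>x\<in>\<Omega>. \<forall>s \<tau>. 1 \<le> \<tau> \<longrightarrow>
       s * f x s + \<theta> * \<bar>s\<bar> powr p * ln \<tau> \<le> s * f x (\<tau> * s) * \<tau> powr (1 - p)"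
begin

abbreviation "M \<equiv> lebesgue_on \<Omega>"
abbreviation "P \<equiv> lebesgue \<Otimes>\<^sub>M (lebesgue :: 'a measure)"

sublocale M: finite_measure M
proof (rule finite_measureI)
  have eq: "emeasure M (space M) = emeasure lebesgue \<Omega>"
    by (subst emeasure_restrict_space) auto
  show "emeasure M (space M) \<noteq> \<infinity>" unfolding eq using \<Omega>_fin by (rule less_imp_neq)
qed

text \<open>Integrability of the full kernel form takes the place of finiteness of the seminorm; for
  the kernel of the application the two conditions coincide.\<close>

definition X :: "('a \<Rightarrow> real) set" where
  "X = {u. u \<in> borel_measurable lebesgue \<and> (AE x in lebesgue. x \<notin> \<Omega> \<longrightarrow> u x = 0) \<and>
     integrable M (\<lambda>x. \<bar>u x\<bar> powr p) \<and> integrable P (\<lambda>z. k z * \<bar>du u z\<bar> powr p)}"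

definition Q :: "('a \<Rightarrow> real) \<Rightarrow> real" where
  "Q u = (\<integral>z. k z * \<bar>du u z\<bar> powr p \<partial>P)"

definition A :: "('a \<Rightarrow> real) \<Rightarrow> ('a \<Rightarrow> real) \<Rightarrow> real" where
  "A u v = (\<integral>z. k z * (h p (du u z) * du v z) \<partial>P)"

definition F :: "('a \<Rightarrow> real) \<Rightarrow> ('a \<Rightarrow> real) \<Rightarrow> real" where
  "F u v = (\<integral>x. f x (u x) * v x \<partial>M)"

definition J :: "('a \<Rightarrow> real) \<Rightarrow> real" where
  "J u = Q u / p - (\<integral>x. H x (u x) \<partial>M)"

text \<open>The derivative of \<open>J\<close> at \<open>u\<close> in the direction of
  \<open>u\<close> itself; its nontrivial zeros are the Nehari points.\<close>

definition Nh :: "('a \<Rightarrow> real) \<Rightarrow> real" where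
  "Nh u = Q u - F u u"

definition Lp :: "('a \<Rightarrow> real) \<Rightarrow> real" where
  "Lp u = (\<integral>x. \<bar>u x\<bar> powr p \<partial>M)"

definition Neh :: "('a \<Rightarrow> real) set" where
  "Neh = {u \<in> X. \<not> (AE x in lebesgue. u x = 0) \<and> Nh u = 0}"

section \<open>The energy space and its estimates\<close>

lemma X_meas: "u \<in> X \<Longrightarrow> u \<in> borel_measurable lebesgue"
  and X_zero: "u \<in> X \<Longrightarrow> AE x in lebesgue. x \<notin> \<Omega> \<longrightarrow> u x = 0"
  and X_Lp: "u \<in> X \<Longrightarrow> integrable M (\<lambda>x. \<bar>u x\<bar> powr p)"
  and X_Q: "u \<in> X \<Longrightarrow> integrable P (\<lambda>z. k z * \<bar>du u z\<bar> powr p)"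
  by (auto simp: X_def)

lemma measurable_M: "u \<in> borel_measurable lebesgue \<Longrightarrow> u \<in> borel_measurable M"
  by (rule measurable_restrict_space1)

lemma X_meas_M: "u \<in> X \<Longrightarrow> u \<in> borel_measurable M"
  by (rule measurable_M[OF X_meas])

lemma space_M [simp]: "space M = \<Omega>"
  by simp

lemma Q_nonneg: "0 \<le> Q u"
  unfolding Q_def by (intro Bochner_Integration.integral_nonneg) simp

lemma Lp_nonneg: "0 \<le> Lp u"
  unfolding Lp_def by (intro Bochner_Integration.integral_nonneg) simp

lemma A_self: "A u u = Q u"
  unfolding A_def Q_def by (simp add: h_mult_self)

lemma X_lincomb:
  assumes u: "u \<in> X" and v: "v \<in> X"
  shows "(\<lambda>x. a * u x + b * v x) \<in> X"
proof -
  note [measurable] = X_meas[OF u] X_meas[OF v] X_meas_M[OF u] X_meas_M[OF v]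
  have "AE x in lebesgue. x \<notin> \<Omega> \<longrightarrow> a * u x + b * v x = 0"
    using X_zero[OF u] X_zero[OF v] by eventually_elim auto
  moreover have "integrable M (\<lambda>x. \<bar>a * u x + b * v x\<bar> powr p)"
  proof (rule Bochner_Integration.integrable_bound)
    show "integrable M (\<lambda>x. 2 powr p * \<bar>a\<bar> powr p * \<bar>u x\<bar> powr p + 2 powr p * \<bar>b\<bar> powr p * \<bar>v x\<bar> powr p)"
      using X_Lp[OF u] X_Lp[OF v] by (intro Bochner_Integration.integrable_add integrable_mult_right)
    show "(\<lambda>x. \<bar>a * u x + b * v x\<bar> powr p) \<in> borel_measurable M" by measurable
    show "AE x in M. norm (\<bar>a * u x + b * v x\<bar> powr p) \<le> norm (2 powr p * \<bar>a\<bar> powr p * \<bar>u x\<bar> powr p + 2 powr p * \<bar>b\<bar> powr p * \<bar>v x\<bar> powr p)"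
      using p by (intro AE_I2) (use abs_lincomb_powr_le in \<open>simp\<close>)
  qed
  moreover have "integrable P (\<lambda>z. k z * \<bar>du (\<lambda>x. a * u x + b * v x) z\<bar> powr p)"
  proof (rule Bochner_Integration.integrable_bound)
    show "integrable P (\<lambda>z. 2 powr p * \<bar>a\<bar> powr p * (k z * \<bar>du u z\<bar> powr p) + 2 powr p * \<bar>b\<bar> powr p * (k z * \<bar>du v z\<bar> powr p))"
      using X_Q[OF u] X_Q[OF v] by (intro Bochner_Integration.integrable_add integrable_mult_right)
    show "(\<lambda>z. k z * \<bar>du (\<lambda>x. a * u x + b * v x) z\<bar> powr p) \<in> borel_measurable P" by measurable
    show "AE z in P. norm (k z * \<bar>du (\<lambda>x. a * u x + b * v x) z\<bar> powr p)
       \<le> norm (2 powr p * \<bar>a\<bar> powr p * (k z * \<bar>du u z\<bar> powr p) + 2 powr p * \<bar>b\<bar> powr p * (k z * \<bar>du v z\<bar> powr p))"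
    proof (rule AE_I2)
      fix z
      have "k z * \<bar>du (\<lambda>x. a * u x + b * v x) z\<bar> powr p
        \<le> k z * (2 powr p * \<bar>a\<bar> powr p * \<bar>du u z\<bar> powr p + 2 powr p * \<bar>b\<bar> powr p * \<bar>du v z\<bar> powr p)"
        unfolding du_lincomb using p by (intro mult_left_mono abs_lincomb_powr_le) auto
      also have "\<dots> = 2 powr p * \<bar>a\<bar> powr p * (k z * \<bar>du u z\<bar> powr p) + 2 powr p * \<bar>b\<bar> powr p * (k z * \<bar>du v z\<bar> powr p)"
        by (simp add: algebra_simps)
      finally show "norm (k z * \<bar>du (\<lambda>x. a * u x + b * v x) z\<bar> powr p)
         \<le> norm (2 powr p * \<bar>a\<bar> powr p * (k z * \<bar>du u z\<bar> powr p) + 2 powr p * \<bar>b\<bar> powr p * (k z * \<bar>du v z\<bar> powr p))"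
        by simp
    qed
  qed
  ultimately show ?thesis by (simp add: X_def)
qed

lemma X_scale: "u \<in> X \<Longrightarrow> (\<lambda>x. a * u x) \<in> X"
  using X_lincomb[of u u a 0] by simp

lemma Q_scale: "0 < t \<Longrightarrow> Q (\<lambda>x. t * u x) = t powr p * Q u"
proof -
  assume t: "0 < t"
  have "k z * \<bar>du (\<lambda>x. t * u x) z\<bar> powr p = t powr p * (k z * \<bar>du u z\<bar> powr p)" for z
    using t by (simp add: du_scale abs_mult powr_mult)
  then show ?thesis unfolding Q_def by (simp only: integral_mult_right_zero)
qed

lemma Lp_scale: "0 < t \<Longrightarrow> Lp (\<lambda>x. t * u x) = t powr p * Lp u"
  unfolding Lp_def by (simp add: abs_mult powr_mult)

lemma nn_integral_X:
  assumes "u \<in> X" "\<phi> 0 = 0"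
  shows "(\<integral>\<^sup>+ x. \<phi> (u x) \<partial>lebesgue) = (\<integral>\<^sup>+ x. \<phi> (u x) \<partial>M)"
  by (rule nn_integral_eq_restrict_space[OF \<Omega>_sets])
     (use X_zero[OF assms(1)] assms(2) in \<open>auto elim: eventually_mono\<close>)

lemma nn_integral_Lp:
  assumes "u \<in> X" shows "(\<integral>\<^sup>+ x. ennreal (\<bar>u x\<bar> powr p) \<partial>lebesgue) = ennreal (Lp u)"
proof -
  have "(\<integral>\<^sup>+ x. ennreal (\<bar>u x\<bar> powr p) \<partial>lebesgue) = (\<integral>\<^sup>+ x. ennreal (\<bar>u x\<bar> powr p) \<partial>M)"
    using nn_integral_X[OF assms, of "\<lambda>t. ennreal (\<bar>t\<bar> powr p)"] by simp
  also have "\<dots> = ennreal (Lp u)"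
    unfolding Lp_def by (rule nn_integral_eq_integral[OF X_Lp[OF assms]]) simp
  finally show ?thesis .
qed

lemma nn_integral_Q:
  assumes "u \<in> X" shows "(\<integral>\<^sup>+ z. ennreal (k z * \<bar>du u z\<bar> powr p) \<partial>P) = ennreal (Q u)"
  unfolding Q_def by (rule nn_integral_eq_integral[OF X_Q[OF assms]]) simp

lemma near_density_le:
  "z \<in> near_region \<Longrightarrow> near_density p u z \<le> k z * \<bar>du u z\<bar> powr p"
  using mult_right_mono[OF k_near, of z "\<bar>du u z\<bar> powr p"] by (simp add: near_density_def du_def mult_ac)

lemma near_le_Q:
  assumes "u \<in> X"
  shows "near_energy p u \<le> ennreal (Q u)"
  unfolding nn_integral_Q[OF assms, symmetric] near_energy_def
  using near_density_le by (intro nn_integral_mono) (auto simp: indicator_def intro: ennreal_leI)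

lemma Lp_pos:
  assumes u: "u \<in> X" and n: "\<not> (AE x in lebesgue. u x = 0)"
  shows "0 < Lp u"
proof (rule ccontr)
  assume "\<not> 0 < Lp u"
  then have "(\<integral>\<^sup>+ x. ennreal (\<bar>u x\<bar> powr p) \<partial>lebesgue) = 0"
    unfolding nn_integral_Lp[OF u] by (simp add: ennreal_neg)
  then have "AE x in lebesgue. ennreal (\<bar>u x\<bar> powr p) = 0"
    using X_meas[OF u] by (subst (asm) nn_integral_0_iff_AE) auto
  then have "AE x in lebesgue. u x = 0" by eventually_elim simp
  then show False using n by simp
qed

text \<open>In the near region \<open>k\<close> dominates the kernel of the logarithmic operator, so
  the superlevel estimate passes to \<open>k\<close> with the factor 1 in front of the energy. That
  factor is what later allows an exact cancellation against the tail of \<open>H\<close>.\<close>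

lemma tail_bound:
  assumes R: "0 < R" and m: "m < p\<^sup>2 / DIM('a)" "0 < m"
  obtains M0 where "1 \<le> M0" "\<And>K u. M0 \<le> K \<Longrightarrow> u \<in> X \<Longrightarrow> Lp u \<le> R \<Longrightarrow>
     (\<integral>\<^sup>+ x. ennreal (m * (\<bar>u x\<bar> powr p * ln \<bar>u x\<bar>)) * indicator {x. K < \<bar>u x\<bar>} x \<partial>M)
      \<le> (\<integral>\<^sup>+ z. ennreal (k z * \<bar>du u z\<bar> powr p) * indicator (tail_region K u) z \<partial>P)"
proof -
  obtain M0 where M0: "1 \<le> M0" "\<And>K (u :: 'a \<Rightarrow> real). M0 \<le> K \<Longrightarrow> u \<in> borel_measurable lebesgue \<Longrightarrow>
     (\<integral>\<^sup>+ x. ennreal (\<bar>u x\<bar> powr p) \<partial>lebesgue) \<le> ennreal R \<Longrightarrow>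
     (\<integral>\<^sup>+ x. ennreal (m * (\<bar>u x\<bar> powr p * ln \<bar>u x\<bar>)) * indicator {x. K < \<bar>u x\<bar>} x \<partial>lebesgue)
    \<le> (\<integral>\<^sup>+ z. ennreal (near_density p u z) * indicator (tail_region K u) z \<partial>P)"
    using log_sobolev_tail[OF p R m(1)] by blast
  show ?thesis
  proof (rule that[OF M0(1)])
    fix K u assume K: "M0 \<le> K" and u: "u \<in> X" and "Lp u \<le> R"
    have "(\<integral>\<^sup>+ x. ennreal (m * (\<bar>u x\<bar> powr p * ln \<bar>u x\<bar>)) * indicator {x. K < \<bar>u x\<bar>} x \<partial>M)
      = (\<integral>\<^sup>+ x. ennreal (m * (\<bar>u x\<bar> powr p * ln \<bar>u x\<bar>)) * indicator {x. K < \<bar>u x\<bar>} x \<partial>lebesgue)"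
      using nn_integral_X[OF u, of "\<lambda>t. ennreal (m * (\<bar>t\<bar> powr p * ln \<bar>t\<bar>)) * indicator {t. K < \<bar>t\<bar>} t"]
      by (simp add: indicator_def)
    also have "\<dots> \<le> (\<integral>\<^sup>+ z. ennreal (near_density p u z) * indicator (tail_region K u) z \<partial>P)"
      using \<open>Lp u \<le> R\<close> by (intro M0(2) K X_meas[OF u]) (simp add: nn_integral_Lp[OF u] ennreal_leI)
    also have "\<dots> \<le> (\<integral>\<^sup>+ z. ennreal (k z * \<bar>du u z\<bar> powr p) * indicator (tail_region K u) z \<partial>P)"
    proof (intro nn_integral_mono)
      fix z
      show "ennreal (near_density p u z) * indicator (tail_region K u) z \<le> ennreal (k z * \<bar>du u z\<bar> powr p) * indicator (tail_region K u) z"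
      proof (cases "z \<in> tail_region K u")
        case True
        then have "z \<in> near_region" by (simp add: tail_region_def near_region_def)
        from near_density_le[OF this] show ?thesis using True by (simp add: ennreal_leI)
      qed simp
    qed
    finally show "(\<integral>\<^sup>+ x. ennreal (m * (\<bar>u x\<bar> powr p * ln \<bar>u x\<bar>)) * indicator {x. K < \<bar>u x\<bar>} x \<partial>M)
      \<le> (\<integral>\<^sup>+ z. ennreal (k z * \<bar>du u z\<bar> powr p) * indicator (tail_region K u) z \<partial>P)" .
  qed
qed

text \<open>Half the threshold is simply one admissible slope. Above \<open>M0\<close> the energy
  controls the integrand, below \<open>M0\<close> it is at most \<open>llog p M0\<close> on a domain
  of finite measure. The bound depends on \<open>u\<close> only through \<open>Q u\<close> once the
  norm is bounded.\<close>

lemma integral_llog_bound: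
  assumes R: "0 < R"
  obtains D where "0 \<le> D" "\<And>u. u \<in> X \<Longrightarrow> Lp u \<le> R \<Longrightarrow> (\<integral>\<^sup>+ x. ennreal (llog p (u x)) \<partial>M) \<le> ennreal (D * (Q u + 1))"
proof -
  define m where "m = p\<^sup>2 / DIM('a) / 2"
  have m: "0 < m" "m < p\<^sup>2 / DIM('a)" using p by (simp_all add: m_def divide_less_eq)
  obtain M0 where M0: "1 \<le> M0" "\<And>K u. M0 \<le> K \<Longrightarrow> u \<in> X \<Longrightarrow> Lp u \<le> R \<Longrightarrow>
     (\<integral>\<^sup>+ x. ennreal (m * (\<bar>u x\<bar> powr p * ln \<bar>u x\<bar>)) * indicator {x. K < \<bar>u x\<bar>} x \<partial>M)
      \<le> (\<integral>\<^sup>+ z. ennreal (k z * \<bar>du u z\<bar> powr p) * indicator (tail_region K u) z \<partial>P)"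
    using tail_bound[OF R m(2,1)] by blast
  define D where "D = max (1 / m) (llog p M0 * measure M \<Omega>)"
  show ?thesis
  proof (rule that[of D])
    show "0 \<le> D" using m by (simp add: D_def le_max_iff_disj)
    fix u assume u: "u \<in> X" "Lp u \<le> R"
    note [measurable] = X_meas_M[OF u(1)]
    let ?T = "\<lambda>x. ennreal (m * (\<bar>u x\<bar> powr p * ln \<bar>u x\<bar>)) * indicator {x. M0 < \<bar>u x\<bar>} x"
    have meas [measurable]: "{x. M0 < \<bar>u x\<bar>} \<inter> \<Omega> \<in> sets M"
    proof -
      have "{x \<in> space M. M0 < \<bar>u x\<bar>} \<in> sets M" by measurable
      then show ?thesis by (simp add: Int_def conj_commute)
    qed
    have "(\<integral>\<^sup>+ x. ennreal (llog p (u x)) \<partial>M) \<le> (\<integral>\<^sup>+ x. ennreal (1 / m) * ?T x + ennreal (llog p M0) \<partial>M)"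
    proof (intro nn_integral_mono)
      fix x
      show "ennreal (llog p (u x)) \<le> ennreal (1 / m) * ?T x + ennreal (llog p M0)"
      proof (cases "M0 < \<bar>u x\<bar>")
        case True
        have "llog p (u x) = 1 / m * (m * (\<bar>u x\<bar> powr p * ln \<bar>u x\<bar>))"
          using True M0(1) m by (simp add: llog_def lnp_eq)
        then have "ennreal (llog p (u x)) = ennreal (1 / m) * ennreal (m * (\<bar>u x\<bar> powr p * ln \<bar>u x\<bar>))"
          using m by (simp only: ennreal_mult' zero_le_divide_1_iff less_imp_le)
        then show ?thesis using True by (simp add: add_increasing2)
      next
        case False
        then have "llog p (u x) \<le> llog p M0" using p M0(1) by (intro llog_mono) auto
        then show ?thesis using False by (simp add: ennreal_leI)
      qed
    qed
    also have "\<dots> = (\<integral>\<^sup>+ x. ennreal (1 / m) * ?T x \<partial>M) + (\<integral>\<^sup>+ x. ennreal (llog p M0) \<partial>M)"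
      by (rule nn_integral_add) measurable
    also have "(\<integral>\<^sup>+ x. ennreal (1 / m) * ?T x \<partial>M) = ennreal (1 / m) * (\<integral>\<^sup>+ x. ?T x \<partial>M)"
      by (rule nn_integral_cmult) measurable
    also have "(\<integral>\<^sup>+ x. ?T x \<partial>M) \<le> (\<integral>\<^sup>+ z. ennreal (k z * \<bar>du u z\<bar> powr p) * indicator (tail_region M0 u) z \<partial>P)"
      by (rule M0(2)[OF order_refl u])
    also have "\<dots> \<le> (\<integral>\<^sup>+ z. ennreal (k z * \<bar>du u z\<bar> powr p) \<partial>P)"
      by (intro nn_integral_mono) (simp add: indicator_def)
    also have "\<dots> = ennreal (Q u)" by (rule nn_integral_Q[OF u(1)])
    also have "(\<integral>\<^sup>+ x. ennreal (llog p M0) \<partial>M) = ennreal (llog p M0 * measure M \<Omega>)"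
      by (simp add: M.emeasure_eq_measure ennreal_mult')
    finally have "(\<integral>\<^sup>+ x. ennreal (llog p (u x)) \<partial>M) \<le> ennreal (1 / m) * ennreal (Q u) + ennreal (llog p M0 * measure M \<Omega>)"
      by (simp add: add_right_mono mult_left_mono)
    also have "\<dots> = ennreal (1 / m * Q u) + ennreal (llog p M0 * measure M \<Omega>)"
      using m by (subst ennreal_mult') auto
    also have "\<dots> = ennreal (1 / m * Q u + llog p M0 * measure M \<Omega>)"
      using m Q_nonneg[of u] by (intro ennreal_plus [symmetric] mult_nonneg_nonneg) auto
    also have "\<dots> \<le> ennreal (D * (Q u + 1))"
    proof (rule ennreal_leI)
      have "1 / m * Q u \<le> D * Q u" by (intro mult_right_mono Q_nonneg) (simp add: D_def)
      moreover have "llog p M0 * measure M \<Omega> \<le> D" by (simp add: D_def)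
      ultimately show "1 / m * Q u + llog p M0 * measure M \<Omega> \<le> D * (Q u + 1)" by (simp add: distrib_left)
    qed
    finally show "(\<integral>\<^sup>+ x. ennreal (llog p (u x)) \<partial>M) \<le> ennreal (D * (Q u + 1))" .
  qed
qed

lemma X_llog:
  assumes u: "u \<in> X" shows "integrable M (\<lambda>x. llog p (u x))"
proof -
  note [measurable] = X_meas_M[OF u]
  have "0 < Lp u + 1" using Lp_nonneg[of u] by simp
  from integral_llog_bound[OF this] obtain D where "\<And>v. v \<in> X \<Longrightarrow> Lp v \<le> Lp u + 1 \<Longrightarrow>
      (\<integral>\<^sup>+ x. ennreal (llog p (v x)) \<partial>M) \<le> ennreal (D * (Q v + 1))" by blast
  from this[OF u] have D: "(\<integral>\<^sup>+ x. ennreal (llog p (u x)) \<partial>M) \<le> ennreal (D * (Q u + 1))" by simp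
  then have "(\<integral>\<^sup>+ x. ennreal (llog p (u x)) \<partial>M) < \<infinity>" by (rule le_less_trans) simp
  then show ?thesis by (intro integrableI_bounded) auto
qed

lemma X_gdom:
  assumes u: "u \<in> X" shows "integrable M (\<lambda>x. gdom p (c * u x))"
  unfolding gdom_def using X_Lp[OF X_scale[OF u]] X_llog[OF X_scale[OF u]]
  by (intro Bochner_Integration.integrable_add) auto

lemma superposition_growth:
  assumes \<phi>_meas: "\<And>t. (\<lambda>x. \<phi> x t) \<in> borel_measurable M"
    and \<phi>_cont: "\<And>x t. x \<in> \<Omega> \<Longrightarrow> isCont (\<phi> x) t"
    and \<phi>_growth: "\<exists>C\<ge>0. \<forall>x\<in>\<Omega>. \<forall>t. \<bar>\<phi> x t\<bar> \<le> C * (1 + \<bar>t\<bar> powr (p - 1) * (1 + lnp t))"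
    and u: "u \<in> X" and v: "v \<in> X"
  shows "superposition M \<phi> u v"
proof
  fix K :: real assume K: "1 \<le> K"
  show "\<exists>w. integrable M w \<and> (\<forall>x\<in>space M. \<forall>s r. \<bar>s\<bar> \<le> K * (\<bar>u x\<bar> + \<bar>v x\<bar>) \<longrightarrow>
           \<bar>r\<bar> \<le> K * (\<bar>u x\<bar> + \<bar>v x\<bar>) \<longrightarrow> \<bar>\<phi> x s * r\<bar> \<le> w x)"
  proof -
    obtain C where C: "0 \<le> C" "\<And>x t. x \<in> \<Omega> \<Longrightarrow> \<bar>\<phi> x t\<bar> \<le> C * (1 + \<bar>t\<bar> powr (p - 1) * (1 + lnp t))"
      using \<phi>_growth by blast
    show ?thesis
    proof (intro exI conjI ballI allI impI)
      show "integrable M (\<lambda>x. 2 * C * (gdom p (2 * K * u x) + gdom p (2 * K * v x)))"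
        by (intro integrable_mult_right Bochner_Integration.integrable_add X_gdom u v)
      fix x s r assume x: "x \<in> space M" and s: "\<bar>s\<bar> \<le> K * (\<bar>u x\<bar> + \<bar>v x\<bar>)" and r: "\<bar>r\<bar> \<le> K * (\<bar>u x\<bar> + \<bar>v x\<bar>)"
      have "\<bar>\<phi> x s * r\<bar> = \<bar>\<phi> x s\<bar> * \<bar>r\<bar>" by (rule abs_mult)
      also have "\<dots> \<le> 2 * C * gdom p (K * (\<bar>u x\<bar> + \<bar>v x\<bar>))"
        using x by (intro growth_le_gdom[OF p C(2) C(1) s r]) auto
      also have "\<dots> \<le> 2 * C * (gdom p (2 * K * u x) + gdom p (2 * K * v x))"
        using C(1) p K by (intro mult_left_mono gdom_add_le) auto
      finally show "\<bar>\<phi> x s * r\<bar> \<le> 2 * C * (gdom p (2 * K * u x) + gdom p (2 * K * v x))" .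
    qed
  qed
qed (use X_meas_M u v \<phi>_meas \<phi>_cont in auto)

lemma superposition_f:
  assumes "u \<in> X" "v \<in> X"
  shows "superposition M f u v"
  by (rule superposition_growth[OF f_meas f_cont f_growth assms])

lemma integrable_growth:
  assumes "\<And>t. (\<lambda>x. \<phi> x t) \<in> borel_measurable M" "\<And>x t. x \<in> \<Omega> \<Longrightarrow> isCont (\<phi> x) t"
    and "\<exists>C\<ge>0. \<forall>x\<in>\<Omega>. \<forall>t. \<bar>\<phi> x t\<bar> \<le> C * (1 + \<bar>t\<bar> powr (p - 1) * (1 + lnp t))"
    and "u \<in> X" "v \<in> X"
  shows "integrable M (\<lambda>x. \<phi> x (u x) * v x)"
  using superposition.integrable[OF superposition_growth[OF assms], of 1 0 0 1] by simp

text \<open>Both factors are controlled by the same number \<open>m\<close>, so the product is at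
  most \<open>k z * m powr p\<close>; splitting the power of the sum gives the two integrable forms
  of \<open>u\<close> and \<open>v\<close>.\<close>

lemma superposition_k:
  assumes u: "u \<in> X" and v: "v \<in> X"
  shows "superposition P (\<lambda>z t. k z * h p t) (du u) (du v)"
proof
  note [measurable] = X_meas[OF u] X_meas[OF v]
  show "du u \<in> borel_measurable P" "du v \<in> borel_measurable P" by measurable
  show "(\<lambda>z. k z * h p t) \<in> borel_measurable P" for t by measurable
  show "isCont (\<lambda>t. k z * h p t) t" for z t by (intro continuous_intros isCont_h p)
  fix K :: real assume K: "1 \<le> K"
  show "\<exists>w. integrable P w \<and> (\<forall>z\<in>space P. \<forall>s r. \<bar>s\<bar> \<le> K * (\<bar>du u z\<bar> + \<bar>du v z\<bar>) \<longrightarrow>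
           \<bar>r\<bar> \<le> K * (\<bar>du u z\<bar> + \<bar>du v z\<bar>) \<longrightarrow> \<bar>k z * h p s * r\<bar> \<le> w z)"
  proof (intro exI conjI ballI allI impI)
    show "integrable P (\<lambda>z. K powr p * 2 powr p * (k z * \<bar>du u z\<bar> powr p + k z * \<bar>du v z\<bar> powr p))"
      by (intro integrable_mult_right Bochner_Integration.integrable_add X_Q u v)
    fix z s r assume s: "\<bar>s\<bar> \<le> K * (\<bar>du u z\<bar> + \<bar>du v z\<bar>)" and r: "\<bar>r\<bar> \<le> K * (\<bar>du u z\<bar> + \<bar>du v z\<bar>)"
    define m where "m = K * (\<bar>du u z\<bar> + \<bar>du v z\<bar>)"
    have m: "0 \<le> m" using K by (simp add: m_def)
    have "\<bar>k z * h p s * r\<bar> = k z * (\<bar>s\<bar> powr (p - 1) * \<bar>r\<bar>)" by (simp add: abs_mult abs_h)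
    also have "\<dots> \<le> k z * (m powr (p - 1) * m)"
      using s r p m by (intro mult_left_mono mult_mono powr_mono2) (auto simp: m_def)
    also have "m powr (p - 1) * m = m powr p" using m by (cases "m = 0") (auto simp: powr_diff)
    also have "\<dots> = K powr p * (\<bar>du u z\<bar> + \<bar>du v z\<bar>) powr p" using K by (simp add: m_def powr_mult)
    also have "k z * \<dots> \<le> k z * (K powr p * (2 powr p * (\<bar>du u z\<bar> powr p + \<bar>du v z\<bar> powr p)))"
      using p by (intro mult_left_mono powr_add_le) auto
    finally show "\<bar>k z * h p s * r\<bar> \<le> K powr p * 2 powr p * (k z * \<bar>du u z\<bar> powr p + k z * \<bar>du v z\<bar> powr p)"
      by (simp add: algebra_simps)
  qed
qed

text \<open>The mean value theorem between 0 and \<open>u x\<close> reduces the claim to the growth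
  of the derivative. A general pair is allowed because the result serves \<open>H\<close> and also
  the primitive of the nonlinearity alone.\<close>

lemma integrable_antiderivative:
  assumes \<Phi>_meas: "\<And>t. (\<lambda>x. \<Phi> x t) \<in> borel_measurable M"
    and \<Phi>_deriv: "\<And>x t. x \<in> \<Omega> \<Longrightarrow> (\<Phi> x has_real_derivative \<phi> x t) (at t)"
    and \<Phi>_zero: "\<And>x. x \<in> \<Omega> \<Longrightarrow> \<Phi> x 0 = 0"
    and \<phi>_growth: "\<exists>C\<ge>0. \<forall>x\<in>\<Omega>. \<forall>t. \<bar>\<phi> x t\<bar> \<le> C * (1 + \<bar>t\<bar> powr (p - 1) * (1 + lnp t))"
    and u: "u \<in> X"
  shows "integrable M (\<lambda>x. \<Phi> x (u x))"
proof -
  obtain C where C: "0 \<le> C" "\<And>x t. x \<in> \<Omega> \<Longrightarrow> \<bar>\<phi> x t\<bar> \<le> C * (1 + \<bar>t\<bar> powr (p - 1) * (1 + lnp t))"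
    using \<phi>_growth by blast
  show ?thesis
  proof (rule Bochner_Integration.integrable_bound)
    show "integrable M (\<lambda>x. 2 * C * gdom p (1 * u x))" by (intro integrable_mult_right X_gdom u)
    show "(\<lambda>x. \<Phi> x (u x)) \<in> borel_measurable M"
      by (rule borel_measurable_caratheodory[OF \<Phi>_meas]) (use \<Phi>_deriv X_meas_M[OF u] in \<open>auto intro: DERIV_isCont\<close>)
    show "AE x in M. norm (\<Phi> x (u x)) \<le> norm (2 * C * gdom p (1 * u x))"
    proof (rule AE_I2)
      fix x assume "x \<in> space M"
      then have x: "x \<in> \<Omega>" by simp
      obtain c where c: "\<bar>c - 0\<bar> \<le> \<bar>1 * u x\<bar>" "\<Phi> x (0 + 1 * u x) - \<Phi> x 0 = \<phi> x c * (1 * u x)"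
        using difference_quotient[OF \<Phi>_deriv[OF x]] by blast
      then have "\<bar>\<Phi> x (u x)\<bar> = \<bar>\<phi> x c\<bar> * \<bar>u x\<bar>" using \<Phi>_zero[OF x] by (simp add: abs_mult)
      also have "\<dots> \<le> 2 * C * gdom p \<bar>u x\<bar>"
        using c(1) by (intro growth_le_gdom[OF p C(2)[OF x] C(1)]) auto
      also have "gdom p \<bar>u x\<bar> = gdom p (1 * u x)" by (simp add: gdom_def llog_def)
      finally show "norm (\<Phi> x (u x)) \<le> norm (2 * C * gdom p (1 * u x))"
        unfolding real_norm_def by (rule order_trans[OF _ abs_ge_self])
    qed
  qed
qed

lemma H_le_gdom:
  obtains C where "0 \<le> C" "\<And>x s K. x \<in> \<Omega> \<Longrightarrow> \<bar>s\<bar> \<le> K \<Longrightarrow> \<bar>H x s\<bar> \<le> 2 * C * gdom p K"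
proof -
  obtain C where C: "0 \<le> C" "\<And>x t. x \<in> \<Omega> \<Longrightarrow> \<bar>f x t\<bar> \<le> C * (1 + \<bar>t\<bar> powr (p - 1) * (1 + lnp t))"
    using f_growth by blast
  show ?thesis
  proof (rule that[OF C(1)])
    fix x and s K :: real assume x: "x \<in> \<Omega>" and s: "\<bar>s\<bar> \<le> K"
    obtain c where c: "\<bar>c - 0\<bar> \<le> \<bar>1 * s\<bar>" "H x (0 + 1 * s) - H x 0 = f x c * (1 * s)"
      using difference_quotient[OF H_deriv[OF x]] by blast
    then have "\<bar>H x s\<bar> = \<bar>f x c\<bar> * \<bar>s\<bar>" using H_zero[OF x] by (simp add: abs_mult)
    also have "\<dots> \<le> 2 * C * gdom p K"
      using c(1) s by (intro growth_le_gdom[OF p C(2)[OF x] C(1)]) auto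
    finally show "\<bar>H x s\<bar> \<le> 2 * C * gdom p K" .
  qed
qed

lemma integrable_H: "u \<in> X \<Longrightarrow> integrable M (\<lambda>x. H x (u x))"
  by (rule integrable_antiderivative[OF H_meas H_deriv H_zero f_growth])

lemma integrable_f:
  assumes u: "u \<in> X" and v: "v \<in> X" shows "integrable M (\<lambda>x. f x (u x) * v x)"
  using superposition.integrable[OF superposition_f[OF u v], of 1 0 0 1] by simp

lemma F_tendsto:
  assumes u: "u \<in> X" and v: "v \<in> X" and "a \<longlonglongrightarrow> a0" "b \<longlonglongrightarrow> b0"
  shows "(\<lambda>n. F (\<lambda>x. a n * u x + b n * v x) (\<lambda>x. a n * u x + b n * v x))
    \<longlonglongrightarrow> F (\<lambda>x. a0 * u x + b0 * v x) (\<lambda>x. a0 * u x + b0 * v x)"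
  unfolding F_def by (rule superposition.tendsto[OF superposition_f[OF u v] assms(3,4,3,4)])

lemma Q_tendsto:
  assumes u: "u \<in> X" and v: "v \<in> X" and "a \<longlonglongrightarrow> a0" "b \<longlonglongrightarrow> b0"
  shows "(\<lambda>n. Q (\<lambda>x. a n * u x + b n * v x)) \<longlonglongrightarrow> Q (\<lambda>x. a0 * u x + b0 * v x)"
  using superposition.tendsto[OF superposition_k[OF u v] assms(3,4,3,4)]
  unfolding A_self[symmetric] A_def du_lincomb by (simp only: mult.assoc)

lemma Nh_tendsto:
  assumes u: "u \<in> X" and v: "v \<in> X" and "a \<longlonglongrightarrow> a0" "b \<longlonglongrightarrow> b0"
  shows "(\<lambda>n. Nh (\<lambda>x. a n * u x + b n * v x)) \<longlonglongrightarrow> Nh (\<lambda>x. a0 * u x + b0 * v x)"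
  unfolding Nh_def by (intro tendsto_diff Q_tendsto F_tendsto assms)

text \<open>Dividing \<open>Q\<close> by \<open>p\<close> turns the derivative \<open>p * h\<close>
  into \<open>h\<close>. The increments start at \<open>t n * u\<close> instead of \<open>u\<close>,
  because that is the point which maximality on the ray compares with \<open>u\<close>.\<close>

lemma J_quotient_tendsto:
  assumes u: "u \<in> X" and v: "v \<in> X" and t: "t \<longlonglongrightarrow> t0" and s: "s \<longlonglongrightarrow> 0" "\<And>n. s n \<noteq> 0"
  shows "(\<lambda>n. (J (\<lambda>x. t n * u x + s n * v x) - J (\<lambda>x. t n * u x)) / s n) \<longlonglongrightarrow> A (\<lambda>x. t0 * u x) v - F (\<lambda>x. t0 * u x) v"
proof -
  have 1: "(\<lambda>n. ((\<integral>z. k z * \<bar>t n * du u z + s n * du v z\<bar> powr p / p \<partial>P) - (\<integral>z. k z * \<bar>t n * du u z\<bar> powr p / p \<partial>P)) / s n)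
    \<longlonglongrightarrow> (\<integral>z. k z * h p (t0 * du u z) * du v z \<partial>P)"
  proof (rule superposition.quotient_tendsto[OF superposition_k[OF u v] _ _ t s, where F = "\<lambda>z t. k z * \<bar>t\<bar> powr p / p"])
    show "((\<lambda>t. k z * \<bar>t\<bar> powr p / p) has_real_derivative k z * h p t) (at t)" for z t
      by (rule DERIV_cong[OF DERIV_cdivide[OF DERIV_cmult[OF DERIV_abs_powr[OF p]]]]) (use p in simp)
    show "integrable P (\<lambda>z. k z * \<bar>a * du u z + b * du v z\<bar> powr p / p)" for a b
      using X_Q[OF X_lincomb[OF u v, of a b]] unfolding du_lincomb by (rule integrable_divide)
  qed
  have 2: "(\<lambda>n. ((\<integral>x. H x (t n * u x + s n * v x) \<partial>M) - (\<integral>x. H x (t n * u x) \<partial>M)) / s n)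
    \<longlonglongrightarrow> (\<integral>x. f x (t0 * u x) * v x \<partial>M)"
    by (rule superposition.quotient_tendsto[OF superposition_f[OF u v] _ _ t s])
       (use H_deriv integrable_H[OF X_lincomb[OF u v]] in auto)
  have "(\<lambda>n. ((\<integral>z. k z * \<bar>t n * du u z + s n * du v z\<bar> powr p / p \<partial>P) - (\<integral>z. k z * \<bar>t n * du u z\<bar> powr p / p \<partial>P)) / s n
     - ((\<integral>x. H x (t n * u x + s n * v x) \<partial>M) - (\<integral>x. H x (t n * u x) \<partial>M)) / s n)
     \<longlonglongrightarrow> (\<integral>z. k z * h p (t0 * du u z) * du v z \<partial>P) - (\<integral>x. f x (t0 * u x) * v x \<partial>M)"
    by (rule tendsto_diff[OF 1 2])
  moreover have "((\<integral>z. k z * \<bar>t n * du u z + s n * du v z\<bar> powr p / p \<partial>P) - (\<integral>z. k z * \<bar>t n * du u z\<bar> powr p / p \<partial>P)) / s n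
     - ((\<integral>x. H x (t n * u x + s n * v x) \<partial>M) - (\<integral>x. H x (t n * u x) \<partial>M)) / s n
     = (J (\<lambda>x. t n * u x + s n * v x) - J (\<lambda>x. t n * u x)) / s n" for n
    unfolding J_def Q_def du_lincomb du_scale by (simp add: diff_divide_distrib)
  ultimately show ?thesis
    unfolding A_def F_def du_scale by (simp only: mult.assoc)
qed

end

text \<open>A null set times the whole space is null because \<open>0 * \<infinity> = 0\<close> in
  \<open>ennreal\<close>; the exceptional pairs lie in the union of two such products.\<close>

lemma AE_fst_snd:
  assumes "AE x in lebesgue. R (x :: 'a::euclidean_space)"
  shows "AE z in lebesgue \<Otimes>\<^sub>M lebesgue. R (fst z) \<and> R (snd z)"
proof -
  obtain N where N: "N \<in> null_sets lebesgue" "{x. \<not> R x} \<subseteq> N"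
    using assms unfolding eventually_ae_filter by auto
  have "N \<times> UNIV \<in> null_sets (lebesgue \<Otimes>\<^sub>M (lebesgue :: 'a measure))"
    using N(1) lebesgue.emeasure_pair_measure_Times[of N lebesgue "UNIV :: 'a set"]
    by (intro null_setsI) (auto simp: null_sets_def)
  moreover have "UNIV \<times> N \<in> null_sets ((lebesgue :: 'a measure) \<Otimes>\<^sub>M lebesgue)"
    using N(1) lebesgue.emeasure_pair_measure_Times[of "UNIV :: 'a set" lebesgue N]
    by (intro null_setsI) (auto simp: null_sets_def)
  ultimately have "N \<times> UNIV \<union> UNIV \<times> N \<in> null_sets (lebesgue \<Otimes>\<^sub>M (lebesgue :: 'a measure))"
    by (rule null_sets.Un)
  then show ?thesis by (rule AE_I') (use N(2) in auto)
qed

section \<open>Behaviour along rays\<close>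

context log_variational
begin

text \<open>The first bound is the monotonicity hypothesis multiplied by
  \<open>\<tau> powr (p - 1)\<close>. The second is the same hypothesis at the point
  \<open>\<tau> * s\<close> with the factor \<open>1 / \<tau>\<close>, which is at least 1.\<close>

lemma f_ray:
  obtains \<theta> where "0 < \<theta>"
    "\<And>x s \<tau>. x \<in> \<Omega> \<Longrightarrow> 1 \<le> \<tau> \<Longrightarrow> \<tau> powr (p - 1) * (s * f x s + \<theta> * \<bar>s\<bar> powr p * ln \<tau>) \<le> s * f x (\<tau> * s)"
    "\<And>x s \<tau>. x \<in> \<Omega> \<Longrightarrow> 0 < \<tau> \<Longrightarrow> \<tau> \<le> 1 \<Longrightarrow> s * f x (\<tau> * s) \<le> \<tau> powr (p - 1) * (s * f x s + \<theta> * \<bar>s\<bar> powr p * ln \<tau>)"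
proof -
  obtain \<theta> where \<theta>: "0 < \<theta>" "\<And>x s \<tau>. x \<in> \<Omega> \<Longrightarrow> 1 \<le> \<tau> \<Longrightarrow> s * f x s + \<theta> * \<bar>s\<bar> powr p * ln \<tau> \<le> s * f x (\<tau> * s) * \<tau> powr (1 - p)"
    using f_mono by blast
  have inv: "\<tau> powr (p - 1) * \<tau> powr (1 - p) = 1" if "0 < \<tau>" for \<tau> :: real
    using that by (simp flip: powr_add)
  show ?thesis
  proof (rule that[OF \<theta>(1)])
    fix x s \<tau> :: real and x' :: 'a
    assume x: "x' \<in> \<Omega>"
    {
      assume t: "1 \<le> \<tau>"
      have "\<tau> powr (p - 1) * (s * f x' s + \<theta> * \<bar>s\<bar> powr p * ln \<tau>) \<le> \<tau> powr (p - 1) * (s * f x' (\<tau> * s) * \<tau> powr (1 - p))"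
        by (intro mult_left_mono \<theta>(2)[OF x t]) simp
      also have "\<dots> = s * f x' (\<tau> * s) * (\<tau> powr (p - 1) * \<tau> powr (1 - p))" by (simp only: mult_ac)
      also have "\<dots> = s * f x' (\<tau> * s)" using t by (simp only: inv[of \<tau>] mult_1_right)
      finally show "\<tau> powr (p - 1) * (s * f x' s + \<theta> * \<bar>s\<bar> powr p * ln \<tau>) \<le> s * f x' (\<tau> * s)" .
    }
    {
      assume t: "0 < \<tau>" "\<tau> \<le> 1"
      have "\<tau> * s * f x' (\<tau> * s) + \<theta> * \<bar>\<tau> * s\<bar> powr p * ln (1 / \<tau>) \<le> \<tau> * s * f x' (1 / \<tau> * (\<tau> * s)) * (1 / \<tau>) powr (1 - p)"
        using t by (intro \<theta>(2)[OF x]) simp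
      also have "1 / \<tau> * (\<tau> * s) = s" using t by simp
      also have "(1 / \<tau>) powr (1 - p) = \<tau> powr (p - 1)" using t by (simp add: powr_divide powr_diff)
      also have "ln (1 / \<tau>) = - ln \<tau>" using t by (simp add: ln_div)
      also have "\<bar>\<tau> * s\<bar> powr p = \<tau> * (\<tau> powr (p - 1) * \<bar>s\<bar> powr p)" using t by (simp add: abs_mult powr_mult powr_diff)
      finally have "\<tau> * (s * f x' (\<tau> * s)) \<le> \<tau> * (\<tau> powr (p - 1) * (s * f x' s + \<theta> * \<bar>s\<bar> powr p * ln \<tau>))"
        by (simp add: algebra_simps)
      then show "s * f x' (\<tau> * s) \<le> \<tau> powr (p - 1) * (s * f x' s + \<theta> * \<bar>s\<bar> powr p * ln \<tau>)"
        using t by (simp only: mult_le_cancel_left_pos)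
    }
  qed
qed

text \<open>Subtracting from \<open>H x (\<tau> * s)\<close> its homogeneous comparison term gives a
  function \<open>G\<close> that decreases up to \<open>\<tau> = 1\<close> and increases afterwards,
  so it is minimal at 1. The logarithmic terms of \<open>f_ray\<close> have the right sign and are
  dropped.\<close>

lemma H_ray:
  assumes x: "x \<in> \<Omega>" and t: "0 < t"
  shows "f x s * s * ((t powr p - 1) / p) \<le> H x (t * s) - H x s"
proof -
  obtain \<theta> where \<theta>: "0 < \<theta>"
    "\<And>x s \<tau>. x \<in> \<Omega> \<Longrightarrow> 1 \<le> \<tau> \<Longrightarrow> \<tau> powr (p - 1) * (s * f x s + \<theta> * \<bar>s\<bar> powr p * ln \<tau>) \<le> s * f x (\<tau> * s)"
    "\<And>x s \<tau>. x \<in> \<Omega> \<Longrightarrow> 0 < \<tau> \<Longrightarrow> \<tau> \<le> 1 \<Longrightarrow> s * f x (\<tau> * s) \<le> \<tau> powr (p - 1) * (s * f x s + \<theta> * \<bar>s\<bar> powr p * ln \<tau>)"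
    using f_ray by blast
  define G where "G \<tau> = H x (\<tau> * s) - f x s * s * (\<tau> powr p / p)" for \<tau>
  define G' where "G' \<tau> = s * f x (\<tau> * s) - f x s * s * \<tau> powr (p - 1)" for \<tau>
  have G: "(G has_real_derivative G' \<tau>) (at \<tau>)" if "0 < \<tau>" for \<tau>
    unfolding G_def G'_def using that p
    by (auto intro!: derivative_eq_intros DERIV_chain'[OF _ H_deriv[OF x], of "\<lambda>\<tau>. \<tau> * s" s] simp: powr_diff field_simps)
  have G'_ge: "0 \<le> G' \<tau>" if "1 \<le> \<tau>" for \<tau>
  proof -
    have "\<tau> powr (p - 1) * (s * f x s) \<le> \<tau> powr (p - 1) * (s * f x s + \<theta> * \<bar>s\<bar> powr p * ln \<tau>)"
      using that \<theta>(1) by (intro mult_left_mono) auto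
    also have "\<dots> \<le> s * f x (\<tau> * s)" by (rule \<theta>(2)[OF x that])
    finally show ?thesis by (simp add: G'_def mult_ac)
  qed
  have G'_le: "G' \<tau> \<le> 0" if "0 < \<tau>" "\<tau> \<le> 1" for \<tau>
  proof -
    have "s * f x (\<tau> * s) \<le> \<tau> powr (p - 1) * (s * f x s + \<theta> * \<bar>s\<bar> powr p * ln \<tau>)" by (rule \<theta>(3)[OF x that])
    also have "\<dots> \<le> \<tau> powr (p - 1) * (s * f x s)"
      using that \<theta>(1) by (intro mult_left_mono) (auto simp: mult_nonneg_nonpos)
    finally show ?thesis by (simp add: G'_def mult_ac)
  qed
  have "G 1 \<le> G t"
  proof (cases "1 \<le> t")
    case True
    show ?thesis
    proof (rule DERIV_nonneg_imp_nondecreasing[OF True])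
      fix \<tau> :: real assume "1 \<le> \<tau>"
      then show "\<exists>y. (G has_real_derivative y) (at \<tau>) \<and> 0 \<le> y"
        by (intro exI[of _ "G' \<tau>"] conjI G G'_ge) auto
    qed
  next
    case False
    show ?thesis
    proof (rule DERIV_nonpos_imp_nonincreasing[of t 1])
      fix \<tau> :: real assume "t \<le> \<tau>" "\<tau> \<le> 1"
      then show "\<exists>y. (G has_real_derivative y) (at \<tau>) \<and> y \<le> 0"
        using t by (intro exI[of _ "G' \<tau>"] conjI G G'_le) auto
    qed (use False in simp)
  qed
  then show ?thesis using p by (simp add: G_def diff_divide_distrib right_diff_distrib)
qed

text \<open>Integrating \<open>H_ray\<close> shows that the nonlinear part changes by at least
  \<open>F u u * ((t powr p - 1) / p)\<close>. On the Nehari set \<open>F u u = Q u\<close>, and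
  this number is exactly the change of \<open>Q / p\<close>.\<close>

lemma J_fibre_le:
  assumes u: "u \<in> Neh" and t: "0 < t"
  shows "J (\<lambda>x. t * u x) \<le> J u"
proof -
  have uX: "u \<in> X" and N: "Q u = F u u" using u by (auto simp: Neh_def Nh_def)
  have "F u u * ((t powr p - 1) / p) = (\<integral>x. f x (u x) * u x * ((t powr p - 1) / p) \<partial>M)"
    unfolding F_def by simp
  also have "\<dots> \<le> (\<integral>x. H x (t * u x) - H x (u x) \<partial>M)"
    by (intro integral_mono Bochner_Integration.integrable_diff integrable_mult_left integrable_f integrable_H X_scale uX H_ray t) simp
  also have "\<dots> = (\<integral>x. H x (t * u x) \<partial>M) - (\<integral>x. H x (u x) \<partial>M)"
    by (intro Bochner_Integration.integral_diff integrable_H X_scale uX)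
  finally have "Q u * ((t powr p - 1) / p) \<le> (\<integral>x. H x (t * u x) \<partial>M) - (\<integral>x. H x (u x) \<partial>M)"
    by (simp only: N)
  then show ?thesis
    unfolding J_def Q_scale[OF t] by (simp add: diff_divide_distrib right_diff_distrib mult.commute)
qed

text \<open>The form \<open>Q\<close> and the comparison value of \<open>F\<close> both scale like
  \<open>t powr p\<close>; what remains is the term \<open>- \<theta> * ln t * Lp u\<close>, which
  decides the sign of \<open>Nh\<close> far out and close to 0 on the ray. The inequality turns
  around at \<open>t = 1\<close> together with that in \<open>f_ray\<close>.\<close>

lemma Nh_ray:
  obtains \<theta> where "0 < \<theta>"
    "\<And>u t. u \<in> X \<Longrightarrow> 1 \<le> t \<Longrightarrow> Nh (\<lambda>x. t * u x) \<le> t powr p * (Nh u - \<theta> * ln t * Lp u)"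
    "\<And>u t. u \<in> X \<Longrightarrow> 0 < t \<Longrightarrow> t \<le> 1 \<Longrightarrow> t powr p * (Nh u - \<theta> * ln t * Lp u) \<le> Nh (\<lambda>x. t * u x)"
proof -
  obtain \<theta> where \<theta>: "0 < \<theta>"
    "\<And>x s \<tau>. x \<in> \<Omega> \<Longrightarrow> 1 \<le> \<tau> \<Longrightarrow> \<tau> powr (p - 1) * (s * f x s + \<theta> * \<bar>s\<bar> powr p * ln \<tau>) \<le> s * f x (\<tau> * s)"
    "\<And>x s \<tau>. x \<in> \<Omega> \<Longrightarrow> 0 < \<tau> \<Longrightarrow> \<tau> \<le> 1 \<Longrightarrow> s * f x (\<tau> * s) \<le> \<tau> powr (p - 1) * (s * f x s + \<theta> * \<bar>s\<bar> powr p * ln \<tau>)"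
    using f_ray by blast
  have eq: "(\<integral>x. t powr p * (f x (u x) * u x + \<theta> * ln t * \<bar>u x\<bar> powr p) \<partial>M) = t powr p * (F u u + \<theta> * ln t * Lp u)"
    if "u \<in> X" for u t
  proof -
    have "(\<integral>x. f x (u x) * u x + \<theta> * ln t * \<bar>u x\<bar> powr p \<partial>M) = F u u + (\<integral>x. \<theta> * ln t * \<bar>u x\<bar> powr p \<partial>M)"
      unfolding F_def by (intro Bochner_Integration.integral_add integrable_f integrable_mult_right X_Lp that)
    then show ?thesis by (simp add: Lp_def)
  qed
  have int: "integrable M (\<lambda>x. t powr p * (f x (u x) * u x + \<theta> * ln t * \<bar>u x\<bar> powr p))" if "u \<in> X" for u t
    by (intro Bochner_Integration.integrable_add integrable_f integrable_mult_right X_Lp that)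
  have tp: "t powr p = t * t powr (p - 1)" if "0 < t" for t :: real using that by (simp add: powr_diff)
  show ?thesis
  proof (rule that[OF \<theta>(1)])
    fix u t assume u: "u \<in> X" and t: "1 \<le> (t::real)"
    have "(\<integral>x. t powr p * (f x (u x) * u x + \<theta> * ln t * \<bar>u x\<bar> powr p) \<partial>M) \<le> (\<integral>x. f x (t * u x) * (t * u x) \<partial>M)"
    proof (rule integral_mono[OF int[OF u] integrable_f[OF X_scale[OF u] X_scale[OF u]]])
      fix x assume x: "x \<in> space M"
      have "t * (t powr (p - 1) * (u x * f x (u x) + \<theta> * \<bar>u x\<bar> powr p * ln t)) \<le> t * (u x * f x (t * u x))"
        using x t by (intro mult_left_mono \<theta>(2)) auto
      then show "t powr p * (f x (u x) * u x + \<theta> * ln t * \<bar>u x\<bar> powr p) \<le> f x (t * u x) * (t * u x)"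
        using t tp[of t] by (simp add: mult_ac)
    qed
    then have "t powr p * (F u u + \<theta> * ln t * Lp u) \<le> F (\<lambda>x. t * u x) (\<lambda>x. t * u x)"
      unfolding eq[OF u] by (simp only: F_def)
    then show "Nh (\<lambda>x. t * u x) \<le> t powr p * (Nh u - \<theta> * ln t * Lp u)"
      using Q_scale[of t u] t by (simp add: Nh_def algebra_simps)
  next
    fix u t assume u: "u \<in> X" and t: "0 < (t::real)" "t \<le> 1"
    have "(\<integral>x. f x (t * u x) * (t * u x) \<partial>M) \<le> (\<integral>x. t powr p * (f x (u x) * u x + \<theta> * ln t * \<bar>u x\<bar> powr p) \<partial>M)"
    proof (rule integral_mono[OF integrable_f[OF X_scale[OF u] X_scale[OF u]] int[OF u]])
      fix x assume x: "x \<in> space M"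
      have "t * (u x * f x (t * u x)) \<le> t * (t powr (p - 1) * (u x * f x (u x) + \<theta> * \<bar>u x\<bar> powr p * ln t))"
        using x t by (intro mult_left_mono \<theta>(3)) auto
      then show "f x (t * u x) * (t * u x) \<le> t powr p * (f x (u x) * u x + \<theta> * ln t * \<bar>u x\<bar> powr p)"
        using t tp[of t] by (simp add: mult_ac)
    qed
    then have "F (\<lambda>x. t * u x) (\<lambda>x. t * u x) \<le> t powr p * (F u u + \<theta> * ln t * Lp u)"
      unfolding eq[OF u] by (simp only: F_def)
    then show "t powr p * (Nh u - \<theta> * ln t * Lp u) \<le> Nh (\<lambda>x. t * u x)"
      using Q_scale[of t u] t by (simp add: Nh_def algebra_simps)
  qed
qed

lemma Nh_zero_between:
  assumes u: "u \<in> X" and ab: "a \<le> b" and Na: "0 \<le> Nh (\<lambda>x. a * u x)" and Nb: "Nh (\<lambda>x. b * u x) \<le> 0"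
  obtains t where "a \<le> t" "t \<le> b" "Nh (\<lambda>x. t * u x) = 0"
proof -
  have "continuous_on {a..b} (\<lambda>t. Nh (\<lambda>x. t * u x))"
    unfolding continuous_on_sequentially
  proof (intro allI ballI impI, elim conjE)
    fix s t assume "s \<longlonglongrightarrow> (t::real)"
    then have "(\<lambda>n. Nh (\<lambda>x. s n * u x + 0 * u x)) \<longlonglongrightarrow> Nh (\<lambda>x. t * u x + 0 * u x)"
      by (intro Nh_tendsto u tendsto_const)
    then show "((\<lambda>t. Nh (\<lambda>x. t * u x)) \<circ> s) \<longlonglongrightarrow> Nh (\<lambda>x. t * u x)" by (simp add: comp_def)
  qed
  from IVT2'[of "\<lambda>t. Nh (\<lambda>x. t * u x)", OF Nb Na ab this] show ?thesis using that by blast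
qed

lemma Neh_ray_exists:
  assumes u: "u \<in> X" and n: "\<not> (AE x in lebesgue. u x = 0)"
  obtains t where "0 < t" "(\<lambda>x. t * u x) \<in> Neh"
proof -
  obtain \<theta> where \<theta>: "0 < \<theta>"
    "\<And>u t. u \<in> X \<Longrightarrow> 1 \<le> t \<Longrightarrow> Nh (\<lambda>x. t * u x) \<le> t powr p * (Nh u - \<theta> * ln t * Lp u)"
    "\<And>u t. u \<in> X \<Longrightarrow> 0 < t \<Longrightarrow> t \<le> 1 \<Longrightarrow> t powr p * (Nh u - \<theta> * ln t * Lp u) \<le> Nh (\<lambda>x. t * u x)"
    using Nh_ray by blast
  have L: "0 < Lp u" by (rule Lp_pos[OF u n])
  \<comment> \<open>At the factors \<open>exp r\<close> and \<open>exp (- r)\<close> the term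
    \<open>\<theta> * ln t * Lp u\<close> has modulus \<open>\<bar>Nh u\<bar>\<close>, so
    \<open>Nh\<close> is nonpositive at the first and nonnegative at the second.\<close>
  define r where "r = \<bar>Nh u\<bar> / (\<theta> * Lp u)"
  have r: "0 \<le> r" "\<theta> * r * Lp u = \<bar>Nh u\<bar>" using \<theta>(1) L by (auto simp: r_def)
  have "Nh (\<lambda>x. exp r * u x) \<le> exp r powr p * (Nh u - \<theta> * ln (exp r) * Lp u)"
    using r by (intro \<theta>(2) u) simp
  also have "\<dots> \<le> 0" using r by (intro mult_nonneg_nonpos) auto
  finally have b: "Nh (\<lambda>x. exp r * u x) \<le> 0" .
  have "0 \<le> exp (- r) powr p * (Nh u - \<theta> * ln (exp (- r)) * Lp u)" using r by (intro mult_nonneg_nonneg) auto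
  also have "\<dots> \<le> Nh (\<lambda>x. exp (- r) * u x)" using r by (intro \<theta>(3) u) auto
  finally have a: "0 \<le> Nh (\<lambda>x. exp (- r) * u x)" .
  obtain t where t: "exp (- r) \<le> t" "Nh (\<lambda>x. t * u x) = 0"
    using Nh_zero_between[OF u _ a b] r by auto
  have t0: "0 < t" using t(1) exp_gt_zero[of "- r"] by linarith
  have "(\<lambda>x. t * u x) \<in> Neh" using t(2) t0 n X_scale[OF u] by (simp add: Neh_def)
  with t0 show ?thesis by (rule that)
qed

section \<open>Minimizers are weak solutions\<close>

lemma Nh_eq_0:
  assumes u: "u \<in> X" and n: "AE x in lebesgue. u x = 0"
  shows "Nh u = 0"
proof -
  have "AE z in P. k z * \<bar>du u z\<bar> powr p = 0" using AE_fst_snd[OF n] by eventually_elim (simp add: du_def)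
  then have "Q u = 0" unfolding Q_def by (rule integral_eq_zero_AE)
  moreover have "AE x in M. u x = 0" using n by (subst AE_restrict_space_iff) auto
  then have "AE x in M. f x (u x) * u x = 0" by eventually_elim simp
  then have "F u u = 0" unfolding F_def by (rule integral_eq_zero_AE)
  ultimately show ?thesis by (simp add: Nh_def)
qed

text \<open>The strict signs of \<open>Nh\<close> on both sides of \<open>u\<close> on its ray
  persist after adding a small multiple of \<open>v\<close>, and a zero in between gives a Nehari
  point \<open>t * (u + s * v)\<close> with \<open>t\<close> close to 1. Since \<open>J\<close> at
  \<open>t * u\<close> is at most \<open>J u\<close>, and \<open>J u\<close> at most
  \<open>J\<close> at that point, the difference quotient in the direction \<open>v\<close> is
  nonnegative.\<close>

lemma minimizer_variation:
  assumes u: "u \<in> Neh" and min: "\<And>w. w \<in> Neh \<Longrightarrow> J u \<le> J w" and v: "v \<in> X"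
  shows "0 \<le> A u v - F u v"
proof -
  obtain \<theta> where \<theta>: "0 < \<theta>"
    "\<And>u t. u \<in> X \<Longrightarrow> 1 \<le> t \<Longrightarrow> Nh (\<lambda>x. t * u x) \<le> t powr p * (Nh u - \<theta> * ln t * Lp u)"
    "\<And>u t. u \<in> X \<Longrightarrow> 0 < t \<Longrightarrow> t \<le> 1 \<Longrightarrow> t powr p * (Nh u - \<theta> * ln t * Lp u) \<le> Nh (\<lambda>x. t * u x)"
    using Nh_ray by blast
  have uX: "u \<in> X" and N: "Nh u = 0" and n: "\<not> (AE x in lebesgue. u x = 0)" using u by (auto simp: Neh_def)
  have L: "0 < Lp u" by (rule Lp_pos[OF uX n])
  have ex: "\<exists>t s. 0 < t \<and> 0 < s \<and> s \<le> 1 / real (Suc j) \<and> \<bar>t - 1\<bar> \<le> 1 / real (j + 2) \<and> (\<lambda>x. t * u x + t * s * v x) \<in> Neh" for j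
  proof -
    \<comment> \<open>The \<open>j + 2\<close> keeps \<open>e\<close> below 1 even for
      \<open>j = 0\<close>, so that \<open>1 - e\<close> is positive.\<close>
    define e where "e = 1 / real (j + 2)"
    have e: "0 < e" "e < 1" by (auto simp: e_def)
    have "ln (1 - e) < 0" using e by simp
    then have "\<theta> * ln (1 - e) * Lp u < 0" using \<theta>(1) L by (intro mult_neg_pos mult_pos_neg)
    then have "0 < (1 - e) powr p * (Nh u - \<theta> * ln (1 - e) * Lp u)"
      using N e by (intro mult_pos_pos) auto
    also have "\<dots> \<le> Nh (\<lambda>x. (1 - e) * u x)" using e by (intro \<theta>(3) uX) auto
    finally have lo: "0 < Nh (\<lambda>x. (1 - e) * u x)" .
    have "Nh (\<lambda>x. (1 + e) * u x) \<le> (1 + e) powr p * (Nh u - \<theta> * ln (1 + e) * Lp u)"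
      using e by (intro \<theta>(2) uX) auto
    also have "\<dots> < 0" using N e \<theta>(1) L by (intro mult_pos_neg) auto
    finally have hi: "Nh (\<lambda>x. (1 + e) * u x) < 0" .
    have s0: "(\<lambda>i. 1 / real (Suc i)) \<longlonglongrightarrow> 0" by real_asymp
    have lim: "(\<lambda>i. Nh (\<lambda>x. r * u x + r * (1 / real (Suc i)) * v x)) \<longlonglongrightarrow> Nh (\<lambda>x. r * u x)" for r
    proof -
      have "(\<lambda>i. r * (1 / real (Suc i))) \<longlonglongrightarrow> r * 0" by (intro tendsto_intros s0)
      then have "(\<lambda>i. Nh (\<lambda>x. r * u x + r * (1 / real (Suc i)) * v x)) \<longlonglongrightarrow> Nh (\<lambda>x. r * u x + r * 0 * v x)"
        by (intro Nh_tendsto uX v tendsto_const)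
      then show ?thesis by (simp only: mult_zero_right mult_zero_left add_0_right)
    qed
    have "\<forall>\<^sub>F i in sequentially. 0 < Nh (\<lambda>x. (1 - e) * u x + (1 - e) * (1 / real (Suc i)) * v x)
       \<and> Nh (\<lambda>x. (1 + e) * u x + (1 + e) * (1 / real (Suc i)) * v x) < 0 \<and> j \<le> i"
      by (intro eventually_conj order_tendstoD(1)[OF lim lo] order_tendstoD(2)[OF lim hi] eventually_ge_at_top)
    then obtain i where i: "0 < Nh (\<lambda>x. (1 - e) * u x + (1 - e) * (1 / real (Suc i)) * v x)"
       "Nh (\<lambda>x. (1 + e) * u x + (1 + e) * (1 / real (Suc i)) * v x) < 0" "j \<le> i"
      using eventually_happens'[OF sequentially_bot] by blast
    define s where "s = 1 / real (Suc i)"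
    define w where "w x = 1 * u x + s * v x" for x
    have w: "w \<in> X" unfolding w_def by (rule X_lincomb[OF uX v])
    have rw: "(\<lambda>x. r * w x) = (\<lambda>x. r * u x + r * s * v x)" for r
      by (simp add: w_def algebra_simps)
    have lo': "0 < Nh (\<lambda>x. (1 - e) * w x)" and hi': "Nh (\<lambda>x. (1 + e) * w x) < 0"
      using i(1,2) unfolding rw s_def by simp_all
    \<comment> \<open>\<open>Nh\<close> vanishes on functions that are zero almost everywhere, so
      its strict sign shows that the perturbed function is nontrivial.\<close>
    have wn: "\<not> (AE x in lebesgue. w x = 0)"
    proof
      assume "AE x in lebesgue. w x = 0"
      then have "Nh (\<lambda>x. (1 - e) * w x) = 0" by (intro Nh_eq_0 X_scale w) auto
      then show False using lo' by simp
    qed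
    obtain t where t: "1 - e \<le> t" "t \<le> 1 + e" "Nh (\<lambda>x. t * w x) = 0"
      using Nh_zero_between[OF w _ less_imp_le[OF lo'] less_imp_le[OF hi']] e by auto
    have "0 < t" using t(1) e by linarith
    moreover have "(\<lambda>x. t * w x) \<in> Neh" using t(3) wn X_scale[OF w] \<open>0 < t\<close> by (simp add: Neh_def)
    moreover have "0 < s" "s \<le> 1 / real (Suc j)" using i(3) by (auto simp: s_def intro!: divide_left_mono)
    moreover have "\<bar>t - 1\<bar> \<le> 1 / real (j + 2)" using t unfolding e_def by linarith
    ultimately show ?thesis unfolding rw by blast
  qed
  have "\<forall>j. \<exists>q. 0 < fst q \<and> 0 < snd q \<and> snd q \<le> 1 / real (Suc j) \<and> \<bar>fst q - 1\<bar> \<le> 1 / real (j + 2)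
      \<and> (\<lambda>x. fst q * u x + fst q * snd q * v x) \<in> Neh"
  proof
    fix j
    obtain t s where "0 < t \<and> 0 < s \<and> s \<le> 1 / real (Suc j) \<and> \<bar>t - 1\<bar> \<le> 1 / real (j + 2) \<and> (\<lambda>x. t * u x + t * s * v x) \<in> Neh"
      using ex[of j] by blast
    then show "\<exists>q. 0 < fst q \<and> 0 < snd q \<and> snd q \<le> 1 / real (Suc j) \<and> \<bar>fst q - 1\<bar> \<le> 1 / real (j + 2)
      \<and> (\<lambda>x. fst q * u x + fst q * snd q * v x) \<in> Neh"
      by (intro exI[of _ "(t, s)"]) (simp only: fst_conv snd_conv)
  qed
  then obtain q where q: "\<forall>j. 0 < fst (q j) \<and> 0 < snd (q j) \<and> snd (q j) \<le> 1 / real (Suc j) \<and> \<bar>fst (q j) - 1\<bar> \<le> 1 / real (j + 2)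
      \<and> (\<lambda>x. fst (q j) * u x + fst (q j) * snd (q j) * v x) \<in> Neh"
    by (rule choice[THEN exE])
  define t where "t j = fst (q j)" for j
  define s where "s j = snd (q j)" for j
  have ts: "\<And>j. 0 < t j" "\<And>j. 0 < s j" "\<And>j. s j \<le> 1 / real (Suc j)"
      "\<And>j. \<bar>t j - 1\<bar> \<le> 1 / real (j + 2)" "\<And>j. (\<lambda>x. t j * u x + t j * s j * v x) \<in> Neh"
    using q unfolding t_def s_def by blast+
  have "(\<lambda>j. t j - 1) \<longlonglongrightarrow> 0"
  proof (rule Lim_null_comparison)
    show "\<forall>\<^sub>F j in sequentially. norm (t j - 1) \<le> 1 / real (j + 2)"
      using ts(4) by (intro always_eventually allI) (simp only: real_norm_def)
    show "(\<lambda>j. 1 / real (j + 2)) \<longlonglongrightarrow> 0" by real_asymp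
  qed
  then have t1: "t \<longlonglongrightarrow> 1" by (simp only: LIM_zero_iff)
  have s1: "s \<longlonglongrightarrow> 0"
  proof (rule Lim_null_comparison)
    show "\<forall>\<^sub>F j in sequentially. norm (s j) \<le> 1 / real (Suc j)"
    proof (intro always_eventually allI)
      fix j show "norm (s j) \<le> 1 / real (Suc j)" using ts(2)[of j] ts(3)[of j] by (simp only: real_norm_def abs_of_pos)
    qed
    show "(\<lambda>j. 1 / real (Suc j)) \<longlonglongrightarrow> 0" by real_asymp
  qed
  have st: "(\<lambda>j. t j * s j) \<longlonglongrightarrow> 0" using tendsto_mult[OF t1 s1] by simp
  have "(\<lambda>j. (J (\<lambda>x. t j * u x + (t j * s j) * v x) - J (\<lambda>x. t j * u x)) / (t j * s j)) \<longlonglongrightarrow> A (\<lambda>x. 1 * u x) v - F (\<lambda>x. 1 * u x) v"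
  proof (rule J_quotient_tendsto[OF uX v t1 st])
    show "t j * s j \<noteq> 0" for j using ts(1)[of j] ts(2)[of j] by simp
  qed
  then have lim: "(\<lambda>j. (J (\<lambda>x. t j * u x + (t j * s j) * v x) - J (\<lambda>x. t j * u x)) / (t j * s j)) \<longlonglongrightarrow> A u v - F u v"
    by simp
  show ?thesis
  proof (rule LIMSEQ_le_const[OF lim], intro exI allI impI)
    fix j
    have "J (\<lambda>x. t j * u x) \<le> J u" by (rule J_fibre_le[OF u ts(1)])
    also have "\<dots> \<le> J (\<lambda>x. t j * u x + (t j * s j) * v x)" by (rule min[OF ts(5)])
    finally show "0 \<le> (J (\<lambda>x. t j * u x + (t j * s j) * v x) - J (\<lambda>x. t j * u x)) / (t j * s j)"
      using ts(1)[of j] ts(2)[of j] by simp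
  qed
qed

lemma minimizer_weak:
  assumes u: "u \<in> Neh" and min: "\<And>w. w \<in> Neh \<Longrightarrow> J u \<le> J w" and v: "v \<in> X"
  shows "A u v = F u v"
proof -
  have "0 \<le> A u v - F u v" by (rule minimizer_variation[OF u min v])
  moreover have "0 \<le> A u (\<lambda>x. - 1 * v x) - F u (\<lambda>x. - 1 * v x)"
    by (rule minimizer_variation[OF u min X_scale[OF v]])
  moreover have "A u (\<lambda>x. - 1 * v x) = - A u v" unfolding A_def du_scale by simp
  moreover have "F u (\<lambda>x. - 1 * v x) = - F u v" unfolding F_def by simp
  ultimately show ?thesis by linarith
qed

text \<open>Let \<open>t * w\<close> be the Nehari point on the ray of
  \<open>w = \<bar>u\<bar>\<close>. Maximality on the ray of \<open>u\<close> and minimality of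
  \<open>u\<close> give \<open>J\<close> at \<open>t * u\<close> at most \<open>J\<close> at
  \<open>t * w\<close>; the hypothesis on \<open>H\<close> then leaves \<open>Q u \<le> Q w\<close>.
  The increments of \<open>w\<close> are pointwise no larger than those of \<open>u\<close>, so the
  integrands agree almost everywhere, whereas they differ at pairs of opposite sign in the domain
  because \<open>k\<close> is positive there.\<close>

lemma minimizer_sign:
  assumes u: "u \<in> Neh" and min: "\<And>w. w \<in> Neh \<Longrightarrow> J u \<le> J w"
    and H: "\<And>x t. x \<in> \<Omega> \<Longrightarrow> H x t \<le> H x \<bar>t\<bar>"
  shows "(AE x in M. 0 \<le> u x) \<or> (AE x in M. u x \<le> 0)"
proof -
  have uX: "u \<in> X" and n: "\<not> (AE x in lebesgue. u x = 0)" using u by (auto simp: Neh_def)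
  note [measurable] = X_meas[OF uX]
  define w where "w x = \<bar>u x\<bar>" for x
  have dw: "\<bar>du w z\<bar> \<le> \<bar>du u z\<bar>" for z by (simp add: w_def du_def)
  have dwp: "k z * \<bar>du w z\<bar> powr p \<le> k z * \<bar>du u z\<bar> powr p" for z
    using p dw[of z] by (intro mult_left_mono powr_mono2) auto
  have [measurable]: "w \<in> borel_measurable lebesgue" unfolding w_def[abs_def] by measurable
  have wX: "w \<in> X"
    unfolding X_def mem_Collect_eq
  proof (intro conjI)
    show "AE x in lebesgue. x \<notin> \<Omega> \<longrightarrow> w x = 0" using X_zero[OF uX] by eventually_elim (simp add: w_def)
    show "integrable M (\<lambda>x. \<bar>w x\<bar> powr p)" using X_Lp[OF uX] by (simp add: w_def)
    show "integrable P (\<lambda>z. k z * \<bar>du w z\<bar> powr p)"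
    proof (rule Bochner_Integration.integrable_bound[OF X_Q[OF uX]])
      show "AE z in P. norm (k z * \<bar>du w z\<bar> powr p) \<le> norm (k z * \<bar>du u z\<bar> powr p)"
        using dwp by (intro AE_I2) simp
    qed measurable
  qed measurable
  have "\<not> (AE x in lebesgue. w x = 0)" using n by (simp add: w_def)
  then obtain t where t: "0 < t" "(\<lambda>x. t * w x) \<in> Neh" using Neh_ray_exists[OF wX] by blast
  have "J (\<lambda>x. t * u x) \<le> J u" by (rule J_fibre_le[OF u t(1)])
  also have "\<dots> \<le> J (\<lambda>x. t * w x)" by (rule min[OF t(2)])
  finally have "t powr p * Q u / p - (\<integral>x. H x (t * u x) \<partial>M) \<le> t powr p * Q w / p - (\<integral>x. H x (t * w x) \<partial>M)"
    unfolding J_def Q_scale[OF t(1)] .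
  moreover have "(\<integral>x. H x (t * u x) \<partial>M) \<le> (\<integral>x. H x (t * w x) \<partial>M)"
  proof (rule integral_mono[OF integrable_H[OF X_scale[OF uX]] integrable_H[OF X_scale[OF wX]]])
    fix x assume "x \<in> space M"
    then show "H x (t * u x) \<le> H x (t * w x)" using H[of x "t * u x"] t(1) by (simp add: w_def abs_mult)
  qed
  ultimately have "t powr p * Q u / p \<le> t powr p * Q w / p" by linarith
  then have "Q u \<le> Q w" using t(1) p by (simp add: divide_le_cancel)
  then have "(\<integral>z. k z * \<bar>du u z\<bar> powr p - k z * \<bar>du w z\<bar> powr p \<partial>P) \<le> 0"
    unfolding Q_def by (subst Bochner_Integration.integral_diff[OF X_Q[OF uX] X_Q[OF wX]]) simp
  moreover have "0 \<le> (\<integral>z. k z * \<bar>du u z\<bar> powr p - k z * \<bar>du w z\<bar> powr p \<partial>P)"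
    using dwp by (intro Bochner_Integration.integral_nonneg) simp
  ultimately have "(\<integral>z. k z * \<bar>du u z\<bar> powr p - k z * \<bar>du w z\<bar> powr p \<partial>P) = 0" by linarith
  then have "AE z in P. k z * \<bar>du u z\<bar> powr p - k z * \<bar>du w z\<bar> powr p = 0"
    using dwp Bochner_Integration.integrable_diff[OF X_Q[OF uX] X_Q[OF wX]]
    by (subst (asm) integral_nonneg_eq_0_iff_AE) auto
  then have "AE z in P. \<not> (fst z \<in> \<Omega> \<and> snd z \<in> \<Omega> \<and> u (snd z) < 0 \<and> 0 < u (fst z))"
  proof eventually_elim
    case (elim z)
    show ?case
    proof
      assume z: "fst z \<in> \<Omega> \<and> snd z \<in> \<Omega> \<and> u (snd z) < 0 \<and> 0 < u (fst z)"
      then have "fst z \<noteq> snd z" by auto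
      then have "0 < k z" using k_pos[of "fst z" "snd z"] z by simp
      moreover have "\<bar>du w z\<bar> < \<bar>du u z\<bar>" using z by (auto simp: du_def w_def)
      then have "\<bar>du w z\<bar> powr p < \<bar>du u z\<bar> powr p" using p by (intro powr_less_mono2) auto
      ultimately show False using elim by simp
    qed
  qed
  from lebesgue_pair.AE_pair[OF this]
  have AE2: "AE x in lebesgue. AE y in lebesgue. \<not> (x \<in> \<Omega> \<and> y \<in> \<Omega> \<and> u y < 0 \<and> 0 < u x)"
    by simp
  show ?thesis
  proof (cases "AE x in lebesgue. \<not> (x \<in> \<Omega> \<and> 0 < u x)")
    case True
    then have "AE x in lebesgue. x \<in> \<Omega> \<longrightarrow> u x \<le> 0" by eventually_elim auto
    then show ?thesis by (subst (2) AE_restrict_space_iff) auto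
  next
    case False
    \<comment> \<open>Almost every \<open>x\<close> satisfies the inner statement. Unless
      \<open>u\<close> is nonpositive, some \<open>x\<close> with \<open>0 < u x\<close> does, and
      for it the negative values of \<open>u\<close> in \<open>\<Omega>\<close> form a null
      set.\<close>
    have "\<exists>x. (x \<in> \<Omega> \<and> 0 < u x) \<and> (AE y in lebesgue. \<not> (x \<in> \<Omega> \<and> y \<in> \<Omega> \<and> u y < 0 \<and> 0 < u x))"
    proof (rule ccontr)
      assume *: "\<not> ?thesis"
      have "AE x in lebesgue. \<not> (x \<in> \<Omega> \<and> 0 < u x)"
        using AE2 by eventually_elim (use * in blast)
      then show False using False by contradiction
    qed
    then obtain x where x: "x \<in> \<Omega>" "0 < u x" "AE y in lebesgue. \<not> (x \<in> \<Omega> \<and> y \<in> \<Omega> \<and> u y < 0 \<and> 0 < u x)"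
      by blast
    from x(3) have "AE y in lebesgue. y \<in> \<Omega> \<longrightarrow> 0 \<le> u y" by eventually_elim (use x(1,2) in auto)
    then show ?thesis by (subst AE_restrict_space_iff) auto
  qed
qed

end

subsection \<open>Existence of a minimizer\<close>

lemma nn_integral_Fatou_le:
  fixes F :: "nat \<Rightarrow> 'a \<Rightarrow> ennreal"
  assumes F: "\<And>n. F n \<in> borel_measurable M"
    and G: "AE x in M. G x \<le> liminf (\<lambda>n. F n x)"
    and B: "\<forall>\<^sub>F n in sequentially. (\<integral>\<^sup>+ x. F n x \<partial>M) \<le> B"
  shows "(\<integral>\<^sup>+ x. G x \<partial>M) \<le> B"
proof -
  have "(\<integral>\<^sup>+ x. G x \<partial>M) \<le> (\<integral>\<^sup>+ x. liminf (\<lambda>n. F n x) \<partial>M)"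
    by (rule nn_integral_mono_AE[OF G])
  also have "\<dots> \<le> liminf (\<lambda>n. \<integral>\<^sup>+ x. F n x \<partial>M)" by (rule nn_integral_liminf[OF F])
  also have "\<dots> \<le> liminf (\<lambda>n. B)" by (rule Liminf_mono[OF B])
  also have "\<dots> = B" by (simp add: Liminf_const)
  finally show ?thesis .
qed

lemma liminf_eq_of_tendsto:
  fixes f :: "nat \<Rightarrow> ennreal"
  assumes "f \<longlonglongrightarrow> l" shows "liminf f = l"
  using lim_imp_Liminf[OF _ assms] by simp

text \<open>Continuity is the point: \<open>H x t * cutoff K t\<close> is bounded and continuous in
  \<open>t\<close>, so its integral passes to almost everywhere limits, while a sharp cutoff could
  fail where the limit has modulus \<open>K\<close>.\<close>

definition cutoff :: "real \<Rightarrow> real \<Rightarrow> real" where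
  "cutoff K t = max 0 (min 1 (2 - \<bar>t\<bar> / K))"

lemma cutoff_nonneg [simp]: "0 \<le> cutoff K t"
  and cutoff_le_1 [simp]: "cutoff K t \<le> 1"
  by (auto simp: cutoff_def)

lemma cutoff_eq_1: "0 < K \<Longrightarrow> \<bar>t\<bar> \<le> K \<Longrightarrow> cutoff K t = 1"
  by (simp add: cutoff_def max_def min_def field_simps)

lemma cutoff_eq_0: "0 < K \<Longrightarrow> 2 * K \<le> \<bar>t\<bar> \<Longrightarrow> cutoff K t = 0"
  by (simp add: cutoff_def max_def min_def field_simps)

lemma borel_measurable_cutoff [measurable]: "cutoff K \<in> borel_measurable borel"
  unfolding cutoff_def[abs_def] by measurable

lemma isCont_cutoff: "isCont (cutoff K) t"
proof -
  have "continuous_on UNIV (\<lambda>t. max 0 (min 1 (2 - \<bar>t\<bar> * inverse K)))"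
    by (intro continuous_intros)
  then show ?thesis
    unfolding cutoff_def[abs_def] divide_inverse by (simp add: continuous_on_eq_continuous_at)
qed

context log_variational
begin

lemma AE_M: "(AE x in lebesgue. R x) \<Longrightarrow> (AE x in M. R x)"
  by (subst AE_restrict_space_iff) auto

text \<open>The slope \<open>m2\<close> lies strictly between \<open>m\<close> and the threshold.
  The tail of \<open>H\<close> then costs at most the fraction \<open>m / m2\<close> of
  \<open>Q / p\<close>, the remaining fraction is the coercivity constant, and values up to
  \<open>K\<close> contribute a bounded amount.\<close>

lemma coercive:
  assumes R: "0 < R"
  obtains a D where "0 < a" "\<And>u. u \<in> X \<Longrightarrow> Lp u \<le> R \<Longrightarrow> a * Q u - D \<le> J u"
proof -
  obtain m M1 where m: "0 < m" "1 \<le> M1" "m < p\<^sup>2 / DIM('a)"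
     "\<And>x t. x \<in> \<Omega> \<Longrightarrow> M1 \<le> \<bar>t\<bar> \<Longrightarrow> 0 \<le> H x t \<and> H x t \<le> m / p * (\<bar>t\<bar> powr p * ln \<bar>t\<bar>)"
    using H_growth by blast
  define m2 where "m2 = (m + p\<^sup>2 / DIM('a)) / 2"
  \<comment> \<open>The midpoint inequality is proved for a plain real \<open>d\<close>, which keeps
    the quotient by the dimension out of the arithmetic.\<close>
  have "m < (m + d) / 2 \<and> (m + d) / 2 < d" if "m < d" for d using that by (auto simp: field_simps)
  from this[OF m(3)] have m2: "m < m2" "m2 < p\<^sup>2 / DIM('a)" unfolding m2_def by blast+
  then have m2_pos: "0 < m2" using m(1) by simp
  note m2 = m2 m2_pos
  obtain M0 where M0: "1 \<le> M0" "\<And>K u. M0 \<le> K \<Longrightarrow> u \<in> X \<Longrightarrow> Lp u \<le> R \<Longrightarrow>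
     (\<integral>\<^sup>+ x. ennreal (m2 * (\<bar>u x\<bar> powr p * ln \<bar>u x\<bar>)) * indicator {x. K < \<bar>u x\<bar>} x \<partial>M)
      \<le> (\<integral>\<^sup>+ z. ennreal (k z * \<bar>du u z\<bar> powr p) * indicator (tail_region K u) z \<partial>P)"
    using tail_bound[OF R m2(2,3)] by blast
  obtain C where C: "0 \<le> C" "\<And>x s K. x \<in> \<Omega> \<Longrightarrow> \<bar>s\<bar> \<le> K \<Longrightarrow> \<bar>H x s\<bar> \<le> 2 * C * gdom p K"
    using H_le_gdom by blast
  define K where "K = max M0 M1"
  have K: "1 \<le> K" "M0 \<le> K" "M1 \<le> K" using M0(1) by (auto simp: K_def)
  define D where "D = 2 * C * gdom p K"
  have D: "0 \<le> D" using C(1) by (simp add: D_def)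
  have Hb: "\<bar>H x s\<bar> \<le> D" if "x \<in> \<Omega>" "\<bar>s\<bar> \<le> K" for x s
    unfolding D_def by (rule C(2)[OF that])
  show ?thesis
  proof (rule that[of "1 / p * (1 - m / m2)" "D * measure M \<Omega>"])
    show "0 < 1 / p * (1 - m / m2)" using p m2 m(1) by (intro mult_pos_pos) auto
    fix u assume u: "u \<in> X" "Lp u \<le> R"
    note [measurable] = X_meas_M[OF u(1)]
    define T where "T x = \<bar>u x\<bar> powr p * ln \<bar>u x\<bar> * indicator {x. K < \<bar>u x\<bar>} x" for x
    have T0: "0 \<le> T x" for x using K(1) by (auto simp: T_def indicator_def)
    have "(\<lambda>x. \<bar>u x\<bar> powr p * ln \<bar>u x\<bar> * (if K < \<bar>u x\<bar> then 1 else 0)) \<in> borel_measurable M" by measurable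
    then have T_meas [measurable]: "T \<in> borel_measurable M"
      unfolding T_def[abs_def] indicator_def by simp
    have T_nn: "(\<integral>\<^sup>+ x. ennreal (m2 * T x) \<partial>M) \<le> ennreal (Q u)"
    proof -
      have "(\<integral>\<^sup>+ x. ennreal (m2 * T x) \<partial>M) = (\<integral>\<^sup>+ x. ennreal (m2 * (\<bar>u x\<bar> powr p * ln \<bar>u x\<bar>)) * indicator {x. K < \<bar>u x\<bar>} x \<partial>M)"
        by (intro nn_integral_cong) (simp add: T_def indicator_def)
      also have "\<dots> \<le> (\<integral>\<^sup>+ z. ennreal (k z * \<bar>du u z\<bar> powr p) * indicator (tail_region K u) z \<partial>P)"
        by (rule M0(2)[OF K(2) u])
      also have "\<dots> \<le> (\<integral>\<^sup>+ z. ennreal (k z * \<bar>du u z\<bar> powr p) \<partial>P)"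
        by (intro nn_integral_mono) (simp add: indicator_def)
      also have "\<dots> = ennreal (Q u)" by (rule nn_integral_Q[OF u(1)])
      finally show ?thesis .
    qed
    have T_int': "integrable M (\<lambda>x. m2 * T x)"
      using le_less_trans[OF T_nn ennreal_less_top] m2(3) T0 by (intro integrableI_bounded) (auto simp: abs_mult)
    have T_int: "integrable M T" using T_int' m2(3) by simp
    have "ennreal (\<integral>x. m2 * T x \<partial>M) = (\<integral>\<^sup>+ x. ennreal (m2 * T x) \<partial>M)"
      using T0 m2(3) by (intro nn_integral_eq_integral [symmetric] T_int') auto
    then have "ennreal (m2 * (\<integral>x. T x \<partial>M)) \<le> ennreal (Q u)" using T_nn by simp
    then have Tle: "m2 * (\<integral>x. T x \<partial>M) \<le> Q u" by (subst (asm) ennreal_le_iff[OF Q_nonneg])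
    have "(\<integral>x. H x (u x) \<partial>M) \<le> (\<integral>x. m / p * T x + D \<partial>M)"
    proof (rule integral_mono[OF integrable_H[OF u(1)]])
      show "integrable M (\<lambda>x. m / p * T x + D)" using T_int by simp
      fix x assume "x \<in> space M"
      then have x: "x \<in> \<Omega>" by simp
      show "H x (u x) \<le> m / p * T x + D"
      proof (cases "K < \<bar>u x\<bar>")
        case True
        then show ?thesis using m(4)[OF x, of "u x"] K(3) D by (simp add: T_def)
      next
        case False
        then show ?thesis using Hb[OF x, of "u x"] by (simp add: T_def)
      qed
    qed
    also have "\<dots> = m / p * (\<integral>x. T x \<partial>M) + D * measure M \<Omega>"
      using T_int by (subst Bochner_Integration.integral_add) auto
    also have "\<dots> \<le> m / p * (Q u / m2) + D * measure M \<Omega>"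
      using Tle m2(3) m(1) p by (intro add_right_mono mult_left_mono) (auto simp: pos_le_divide_eq mult.commute)
    finally have "Q u / p - (m / p * (Q u / m2) + D * measure M \<Omega>) \<le> J u" by (simp add: J_def)
    then show "1 / p * (1 - m / m2) * Q u - D * measure M \<Omega> \<le> J u"
      by (simp add: algebra_simps diff_divide_distrib)
  qed
qed

text \<open>Fatou's lemma, once for the \<open>p\<close>-norm and once for the kernel form.\<close>

lemma X_limit:
  assumes w: "\<And>n. w n \<in> X" and v [measurable]: "v \<in> borel_measurable lebesgue"
    and lim: "AE x in lebesgue. (\<lambda>n. w n x) \<longlonglongrightarrow> v x"
    and L: "\<And>n. Lp (w n) \<le> R" and Q: "\<And>n. Q (w n) \<le> B"
  shows "v \<in> X"
proof -
  note [measurable] = X_meas[OF w] X_meas_M[OF w] measurable_M[OF v]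
  have "AE x in lebesgue. \<forall>n. x \<notin> \<Omega> \<longrightarrow> w n x = 0" unfolding AE_all_countable using X_zero[OF w] by simp
  with lim have 1: "AE x in lebesgue. x \<notin> \<Omega> \<longrightarrow> v x = 0"
  proof eventually_elim
    case (elim x)
    show ?case
    proof
      assume "x \<notin> \<Omega>"
      then have "(\<lambda>n. w n x) = (\<lambda>n. 0)" using elim(2) by auto
      then show "v x = 0" using elim(1) by (simp add: LIMSEQ_const_iff)
    qed
  qed
  have "(\<integral>\<^sup>+ x. ennreal (\<bar>v x\<bar> powr p) \<partial>M) \<le> ennreal R"
  proof (rule nn_integral_Fatou_le[where F = "\<lambda>n x. ennreal (\<bar>w n x\<bar> powr p)"])
    show "AE x in M. ennreal (\<bar>v x\<bar> powr p) \<le> liminf (\<lambda>n. ennreal (\<bar>w n x\<bar> powr p))"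
      using AE_M[OF lim]
    proof eventually_elim
      case (elim x)
      then have lim: "(\<lambda>n. ennreal (\<bar>w n x\<bar> powr p)) \<longlonglongrightarrow> ennreal (\<bar>v x\<bar> powr p)"
        using p by (intro tendsto_ennrealI tendsto_powr2 tendsto_intros) auto
      show ?case by (simp only: liminf_eq_of_tendsto[OF lim] order_refl)
    qed
    have "(\<integral>\<^sup>+ x. ennreal (\<bar>w n x\<bar> powr p) \<partial>M) \<le> ennreal R" for n
      using nn_integral_eq_integral[OF X_Lp[OF w[of n]]] L[of n] by (simp add: Lp_def ennreal_leI)
    then show "\<forall>\<^sub>F n in sequentially. (\<integral>\<^sup>+ x. ennreal (\<bar>w n x\<bar> powr p) \<partial>M) \<le> ennreal R" by simp
  qed measurable
  then have 2: "integrable M (\<lambda>x. \<bar>v x\<bar> powr p)"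
    by (intro integrableI_bounded) (auto intro: le_less_trans)
  have "(\<integral>\<^sup>+ z. ennreal (k z * \<bar>du v z\<bar> powr p) \<partial>P) \<le> ennreal B"
  proof (rule nn_integral_Fatou_le[where F = "\<lambda>n z. ennreal (k z * \<bar>du (w n) z\<bar> powr p)"])
    show "AE z in P. ennreal (k z * \<bar>du v z\<bar> powr p) \<le> liminf (\<lambda>n. ennreal (k z * \<bar>du (w n) z\<bar> powr p))"
      using AE_fst_snd[OF lim]
    proof eventually_elim
      case (elim z)
      then have lim: "(\<lambda>n. ennreal (k z * \<bar>du (w n) z\<bar> powr p)) \<longlonglongrightarrow> ennreal (k z * \<bar>du v z\<bar> powr p)"
        unfolding du_def using p by (intro tendsto_ennrealI tendsto_mult_left tendsto_powr2 tendsto_intros) auto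
      show ?case by (simp only: liminf_eq_of_tendsto[OF lim] order_refl)
    qed
    show "\<forall>\<^sub>F n in sequentially. (\<integral>\<^sup>+ z. ennreal (k z * \<bar>du (w n) z\<bar> powr p) \<partial>P) \<le> ennreal B"
      using Q by (simp add: nn_integral_Q[OF w] ennreal_leI)
  qed measurable
  then have 3: "integrable P (\<lambda>z. k z * \<bar>du v z\<bar> powr p)"
    by (intro integrableI_bounded) (auto intro: le_less_trans)
  show ?thesis using 1 2 3 by (simp add: X_def)
qed

text \<open>The bound on \<open>|u|^p ln|u|\<close> gives uniform integrability of \<open>|u|^p\<close>, so no mass is lost in the limit.\<close>

lemma limit_nontrivial:
  assumes w: "\<And>n. w n \<in> X" and v: "v \<in> X"
    and lim: "AE x in lebesgue. (\<lambda>n. w n x) \<longlonglongrightarrow> v x"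
    and L: "\<And>n. Lp (w n) = 1" and Q: "\<And>n. Q (w n) \<le> B"
  shows "\<not> (AE x in lebesgue. v x = 0)"
proof
  assume v0: "AE x in lebesgue. v x = 0"
  note [measurable] = X_meas[OF w] X_meas_M[OF w] X_meas_M[OF v]
  obtain D where D: "0 \<le> D" "\<And>u. u \<in> X \<Longrightarrow> Lp u \<le> 1 \<Longrightarrow> (\<integral>\<^sup>+ x. ennreal (llog p (u x)) \<partial>M) \<le> ennreal (D * (Q u + 1))"
    using integral_llog_bound[of 1] by auto
  \<comment> \<open>With this \<open>l\<close> the integral of \<open>llog p (w n x) / l\<close> is
    at most one half, so at least half of the unit mass remains in the part truncated at the fixed
    level \<open>K = exp l\<close>.\<close>
  define l where "l = 2 * (D * (B + 1)) + 1"
  have B: "0 \<le> B" using order_trans[OF Q_nonneg Q] .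
  have l: "0 < l" using D(1) B by (simp add: l_def add_nonneg_pos)
  define K where "K = exp l"
  have K: "1 < K" "ln K = l" using l by (auto simp: K_def)
  have llog_le: "(\<integral>x. llog p (w n x) \<partial>M) \<le> D * (B + 1)" for n
  proof -
    have "ennreal (\<integral>x. llog p (w n x) \<partial>M) = (\<integral>\<^sup>+ x. ennreal (llog p (w n x)) \<partial>M)"
      by (rule nn_integral_eq_integral [symmetric, OF X_llog[OF w]]) simp
    also have "\<dots> \<le> ennreal (D * (Q (w n) + 1))" by (rule D(2)[OF w]) (simp add: L)
    also have "\<dots> \<le> ennreal (D * (B + 1))" using Q[of n] D(1) by (intro ennreal_leI mult_left_mono) auto
    finally show ?thesis using D(1) B by (subst (asm) ennreal_le_iff) auto
  qed
  define \<psi> where "\<psi> t = min (\<bar>t\<bar> powr p) (K powr p)" for t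
  have \<psi>_meas [measurable]: "\<psi> \<in> borel_measurable borel" unfolding \<psi>_def by measurable
  have \<psi>_bd: "\<bar>\<psi> t\<bar> \<le> K powr p" for t by (simp add: \<psi>_def)
  have \<psi>_int: "integrable M (\<lambda>x. \<psi> (w n x))" for n
    by (rule M.integrable_const_bound[of _ "K powr p"]) (use \<psi>_bd in auto)
  \<comment> \<open>Up to \<open>K\<close> the truncation \<open>\<psi>\<close> is inactive; above
    \<open>K\<close> the logarithm is at least \<open>l\<close>, so \<open>llog p t / l\<close>
    alone is large enough.\<close>
  have pt: "\<bar>t\<bar> powr p \<le> \<psi> t + llog p t / l" for t
  proof (cases "\<bar>t\<bar> \<le> K")
    case True
    then have "\<psi> t = \<bar>t\<bar> powr p" using p K(1) unfolding \<psi>_def by (intro min_absorb1 powr_mono2) auto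
    then show ?thesis using l by simp
  next
    case False
    then have "l \<le> ln \<bar>t\<bar>" using K by (subst K(2) [symmetric]) (intro ln_mono, auto)
    then have "\<bar>t\<bar> powr p * l \<le> llog p t"
      using False K(1) by (auto simp: llog_def lnp_eq intro!: mult_left_mono)
    then have "\<bar>t\<bar> powr p \<le> llog p t / l" using l by (simp add: pos_le_divide_eq)
    moreover have "0 \<le> \<psi> t" by (simp add: \<psi>_def)
    ultimately show ?thesis by simp
  qed
  have half: "1 / 2 \<le> (\<integral>x. \<psi> (w n x) \<partial>M)" for n
  proof -
    have "1 = (\<integral>x. \<bar>w n x\<bar> powr p \<partial>M)" using L[of n] by (simp add: Lp_def)
    also have "\<dots> \<le> (\<integral>x. \<psi> (w n x) + llog p (w n x) / l \<partial>M)"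
      by (intro integral_mono X_Lp[OF w] Bochner_Integration.integrable_add \<psi>_int integrable_divide X_llog[OF w] pt)
    also have "\<dots> = (\<integral>x. \<psi> (w n x) \<partial>M) + (\<integral>x. llog p (w n x) / l \<partial>M)"
      by (intro Bochner_Integration.integral_add \<psi>_int integrable_divide X_llog[OF w])
    also have "(\<integral>x. llog p (w n x) / l \<partial>M) = (\<integral>x. llog p (w n x) \<partial>M) / l" by simp
    also have "\<dots> \<le> D * (B + 1) / l" using llog_le[of n] l by (intro divide_right_mono) auto
    also have "\<dots> \<le> 1 / 2" using l by (simp add: l_def field_simps)
    finally show ?thesis by simp
  qed
  have "(\<lambda>n. \<integral>x. \<psi> (w n x) \<partial>M) \<longlonglongrightarrow> (\<integral>x. 0 \<partial>M)"
  proof (rule integral_dominated_convergence[where w = "\<lambda>x. K powr p"])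
    show "AE x in M. (\<lambda>n. \<psi> (w n x)) \<longlonglongrightarrow> 0"
      using AE_M[OF lim] AE_M[OF v0]
    proof eventually_elim
      case (elim x)
      have "(\<lambda>n. \<psi> (w n x)) \<longlonglongrightarrow> min (\<bar>v x\<bar> powr p) (K powr p)"
        unfolding \<psi>_def using p elim(1) by (intro tendsto_min tendsto_powr2 tendsto_intros) auto
      then show ?case using elim(2) by simp
    qed
  qed (use \<psi>_bd in auto)
  then have "(\<lambda>n. \<integral>x. \<psi> (w n x) \<partial>M) \<longlonglongrightarrow> 0" by simp
  then have "1 / 2 \<le> (0::real)" by (rule LIMSEQ_le_const) (use half in blast)
  then show False by simp
qed

text \<open>Fatou's lemma handles \<open>Q\<close>, but the nonlinear term enters with the wrong
  sign. For each \<open>n\<close> the energy on the tail region pays for \<open>H\<close> above the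
  level \<open>K\<close>, and both are discarded together. There remain a kernel form, to which
  Fatou's lemma applies, and an integral of \<open>H\<close> against a cutoff, which converges. The
  level tends to infinity only after \<open>n\<close>.\<close>

lemma J_lower_semicontinuous:
  assumes w: "\<And>n. w n \<in> X" and v: "v \<in> X"
    and lim: "AE x in lebesgue. (\<lambda>n. w n x) \<longlonglongrightarrow> v x"
    and L: "\<And>n. Lp (w n) \<le> R" and R: "0 < R"
    and J: "\<And>n. J (w n) \<le> b"
  shows "J v \<le> b"
proof -
  note [measurable] = X_meas[OF w] X_meas_M[OF w] X_meas_M[OF v] X_meas[OF v]
  obtain m M1 where m: "0 < m" "1 \<le> M1" "m < p\<^sup>2 / DIM('a)"
     "\<And>x t. x \<in> \<Omega> \<Longrightarrow> M1 \<le> \<bar>t\<bar> \<Longrightarrow> 0 \<le> H x t \<and> H x t \<le> m / p * (\<bar>t\<bar> powr p * ln \<bar>t\<bar>)"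
    using H_growth by blast
  obtain M0 where M0: "1 \<le> M0" "\<And>K u. M0 \<le> K \<Longrightarrow> u \<in> X \<Longrightarrow> Lp u \<le> R \<Longrightarrow>
     (\<integral>\<^sup>+ x. ennreal (m * (\<bar>u x\<bar> powr p * ln \<bar>u x\<bar>)) * indicator {x. K < \<bar>u x\<bar>} x \<partial>M)
      \<le> (\<integral>\<^sup>+ z. ennreal (k z * \<bar>du u z\<bar> powr p) * indicator (tail_region K u) z \<partial>P)"
    using tail_bound[OF R m(3,1)] by blast
  obtain C where C: "0 \<le> C" "\<And>x s K. x \<in> \<Omega> \<Longrightarrow> \<bar>s\<bar> \<le> K \<Longrightarrow> \<bar>H x s\<bar> \<le> 2 * C * gdom p K"
    using H_le_gdom by blast
  define q where "q u z = k z * \<bar>du u z\<bar> powr p" for u z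
  \<comment> \<open>The inequalities for \<open>v\<close> are strict, so for almost every near pair
    in \<open>S K\<close> both values of \<open>w n\<close> are eventually below \<open>K\<close>,
    and the pair is eventually outside the tail region of \<open>w n\<close>.\<close>
  define S where "S K = {z. z \<notin> near_region \<or> (\<bar>v (fst z)\<bar> < K \<and> \<bar>v (snd z)\<bar> < K)}" for K
  have S_sets [measurable]: "S K \<in> sets P" for K
  proof -
    have "{z \<in> space P. z \<notin> near_region \<or> (\<bar>v (fst z)\<bar> < K \<and> \<bar>v (snd z)\<bar> < K)} \<in> sets P" by measurable
    then show ?thesis by (simp add: S_def space_pair_measure)
  qed
  have q0: "0 \<le> q u z" for u z by (simp add: q_def)
  have q_int: "integrable P (q u)" if "u \<in> X" for u using X_Q[OF that] by (simp add: q_def[abs_def])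
  have [measurable]: "q (w n) \<in> borel_measurable P" "q v \<in> borel_measurable P" for n
    by (simp_all add: q_def[abs_def])
  have step: "(\<integral>z. q v z * indicator (S K) z \<partial>P) \<le> p * (b + (\<integral>x. H x (v x) * cutoff K (v x) \<partial>M))"
    if K: "M0 \<le> K" "M1 \<le> K" for K
  proof -
    have K1: "1 \<le> K" using K(1) M0(1) by simp
    have Hc_bd: "\<bar>H x s * cutoff K s\<bar> \<le> 2 * C * gdom p (2 * K)" if "x \<in> \<Omega>" for x s
    proof (cases "\<bar>s\<bar> \<le> 2 * K")
      case True
      have "\<bar>H x s * cutoff K s\<bar> \<le> \<bar>H x s\<bar>" by (simp add: abs_mult mult_left_le)
      then show ?thesis using C(2)[OF that True] by simp
    next
      case False
      then show ?thesis using K1 C(1) by (simp add: cutoff_eq_0)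
    qed
    have Hc_meas: "(\<lambda>x. H x (u x) * cutoff K (u x)) \<in> borel_measurable M" if "u \<in> X" for u
    proof (rule borel_measurable_times)
      show "(\<lambda>x. cutoff K (u x)) \<in> borel_measurable M"
        by (rule measurable_compose[OF X_meas_M[OF that] borel_measurable_cutoff])
    qed (rule borel_measurable_integrable[OF integrable_H[OF that]])
    have Hc_int: "integrable M (\<lambda>x. H x (u x) * cutoff K (u x))" if "u \<in> X" for u
      using Hc_bd by (intro M.integrable_const_bound[of _ "2 * C * gdom p (2 * K)"] AE_I2 Hc_meas that) auto
    define al where "al n = (\<integral>x. H x (w n x) * cutoff K (w n x) \<partial>M)" for n
    define al0 where "al0 = (\<integral>x. H x (v x) * cutoff K (v x) \<partial>M)"
    have al_lim: "al \<longlonglongrightarrow> al0"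
      unfolding al_def al0_def
    proof (rule integral_dominated_convergence[where w = "\<lambda>x. 2 * C * gdom p (2 * K)"])
      show "AE x in M. (\<lambda>n. H x (w n x) * cutoff K (w n x)) \<longlonglongrightarrow> H x (v x) * cutoff K (v x)"
        using AE_M[OF lim] AE_space
      proof eventually_elim
        case (elim x)
        then have x: "x \<in> \<Omega>" by simp
        show ?case
          by (intro tendsto_mult isCont_tendsto_compose[OF isCont_cutoff] isCont_tendsto_compose[OF DERIV_isCont[OF H_deriv[OF x]]] elim(1))
      qed
      show "AE x in M. norm (H x (w n x) * cutoff K (w n x)) \<le> 2 * C * gdom p (2 * K)" for n
        using Hc_bd by (intro AE_I2) simp
    qed (use Hc_meas w v in auto)
    \<comment> \<open>This is \<open>J (w n) \<le> b\<close> after cancelling the tail energy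
      against the tail of \<open>H\<close>. Nonnegativity of the right-hand side is recorded as
      well, because \<open>ennreal\<close> sends negative numbers to 0.\<close>
    have split': "(\<integral>\<^sup>+ z. ennreal (q (w n) z) * indicator (- tail_region K (w n)) z \<partial>P) \<le> ennreal (p * (b + al n))
       \<and> 0 \<le> p * (b + al n)" for n
    proof -
      define T where "T x = \<bar>w n x\<bar> powr p * ln \<bar>w n x\<bar> * (if K < \<bar>w n x\<bar> then 1 else 0)" for x
      have T0: "0 \<le> T x" for x using K1 by (auto simp: T_def)
      have T_meas [measurable]: "T \<in> borel_measurable M" unfolding T_def[abs_def] by measurable
      have tail_int: "integrable P (\<lambda>z. q (w n) z * indicator (tail_region K (w n)) z)"
        by (intro integrable_real_mult_indicator q_int w) measurable
      have ntail_int: "integrable P (\<lambda>z. q (w n) z * indicator (- tail_region K (w n)) z)"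
        by (intro integrable_real_mult_indicator q_int w) (simp add: Compl_eq_Diff_UNIV space_pair_measure sets.compl_sets[of "tail_region K (w n)" P, simplified space_pair_measure, simplified])
      have T_nn: "(\<integral>\<^sup>+ x. ennreal (m * T x) \<partial>M) \<le> ennreal (\<integral>z. q (w n) z * indicator (tail_region K (w n)) z \<partial>P)"
      proof -
        have "(\<integral>\<^sup>+ x. ennreal (m * T x) \<partial>M) = (\<integral>\<^sup>+ x. ennreal (m * (\<bar>w n x\<bar> powr p * ln \<bar>w n x\<bar>)) * indicator {x. K < \<bar>w n x\<bar>} x \<partial>M)"
          by (intro nn_integral_cong) (simp add: T_def indicator_def)
        also have "\<dots> \<le> (\<integral>\<^sup>+ z. ennreal (k z * \<bar>du (w n) z\<bar> powr p) * indicator (tail_region K (w n)) z \<partial>P)"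
          by (rule M0(2)[OF K(1) w L])
        also have "\<dots> = (\<integral>\<^sup>+ z. ennreal (q (w n) z * indicator (tail_region K (w n)) z) \<partial>P)"
          by (intro nn_integral_cong) (simp add: q_def indicator_def)
        also have "\<dots> = ennreal (\<integral>z. q (w n) z * indicator (tail_region K (w n)) z \<partial>P)"
          by (rule nn_integral_eq_integral[OF tail_int]) (simp add: q0)
        finally show ?thesis .
      qed
      have T_int: "integrable M (\<lambda>x. m * T x)"
        using le_less_trans[OF T_nn ennreal_less_top] m(1) T0 by (intro integrableI_bounded) (auto simp: abs_mult)
      have "ennreal (\<integral>x. m * T x \<partial>M) = (\<integral>\<^sup>+ x. ennreal (m * T x) \<partial>M)"
        using T0 m(1) by (intro nn_integral_eq_integral [symmetric] T_int) auto
      then have "ennreal (\<integral>x. m * T x \<partial>M) \<le> ennreal (\<integral>z. q (w n) z * indicator (tail_region K (w n)) z \<partial>P)" using T_nn by simp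
      then have Tle: "(\<integral>x. m * T x \<partial>M) \<le> (\<integral>z. q (w n) z * indicator (tail_region K (w n)) z \<partial>P)"
      proof (subst (asm) ennreal_le_iff)
        show "0 \<le> (\<integral>z. q (w n) z * indicator (tail_region K (w n)) z \<partial>P)"
          by (intro Bochner_Integration.integral_nonneg mult_nonneg_nonneg q0) simp
      qed
      have "(\<integral>x. H x (w n x) \<partial>M) \<le> (\<integral>x. (m * T x) / p + H x (w n x) * cutoff K (w n x) \<partial>M)"
      proof (rule integral_mono[OF integrable_H[OF w]])
        show "integrable M (\<lambda>x. (m * T x) / p + H x (w n x) * cutoff K (w n x))"
          by (intro Bochner_Integration.integrable_add integrable_divide T_int Hc_int w)
        fix x assume "x \<in> space M"
        then have x: "x \<in> \<Omega>" by simp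
        show "H x (w n x) \<le> (m * T x) / p + H x (w n x) * cutoff K (w n x)"
        proof (cases "K < \<bar>w n x\<bar>")
          case True
          then have H: "0 \<le> H x (w n x)" "H x (w n x) \<le> m / p * (\<bar>w n x\<bar> powr p * ln \<bar>w n x\<bar>)"
            using m(4)[OF x, of "w n x"] K(2) by auto
          have "H x (w n x) \<le> (m * T x) / p" using H(2) True by (simp add: T_def)
          \<comment> \<open>Between \<open>K\<close> and \<open>2 * K\<close> the value of
            \<open>H\<close> is counted in both summands; the surplus is harmless because
            \<open>H\<close> is nonnegative beyond \<open>M1\<close>.\<close>
          moreover have "0 \<le> H x (w n x) * cutoff K (w n x)" using H(1) by simp
          ultimately show ?thesis by simp
        next
          case False
          then show ?thesis using K1 by (simp add: T_def cutoff_eq_1)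
        qed
      qed
      also have "\<dots> = (\<integral>x. m * T x \<partial>M) / p + al n"
        unfolding al_def using T_int Hc_int[OF w] by (subst Bochner_Integration.integral_add) auto
      finally have H_le: "(\<integral>x. H x (w n x) \<partial>M) \<le> (\<integral>z. q (w n) z * indicator (tail_region K (w n)) z \<partial>P) / p + al n"
        using Tle p by (smt (verit) divide_right_mono)
      have "Q (w n) = (\<integral>z. q (w n) z * indicator (tail_region K (w n)) z + q (w n) z * indicator (- tail_region K (w n)) z \<partial>P)"
        unfolding Q_def by (intro Bochner_Integration.integral_cong) (auto simp: q_def indicator_def)
      also have "\<dots> = (\<integral>z. q (w n) z * indicator (tail_region K (w n)) z \<partial>P) + (\<integral>z. q (w n) z * indicator (- tail_region K (w n)) z \<partial>P)"
        by (rule Bochner_Integration.integral_add[OF tail_int ntail_int])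
      finally have Q_eq: "Q (w n) = \<dots>" .
      have "Q (w n) / p \<le> b + (\<integral>x. H x (w n x) \<partial>M)" using J[of n] by (simp add: J_def)
      then have "(\<integral>z. q (w n) z * indicator (- tail_region K (w n)) z \<partial>P) / p \<le> b + al n"
        using H_le by (simp add: Q_eq add_divide_distrib)
      then have "(\<integral>z. q (w n) z * indicator (- tail_region K (w n)) z \<partial>P) \<le> p * (b + al n)"
        using p by (simp add: divide_le_eq mult.commute)
      moreover have "0 \<le> (\<integral>z. q (w n) z * indicator (- tail_region K (w n)) z \<partial>P)"
        by (intro Bochner_Integration.integral_nonneg) (simp add: q0)
      ultimately have "ennreal (\<integral>z. q (w n) z * indicator (- tail_region K (w n)) z \<partial>P) \<le> ennreal (p * (b + al n))"
        and "0 \<le> p * (b + al n)"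
        by (auto intro: ennreal_leI)
      moreover have "(\<integral>\<^sup>+ z. ennreal (q (w n) z) * indicator (- tail_region K (w n)) z \<partial>P)
        = (\<integral>\<^sup>+ z. ennreal (q (w n) z * indicator (- tail_region K (w n)) z) \<partial>P)"
        by (intro nn_integral_cong) (simp add: indicator_def)
      moreover have "\<dots> = ennreal (\<integral>z. q (w n) z * indicator (- tail_region K (w n)) z \<partial>P)"
        by (rule nn_integral_eq_integral[OF ntail_int]) (simp add: q0)
      ultimately show ?thesis by simp
    qed
    then have split: "(\<integral>\<^sup>+ z. ennreal (q (w n) z) * indicator (- tail_region K (w n)) z \<partial>P) \<le> ennreal (p * (b + al n))"
      and al_pos: "0 \<le> p * (b + al n)" for n by blast+
    have S_int: "integrable P (\<lambda>z. q v z * indicator (S K) z)"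
      by (intro integrable_real_mult_indicator q_int v S_sets)
    have main: "(\<integral>z. q v z * indicator (S K) z \<partial>P) \<le> p * (b + al0) + e" if e: "0 < e" for e
    proof -
      have al_ev: "\<forall>\<^sub>F n in sequentially. p * (b + al n) < p * (b + al0) + e"
        using e by (intro order_tendstoD(2)[of _ "p * (b + al0)"] tendsto_intros al_lim) auto
      have "(\<integral>\<^sup>+ z. ennreal (q v z * indicator (S K) z) \<partial>P) \<le> ennreal (p * (b + al0) + e)"
      proof (rule nn_integral_Fatou_le[where F = "\<lambda>n z. ennreal (q (w n) z) * indicator (- tail_region K (w n)) z"])
        show "(\<lambda>z. ennreal (q (w n) z) * indicator (- tail_region K (w n)) z) \<in> borel_measurable P" for n
        proof -
          have "(\<lambda>z. ennreal (q (w n) z) * (1 - indicator (tail_region K (w n)) z)) \<in> borel_measurable P" by measurable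
          moreover have "(\<lambda>z. ennreal (q (w n) z) * (1 - indicator (tail_region K (w n)) z)) = (\<lambda>z. ennreal (q (w n) z) * indicator (- tail_region K (w n)) z)"
            by (auto simp: indicator_def)
          ultimately show ?thesis by simp
        qed
        show "AE z in P. ennreal (q v z * indicator (S K) z) \<le> liminf (\<lambda>n. ennreal (q (w n) z) * indicator (- tail_region K (w n)) z)"
          using AE_fst_snd[OF lim]
        proof eventually_elim
          case (elim z)
          show ?case
          proof (cases "z \<in> S K")
            case True
            have l1: "(\<lambda>n. w n (fst z)) \<longlonglongrightarrow> v (fst z)" and l2: "(\<lambda>n. w n (snd z)) \<longlonglongrightarrow> v (snd z)" using elim by auto
            have "\<forall>\<^sub>F n in sequentially. z \<notin> tail_region K (w n)"
            proof (cases "z \<in> near_region")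
              case near: True
              then have "\<bar>v (fst z)\<bar> < K" "\<bar>v (snd z)\<bar> < K" using True by (auto simp: S_def)
              then have "\<forall>\<^sub>F n in sequentially. \<bar>w n (fst z)\<bar> < K" "\<forall>\<^sub>F n in sequentially. \<bar>w n (snd z)\<bar> < K"
                using order_tendstoD(2)[OF tendsto_rabs[OF l1]] order_tendstoD(2)[OF tendsto_rabs[OF l2]] by auto
              then show ?thesis by eventually_elim (auto simp: tail_region_def)
            next
              case False
              then show ?thesis by (simp add: tail_region_def near_region_def)
            qed
            then have "\<forall>\<^sub>F n in sequentially. ennreal (q (w n) z) * indicator (- tail_region K (w n)) z = ennreal (q (w n) z)"
              by eventually_elim simp
            moreover have "(\<lambda>n. ennreal (q (w n) z)) \<longlonglongrightarrow> ennreal (q v z)"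
              unfolding q_def du_def using p by (intro tendsto_ennrealI tendsto_mult_left tendsto_powr2 tendsto_intros l1 l2) auto
            ultimately have "(\<lambda>n. ennreal (q (w n) z) * indicator (- tail_region K (w n)) z) \<longlonglongrightarrow> ennreal (q v z)"
              by (simp add: tendsto_cong)
            then show ?thesis using True by (simp add: liminf_eq_of_tendsto)
          qed simp
        qed
        show "\<forall>\<^sub>F n in sequentially. (\<integral>\<^sup>+ z. ennreal (q (w n) z) * indicator (- tail_region K (w n)) z \<partial>P) \<le> ennreal (p * (b + al0) + e)"
          using al_ev
        proof eventually_elim
          case (elim n)
          show ?case by (rule order_trans[OF split ennreal_leI]) (use elim in simp)
        qed
      qed
      moreover have "(\<integral>\<^sup>+ z. ennreal (q v z * indicator (S K) z) \<partial>P) = ennreal (\<integral>z. q v z * indicator (S K) z \<partial>P)"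
        by (rule nn_integral_eq_integral[OF S_int]) (simp add: q0)
      ultimately have le: "ennreal (\<integral>z. q v z * indicator (S K) z \<partial>P) \<le> ennreal (p * (b + al0) + e)" by simp
      \<comment> \<open>An inequality in \<open>ennreal\<close> can be read back in the reals only
        if the right-hand side is nonnegative; here it is a limit of nonnegative numbers.\<close>
      have pos: "0 \<le> p * (b + al0) + e"
      proof (rule LIMSEQ_le_const)
        show "(\<lambda>n. p * (b + al n) + e) \<longlonglongrightarrow> p * (b + al0) + e" by (intro tendsto_intros al_lim)
        show "\<exists>N. \<forall>n\<ge>N. 0 \<le> p * (b + al n) + e" using e al_pos by (intro exI allI impI add_nonneg_nonneg) auto
      qed
      show ?thesis using le pos by (subst (asm) ennreal_le_iff) auto
    qed
    show ?thesis unfolding al0_def[symmetric] by (rule field_le_epsilon) (rule main)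
  qed
  define K where "K n = real n + max M0 M1" for n
  have Kinf: "\<forall>\<^sub>F n in sequentially. c < K n" for c
  proof -
    obtain n0 where "c < real n0" using reals_Archimedean2 by blast
    then have "c < K n" if "n0 \<le> n" for n
      using that M0(1) unfolding K_def by (smt (verit) of_nat_le_iff max.cobounded1)
    then show ?thesis by (auto simp: eventually_sequentially)
  qed
  have "(\<lambda>n. \<integral>z. q v z * indicator (S (K n)) z \<partial>P) \<longlonglongrightarrow> (\<integral>z. q v z \<partial>P)"
  proof (rule integral_dominated_convergence[where w = "q v"])
    show "AE z in P. (\<lambda>n. q v z * indicator (S (K n)) z) \<longlonglongrightarrow> q v z"
    proof (rule AE_I2)
      fix z
      have "\<forall>\<^sub>F n in sequentially. q v z * indicator (S (K n)) z = q v z"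
        using Kinf[of "\<bar>v (fst z)\<bar>"] Kinf[of "\<bar>v (snd z)\<bar>"] by eventually_elim (simp add: S_def)
      then show "(\<lambda>n. q v z * indicator (S (K n)) z) \<longlonglongrightarrow> q v z" by (rule tendsto_eventually)
    qed
    show "AE z in P. norm (q v z * indicator (S (K n)) z) \<le> q v z" for n
      using q0 by (intro AE_I2) (simp add: indicator_def)
  qed (use q_int[OF v] in auto)
  moreover have "(\<lambda>n. p * (b + (\<integral>x. H x (v x) * cutoff (K n) (v x) \<partial>M))) \<longlonglongrightarrow> p * (b + (\<integral>x. H x (v x) \<partial>M))"
  proof (intro tendsto_intros integral_dominated_convergence[where w = "\<lambda>x. \<bar>H x (v x)\<bar>"])
    show "AE x in M. (\<lambda>n. H x (v x) * cutoff (K n) (v x)) \<longlonglongrightarrow> H x (v x)"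
    proof (rule AE_I2)
      fix x
      have "\<forall>\<^sub>F n in sequentially. H x (v x) * cutoff (K n) (v x) = H x (v x)"
        using Kinf[of "\<bar>v x\<bar>"] by eventually_elim (simp add: cutoff_eq_1)
      then show "(\<lambda>n. H x (v x) * cutoff (K n) (v x)) \<longlonglongrightarrow> H x (v x)" by (rule tendsto_eventually)
    qed
    show "AE x in M. norm (H x (v x) * cutoff (K n) (v x)) \<le> \<bar>H x (v x)\<bar>" for n
      by (intro AE_I2) (simp add: abs_mult mult_left_le)
    show "(\<lambda>x. H x (v x) * cutoff (K n) (v x)) \<in> borel_measurable M" for n
      by (intro borel_measurable_times borel_measurable_integrable[OF integrable_H[OF v]]
          measurable_compose[OF X_meas_M[OF v] borel_measurable_cutoff])
  qed (use integrable_H[OF v] in auto)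
  ultimately have "(\<integral>z. q v z \<partial>P) \<le> p * (b + (\<integral>x. H x (v x) \<partial>M))"
  proof (rule LIMSEQ_le, intro exI allI impI)
    fix n
    show "(\<integral>z. q v z * indicator (S (K n)) z \<partial>P) \<le> p * (b + (\<integral>x. H x (v x) * cutoff (K n) (v x) \<partial>M))"
      by (rule step) (auto simp: K_def)
  qed
  then have "Q v / p \<le> b + (\<integral>x. H x (v x) \<partial>M)"
    using p by (simp add: Q_def q_def divide_le_eq mult.commute)
  then show ?thesis by (simp add: J_def)
qed

text \<open>No lower bound of \<open>J\<close> on the Nehari set is presupposed: the infimum
  \<open>c\<close> is an extended real, and every estimate has the form \<open>J \<le> b\<close> for
  a real \<open>b\<close> above \<open>c\<close>. That the infimum is finite comes out together with
  the minimizer.\<close>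

theorem minimizer_exists:
  assumes ne: "\<exists>u\<in>X. \<not> (AE x in lebesgue. u x = 0)"
  obtains u where "u \<in> Neh" "\<And>w. w \<in> Neh \<Longrightarrow> J u \<le> J w"
proof -
  have Neh_ne: "Neh \<noteq> {}" using ne Neh_ray_exists by blast
  define S where "S = (\<lambda>u. ereal (J u)) ` Neh"
  have "S \<noteq> {}" using Neh_ne by (simp add: S_def)
  from Inf_as_limit[OF this] obtain e where e: "\<And>n. e n \<in> S" "e \<longlonglongrightarrow> Inf S" by (elim exE conjE) blast
  define c where "c = Inf S"
  have "\<forall>n. \<exists>u. u \<in> Neh \<and> e n = ereal (J u)" using e(1) unfolding S_def by blast
  then obtain u where u: "\<And>n. u n \<in> Neh" "\<And>n. e n = ereal (J (u n))" by metis
  have "e = (\<lambda>n. ereal (J (u n)))" by (rule ext) (rule u(2))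
  then have lim_c: "(\<lambda>n. ereal (J (u n))) \<longlonglongrightarrow> c" using e(2) by (simp only: c_def)
  have c_less: "c < \<infinity>"
  proof -
    have "c \<le> ereal (J (u 0))" unfolding c_def S_def by (intro Inf_lower imageI u(1))
    then show ?thesis by (rule le_less_trans) simp
  qed
  then obtain b0 where b0: "c < ereal b0" using ereal_dense2 by blast
  have "\<forall>\<^sub>F n in sequentially. ereal (J (u n)) < ereal b0" by (rule order_tendstoD(2)[OF lim_c b0])
  then obtain n0 where n0: "\<And>n. n0 \<le> n \<Longrightarrow> J (u n) < b0" by (auto simp: eventually_sequentially)
  \<comment> \<open>The coercivity estimate depends on a bound for the \<open>p\<close>-norm, and
    none is at hand for the Nehari points. Each is replaced by the point of unit norm on its ray;
    this does not raise \<open>J\<close>, so coercivity bounds \<open>Q\<close>.\<close>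
  define r where "r n = Lp (u (n + n0)) powr (- 1 / p)" for n
  define v where "v n x = r n * u (n + n0) x" for n x
  have uX: "u n \<in> X" and unz: "\<not> (AE x in lebesgue. u n x = 0)" for n using u(1)[of n] by (auto simp: Neh_def)
  have Lpos: "0 < Lp (u n)" for n by (rule Lp_pos[OF uX unz])
  have r: "0 < r n" for n using Lpos[of "n + n0"] by (simp add: r_def)
  have vX: "v n \<in> X" for n unfolding v_def[abs_def] by (rule X_scale[OF uX])
  have Lv: "Lp (v n) = 1" for n
  proof -
    have "Lp (v n) = r n powr p * Lp (u (n + n0))" unfolding v_def[abs_def] by (rule Lp_scale[OF r])
    also have "r n powr p = Lp (u (n + n0)) powr (- 1)" using p by (simp add: r_def powr_powr)
    also have "\<dots> * Lp (u (n + n0)) = 1" using Lpos[of "n + n0"] by (simp add: powr_minus_divide)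
    finally show ?thesis .
  qed
  have Jv: "J (\<lambda>x. t * v n x) \<le> J (u (n + n0))" if "0 < t" for t n
  proof -
    have "(\<lambda>x. t * v n x) = (\<lambda>x. (t * r n) * u (n + n0) x)" by (simp add: v_def mult.assoc)
    then show ?thesis using J_fibre_le[OF u(1), of "t * r n" "n + n0"] that r[of n] by simp
  qed
  obtain a D where aD: "0 < a" "\<And>u. u \<in> X \<Longrightarrow> Lp u \<le> 1 \<Longrightarrow> a * Q u - D \<le> J u"
    using coercive[of 1] by auto
  define B where "B = max 1 ((b0 + D) / a)"
  have QB: "Q (v n) \<le> B" for n
  proof -
    have "a * Q (v n) - D \<le> J (v n)" by (rule aD(2)[OF vX]) (simp add: Lv)
    also have "\<dots> \<le> b0" using Jv[of 1 n] n0[of "n + n0"] by simp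
    finally have "Q (v n) \<le> (b0 + D) / a" using aD(1) by (simp add: pos_le_divide_eq mult.commute)
    then show ?thesis by (simp add: B_def)
  qed
  have B1: "1 \<le> B" by (simp add: B_def)
  obtain s w where s: "strict_mono (s :: nat \<Rightarrow> nat)" and w: "w \<in> borel_measurable lebesgue"
    and lim: "AE x in lebesgue. (\<lambda>n. v (s n) x) \<longlonglongrightarrow> w x"
  proof (rule AE_convergent_subsequence[where u = v and R = B, OF p \<Omega>_sets \<Omega>_fin])
    show "v n \<in> borel_measurable lebesgue" for n by (rule X_meas[OF vX])
    show "AE x in lebesgue. x \<notin> \<Omega> \<longrightarrow> v n x = 0" for n by (rule X_zero[OF vX])
    show "(\<integral>\<^sup>+ x. ennreal (\<bar>v n x\<bar> powr p) \<partial>lebesgue) \<le> ennreal B" for n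
      unfolding nn_integral_Lp[OF vX] Lv using B1 by (intro ennreal_leI)
    show "near_energy p (v n) \<le> ennreal B" for n
      by (rule order_trans[OF near_le_Q[OF vX] ennreal_leI[OF QB]])
    show "0 < B" using B1 by simp
  qed blast
  have wX: "w \<in> X" by (rule X_limit[OF vX w lim _ QB, of 1]) (simp add: Lv)
  have wnz: "\<not> (AE x in lebesgue. w x = 0)" by (rule limit_nontrivial[OF vX wX lim Lv QB])
  \<comment> \<open>The factor is taken from the limit and used for the entire sequence: for any
    \<open>t > 0\<close> the energy at \<open>t * v n\<close> is at most that of the Nehari point on
    the same ray.\<close>
  obtain t where t: "0 < t" "(\<lambda>x. t * w x) \<in> Neh" using Neh_ray_exists[OF wX wnz] by blast
  have Jw: "J (\<lambda>x. t * w x) \<le> b" if b: "c < ereal b" for b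
  proof -
    have "\<forall>\<^sub>F n in sequentially. ereal (J (u n)) < ereal b" by (rule order_tendstoD(2)[OF lim_c b])
    then obtain n1 where n1: "\<And>n. n1 \<le> n \<Longrightarrow> J (u n) < b" by (auto simp: eventually_sequentially)
    show ?thesis
    \<comment> \<open>The shift by \<open>n1\<close> makes the bound \<open>b\<close> valid for
      every member of the sequence.\<close>
    proof (rule J_lower_semicontinuous[of "\<lambda>n x. t * v (s (n + n1)) x" _ "t powr p"])
      show "(\<lambda>x. t * v (s (n + n1)) x) \<in> X" for n by (rule X_scale[OF vX])
      show "(\<lambda>x. t * w x) \<in> X" by (rule X_scale[OF wX])
      show "AE x in lebesgue. (\<lambda>n. t * v (s (n + n1)) x) \<longlonglongrightarrow> t * w x"
        using lim
      proof eventually_elim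
        case (elim x)
        from LIMSEQ_ignore_initial_segment[OF elim, of n1] show ?case by (rule tendsto_mult_left)
      qed
      show "Lp (\<lambda>x. t * v (s (n + n1)) x) \<le> t powr p" for n
        using Lp_scale[OF t(1), of "v (s (n + n1))"] by (simp add: Lv)
      show "0 < t powr p" using t(1) by simp
      show "J (\<lambda>x. t * v (s (n + n1)) x) \<le> b" for n
      proof -
        have "n1 \<le> s (n + n1) + n0" using strict_mono_imp_increasing[OF s, of "n + n1"] by simp
        then show ?thesis using Jv[OF t(1), of "s (n + n1)"] n1 by (meson less_imp_le order_trans)
      qed
    qed
  qed
  have "J (\<lambda>x. t * w x) \<le> J w'" if w': "w' \<in> Neh" for w'
  proof (rule dense_ge)
    fix b assume "J w' < b"
    have "c \<le> ereal (J w')" unfolding c_def S_def by (intro Inf_lower imageI w')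
    also have "\<dots> < ereal b" using \<open>J w' < b\<close> by simp
    finally show "J (\<lambda>x. t * w x) \<le> b" by (rule Jw)
  qed
  with t(2) show ?thesis by (rule that)
qed

end

subsection \<open>Growth of the nonlinearity\<close>

text \<open>Condition \<open>(g\<^sub>4)\<close> says that \<open>\<tau> \<mapsto> s \<gamma>(\<tau>s) \<tau>\<^bsup>1-p\<^esup> + \<delta>|s|\<^sup>p ln \<tau>\<close> is nondecreasing.\<close>

lemma ray_monotone:
  fixes \<gamma> :: "real \<Rightarrow> real"
  assumes \<gamma>: "\<And>t. (\<gamma> has_real_derivative \<gamma>' t) (at t)"
    and g4: "\<And>t. 0 \<le> t\<^sup>2 * \<gamma>' t + \<delta> * \<bar>t\<bar> powr p - (p - 1) * t * \<gamma> t" and \<tau>: "1 \<le> \<tau>"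
  shows "s * \<gamma> s \<le> s * \<gamma> (\<tau> * s) * \<tau> powr (1 - p) + \<delta> * \<bar>s\<bar> powr p * ln \<tau>"
proof -
  define q where "q \<sigma> = s * \<gamma> (\<sigma> * s) * \<sigma> powr (1 - p) + \<delta> * \<bar>s\<bar> powr p * ln \<sigma>" for \<sigma>
  define q' where "q' \<sigma> = s * (\<gamma>' (\<sigma> * s) * s) * \<sigma> powr (1 - p) + (1 - p) * \<sigma> powr (- p) * (s * \<gamma> (\<sigma> * s)) + \<delta> * \<bar>s\<bar> powr p * (1 / \<sigma>)" for \<sigma>
  have q: "(q has_real_derivative q' \<sigma>) (at \<sigma>)" if "0 < \<sigma>" for \<sigma>
  proof -
    have 1: "((\<lambda>\<sigma>. s * \<gamma> (\<sigma> * s)) has_real_derivative s * (\<gamma>' (\<sigma> * s) * s)) (at \<sigma>)"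
      by (rule DERIV_cmult, rule DERIV_chain2[OF \<gamma>]) (auto intro!: derivative_eq_intros)
    have 2: "((\<lambda>\<sigma>. \<sigma> powr (1 - p)) has_real_derivative (1 - p) * \<sigma> powr (- p)) (at \<sigma>)"
      using has_real_derivative_powr[OF that, of "1 - p"] by simp
    have 3: "((\<lambda>\<sigma>. \<delta> * \<bar>s\<bar> powr p * ln \<sigma>) has_real_derivative \<delta> * \<bar>s\<bar> powr p * (1 / \<sigma>)) (at \<sigma>)"
      by (rule DERIV_cmult, rule DERIV_ln_divide[OF that])
    show ?thesis unfolding q_def[abs_def] q'_def
      by (rule DERIV_add[OF DERIV_mult[OF 1 2] 3, THEN DERIV_cong]) (simp add: mult_ac)
  qed
  have q'0: "0 \<le> q' \<sigma>" if "1 \<le> \<sigma>" for \<sigma>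
  proof -
    have \<sigma>: "0 < \<sigma>" using that by simp
    \<comment> \<open>All powers are rewritten with the factor
      \<open>\<sigma> powr (- 1 - p)\<close>, so that \<open>q' \<sigma>\<close> becomes this
      positive factor times the expression of \<open>g4\<close> at
      \<open>\<sigma> * s\<close>.\<close>
    have e1: "\<sigma> powr (1 - p) = \<sigma> powr (- 1 - p) * \<sigma>\<^sup>2"
    proof -
      have "\<sigma> powr (- 1 - p) * \<sigma>\<^sup>2 = \<sigma> powr (- 1 - p) * \<sigma> powr 2" using \<sigma> by (simp add: powr_numeral)
      then show ?thesis by (simp only: powr_add [symmetric]) simp
    qed
    have e2: "\<sigma> powr (- p) = \<sigma> powr (- 1 - p) * \<sigma>"
    proof -
      have "\<sigma> powr (- 1 - p) * \<sigma> = \<sigma> powr (- 1 - p) * \<sigma> powr 1" using \<sigma> by simp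
      then show ?thesis by (simp only: powr_add [symmetric]) simp
    qed
    have e3: "1 / \<sigma> = \<sigma> powr (- 1 - p) * \<sigma> powr p"
    proof -
      have "\<sigma> powr (- 1 - p) * \<sigma> powr p = \<sigma> powr (- 1)" by (simp flip: powr_add)
      then show ?thesis using \<sigma> by (simp add: powr_minus_divide)
    qed
    have "q' \<sigma> = \<sigma> powr (- 1 - p) * ((\<sigma> * s)\<^sup>2 * \<gamma>' (\<sigma> * s) + \<delta> * \<bar>\<sigma> * s\<bar> powr p - (p - 1) * (\<sigma> * s) * \<gamma> (\<sigma> * s))"
      unfolding q'_def e1 e2 e3 using \<sigma> by (simp add: abs_mult powr_mult algebra_simps power2_eq_square)
    then show ?thesis using g4[of "\<sigma> * s"] by simp
  qed
  have "q 1 \<le> q \<tau>"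
  proof (rule DERIV_nonneg_imp_nondecreasing[OF \<tau>])
    fix \<sigma> :: real assume "1 \<le> \<sigma>"
    then show "\<exists>y. (q has_real_derivative y) (at \<sigma>) \<and> 0 \<le> y"
      by (intro exI[of _ "q' \<sigma>"] conjI q q'0) auto
  qed
  then show ?thesis by (simp add: q_def)
qed

text \<open>The hypotheses \<open>small\<close> and \<open>large\<close> leave out intermediate
  arguments. There, monotonicity along rays compares \<open>t\<close> with the end points of the
  same sign: scaling up from \<open>s0\<close> bounds \<open>sgn t * \<gamma> t\<close> from below,
  and scaling \<open>t\<close> up to \<open>T\<close> bounds it from above. The logarithm of either
  scaling factor is at most \<open>ln (T / s0)\<close>.\<close>

lemma nonlinearity_bound:
  fixes \<gamma> :: "real \<Rightarrow> real"
  assumes p: "1 < p" and s0: "0 < s0" "s0 \<le> 1" and T: "1 \<le> T" and C: "0 \<le> C" and \<eta>: "0 \<le> \<eta>"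
    and cont: "isCont \<gamma> 0"
    and small: "\<And>t. t \<noteq> 0 \<Longrightarrow> \<bar>t\<bar> \<le> s0 \<Longrightarrow> \<bar>\<gamma> t\<bar> \<le> C * \<bar>t\<bar> powr (p - 1)"
    and large: "\<And>t. T \<le> \<bar>t\<bar> \<Longrightarrow> \<bar>\<gamma> t\<bar> \<le> \<eta> * (\<bar>t\<bar> powr (p - 1) * ln \<bar>t\<bar>)"
    and ray: "\<And>s \<tau>. 1 \<le> \<tau> \<Longrightarrow> s * \<gamma> s \<le> s * \<gamma> (\<tau> * s) * \<tau> powr (1 - p) + \<delta> * \<bar>s\<bar> powr p * ln \<tau>"
  shows "\<bar>\<gamma> t\<bar> \<le> \<bar>t\<bar> powr (p - 1) * (C + \<eta> * ln T + \<bar>\<delta>\<bar> * ln (T / s0) + \<eta> * lnp t)"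
proof -
  define B where "B = C + \<eta> * ln T + \<bar>\<delta>\<bar> * ln (T / s0)"
  have lnT: "0 \<le> ln T" using T by simp
  have lnTs: "0 \<le> ln (T / s0)" using T s0 by (intro ln_ge_zero) (simp add: pos_le_divide_eq)
  have B: "C \<le> B" "\<eta> * ln T + \<bar>\<delta>\<bar> * ln (T / s0) \<le> B" "C + \<bar>\<delta>\<bar> * ln (T / s0) \<le> B" "0 \<le> B"
    using C \<eta> lnT lnTs mult_nonneg_nonneg[OF \<eta> lnT] mult_nonneg_nonneg[OF abs_ge_zero[of \<delta>] lnTs] unfolding B_def by linarith+
  consider "t = 0" | "t \<noteq> 0" "\<bar>t\<bar> \<le> s0" | "T \<le> \<bar>t\<bar>" | "s0 \<le> \<bar>t\<bar>" "\<bar>t\<bar> \<le> T" by linarith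
  then have "\<bar>\<gamma> t\<bar> \<le> \<bar>t\<bar> powr (p - 1) * (B + \<eta> * lnp t)"
  proof cases
    case 1
    \<comment> \<open>The bound on a punctured neighbourhood together with continuity forces
      \<open>\<gamma> 0 = 0\<close>.\<close>
    have lim: "((\<lambda>t. C * \<bar>t\<bar> powr (p - 1)) \<longlongrightarrow> C * \<bar>0\<bar> powr (p - 1)) (at (0::real))"
      using p by (intro tendsto_mult_left tendsto_powr2 tendsto_intros) auto
    have lim0: "(\<gamma> \<longlongrightarrow> 0) (at 0)"
    proof (rule Lim_null_comparison)
      show "((\<lambda>t. C * \<bar>t\<bar> powr (p - 1)) \<longlongrightarrow> 0) (at (0::real))" using lim by simp
      show "\<forall>\<^sub>F t in at 0. norm (\<gamma> t) \<le> C * \<bar>t\<bar> powr (p - 1)"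
        unfolding eventually_at by (rule exI[of _ s0]) (use s0 small in \<open>auto simp: dist_real_def\<close>)
    qed
    have "0 = \<gamma> 0" by (rule LIM_unique[OF lim0 cont[unfolded isCont_def]])
    then show ?thesis using 1 by simp
  next
    case 2
    have "\<bar>\<gamma> t\<bar> \<le> \<bar>t\<bar> powr (p - 1) * C" using small[OF 2] by (simp add: mult.commute)
    also have "\<dots> \<le> \<bar>t\<bar> powr (p - 1) * (B + \<eta> * lnp t)"
      using B(1) \<eta> by (intro mult_left_mono) (auto intro: add_increasing2)
    finally show ?thesis .
  next
    case 3
    have "\<bar>\<gamma> t\<bar> \<le> \<bar>t\<bar> powr (p - 1) * (\<eta> * lnp t)" using large[OF 3] T 3 by (simp add: lnp_eq mult_ac)
    also have "\<dots> \<le> \<bar>t\<bar> powr (p - 1) * (B + \<eta> * lnp t)"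
      using B(4) by (intro mult_left_mono) auto
    finally show ?thesis .
  next
    case 4
    define a where "a = \<bar>t\<bar>"
    define \<sigma> where "\<sigma> = sgn t"
    have a: "0 < a" "s0 \<le> a" "a \<le> T" using 4 s0 by (auto simp: a_def)
    have t: "t = \<sigma> * a" by (simp add: \<sigma>_def a_def sgn_mult_abs)
    have \<sigma>: "\<bar>\<sigma>\<bar> = 1" using a by (auto simp: \<sigma>_def a_def abs_sgn_eq)
    have lower: "- (a powr (p - 1) * B) \<le> \<sigma> * \<gamma> t"
    proof -
      define \<tau> where "\<tau> = a / s0"
      have \<tau>: "1 \<le> \<tau>" using a s0 by (simp add: \<tau>_def)
      have \<tau>t: "\<tau> * (\<sigma> * s0) = t" using s0 by (simp add: \<tau>_def t)
      have s0\<sigma>: "\<bar>\<sigma> * s0\<bar> = s0" using \<sigma> s0 by (simp add: abs_mult)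
      have \<tau>p: "\<tau> powr (p - 1) * \<tau> powr (1 - p) = 1" using \<tau> by (simp flip: powr_add)
      have sp: "s0 powr p = s0 * s0 powr (p - 1)" using s0 by (simp add: powr_diff)
      have "s0 * (\<sigma> * \<gamma> (\<sigma> * s0)) \<le> s0 * (\<sigma> * \<gamma> t * \<tau> powr (1 - p) + \<delta> * s0 powr (p - 1) * ln \<tau>)"
        using ray[OF \<tau>, of "\<sigma> * s0"] unfolding \<tau>t s0\<sigma> sp by (simp add: algebra_simps)
      then have "\<sigma> * \<gamma> (\<sigma> * s0) \<le> \<sigma> * \<gamma> t * \<tau> powr (1 - p) + \<delta> * s0 powr (p - 1) * ln \<tau>"
        using s0 by (simp only: mult_le_cancel_left_pos)
      moreover have "- (C * s0 powr (p - 1)) \<le> \<sigma> * \<gamma> (\<sigma> * s0)"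
      proof -
        have "\<sigma> * s0 \<noteq> 0" using s0\<sigma> s0 by auto
        from small[OF this] have "\<bar>\<sigma> * \<gamma> (\<sigma> * s0)\<bar> \<le> C * s0 powr (p - 1)" using \<sigma> s0\<sigma> by (simp add: abs_mult)
        then show ?thesis by linarith
      qed
      moreover have "\<delta> * s0 powr (p - 1) * ln \<tau> \<le> \<bar>\<delta>\<bar> * ln (T / s0) * s0 powr (p - 1)"
      proof -
        have "ln \<tau> \<le> ln (T / s0)" using \<tau> a s0 unfolding \<tau>_def by (intro ln_mono divide_right_mono) auto
        then have "\<bar>\<delta>\<bar> * ln \<tau> \<le> \<bar>\<delta>\<bar> * ln (T / s0)" by (rule mult_left_mono) simp
        moreover have "\<delta> * ln \<tau> \<le> \<bar>\<delta>\<bar> * ln \<tau>" using \<tau> by (intro mult_right_mono) auto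
        ultimately have "\<delta> * ln \<tau> * s0 powr (p - 1) \<le> \<bar>\<delta>\<bar> * ln (T / s0) * s0 powr (p - 1)"
          by (intro mult_right_mono) auto
        then show ?thesis by (simp add: mult_ac)
      qed
      ultimately have "- ((C + \<bar>\<delta>\<bar> * ln (T / s0)) * s0 powr (p - 1)) \<le> \<sigma> * \<gamma> t * \<tau> powr (1 - p)"
        by (simp add: algebra_simps)
      then have "\<tau> powr (p - 1) * - ((C + \<bar>\<delta>\<bar> * ln (T / s0)) * s0 powr (p - 1)) \<le> \<tau> powr (p - 1) * (\<sigma> * \<gamma> t * \<tau> powr (1 - p))"
        by (rule mult_left_mono) simp
      also have "\<dots> = \<sigma> * \<gamma> t * (\<tau> powr (p - 1) * \<tau> powr (1 - p))" by (simp only: mult_ac)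
      also have "\<dots> = \<sigma> * \<gamma> t" by (simp only: \<tau>p mult_1_right)
      also have "\<tau> powr (p - 1) * - ((C + \<bar>\<delta>\<bar> * ln (T / s0)) * s0 powr (p - 1)) = - (a powr (p - 1) * (C + \<bar>\<delta>\<bar> * ln (T / s0)))"
        using a s0 by (simp add: \<tau>_def powr_divide)
      finally have "- (a powr (p - 1) * (C + \<bar>\<delta>\<bar> * ln (T / s0))) \<le> \<sigma> * \<gamma> t" .
      moreover have "a powr (p - 1) * (C + \<bar>\<delta>\<bar> * ln (T / s0)) \<le> a powr (p - 1) * B"
        by (intro mult_left_mono B(3)) simp
      ultimately show ?thesis by linarith
    qed
    have upper: "\<sigma> * \<gamma> t \<le> a powr (p - 1) * B"
    proof -
      define \<tau> where "\<tau> = T / a"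
      have \<tau>: "1 \<le> \<tau>" using a by (simp add: \<tau>_def)
      have \<tau>t: "\<tau> * t = \<sigma> * T" using a by (simp add: \<tau>_def t)
      have T\<sigma>: "\<bar>\<sigma> * T\<bar> = T" using \<sigma> T by (simp add: abs_mult)
      have ap: "a powr p = a * a powr (p - 1)" using a by (simp add: powr_diff)
      have "a * (\<sigma> * \<gamma> t) \<le> a * (\<sigma> * \<gamma> (\<sigma> * T) * \<tau> powr (1 - p) + \<delta> * a powr (p - 1) * ln \<tau>)"
        using ray[OF \<tau>, of t] unfolding \<tau>t a_def[symmetric] ap by (simp add: t algebra_simps)
      then have "\<sigma> * \<gamma> t \<le> \<sigma> * \<gamma> (\<sigma> * T) * \<tau> powr (1 - p) + \<delta> * a powr (p - 1) * ln \<tau>"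
        using a by (simp only: mult_le_cancel_left_pos)
      also have "\<dots> \<le> \<eta> * (T powr (p - 1) * ln T) * \<tau> powr (1 - p) + \<bar>\<delta>\<bar> * ln (T / s0) * a powr (p - 1)"
      proof (rule add_mono)
        have "\<bar>\<sigma> * \<gamma> (\<sigma> * T)\<bar> \<le> \<eta> * (T powr (p - 1) * ln T)"
          using large[of "\<sigma> * T"] T\<sigma> \<sigma> by (simp add: abs_mult)
        then show "\<sigma> * \<gamma> (\<sigma> * T) * \<tau> powr (1 - p) \<le> \<eta> * (T powr (p - 1) * ln T) * \<tau> powr (1 - p)"
          by (intro mult_right_mono) auto
        have "ln \<tau> \<le> ln (T / s0)" using \<tau> a s0 T unfolding \<tau>_def by (intro ln_mono divide_left_mono) auto
        then have "\<bar>\<delta>\<bar> * ln \<tau> \<le> \<bar>\<delta>\<bar> * ln (T / s0)" by (rule mult_left_mono) simp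
        moreover have "\<delta> * ln \<tau> \<le> \<bar>\<delta>\<bar> * ln \<tau>" using \<tau> by (intro mult_right_mono) auto
        ultimately have "\<delta> * ln \<tau> * a powr (p - 1) \<le> \<bar>\<delta>\<bar> * ln (T / s0) * a powr (p - 1)"
          by (intro mult_right_mono) auto
        then show "\<delta> * a powr (p - 1) * ln \<tau> \<le> \<bar>\<delta>\<bar> * ln (T / s0) * a powr (p - 1)" by (simp add: mult_ac)
      qed
      also have "\<tau> powr (1 - p) = a powr (p - 1) / T powr (p - 1)"
        using a T by (simp add: \<tau>_def powr_divide powr_diff)
      also have "\<eta> * (T powr (p - 1) * ln T) * (a powr (p - 1) / T powr (p - 1)) = a powr (p - 1) * (\<eta> * ln T)"
        using T by simp
      also have "a powr (p - 1) * (\<eta> * ln T) + \<bar>\<delta>\<bar> * ln (T / s0) * a powr (p - 1) = a powr (p - 1) * (\<eta> * ln T + \<bar>\<delta>\<bar> * ln (T / s0))"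
        by (simp add: algebra_simps)
      also have "\<dots> \<le> a powr (p - 1) * B" by (intro mult_left_mono B(2)) simp
      finally show ?thesis .
    qed
    have "\<bar>\<gamma> t\<bar> = \<bar>\<sigma> * \<gamma> t\<bar>" using \<sigma> by (simp add: abs_mult)
    also have "\<dots> \<le> a powr (p - 1) * B" using lower upper by linarith
    also have "\<dots> \<le> \<bar>t\<bar> powr (p - 1) * (B + \<eta> * lnp t)"
      unfolding a_def using \<eta> by (intro mult_left_mono) auto
    finally show ?thesis .
  qed
  then show ?thesis by (simp add: B_def add.assoc)
qed

text \<open>The constants are kept separate because each of the three summands is also bounded on
  its own later, by setting the other coefficients to 0.\<close>

lemma total_growth:
  assumes p: "1 < p" and \<mu>: "0 \<le> \<mu>" and b: "0 \<le> B" "0 \<le> \<eta>" and k: "\<bar>k\<bar> \<le> kb"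
    and \<gamma>: "\<bar>\<gamma>\<bar> \<le> \<bar>t\<bar> powr (p - 1) * (B + \<eta> * lnp t)"
  shows "\<bar>\<gamma> + k * h p t + \<mu> * (h p t * ln \<bar>t\<bar>)\<bar> \<le> (B + \<eta> + kb + \<mu> + \<mu> / (p - 1)) * (1 + \<bar>t\<bar> powr (p - 1) * (1 + lnp t))"
proof -
  define y where "y = \<bar>t\<bar> powr (p - 1)"
  have y: "0 \<le> y" by (simp add: y_def)
  have l: "0 \<le> y * lnp t" using y by simp
  have "\<bar>\<gamma> + k * h p t + \<mu> * (h p t * ln \<bar>t\<bar>)\<bar> \<le> \<bar>\<gamma>\<bar> + \<bar>k * h p t\<bar> + \<bar>\<mu> * (h p t * ln \<bar>t\<bar>)\<bar>" by linarith
  also have "\<dots> \<le> (B * y + \<eta> * (y * lnp t)) + kb * y + (\<mu> / (p - 1) + \<mu> * (y * lnp t))"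
  proof (intro add_mono)
    show "\<bar>\<gamma>\<bar> \<le> B * y + \<eta> * (y * lnp t)" using \<gamma> by (simp add: y_def algebra_simps)
    show "\<bar>k * h p t\<bar> \<le> kb * y" unfolding abs_mult abs_h y_def using k by (intro mult_right_mono) auto
    have "\<bar>\<mu> * (h p t * ln \<bar>t\<bar>)\<bar> = \<mu> * \<bar>h p t * ln \<bar>t\<bar>\<bar>" using \<mu> by (simp add: abs_mult)
    also have "\<dots> \<le> \<mu> * (1 / (p - 1) + y * lnp t)"
      unfolding y_def by (intro mult_left_mono abs_h_ln_le p \<mu>)
    finally show "\<bar>\<mu> * (h p t * ln \<bar>t\<bar>)\<bar> \<le> \<mu> / (p - 1) + \<mu> * (y * lnp t)" by (simp add: distrib_left)
  qed
  also have "\<dots> \<le> (B + \<eta> + kb + \<mu> + \<mu> / (p - 1)) * (1 + y * (1 + lnp t))"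
  proof -
    define S where "S = B + \<eta> + kb + \<mu> + \<mu> / (p - 1)"
    have kb: "0 \<le> kb" using k by linarith
    have m: "0 \<le> \<mu> / (p - 1)" using \<mu> p by simp
    have "(B + kb) * y \<le> S * y" "(\<eta> + \<mu>) * (y * lnp t) \<le> S * (y * lnp t)"
      using b kb \<mu> m y l unfolding S_def by (intro mult_right_mono; linarith)+
    moreover have "\<mu> / (p - 1) \<le> S" using b kb \<mu> unfolding S_def by linarith
    ultimately have "(B + kb) * y + (\<eta> + \<mu>) * (y * lnp t) + \<mu> / (p - 1) \<le> S * y + S * (y * lnp t) + S" by linarith
    also have "\<dots> = S * (1 + y * (1 + lnp t))" by (simp add: algebra_simps)
    finally show ?thesis unfolding S_def by (simp add: algebra_simps)
  qed
  finally show ?thesis by (simp add: y_def)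
qed

text \<open>The term with \<open>k\<close> is homogeneous of degree \<open>p - 1\<close> and
  cancels. The logarithmic term yields \<open>\<mu> * \<bar>s\<bar> powr p * ln \<tau>\<close>, of
  which the share \<open>\<delta>\<close> is spent on \<open>\<gamma>\<close>; the gap
  \<open>\<mu> - \<delta>\<close> makes the monotonicity strict.\<close>

lemma total_mono:
  assumes p: "1 < p" and \<tau>: "1 \<le> \<tau>"
    and ray: "s * \<gamma> s \<le> s * \<gamma> (\<tau> * s) * \<tau> powr (1 - p) + \<delta> * \<bar>s\<bar> powr p * ln \<tau>"
  shows "s * (\<gamma> s + k * h p s + \<mu> * (h p s * ln \<bar>s\<bar>)) + (\<mu> - \<delta>) * \<bar>s\<bar> powr p * ln \<tau>
    \<le> s * (\<gamma> (\<tau> * s) + k * h p (\<tau> * s) + \<mu> * (h p (\<tau> * s) * ln \<bar>\<tau> * s\<bar>)) * \<tau> powr (1 - p)"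
proof (cases "s = 0")
  case False
  have \<tau>0: "0 < \<tau>" using \<tau> by simp
  have \<tau>p: "\<tau> powr (p - 1) * \<tau> powr (1 - p) = 1" using \<tau> by (simp flip: powr_add)
  have sh: "s * h p s = \<bar>s\<bar> powr p" using h_mult_self[of p s] by (simp add: mult.commute)
  have ln: "ln \<bar>\<tau> * s\<bar> = ln \<tau> + ln \<bar>s\<bar>" using False \<tau>0 by (simp add: abs_mult ln_mult)
  have "s * (\<gamma> (\<tau> * s) + k * h p (\<tau> * s) + \<mu> * (h p (\<tau> * s) * ln \<bar>\<tau> * s\<bar>)) * \<tau> powr (1 - p)
     = s * \<gamma> (\<tau> * s) * \<tau> powr (1 - p) + (s * h p s) * (\<tau> powr (p - 1) * \<tau> powr (1 - p)) * (k + \<mu> * (ln \<tau> + ln \<bar>s\<bar>))"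
    unfolding ln h_scale[OF \<tau>0] by (simp add: algebra_simps)
  also have "\<dots> = s * \<gamma> (\<tau> * s) * \<tau> powr (1 - p) + \<bar>s\<bar> powr p * (k + \<mu> * (ln \<tau> + ln \<bar>s\<bar>))"
    unfolding \<tau>p sh by simp
  finally have eq: "s * (\<gamma> (\<tau> * s) + k * h p (\<tau> * s) + \<mu> * (h p (\<tau> * s) * ln \<bar>\<tau> * s\<bar>)) * \<tau> powr (1 - p) = \<dots>" .
  have "s * (\<gamma> s + k * h p s + \<mu> * (h p s * ln \<bar>s\<bar>)) = s * \<gamma> s + (s * h p s) * (k + \<mu> * ln \<bar>s\<bar>)"
    by (simp add: algebra_simps)
  also have "\<dots> = s * \<gamma> s + \<bar>s\<bar> powr p * (k + \<mu> * ln \<bar>s\<bar>)" by (simp only: sh)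
  finally show ?thesis unfolding eq using ray by (simp add: algebra_simps)
qed simp

lemma total_deriv:
  assumes p: "1 < p" and \<Gamma>: "(\<Gamma> has_real_derivative \<gamma> t) (at t)"
  shows "((\<lambda>t. \<Gamma> t + k / p * \<bar>t\<bar> powr p + \<mu> / p\<^sup>2 * (\<bar>t\<bar> powr p * (ln (\<bar>t\<bar> powr p) - 1)))
    has_real_derivative \<gamma> t + k * h p t + \<mu> * (h p t * ln \<bar>t\<bar>)) (at t)"
  by (rule DERIV_cong[OF DERIV_add[OF DERIV_add[OF \<Gamma> DERIV_cmult[OF DERIV_abs_powr[OF p]]] DERIV_cmult[OF DERIV_abs_powr_ln[OF p]]]])
     (use p in \<open>simp add: power2_eq_square\<close>)

text \<open>The leading term is
  \<open>\<mu> / p * (\<bar>t\<bar> powr p * ln \<bar>t\<bar>)\<close>. For the upper bound one half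
  of the gap \<open>(m - \<mu>) / p\<close> absorbs \<open>\<eta>\<close> and the other half the
  constants; for the lower bound \<open>\<mu> / p\<close> is halved in the same way. This dictates
  both bounds on \<open>\<eta>\<close> and both thresholds for
  \<open>ln \<bar>t\<bar>\<close>.\<close>

lemma total_H_growth:
  assumes p: "1 < p" and \<mu>: "0 < \<mu>" "\<mu> < m" and k: "\<bar>k\<bar> \<le> kb" and \<eta>: "\<eta> \<le> (m - \<mu>) / (2 * p)" "\<eta> \<le> \<mu> / (2 * p)"
    and \<Gamma>: "\<bar>\<Gamma>\<bar> \<le> \<bar>t\<bar> powr p * (B + \<eta> * lnp t)" and B: "0 \<le> B"
    and t1: "1 \<le> \<bar>t\<bar>" and t2: "(B + kb / p) * (2 * p) / (m - \<mu>) \<le> ln \<bar>t\<bar>" and t3: "(B + kb / p + \<mu> / p\<^sup>2) * (2 * p) / \<mu> \<le> ln \<bar>t\<bar>"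
  shows "0 \<le> \<Gamma> + k / p * \<bar>t\<bar> powr p + \<mu> / p\<^sup>2 * (\<bar>t\<bar> powr p * (ln (\<bar>t\<bar> powr p) - 1))"
    and "\<Gamma> + k / p * \<bar>t\<bar> powr p + \<mu> / p\<^sup>2 * (\<bar>t\<bar> powr p * (ln (\<bar>t\<bar> powr p) - 1)) \<le> m / p * (\<bar>t\<bar> powr p * ln \<bar>t\<bar>)"
proof -
  define y where "y = \<bar>t\<bar> powr p"
  define l where "l = ln \<bar>t\<bar>"
  have t0: "t \<noteq> 0" using t1 by auto
  have y: "0 \<le> y" and l: "0 \<le> l" using t1 by (auto simp: y_def l_def)
  have lnp: "lnp t = l" using t1 by (simp add: l_def lnp_eq)
  have eq: "\<mu> / p\<^sup>2 * (\<bar>t\<bar> powr p * (ln (\<bar>t\<bar> powr p) - 1)) = y * (\<mu> / p * l - \<mu> / p\<^sup>2)"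
    using t0 p by (simp add: y_def l_def ln_powr power2_eq_square field_simps)
  have kp: "- (kb / p) \<le> k / p" "k / p \<le> kb / p"
  proof -
    have "- kb \<le> k" "k \<le> kb" using k by linarith+
    then show "- (kb / p) \<le> k / p" "k / p \<le> kb / p"
      using p divide_right_mono[of "- kb" k p] divide_right_mono[of k kb p] by simp_all
  qed
  have G: "- (y * (B + \<eta> * l)) \<le> \<Gamma>" "\<Gamma> \<le> y * (B + \<eta> * l)" using \<Gamma> by (auto simp: y_def lnp abs_le_iff)
  have \<eta>l: "\<eta> * l \<le> (m - \<mu>) / (2 * p) * l" "\<eta> * l \<le> \<mu> / (2 * p) * l"
    by (rule mult_right_mono[OF \<eta>(1) l], rule mult_right_mono[OF \<eta>(2) l])
  have t2': "B + kb / p \<le> (m - \<mu>) / (2 * p) * l"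
    using t2 p \<mu> by (simp add: l_def divide_le_eq pos_le_divide_eq mult_ac)
  have t3': "B + kb / p + \<mu> / p\<^sup>2 \<le> \<mu> / (2 * p) * l"
    using t3 p \<mu> by (simp add: l_def divide_le_eq pos_le_divide_eq mult_ac)
  have half: "\<mu> / p * l = \<mu> / (2 * p) * l + \<mu> / (2 * p) * l" "(m - \<mu>) / p * l = (m - \<mu>) / (2 * p) * l + (m - \<mu>) / (2 * p) * l"
    using p by (auto simp: field_simps)
  define a where "a = B + \<eta> * l"
  define c where "c = k / p + (\<mu> / p * l - \<mu> / p\<^sup>2)"
  have e: "\<Gamma> + k / p * \<bar>t\<bar> powr p + \<mu> / p\<^sup>2 * (\<bar>t\<bar> powr p * (ln (\<bar>t\<bar> powr p) - 1)) = \<Gamma> + y * c"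
    unfolding eq by (simp add: y_def c_def distrib_left mult.commute)
  have "0 \<le> y * (c - a)"
    using y kp \<eta>l t3' half unfolding c_def a_def by (intro mult_nonneg_nonneg) linarith+
  then show "0 \<le> \<Gamma> + k / p * \<bar>t\<bar> powr p + \<mu> / p\<^sup>2 * (\<bar>t\<bar> powr p * (ln (\<bar>t\<bar> powr p) - 1))"
    unfolding e using G(1) by (simp add: right_diff_distrib a_def)
  have p2: "0 \<le> \<mu> / p\<^sup>2" using \<mu> by simp
  have mm: "(m - \<mu>) / p * l = m / p * l - \<mu> / p * l" by (simp add: diff_divide_distrib left_diff_distrib)
  have "y * (c + a) \<le> y * (m / p * l)"
    using kp \<eta>l t2' half p2 mm unfolding c_def a_def by (intro mult_left_mono y) linarith
  then have "\<Gamma> + y * c \<le> y * (m / p * l)" using G(2) by (simp add: distrib_left a_def)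
  then show "\<Gamma> + k / p * \<bar>t\<bar> powr p + \<mu> / p\<^sup>2 * (\<bar>t\<bar> powr p * (ln (\<bar>t\<bar> powr p) - 1)) \<le> m / p * (\<bar>t\<bar> powr p * ln \<bar>t\<bar>)"
    unfolding e by (simp add: y_def l_def mult_ac)
qed

subsection \<open>The energy form\<close>

text \<open>The smaller of the two moduli is replaced by the larger one; this serves in place of
  Young's inequality.\<close>

lemma abs_h_mult_le:
  assumes "1 < p" shows "\<bar>h p a * b\<bar> \<le> \<bar>a\<bar> powr p + \<bar>b\<bar> powr p"
proof (cases "\<bar>a\<bar> \<le> \<bar>b\<bar>")
  case True
  have "\<bar>h p a * b\<bar> \<le> \<bar>b\<bar> powr (p - 1) * \<bar>b\<bar>"
    unfolding abs_mult abs_h using True assms by (intro mult_right_mono powr_mono2) auto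
  also have "\<dots> = \<bar>b\<bar> powr p" by (cases "b = 0") (auto simp: powr_diff)
  finally show ?thesis by (simp add: add_increasing)
next
  case False
  have "\<bar>h p a * b\<bar> \<le> \<bar>a\<bar> powr (p - 1) * \<bar>a\<bar>"
    unfolding abs_mult abs_h using False by (intro mult_left_mono) auto
  also have "\<dots> = \<bar>a\<bar> powr p" by (cases "a = 0") (auto simp: powr_diff)
  finally show ?thesis by (simp add: add_increasing2)
qed

text \<open>Both points are required to lie in \<open>\<Omega>\<close>: if one does not,
  \<open>Upsilon\<close> vanishes for functions that are zero outside
  \<open>\<Omega>\<close>.\<close>

definition far_region :: "'a::real_normed_vector set \<Rightarrow> ('a \<times> 'a) set" where
  "far_region \<Omega> = {z. 1 \<le> norm (fst z - snd z) \<and> fst z \<in> \<Omega> \<and> snd z \<in> \<Omega>}"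

definition far_kernel :: "'a::euclidean_space set \<Rightarrow> 'a \<times> 'a \<Rightarrow> real" where
  "far_kernel \<Omega> z = inv_kernel (fst z) (snd z) * indicator (far_region \<Omega>) z"

text \<open>Pairs at distance exactly 1 are counted in both summands, as they are in the energy
  form.\<close>

definition total_kernel :: "real \<Rightarrow> 'a::euclidean_space set \<Rightarrow> 'a \<times> 'a \<Rightarrow> real" where
  "total_kernel p \<Omega> z = C_const DIM('a) p / 2 * (inv_kernel (fst z) (snd z) * indicator near_region z + far_kernel \<Omega> z)"

text \<open>The terms \<open>h p z1 * t1\<close> and \<open>h p z2 * t2\<close> of
  \<open>Upsilon\<close> contribute equally by symmetry, so the full constant times this mass acts
  as a potential.\<close>

definition far_mass :: "'a::euclidean_space set \<Rightarrow> 'a \<Rightarrow> real" where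
  "far_mass \<Omega> x = (\<integral>y. far_kernel \<Omega> (x, y) \<partial>lebesgue)"

lemma far_kernel_nonneg [simp]: "0 \<le> far_kernel \<Omega> z"
  by (simp add: far_kernel_def)

lemma far_kernel_swap: "far_kernel \<Omega> (y, x) = far_kernel \<Omega> (x, y)"
  by (simp add: far_kernel_def far_region_def inv_kernel_def norm_minus_commute indicator_def conj_commute)

lemma far_kernel_le: "far_kernel \<Omega> (x, y) \<le> indicator \<Omega> y"
proof (cases "(x, y) \<in> far_region \<Omega>")
  case True
  then have "1 \<le> norm (x - y) ^ DIM('a)" by (intro one_le_power) (simp add: far_region_def)
  then have "inv_kernel x y \<le> 1" by (simp add: inv_kernel_def)
  then show ?thesis using True by (simp add: far_kernel_def far_region_def)
qed (simp add: far_kernel_def)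

locale finite_domain =
  fixes \<Omega> :: "'a::euclidean_space set" and p :: real
  assumes \<Omega>_sets [measurable]: "\<Omega> \<in> sets lebesgue" and \<Omega>_fin: "emeasure lebesgue \<Omega> < \<infinity>" and p: "1 < p"
begin

abbreviation "M \<equiv> lebesgue_on \<Omega>"
abbreviation "P \<equiv> lebesgue \<Otimes>\<^sub>M (lebesgue :: 'a measure)"

lemma sets_far_region [measurable]: "far_region \<Omega> \<in> sets P"
proof -
  have "{z \<in> space P. 1 \<le> norm (fst z - snd z) \<and> fst z \<in> \<Omega> \<and> snd z \<in> \<Omega>} \<in> sets P" by measurable
  then show ?thesis by (simp add: far_region_def space_pair_measure)
qed

lemma far_kernel_meas [measurable]: "far_kernel \<Omega> \<in> borel_measurable P"
  unfolding far_kernel_def[abs_def] by measurable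

lemma total_kernel_meas [measurable]: "total_kernel p \<Omega> \<in> borel_measurable P"
  unfolding total_kernel_def[abs_def] by measurable

lemma C_pos: "0 < C_const DIM('a) p"
  using p by (intro C_const_pos) auto

lemma total_kernel_nonneg: "0 \<le> total_kernel p \<Omega> z"
  unfolding total_kernel_def using C_pos by (intro mult_nonneg_nonneg add_nonneg_nonneg) auto

lemma indicator_integrable: "integrable lebesgue (indicator \<Omega> :: 'a \<Rightarrow> real)"
  using \<Omega>_fin by (intro integrable_real_indicator) auto

lemma far_kernel_Pair_meas [measurable]: "(\<lambda>y. far_kernel \<Omega> (x, y)) \<in> borel_measurable lebesgue"
  by (rule measurable_compose[OF measurable_Pair1' far_kernel_meas]) simp

lemma far_kernel_Pair_integrable: "integrable lebesgue (\<lambda>y. far_kernel \<Omega> (x, y))"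
proof (rule Bochner_Integration.integrable_bound[OF indicator_integrable])
  show "AE y in lebesgue. norm (far_kernel \<Omega> (x, y)) \<le> norm (indicator \<Omega> y :: real)"
    using far_kernel_le[of \<Omega> x] by (intro AE_I2) simp
qed measurable

lemma far_mass_bounds: "0 \<le> far_mass \<Omega> x" "far_mass \<Omega> x \<le> measure lebesgue \<Omega>"
proof -
  show "0 \<le> far_mass \<Omega> x" unfolding far_mass_def by (intro Bochner_Integration.integral_nonneg) simp
  have "far_mass \<Omega> x \<le> (\<integral>y. indicator \<Omega> y \<partial>lebesgue)"
    unfolding far_mass_def
    by (rule integral_mono[OF far_kernel_Pair_integrable indicator_integrable far_kernel_le])
  then show "far_mass \<Omega> x \<le> measure lebesgue \<Omega>" by simp
qed

lemma far_mass_meas [measurable]: "far_mass \<Omega> \<in> borel_measurable lebesgue"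
  unfolding far_mass_def[abs_def]
  by (intro lebesgue.borel_measurable_lebesgue_integral) (simp add: case_prod_beta')

lemma far_mass_zero: "x \<notin> \<Omega> \<Longrightarrow> far_mass \<Omega> x = 0"
  by (simp add: far_mass_def far_kernel_def far_region_def)

text \<open>Fubini's theorem; the kernel is at most the indicator of \<open>\<Omega>\<close> in its
  second argument, and \<open>\<Omega>\<close> has finite measure. The versions with
  \<open>snd\<close> follow from the symmetry of the kernel.\<close>

lemma far_integral:
  assumes w: "integrable lebesgue w"
  shows "integrable P (\<lambda>z. far_kernel \<Omega> z * w (fst z))"
    and "(\<integral>z. far_kernel \<Omega> z * w (fst z) \<partial>P) = (\<integral>x. far_mass \<Omega> x * w x \<partial>lebesgue)"
    and "integrable P (\<lambda>z. far_kernel \<Omega> z * w (snd z))"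
    and "(\<integral>z. far_kernel \<Omega> z * w (snd z) \<partial>P) = (\<integral>x. far_mass \<Omega> x * w x \<partial>lebesgue)"
proof -
  have w_meas [measurable]: "w \<in> borel_measurable lebesgue" using w by auto
  have "(\<integral>\<^sup>+ z. ennreal (norm (far_kernel \<Omega> z * w (fst z))) \<partial>P)
    = (\<integral>\<^sup>+ x. \<integral>\<^sup>+ y. ennreal (norm (far_kernel \<Omega> (x, y) * w x)) \<partial>lebesgue \<partial>lebesgue)"
    by (subst lebesgue.nn_integral_fst [symmetric]) auto
  also have "\<dots> \<le> (\<integral>\<^sup>+ x. ennreal (norm (w x)) * emeasure lebesgue \<Omega> \<partial>lebesgue)"
  proof (intro nn_integral_mono)
    fix x
    have "(\<integral>\<^sup>+ y. ennreal (norm (far_kernel \<Omega> (x, y) * w x)) \<partial>lebesgue) \<le> (\<integral>\<^sup>+ y. ennreal (norm (w x)) * indicator \<Omega> y \<partial>lebesgue)"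
    proof (intro nn_integral_mono)
      fix y
      have "far_kernel \<Omega> (x, y) * \<bar>w x\<bar> \<le> indicator \<Omega> y * \<bar>w x\<bar>" by (rule mult_right_mono[OF far_kernel_le]) simp
      then have "ennreal (norm (far_kernel \<Omega> (x, y) * w x)) \<le> ennreal (indicator \<Omega> y * \<bar>w x\<bar>)"
        by (intro ennreal_leI) (simp add: abs_mult)
      also have "\<dots> = ennreal (norm (w x)) * indicator \<Omega> y" by (simp add: indicator_def)
      finally show "ennreal (norm (far_kernel \<Omega> (x, y) * w x)) \<le> ennreal (norm (w x)) * indicator \<Omega> y" .
    qed
    also have "\<dots> = ennreal (norm (w x)) * emeasure lebesgue \<Omega>"
      by (rule nn_integral_cmult_indicator) simp
    finally show "(\<integral>\<^sup>+ y. ennreal (norm (far_kernel \<Omega> (x, y) * w x)) \<partial>lebesgue) \<le> ennreal (norm (w x)) * emeasure lebesgue \<Omega>" .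
  qed
  also have "\<dots> = (\<integral>\<^sup>+ x. ennreal (norm (w x)) \<partial>lebesgue) * emeasure lebesgue \<Omega>"
    by (rule nn_integral_multc) measurable
  also have "\<dots> < \<infinity>"
    using \<Omega>_fin w unfolding integrable_iff_bounded by (auto simp: ennreal_mult_less_top)
  finally show int: "integrable P (\<lambda>z. far_kernel \<Omega> z * w (fst z))"
    by (intro integrableI_bounded) measurable
  have "(\<integral>x. \<integral>y. far_kernel \<Omega> (x, y) * w x \<partial>lebesgue \<partial>lebesgue) = (\<integral>z. far_kernel \<Omega> z * w (fst z) \<partial>P)"
    using lebesgue_pair.integral_fst'[OF int] by simp
  then show eq: "(\<integral>z. far_kernel \<Omega> z * w (fst z) \<partial>P) = (\<integral>x. far_mass \<Omega> x * w x \<partial>lebesgue)"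
    by (simp add: far_mass_def)
  have sw: "(\<lambda>(x, y). far_kernel \<Omega> (y, x) * w (fst (y, x))) = (\<lambda>z. far_kernel \<Omega> z * w (snd z))"
    by (auto simp: far_kernel_swap)
  show "integrable P (\<lambda>z. far_kernel \<Omega> z * w (snd z))"
    using lebesgue_pair.integrable_product_swap[OF int] unfolding sw .
  show "(\<integral>z. far_kernel \<Omega> z * w (snd z) \<partial>P) = (\<integral>x. far_mass \<Omega> x * w x \<partial>lebesgue)"
    using lebesgue_pair.integral_product_swap[of "\<lambda>z. far_kernel \<Omega> z * w (fst z)"] int eq unfolding sw
    by (simp add: borel_measurable_integrable)
qed

lemma integrable_extend:
  assumes "w \<in> borel_measurable lebesgue" "AE x in lebesgue. x \<notin> \<Omega> \<longrightarrow> w x = 0" "integrable M w"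
  shows "integrable lebesgue (w :: 'a \<Rightarrow> real)"
    and "(\<integral>x. w x \<partial>lebesgue) = (\<integral>x. w x \<partial>M)"
proof -
  have ae: "AE x in lebesgue. indicator \<Omega> x *\<^sub>R w x = w x" using assms(2) by eventually_elim (auto simp: indicator_def)
  have i: "integrable lebesgue (\<lambda>x. indicator \<Omega> x *\<^sub>R w x)" using assms(3) by (subst (asm) integrable_restrict_space) auto
  show "integrable lebesgue w"
    by (rule integrable_cong_AE_imp[OF i assms(1)]) (use ae in \<open>auto elim: eventually_mono\<close>)
  have "(\<integral>x. w x \<partial>M) = (\<integral>x. indicator \<Omega> x *\<^sub>R w x \<partial>lebesgue)" by (subst integral_restrict_space) auto
  also have "\<dots> = (\<integral>x. w x \<partial>lebesgue)"
    by (rule integral_cong_AE[OF _ assms(1) ae]) (use i in auto)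
  finally show "(\<integral>x. w x \<partial>lebesgue) = (\<integral>x. w x \<partial>M)" by simp
qed

lemma far_diff_integrable:
  assumes [measurable]: "u \<in> borel_measurable lebesgue" and u: "integrable lebesgue (\<lambda>x. \<bar>u x\<bar> powr p)"
  shows "integrable P (\<lambda>z. far_kernel \<Omega> z * \<bar>du u z\<bar> powr p)"
proof (rule Bochner_Integration.integrable_bound)
  show "integrable P (\<lambda>z. 2 powr p * (far_kernel \<Omega> z * \<bar>u (fst z)\<bar> powr p + far_kernel \<Omega> z * \<bar>u (snd z)\<bar> powr p))"
    by (intro integrable_mult_right Bochner_Integration.integrable_add far_integral u)
  show "AE z in P. norm (far_kernel \<Omega> z * \<bar>du u z\<bar> powr p) \<le> norm (2 powr p * (far_kernel \<Omega> z * \<bar>u (fst z)\<bar> powr p + far_kernel \<Omega> z * \<bar>u (snd z)\<bar> powr p))"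
  proof (rule AE_I2)
    fix z
    have "far_kernel \<Omega> z * \<bar>du u z\<bar> powr p \<le> far_kernel \<Omega> z * (2 powr p * (\<bar>u (fst z)\<bar> powr p + \<bar>u (snd z)\<bar> powr p))"
      unfolding du_def using p by (intro mult_left_mono abs_diff_powr_le) auto
    then show "norm (far_kernel \<Omega> z * \<bar>du u z\<bar> powr p) \<le> norm (2 powr p * (far_kernel \<Omega> z * \<bar>u (fst z)\<bar> powr p + far_kernel \<Omega> z * \<bar>u (snd z)\<bar> powr p))"
      by (simp add: algebra_simps)
  qed
qed measurable

lemma total_kernel_split:
  "total_kernel p \<Omega> z * \<bar>du u z\<bar> powr p = near_density p u z * indicator near_region z + C_const DIM('a) p / 2 * (far_kernel \<Omega> z * \<bar>du u z\<bar> powr p)"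
  by (simp add: total_kernel_def near_density_def du_def algebra_simps)

text \<open>The far kernel is bounded and lives on pairs of points of a set of finite measure, so
  its part of the form is integrable whenever the \<open>p\<close>-th power of \<open>u\<close> is,
  and the near part alone decides.\<close>

lemma total_integrable_iff:
  assumes [measurable]: "u \<in> borel_measurable lebesgue" and u: "integrable lebesgue (\<lambda>x. \<bar>u x\<bar> powr p)"
  shows "integrable P (\<lambda>z. total_kernel p \<Omega> z * \<bar>du u z\<bar> powr p)
    \<longleftrightarrow> near_energy p u < \<infinity>"
proof -
  have nn: "near_energy p u
    = (\<integral>\<^sup>+ z. ennreal (norm (near_density p u z * indicator near_region z)) \<partial>P)"
    unfolding near_energy_def using p by (intro nn_integral_cong) (auto simp: indicator_def)
  have m: "(\<lambda>z. near_density p u z * indicator near_region z) \<in> borel_measurable P" by measurable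
  have "integrable P (\<lambda>z. near_density p u z * indicator near_region z) \<longleftrightarrow> near_energy p u < \<infinity>"
    unfolding nn integrable_iff_bounded using m by simp
  moreover have far: "integrable P (\<lambda>z. C_const DIM('a) p / 2 * (far_kernel \<Omega> z * \<bar>du u z\<bar> powr p))"
    by (intro integrable_mult_right far_diff_integrable assms)
  have "integrable P (\<lambda>z. total_kernel p \<Omega> z * \<bar>du u z\<bar> powr p) \<longleftrightarrow> integrable P (\<lambda>z. near_density p u z * indicator near_region z)"
  proof
    assume "integrable P (\<lambda>z. total_kernel p \<Omega> z * \<bar>du u z\<bar> powr p)"
    from Bochner_Integration.integrable_diff[OF this far] show "integrable P (\<lambda>z. near_density p u z * indicator near_region z)"
      unfolding total_kernel_split by simp
  next
    assume "integrable P (\<lambda>z. near_density p u z * indicator near_region z)"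
    from Bochner_Integration.integrable_add[OF this far] show "integrable P (\<lambda>z. total_kernel p \<Omega> z * \<bar>du u z\<bar> powr p)"
      unfolding total_kernel_split .
  qed
  ultimately show ?thesis by simp
qed

end

text \<open>The seminorm carries the full normalising constant, the energy density half of
  it.\<close>

lemma X_seminorm_pow_eq:
  fixes u :: "real ^ 'n \<Rightarrow> real"
  assumes [measurable]: "u \<in> borel_measurable lebesgue" and p: "1 < p"
  shows "X_seminorm_pow p u = 2 * near_energy p u"
proof -
  have C: "0 < C_const CARD('n) p" using p by (intro C_const_pos) auto
  have "X_seminorm_pow p u = ennreal (C_const CARD('n) p) *
     (\<integral>\<^sup>+ z. ennreal (\<bar>u (fst z) - u (snd z)\<bar> powr p * inv_kernel (fst z) (snd z)) * indicator near_region z \<partial>(lebesgue \<Otimes>\<^sub>M lebesgue))"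
    unfolding X_seminorm_pow_def by (intro arg_cong2[where f = "(*)"] refl nn_integral_cong)
      (auto simp: inv_kernel_def near_region_def indicator_def)
  also have "\<dots> = (\<integral>\<^sup>+ z. ennreal (C_const CARD('n) p) * (ennreal (\<bar>u (fst z) - u (snd z)\<bar> powr p * inv_kernel (fst z) (snd z)) * indicator near_region z) \<partial>(lebesgue \<Otimes>\<^sub>M lebesgue))"
    by (rule nn_integral_cmult [symmetric]) measurable
  also have "\<dots> = (\<integral>\<^sup>+ z. 2 * (ennreal (near_density p u z) * indicator near_region z) \<partial>(lebesgue \<Otimes>\<^sub>M lebesgue))"
  proof (rule nn_integral_cong)
    fix z :: "(real ^ 'n) \<times> (real ^ 'n)"
    have "ennreal (C_const CARD('n) p) * ennreal (\<bar>u (fst z) - u (snd z)\<bar> powr p * inv_kernel (fst z) (snd z)) = ennreal (2 * near_density p u z)"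
      using C by (subst ennreal_mult' [symmetric]) (auto simp: near_density_def)
    also have "\<dots> = 2 * ennreal (near_density p u z)" by (subst ennreal_mult') auto
    finally show "ennreal (C_const CARD('n) p) * (ennreal (\<bar>u (fst z) - u (snd z)\<bar> powr p * inv_kernel (fst z) (snd z)) * indicator near_region z)
      = 2 * (ennreal (near_density p u z) * indicator near_region z)"
      by (simp add: mult.assoc [symmetric])
  qed
  also have "\<dots> = 2 * near_energy p u"
    unfolding near_energy_def by (rule nn_integral_cmult) measurable
  finally show ?thesis .
qed

lemma X_space_iff:
  fixes u :: "real ^ 'n \<Rightarrow> real"
  assumes "finite_domain \<Omega> p"
  shows "u \<in> X_space p \<Omega> \<longleftrightarrow> u \<in> borel_measurable lebesgue \<and> (AE x in lebesgue. x \<notin> \<Omega> \<longrightarrow> u x = 0) \<and>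
     integrable (lebesgue_on \<Omega>) (\<lambda>x. \<bar>u x\<bar> powr p) \<and> integrable (lebesgue \<Otimes>\<^sub>M lebesgue) (\<lambda>z. total_kernel p \<Omega> z * \<bar>du u z\<bar> powr p)"
proof -
  interpret finite_domain \<Omega> p by fact
  have "X_seminorm_pow p u < \<infinity> \<longleftrightarrow> integrable P (\<lambda>z. total_kernel p \<Omega> z * \<bar>du u z\<bar> powr p)"
    if u [measurable]: "u \<in> borel_measurable lebesgue" "AE x in lebesgue. x \<notin> \<Omega> \<longrightarrow> u x = 0" "integrable M (\<lambda>x. \<bar>u x\<bar> powr p)"
  proof -
    have "integrable lebesgue (\<lambda>x. \<bar>u x\<bar> powr p)"
    proof (rule integrable_extend(1)[OF _ _ u(3)])
      show "AE x in lebesgue. x \<notin> \<Omega> \<longrightarrow> \<bar>u x\<bar> powr p = 0" using u(2) by eventually_elim simp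
    qed measurable
    from total_integrable_iff[OF u(1) this] show ?thesis
      unfolding X_seminorm_pow_eq[OF u(1) p] by (auto simp: ennreal_mult_less_top)
  qed
  then show ?thesis unfolding X_space_def by auto
qed

text \<open>Expanding \<open>Upsilon\<close> gives the kernel form of the far region minus one
  multiplication term at each of the two points. Those two integrals agree by symmetry, which
  cancels the factor one half and leaves the potential; the zero order term of the form joins
  it.\<close>

lemma E_form_eq:
  fixes u v :: "real ^ 'n \<Rightarrow> real"
  assumes fd: "finite_domain \<Omega> p" and u: "u \<in> X_space p \<Omega>" and v: "v \<in> X_space p \<Omega>"
  shows "E_form p u v = (\<integral>z. total_kernel p \<Omega> z * (h p (du u z) * du v z) \<partial>(lebesgue \<Otimes>\<^sub>M lebesgue))
    - (\<integral>x. (C_const CARD('n) p * far_mass \<Omega> x - rho_const CARD('n) p) * (h p (u x) * v x) \<partial>lebesgue_on \<Omega>)"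
proof -
  interpret finite_domain \<Omega> p by fact
  define C where "C = C_const CARD('n) p"
  have C: "0 < C" using C_pos by (simp add: C_def)
  have u' [measurable]: "u \<in> borel_measurable lebesgue" and u0: "AE x in lebesgue. x \<notin> \<Omega> \<longrightarrow> u x = 0" and
    uL: "integrable M (\<lambda>x. \<bar>u x\<bar> powr p)" and uQ: "integrable P (\<lambda>z. total_kernel p \<Omega> z * \<bar>du u z\<bar> powr p)"
    using u unfolding X_space_iff[OF fd] by auto
  have v' [measurable]: "v \<in> borel_measurable lebesgue" and v0: "AE x in lebesgue. x \<notin> \<Omega> \<longrightarrow> v x = 0" and
    vL: "integrable M (\<lambda>x. \<bar>v x\<bar> powr p)" and vQ: "integrable P (\<lambda>z. total_kernel p \<Omega> z * \<bar>du v z\<bar> powr p)"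
    using v unfolding X_space_iff[OF fd] by auto
  define w where "w x = h p (u x) * v x" for x
  have w [measurable]: "w \<in> borel_measurable lebesgue" unfolding w_def[abs_def] by measurable
  have w0: "AE x in lebesgue. x \<notin> \<Omega> \<longrightarrow> w x = 0" using v0 by eventually_elim (simp add: w_def)
  have wM: "integrable M w"
  proof (rule Bochner_Integration.integrable_bound[OF Bochner_Integration.integrable_add[OF uL vL]])
    show "w \<in> borel_measurable M" by (rule measurable_restrict_space1[OF w])
    show "AE x in M. norm (w x) \<le> norm (\<bar>u x\<bar> powr p + \<bar>v x\<bar> powr p)"
      unfolding w_def using abs_h_mult_le[OF p] by (intro AE_I2) simp
  qed
  have wL: "integrable lebesgue w" and w_eq: "(\<integral>x. w x \<partial>lebesgue) = (\<integral>x. w x \<partial>M)"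
    by (rule integrable_extend[OF w w0 wM])+
  have fw_eq: "(\<integral>x. far_mass \<Omega> x * w x \<partial>lebesgue) = (\<integral>x. far_mass \<Omega> x * w x \<partial>M)"
    and fwM: "integrable M (\<lambda>x. far_mass \<Omega> x * w x)"
  proof -
    show fwM: "integrable M (\<lambda>x. far_mass \<Omega> x * w x)"
    proof (rule Bochner_Integration.integrable_bound[OF integrable_mult_right[OF wM, of "measure lebesgue \<Omega>"]])
      show "(\<lambda>x. far_mass \<Omega> x * w x) \<in> borel_measurable M"
        by (rule measurable_restrict_space1) measurable
      show "AE x in M. norm (far_mass \<Omega> x * w x) \<le> norm (measure lebesgue \<Omega> * w x)"
        using far_mass_bounds by (intro AE_I2) (simp add: abs_mult mult_right_mono)
    qed
    show "(\<integral>x. far_mass \<Omega> x * w x \<partial>lebesgue) = (\<integral>x. far_mass \<Omega> x * w x \<partial>M)"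
    proof (rule integrable_extend(2)[OF _ _ fwM])
      show "AE x in lebesgue. x \<notin> \<Omega> \<longrightarrow> far_mass \<Omega> x * w x = 0" by (simp add: far_mass_zero)
    qed measurable
  qed
  define D where "D z = h p (du u z) * du v z" for z
  have D [measurable]: "D \<in> borel_measurable P" unfolding D_def[abs_def] by measurable
  have tD: "integrable P (\<lambda>z. total_kernel p \<Omega> z * D z)"
  proof (rule Bochner_Integration.integrable_bound[OF Bochner_Integration.integrable_add[OF uQ vQ]])
    show "AE z in P. norm (total_kernel p \<Omega> z * D z) \<le> norm (total_kernel p \<Omega> z * \<bar>du u z\<bar> powr p + total_kernel p \<Omega> z * \<bar>du v z\<bar> powr p)"
    proof (rule AE_I2)
      fix z
      have "total_kernel p \<Omega> z * \<bar>D z\<bar> \<le> total_kernel p \<Omega> z * (\<bar>du u z\<bar> powr p + \<bar>du v z\<bar> powr p)"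
        unfolding D_def by (intro mult_left_mono abs_h_mult_le p total_kernel_nonneg)
      then show "norm (total_kernel p \<Omega> z * D z) \<le> norm (total_kernel p \<Omega> z * \<bar>du u z\<bar> powr p + total_kernel p \<Omega> z * \<bar>du v z\<bar> powr p)"
        using total_kernel_nonneg[of z] by (simp add: abs_mult distrib_left)
    qed
  qed measurable
  have fD: "integrable P (\<lambda>z. far_kernel \<Omega> z * D z)"
  proof (rule Bochner_Integration.integrable_bound[OF integrable_mult_right[OF tD, of "2 / C"]])
    show "AE z in P. norm (far_kernel \<Omega> z * D z) \<le> norm (2 / C * (total_kernel p \<Omega> z * D z))"
    proof (rule AE_I2)
      fix z
      have "far_kernel \<Omega> z \<le> 2 / C * total_kernel p \<Omega> z"
        using C by (simp add: total_kernel_def C_def)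
      then have "far_kernel \<Omega> z * \<bar>D z\<bar> \<le> 2 / C * total_kernel p \<Omega> z * \<bar>D z\<bar>" by (rule mult_right_mono) simp
      then show "norm (far_kernel \<Omega> z * D z) \<le> norm (2 / C * (total_kernel p \<Omega> z * D z))"
        using C total_kernel_nonneg[of z] by (simp add: abs_mult mult.assoc)
    qed
  qed measurable
  define N where "N z = inv_kernel (fst z) (snd z) * indicator near_region z" for z :: "(real ^ 'n) \<times> (real ^ 'n)"
  have tNf: "total_kernel p \<Omega> z = C / 2 * (N z + far_kernel \<Omega> z)" for z
    by (simp add: total_kernel_def N_def C_def)
  \<comment> \<open>The near part is recovered as a difference, since the total and the far kernel
    are both already integrable against \<open>D\<close>.\<close>
  have nD: "integrable P (\<lambda>z. N z * D z)"
  proof -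
    have "N z * D z = 2 / C * (total_kernel p \<Omega> z * D z) - far_kernel \<Omega> z * D z" for z
      using C unfolding tNf by (simp add: algebra_simps)
    then show ?thesis by (simp only:) (intro Bochner_Integration.integrable_diff integrable_mult_right tD fD)
  qed
  have near: "set_lebesgue_integral P {(x, y). norm (x - y) \<le> 1} (\<lambda>(x, y). h p (u x - u y) * (v x - v y) / norm (x - y) ^ CARD('n))
    = (\<integral>z. N z * D z \<partial>P)"
    unfolding set_lebesgue_integral_def
    by (rule Bochner_Integration.integral_cong) (auto simp: N_def D_def du_def inv_kernel_def near_region_def indicator_def)
  have far: "set_lebesgue_integral P {(x, y). 1 \<le> norm (x - y)} (\<lambda>(x, y). Upsilon p (u x) (u y) (v x) (v y) / norm (x - y) ^ CARD('n))
    = (\<integral>z. far_kernel \<Omega> z * D z - far_kernel \<Omega> z * w (fst z) - far_kernel \<Omega> z * w (snd z) \<partial>P)"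
    unfolding set_lebesgue_integral_def
  proof (rule integral_cong_AE)
    have "{z \<in> space P. 1 \<le> norm (fst z - snd z)} \<in> sets P" by measurable
    then have [measurable]: "{z :: (real ^ 'n) \<times> (real ^ 'n). 1 \<le> norm (fst z - snd z)} \<in> sets P" by (simp add: space_pair_measure)
    have "(\<lambda>z. indicator {z. 1 \<le> norm (fst z - snd z)} z * (Upsilon p (u (fst z)) (u (snd z)) (v (fst z)) (v (snd z)) / norm (fst z - snd z) ^ CARD('n))) \<in> borel_measurable P"
      unfolding Upsilon_def by measurable
    then show "(\<lambda>z. indicator {(x, y). 1 \<le> norm (x - y)} z *\<^sub>R (case z of (x, y) \<Rightarrow> Upsilon p (u x) (u y) (v x) (v y) / norm (x - y) ^ CARD('n))) \<in> borel_measurable P"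
      by (simp add: case_prod_beta')
    show "(\<lambda>z. far_kernel \<Omega> z * D z - far_kernel \<Omega> z * w (fst z) - far_kernel \<Omega> z * w (snd z)) \<in> borel_measurable P"
      by measurable
    show "AE z in P. indicator {(x, y). 1 \<le> norm (x - y)} z *\<^sub>R (case z of (x, y) \<Rightarrow> Upsilon p (u x) (u y) (v x) (v y) / norm (x - y) ^ CARD('n))
       = far_kernel \<Omega> z * D z - far_kernel \<Omega> z * w (fst z) - far_kernel \<Omega> z * w (snd z)"
      using AE_fst_snd[OF u0] AE_fst_snd[OF v0]
    proof eventually_elim
      case (elim z)
      obtain x y where z: "z = (x, y)" by force
      show ?case
      proof (cases "x \<in> \<Omega> \<and> y \<in> \<Omega>")
        case True
        then show ?thesis
          by (auto simp: z far_kernel_def far_region_def inv_kernel_def indicator_def Upsilon_def D_def w_def du_def diff_divide_distrib)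
      next
        \<comment> \<open>If, say, \<open>y\<close> lies outside \<open>\<Omega>\<close>, then
          \<open>u y\<close> and \<open>v y\<close> are 0 for almost every such pair, and
          \<open>Upsilon\<close> reduces to
          \<open>h p (u x) * v x - h p (u x) * v x\<close>.\<close>
        case False
        then have "far_kernel \<Omega> z = 0" by (auto simp: far_kernel_def far_region_def z)
        moreover have "Upsilon p (u x) (u y) (v x) (v y) = 0"
          using False elim by (auto simp: z Upsilon_def)
        ultimately show ?thesis by (simp add: z)
      qed
    qed
  qed
  have "(\<integral>z. far_kernel \<Omega> z * D z - far_kernel \<Omega> z * w (fst z) - far_kernel \<Omega> z * w (snd z) \<partial>P)
    = (\<integral>z. far_kernel \<Omega> z * D z \<partial>P) - (\<integral>z. far_kernel \<Omega> z * w (fst z) \<partial>P) - (\<integral>z. far_kernel \<Omega> z * w (snd z) \<partial>P)"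
    by (simp add: Bochner_Integration.integral_diff fD far_integral[OF wL] Bochner_Integration.integrable_diff)
  also have "\<dots> = (\<integral>z. far_kernel \<Omega> z * D z \<partial>P) - 2 * (\<integral>x. far_mass \<Omega> x * w x \<partial>M)"
    by (simp add: far_integral[OF wL] fw_eq)
  finally have far_eq: "(\<integral>z. far_kernel \<Omega> z * D z - far_kernel \<Omega> z * w (fst z) - far_kernel \<Omega> z * w (snd z) \<partial>P) = \<dots>" .
  have "(\<integral>z. total_kernel p \<Omega> z * D z \<partial>P) = (\<integral>z. C / 2 * (N z * D z) + C / 2 * (far_kernel \<Omega> z * D z) \<partial>P)"
    by (rule Bochner_Integration.integral_cong) (auto simp: tNf algebra_simps)
  also have "\<dots> = C / 2 * (\<integral>z. N z * D z \<partial>P) + C / 2 * (\<integral>z. far_kernel \<Omega> z * D z \<partial>P)"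
    using nD fD by (subst Bochner_Integration.integral_add) auto
  finally have tot: "(\<integral>z. total_kernel p \<Omega> z * D z \<partial>P) = \<dots>" .
  have "(\<integral>x. (C * far_mass \<Omega> x - rho_const CARD('n) p) * w x \<partial>M)
    = (\<integral>x. C * (far_mass \<Omega> x * w x) - rho_const CARD('n) p * w x \<partial>M)"
    by (rule Bochner_Integration.integral_cong) (auto simp: algebra_simps)
  also have "\<dots> = C * (\<integral>x. far_mass \<Omega> x * w x \<partial>M) - rho_const CARD('n) p * (\<integral>x. w x \<partial>M)"
    using fwM wM by (subst Bochner_Integration.integral_diff) auto
  finally have sing: "(\<integral>x. (C * far_mass \<Omega> x - rho_const CARD('n) p) * w x \<partial>M) = \<dots>" .
  have "E_form p u v = C / 2 * (\<integral>z. N z * D z \<partial>P) + C / 2 * ((\<integral>z. far_kernel \<Omega> z * D z \<partial>P) - 2 * (\<integral>x. far_mass \<Omega> x * w x \<partial>M))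
     + rho_const CARD('n) p * (\<integral>x. w x \<partial>M)"
    unfolding E_form_def near far far_eq C_def[symmetric] w_def[symmetric] w_eq by (rule refl)
  also have "\<dots> = (\<integral>z. total_kernel p \<Omega> z * D z \<partial>P) - (\<integral>x. (C * far_mass \<Omega> x - rho_const CARD('n) p) * w x \<partial>M)"
    unfolding tot sing by (simp add: algebra_simps)
  finally show ?thesis unfolding D_def w_def C_def .
qed

subsection \<open>The boundary value problem\<close>

lemma primitive_zero: "primitive g x 0 = 0"
  by (simp add: primitive_def)

text \<open>The interval \<open>{- b..b}\<close> has both 0 and \<open>t\<close> in its interior, so
  one application of the fundamental theorem covers both signs of \<open>t\<close>, and the
  derivative within the interval is the ordinary one.\<close>

lemma DERIV_primitive:
  assumes "continuous_on UNIV (g x)"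
  shows "(primitive g x has_real_derivative g x t) (at t)"
proof -
  define b where "b = \<bar>t\<bar> + 1"
  have "((\<lambda>u. LBINT y=ereal 0..ereal u. g x y) has_vector_derivative g x t) (at t within {- b..b})"
    by (rule interval_integral_FTC2) (auto simp: b_def intro: continuous_on_subset[OF assms])
  moreover have "at t within {- b..b} = at t"
    by (rule at_within_interior) (auto simp: b_def)
  ultimately show ?thesis
    unfolding has_real_derivative_iff_has_vector_derivative primitive_def[abs_def] by simp
qed

text \<open>Joint measurability comes from \<open>borel_measurable_caratheodory\<close> with the
  second coordinate as inner function; integrals depending on a parameter are then measurable. The
  two orientations of the interval are separated at the end.\<close>

lemma borel_measurable_primitive:
  fixes g :: "'a \<Rightarrow> real \<Rightarrow> real"
  assumes g: "\<And>t. (\<lambda>x. g x t) \<in> borel_measurable M" and cont: "\<And>x t. x \<in> space M \<Longrightarrow> isCont (g x) t"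
  shows "(\<lambda>x. primitive g x t) \<in> borel_measurable M"
proof -
  have joint: "(\<lambda>z. g (fst z) (snd z)) \<in> borel_measurable (M \<Otimes>\<^sub>M lborel)"
  proof (rule borel_measurable_caratheodory[where f = "\<lambda>z. g (fst z)" and w = snd])
    show "(\<lambda>z. g (fst z) t) \<in> borel_measurable (M \<Otimes>\<^sub>M lborel)" for t
      by (rule measurable_compose[OF measurable_fst g])
    show "isCont (g (fst z)) t" if "z \<in> space (M \<Otimes>\<^sub>M lborel)" for z t
      using that by (intro cont) (auto simp: space_pair_measure)
    show "snd \<in> borel_measurable (M \<Otimes>\<^sub>M lborel)" by measurable
  qed
  have "(\<lambda>x. LINT y:S|lborel. g x y) \<in> borel_measurable M" if [measurable]: "S \<in> sets borel" for S
    unfolding set_lebesgue_integral_def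
  proof (rule lborel.borel_measurable_lebesgue_integral)
    have "(\<lambda>z. indicator S (snd z) * g (fst z) (snd z)) \<in> borel_measurable (M \<Otimes>\<^sub>M lborel)"
      using joint by measurable
    then show "(\<lambda>(x, y). indicator S y *\<^sub>R g x y) \<in> borel_measurable (M \<Otimes>\<^sub>M lborel)"
      by (simp add: case_prod_beta')
  qed
  then show ?thesis
    unfolding primitive_def interval_lebesgue_integral_def
    by (cases "ereal 0 \<le> ereal t") auto
qed

text \<open>Completeness of Lebesgue measure. It gives measurability of compositions with the
  original nonlinearity, which is well behaved only off a null set.\<close>

lemma borel_measurable_lebesgue_on_AE:
  fixes \<phi> :: "'a::euclidean_space \<Rightarrow> real"
  assumes S: "S \<in> sets lebesgue" and \<phi>: "\<phi> \<in> borel_measurable (lebesgue_on S)"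
    and ae: "AE x in lebesgue_on S. \<phi> x = \<psi> x"
  shows "\<psi> \<in> borel_measurable (lebesgue_on S)"
proof -
  have "(\<lambda>x. if x \<in> S then \<phi> x else 0) \<in> borel_measurable lebesgue"
    using \<phi> S by (simp add: borel_measurable_if)
  moreover have "AE x in lebesgue. x \<in> S \<longrightarrow> \<phi> x = \<psi> x"
    using ae S by (subst (asm) AE_restrict_space_iff) auto
  then have "AE x in lebesgue. (if x \<in> S then \<phi> x else 0) = (if x \<in> S then \<psi> x else 0)"
    by eventually_elim simp
  ultimately have "(\<lambda>x. if x \<in> S then \<psi> x else 0) \<in> borel_measurable lebesgue"
    by (rule borel_measurable_AE)
  then show ?thesis using S by (simp add: borel_measurable_if)
qed

section \<open>The boundary value problem as an instance of the variational problem\<close>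

theorem theorem2p12:
  fixes p \<mu> :: real and \<Omega> :: "(real ^ 'n) set" and g :: "real ^ 'n \<Rightarrow> real \<Rightarrow> real"
  assumes p: "1 < p"
    and \<Omega>: "bounded_lipschitz_domain \<Omega>"
    and \<mu>: "0 < \<mu>" "\<mu> < p\<^sup>2 / real CARD('n)"
    and g: "caratheodory \<Omega> g"
    and g1: "\<And>K. compact K \<Longrightarrow> L_infty (lebesgue_on (\<Omega> \<times> K)) (\<lambda>(x, t). g x t)"
    and g2: "uniform_limit_AE (lebesgue_on \<Omega>) (\<lambda>t x. g x t / (h p t * ln \<bar>t\<bar>)) (\<lambda>x. 0) at_infinity"
    and g3: "\<exists>f. L_infty (lebesgue_on \<Omega>) f \<and>
               uniform_limit_AE (lebesgue_on \<Omega>) (\<lambda>t x. g x t / h p t) f (at 0)"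
    and g4: "AE x in lebesgue_on \<Omega>. g x C1_differentiable_on UNIV"
            "\<exists>\<delta><\<mu>. AE x in lebesgue_on \<Omega>. \<forall>t.
               t\<^sup>2 * deriv (g x) t + \<delta> * \<bar>t\<bar> powr p - (p - 1) * t * g x t \<ge> 0"
    and g5: "uniform_limit_AE (lebesgue_on \<Omega>)
               (\<lambda>t x. t * deriv (g x) t / (h p t * ln \<bar>t\<bar>)) (\<lambda>x. 0) at_infinity"
  shows "(\<exists>u. least_energy_solution p \<mu> \<Omega> g u \<and> nontrivial u) \<and>
         ((AE x in lebesgue_on \<Omega>. \<forall>t. primitive g x t \<le> primitive g x \<bar>t\<bar>) \<longrightarrow>
          (\<forall>u. least_energy_solution p \<mu> \<Omega> g u \<longrightarrow> constant_sign \<Omega> u))"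
proof -
  have \<Omega>_props: "open \<Omega>" "\<Omega> \<noteq> {}" "bounded \<Omega>" using \<Omega> by (auto simp: bounded_lipschitz_domain_def)
  have fd: "finite_domain \<Omega> p"
  proof
    show "\<Omega> \<in> sets lebesgue" using \<Omega>_props(1) by (intro sets_completionI_sets) auto
    show "emeasure lebesgue \<Omega> < \<infinity>"
      using emeasure_bounded_finite[OF \<Omega>_props(3)] \<Omega>_props(1) by (simp add: emeasure_completion main_part_sets)
  qed (rule p)
  interpret D: finite_domain \<Omega> p by (rule fd)
  note \<Omega>_sets [measurable] = D.\<Omega>_sets
  let ?M = "lebesgue_on \<Omega>"
  \<comment> \<open>The slope allowed for \<open>H\<close> lies midway between \<open>\<mu>\<close>
    and the threshold, with a gap on either side.\<close>
  define m where "m = (\<mu> + p\<^sup>2 / real CARD('n)) / 2"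
  have "\<mu> < (\<mu> + d) / 2 \<and> (\<mu> + d) / 2 < d" if "\<mu> < d" for d using that by (auto simp: field_simps)
  from this[OF \<mu>(2)] have m: "\<mu> < m" "m < p\<^sup>2 / real CARD('n)" unfolding m_def by blast+
  \<comment> \<open>The slope to which \<open>g\<close> is reduced at infinity: as small as the
    upper and the lower growth bound of \<open>H\<close> each demand.\<close>
  define \<eta> where "\<eta> = min ((m - \<mu>) / (2 * p)) (\<mu> / (2 * p))"
  have \<eta>: "0 < \<eta>" "\<eta> \<le> (m - \<mu>) / (2 * p)" "\<eta> \<le> \<mu> / (2 * p)" using m(1) \<mu>(1) p by (auto simp: \<eta>_def)

  obtain Z2 where Z2: "Z2 \<in> null_sets ?M" "uniform_limit (space ?M - Z2) (\<lambda>t x. g x t / (h p t * ln \<bar>t\<bar>)) (\<lambda>x. 0) at_infinity"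
    using g2 unfolding uniform_limit_AE_def by blast
  from uniform_limitD[OF Z2(2) \<eta>(1)] obtain b where b: "\<And>t x. b \<le> norm t \<Longrightarrow> x \<in> space ?M - Z2 \<Longrightarrow> dist (g x t / (h p t * ln \<bar>t\<bar>)) 0 < \<eta>"
    unfolding eventually_at_infinity by blast
  \<comment> \<open>At least 2, so that \<open>ln \<bar>t\<bar>\<close> is positive where the
    quotient is cleared.\<close>
  define T where "T = max 2 b"
  have T: "1 \<le> T" "2 \<le> T" "b \<le> T" by (auto simp: T_def)
  have large: "\<bar>g x t\<bar> \<le> \<eta> * (\<bar>t\<bar> powr (p - 1) * ln \<bar>t\<bar>)" if x: "x \<in> \<Omega>" "x \<notin> Z2" and t: "T \<le> \<bar>t\<bar>" for x t
  proof -
    have pos: "0 < \<bar>t\<bar> powr (p - 1) * ln \<bar>t\<bar>" using t T by (intro mult_pos_pos) auto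
    have "\<bar>g x t / (h p t * ln \<bar>t\<bar>)\<bar> < \<eta>" using b[of t x] x t T by simp
    moreover have "\<bar>h p t * ln \<bar>t\<bar>\<bar> = \<bar>t\<bar> powr (p - 1) * ln \<bar>t\<bar>" using t T by (simp add: abs_mult abs_h)
    ultimately have "\<bar>g x t\<bar> / (\<bar>t\<bar> powr (p - 1) * ln \<bar>t\<bar>) < \<eta>" by (simp only: abs_divide)
    then show ?thesis using pos by (simp add: pos_divide_less_eq)
  qed

  obtain f0 Cf Z3 where f0: "AE x in ?M. \<bar>f0 x\<bar> \<le> Cf" and Z3: "Z3 \<in> null_sets ?M" "uniform_limit (space ?M - Z3) (\<lambda>t x. g x t / h p t) f0 (at 0)"
    using g3 unfolding uniform_limit_AE_def L_infty_def by blast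
  from uniform_limitD[OF Z3(2) zero_less_one] obtain d where d: "0 < d" "\<And>t x. t \<noteq> 0 \<Longrightarrow> dist t 0 < d \<Longrightarrow> x \<in> space ?M - Z3 \<Longrightarrow> dist (g x t / h p t) (f0 x) < 1"
    unfolding eventually_at by blast
  define s0 where "s0 = min 1 (d / 2)"
  have s0: "0 < s0" "s0 \<le> 1" "s0 < d" using d(1) by (auto simp: s0_def)
  \<comment> \<open>Near 0 the quotient differs from \<open>f0\<close> by less than 1; the
    \<open>max\<close> makes the constant nonnegative whatever the sign of the essential bound
    \<open>Cf\<close>.\<close>
  define C0 where "C0 = max 0 Cf + 1"
  have C0: "0 \<le> C0" by (simp add: C0_def)
  have small: "\<bar>g x t\<bar> \<le> C0 * \<bar>t\<bar> powr (p - 1)" if x: "x \<in> \<Omega>" "x \<notin> Z3" "\<bar>f0 x\<bar> \<le> Cf" and t: "t \<noteq> 0" "\<bar>t\<bar> \<le> s0" for x t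
  proof -
    have "\<bar>g x t / h p t - f0 x\<bar> < 1" using d(2)[of t x] x t s0 by (simp add: dist_real_def)
    then have "\<bar>g x t / h p t\<bar> \<le> C0" using x(3) unfolding C0_def by linarith
    moreover have "0 < \<bar>h p t\<bar>" using t by (simp add: abs_h)
    ultimately show ?thesis by (simp add: abs_divide abs_h pos_divide_le_eq)
  qed

  obtain \<delta>0 where \<delta>0: "\<delta>0 < \<mu>" "AE x in ?M. \<forall>t. t\<^sup>2 * deriv (g x) t + \<delta>0 * \<bar>t\<bar> powr p - (p - 1) * t * g x t \<ge> 0"
    using g4(2) by blast
  \<comment> \<open>A nonnegative \<open>\<delta>\<close> is still below \<open>\<mu>\<close>, and
    it keeps the inequality true on the exceptional set, where the nonlinearity is replaced by
    0.\<close>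
  define \<delta> where "\<delta> = max 0 \<delta>0"
  have \<delta>: "0 \<le> \<delta>" "\<delta>0 \<le> \<delta>" "\<delta> < \<mu>" using \<delta>0(1) \<mu>(1) by (auto simp: \<delta>_def)

  define even_bound where "even_bound x \<longleftrightarrow> (\<forall>t. primitive g x t \<le> primitive g x \<bar>t\<bar>)" for x
  \<comment> \<open>The clause on \<open>even_bound\<close> is an implication, so that one null set
    serves both claims of the theorem: it is vacuous unless the symmetry condition holds almost
    everywhere.\<close>
  define good where "good x \<longleftrightarrow> x \<notin> Z2 \<and> x \<notin> Z3 \<and> \<bar>f0 x\<bar> \<le> Cf \<and> g x C1_differentiable_on UNIV
     \<and> (\<forall>t. t\<^sup>2 * deriv (g x) t + \<delta>0 * \<bar>t\<bar> powr p - (p - 1) * t * g x t \<ge> 0)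
     \<and> ((AE x in ?M. even_bound x) \<longrightarrow> even_bound x)" for x
  have "AE x in ?M. (AE x in ?M. even_bound x) \<longrightarrow> even_bound x"
    by (cases "AE x in ?M. even_bound x") auto
  then have "AE x in ?M. good x"
    using AE_not_in[OF Z2(1)] AE_not_in[OF Z3(1)] f0 g4(1) \<delta>0(2)
    unfolding good_def by eventually_elim blast
  then obtain Z where Z: "Z \<in> null_sets ?M" "{x \<in> space ?M. \<not> good x} \<subseteq> Z"
    unfolding eventually_ae_filter by blast
  have good: "good x" if "x \<in> \<Omega>" "x \<notin> Z" for x using Z(2) that by auto
  have Z_sets [measurable]: "Z \<in> sets ?M" using Z(1) by auto
  have AE_Z: "AE x in ?M. x \<notin> Z" by (rule AE_not_in[OF Z(1)])

  \<comment> \<open>Setting \<open>g\<close> to 0 on the exceptional null set turns the almost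
    everywhere hypotheses into hypotheses at every point of \<open>\<Omega>\<close> without changing
    any integral over \<open>\<Omega>\<close>.\<close>
  define g0 where "g0 x t = (if x \<in> Z then 0 else g x t)" for x t
  define g0' where "g0' x t = (if x \<in> Z then 0 else deriv (g x) t)" for x t
  have g0_deriv: "(g0 x has_real_derivative g0' x t) (at t)" if "x \<in> \<Omega>" for x t
  proof (cases "x \<in> Z")
    case True
    then show ?thesis by (simp add: g0_def[abs_def] g0'_def)
  next
    case False
    then have "g x C1_differentiable_on UNIV" using good[OF that] by (simp add: good_def)
    then obtain G where "(g x has_vector_derivative G t) (at t)"
      unfolding C1_differentiable_on_def by blast
    then have "(g x has_real_derivative G t) (at t)" by (simp add: has_real_derivative_iff_has_vector_derivative)
    then have "(g x has_real_derivative deriv (g x) t) (at t)" by (simp add: DERIV_imp_deriv)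
    then show ?thesis using False by (simp add: g0_def[abs_def] g0'_def)
  qed
  have g0_cont: "isCont (g0 x) t" if "x \<in> \<Omega>" for x t by (rule DERIV_isCont[OF g0_deriv[OF that]])
  have g0_cont': "continuous_on UNIV (g0 x)" if "x \<in> \<Omega>" for x
    using g0_cont[OF that] by (simp add: continuous_at_imp_continuous_on)
  have g0_meas: "(\<lambda>x. g0 x t) \<in> borel_measurable ?M" for t
  proof -
    have [measurable]: "(\<lambda>x. g x t) \<in> borel_measurable ?M" using g by (simp add: caratheodory_def)
    show ?thesis unfolding g0_def by measurable
  qed
  have g0_ray: "s * g0 x s \<le> s * g0 x (\<tau> * s) * \<tau> powr (1 - p) + \<delta> * \<bar>s\<bar> powr p * ln \<tau>"
    if x: "x \<in> \<Omega>" and \<tau>: "1 \<le> \<tau>" for x s \<tau>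
  proof (rule ray_monotone[where \<gamma> = "g0 x" and \<gamma>' = "g0' x", OF g0_deriv[OF x] _ \<tau>])
    fix t
    have le: "\<delta>0 * \<bar>t\<bar> powr p \<le> \<delta> * \<bar>t\<bar> powr p" using \<delta>(2) by (intro mult_right_mono) auto
    show "0 \<le> t\<^sup>2 * g0' x t + \<delta> * \<bar>t\<bar> powr p - (p - 1) * t * g0 x t"
    proof (cases "x \<in> Z")
      case True
      then show ?thesis using \<delta>(1) by (simp add: g0_def g0'_def)
    next
      case False
      then have "0 \<le> t\<^sup>2 * deriv (g x) t + \<delta>0 * \<bar>t\<bar> powr p - (p - 1) * t * g x t" using good[OF x] by (simp add: good_def)
      then show ?thesis using le False by (simp add: g0_def g0'_def)
    qed
  qed
  define B where "B = C0 + \<eta> * ln T + \<bar>\<delta>\<bar> * ln (T / s0)"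
  have B: "0 \<le> B"
    unfolding B_def using C0 \<eta>(1) T s0 by (intro add_nonneg_nonneg mult_nonneg_nonneg ln_ge_zero) (auto simp: pos_le_divide_eq)
  have g0_bound: "\<bar>g0 x t\<bar> \<le> \<bar>t\<bar> powr (p - 1) * (B + \<eta> * lnp t)" if x: "x \<in> \<Omega>" for x t
    unfolding B_def
  proof (rule nonlinearity_bound[OF p s0(1,2) T(1) C0 less_imp_le[OF \<eta>(1)] g0_cont[OF x]])
    show "\<bar>g0 x t\<bar> \<le> C0 * \<bar>t\<bar> powr (p - 1)" if "t \<noteq> 0" "\<bar>t\<bar> \<le> s0" for t
      using small[OF x _ _ that] good[OF x] C0 by (auto simp: g0_def good_def)
    show "\<bar>g0 x t\<bar> \<le> \<eta> * (\<bar>t\<bar> powr (p - 1) * ln \<bar>t\<bar>)" if "T \<le> \<bar>t\<bar>" for t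
      using large[OF x _ that] good[OF x] \<eta>(1) T(1) that by (auto simp: g0_def good_def)
    show "s * g0 x s \<le> s * g0 x (\<tau> * s) * \<tau> powr (1 - p) + \<delta> * \<bar>s\<bar> powr p * ln \<tau>" if "1 \<le> \<tau>" for s \<tau>
      by (rule g0_ray[OF x that])
  qed
  have G0_deriv: "(primitive g0 x has_real_derivative g0 x t) (at t)" if "x \<in> \<Omega>" for x t
    by (rule DERIV_primitive[of g0, OF g0_cont'[OF that]])
  have G0_meas: "(\<lambda>x. primitive g0 x t) \<in> borel_measurable ?M" for t
    by (rule borel_measurable_primitive[OF g0_meas]) (simp add: g0_cont)
  have G0_bound: "\<bar>primitive g0 x t\<bar> \<le> \<bar>t\<bar> powr p * (B + \<eta> * lnp t)" if x: "x \<in> \<Omega>" for x t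
  proof -
    obtain c where c: "\<bar>c - 0\<bar> \<le> \<bar>1 * t\<bar>" "primitive g0 x (0 + 1 * t) - primitive g0 x 0 = g0 x c * (1 * t)"
      using difference_quotient[OF G0_deriv[OF x]] by blast
    then have "\<bar>primitive g0 x t\<bar> = \<bar>g0 x c\<bar> * \<bar>t\<bar>" by (simp add: primitive_zero abs_mult)
    also have "\<dots> \<le> \<bar>c\<bar> powr (p - 1) * (B + \<eta> * lnp c) * \<bar>t\<bar>" by (intro mult_right_mono g0_bound x) simp
    also have "\<dots> \<le> \<bar>t\<bar> powr (p - 1) * (B + \<eta> * lnp t) * \<bar>t\<bar>"
      using c(1) p B \<eta>(1) by (intro mult_right_mono mult_mono powr_mono2 add_left_mono mult_left_mono lnp_mono) auto
    also have "\<dots> = \<bar>t\<bar> powr p * (B + \<eta> * lnp t)" by (cases "t = 0") (auto simp: powr_diff)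
    finally show ?thesis .
  qed

  \<comment> \<open>The potential split off the energy form. It is bounded, and it enters the
    nonlinearity as \<open>k x * h p t\<close>.\<close>
  define k where "k x = C_const CARD('n) p * far_mass \<Omega> x - rho_const CARD('n) p" for x
  define kb where "kb = C_const CARD('n) p * measure lebesgue \<Omega> + \<bar>rho_const CARD('n) p\<bar>"
  have C_pos: "0 < C_const CARD('n) p" using D.C_pos by simp
  have k_bound: "\<bar>k x\<bar> \<le> kb" for x
  proof -
    have "0 \<le> C_const CARD('n) p * far_mass \<Omega> x" "C_const CARD('n) p * far_mass \<Omega> x \<le> C_const CARD('n) p * measure lebesgue \<Omega>"
      using C_pos D.far_mass_bounds[of x] by (auto intro: mult_left_mono)
    then show ?thesis unfolding k_def kb_def by linarith
  qed
  have kb: "0 \<le> kb" using k_bound[of 0] by linarith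
  have k_meas [measurable]: "k \<in> borel_measurable ?M"
    unfolding k_def[abs_def] by (intro measurable_restrict_space1) measurable
  define f where "f x t = g0 x t + k x * h p t + \<mu> * (h p t * ln \<bar>t\<bar>)" for x t
  define H where "H x t = primitive g0 x t + k x / p * \<bar>t\<bar> powr p + \<mu> / p\<^sup>2 * (\<bar>t\<bar> powr p * (ln (\<bar>t\<bar> powr p) - 1))" for x t

  interpret V: log_variational p \<Omega> "total_kernel p \<Omega>" f H
  proof
    show "1 < p" "\<Omega> \<in> sets lebesgue" "emeasure lebesgue \<Omega> < \<infinity>" by (rule p D.\<Omega>_sets D.\<Omega>_fin)+
    show "total_kernel p \<Omega> \<in> borel_measurable (lebesgue \<Otimes>\<^sub>M lebesgue)" "\<And>z. 0 \<le> total_kernel p \<Omega> z"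
      by (rule D.total_kernel_meas D.total_kernel_nonneg)+
    show "C_const DIM(real ^ 'n) p / 2 * inv_kernel (fst z) (snd z) \<le> total_kernel p \<Omega> z" if "z \<in> near_region" for z
      unfolding total_kernel_def using that D.C_pos by (intro mult_left_mono) auto
    show "0 < total_kernel p \<Omega> (x, y)" if "x \<in> \<Omega>" "y \<in> \<Omega>" "x \<noteq> y" for x y
    proof -
      have inv: "0 < inv_kernel x y" using that by (simp add: inv_kernel_def)
      have "0 < inv_kernel x y * indicator near_region (x, y) + far_kernel \<Omega> (x, y)"
      proof (cases "norm (x - y) \<le> 1")
        case True
        then show ?thesis using inv by (simp add: near_region_def add_pos_nonneg)
      next
        case False
        then show ?thesis using inv that by (simp add: near_region_def far_kernel_def far_region_def)
      qed
      then show ?thesis unfolding total_kernel_def fst_conv snd_conv by (intro mult_pos_pos half_gt_zero D.C_pos)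
    qed
    show "(\<lambda>x. f x t) \<in> borel_measurable ?M" for t
      unfolding f_def using g0_meas[of t] by measurable
    show "(\<lambda>x. H x t) \<in> borel_measurable ?M" for t
      unfolding H_def using G0_meas[of t] by measurable
    show "isCont (f x) t" if "x \<in> \<Omega>" for x t
      unfolding f_def by (intro continuous_intros g0_cont that isCont_h isCont_h_ln p)
    show "(H x has_real_derivative f x t) (at t)" if "x \<in> \<Omega>" for x t
      unfolding f_def H_def[abs_def] by (rule total_deriv[OF p G0_deriv[OF that]])
    show "H x 0 = 0" if "x \<in> \<Omega>" for x by (simp add: H_def primitive_zero)
    show "\<exists>C\<ge>0. \<forall>x\<in>\<Omega>. \<forall>t. \<bar>f x t\<bar> \<le> C * (1 + \<bar>t\<bar> powr (p - 1) * (1 + lnp t))"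
    proof (intro exI conjI ballI allI)
      show "0 \<le> B + \<eta> + kb + \<mu> + \<mu> / (p - 1)" using B \<eta>(1) kb \<mu>(1) p by (intro add_nonneg_nonneg) auto
      show "\<bar>f x t\<bar> \<le> (B + \<eta> + kb + \<mu> + \<mu> / (p - 1)) * (1 + \<bar>t\<bar> powr (p - 1) * (1 + lnp t))" if "x \<in> \<Omega>" for x t
        unfolding f_def by (rule total_growth[OF p less_imp_le[OF \<mu>(1)] B less_imp_le[OF \<eta>(1)] k_bound g0_bound[OF that]])
    qed
    \<comment> \<open>\<open>a1\<close> and \<open>a2\<close> are the thresholds for
      \<open>ln \<bar>t\<bar>\<close> in \<open>total_H_growth\<close>; from the level
      \<open>M1\<close> on both are exceeded and \<open>\<bar>t\<bar>\<close> is at least 1.\<close>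
    define a1 where "a1 = (B + kb / p) * (2 * p) / (m - \<mu>)"
    define a2 where "a2 = (B + kb / p + \<mu> / p\<^sup>2) * (2 * p) / \<mu>"
    define M1 where "M1 = exp (max 0 (max a1 a2))"
    show "\<exists>m>0. \<exists>M1\<ge>1. m < p\<^sup>2 / DIM(real ^ 'n) \<and>
       (\<forall>x\<in>\<Omega>. \<forall>t. M1 \<le> \<bar>t\<bar> \<longrightarrow> 0 \<le> H x t \<and> H x t \<le> m / p * (\<bar>t\<bar> powr p * ln \<bar>t\<bar>))"
    proof (rule exI[of _ m], rule conjI, use m(1) \<mu>(1) in linarith, rule exI[of _ M1], intro conjI ballI allI impI)
      show M1: "1 \<le> M1" by (simp add: M1_def)
      show "m < p\<^sup>2 / DIM(real ^ 'n)" using m(2) by simp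
      fix x t assume x: "x \<in> \<Omega>" and t: "M1 \<le> \<bar>t\<bar>"
      have t1: "1 \<le> \<bar>t\<bar>" using M1 t by simp
      have "max 0 (max a1 a2) = ln M1" by (simp add: M1_def)
      also have "\<dots> \<le> ln \<bar>t\<bar>" using M1 t by (intro ln_mono) auto
      finally have t23: "a1 \<le> ln \<bar>t\<bar>" "a2 \<le> ln \<bar>t\<bar>" by auto
      show "0 \<le> H x t" "H x t \<le> m / p * (\<bar>t\<bar> powr p * ln \<bar>t\<bar>)"
        unfolding H_def
        by (rule total_H_growth[OF p \<mu>(1) m(1) k_bound \<eta>(2,3) G0_bound[OF x] B t1 t23[unfolded a1_def a2_def]])+
    qed
    show "\<exists>\<theta>>0. \<forall>x\<in>\<Omega>. \<forall>s \<tau>. 1 \<le> \<tau> \<longrightarrow> s * f x s + \<theta> * \<bar>s\<bar> powr p * ln \<tau> \<le> s * f x (\<tau> * s) * \<tau> powr (1 - p)"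
    proof (intro exI[of _ "\<mu> - \<delta>"] conjI ballI allI impI)
      show "0 < \<mu> - \<delta>" using \<delta>(3) by simp
      show "s * f x s + (\<mu> - \<delta>) * \<bar>s\<bar> powr p * ln \<tau> \<le> s * f x (\<tau> * s) * \<tau> powr (1 - p)"
        if "x \<in> \<Omega>" "1 \<le> \<tau>" for x s \<tau>
        unfolding f_def by (rule total_mono[OF p that(2) g0_ray[OF that]])
    qed
  qed

  have X: "X_space p \<Omega> = V.X"
    unfolding V.X_def using X_space_iff[OF fd] by blast

  have growth_g0: "\<exists>C\<ge>0. \<forall>x\<in>\<Omega>. \<forall>t. \<bar>g0 x t\<bar> \<le> C * (1 + \<bar>t\<bar> powr (p - 1) * (1 + lnp t))"
    using total_growth[OF p order_refl B less_imp_le[OF \<eta>(1)], of 0 0] g0_bound B \<eta>(1)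
    by (intro exI[of _ "B + \<eta>"]) auto
  have growth_k: "\<exists>C\<ge>0. \<forall>x\<in>\<Omega>. \<forall>t. \<bar>k x * h p t\<bar> \<le> C * (1 + \<bar>t\<bar> powr (p - 1) * (1 + lnp t))"
  proof (intro exI[of _ kb] conjI ballI allI)
    show "\<bar>k x * h p t\<bar> \<le> kb * (1 + \<bar>t\<bar> powr (p - 1) * (1 + lnp t))" for x t
      using total_growth[OF p order_refl order_refl order_refl k_bound, of 0 t x] by simp
  qed (rule kb)
  have growth_ln: "\<exists>C\<ge>0. \<forall>x\<in>\<Omega>. \<forall>t. \<bar>h p t * ln \<bar>t\<bar>\<bar> \<le> C * (1 + \<bar>t\<bar> powr (p - 1) * (1 + lnp t))"
  proof (intro exI[of _ "1 + 1 / (p - 1)"] conjI ballI allI)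
    show "0 \<le> 1 + 1 / (p - 1)" using p by simp
    show "\<bar>h p t * ln \<bar>t\<bar>\<bar> \<le> (1 + 1 / (p - 1)) * (1 + \<bar>t\<bar> powr (p - 1) * (1 + lnp t))" for t
      using total_growth[OF p zero_le_one order_refl order_refl, of 0 0 0 t] by simp
  qed
  have int_g: "integrable ?M (\<lambda>x. g0 x (u x) * v x)" if "u \<in> V.X" "v \<in> V.X" for u v
    by (rule V.integrable_growth[OF g0_meas g0_cont growth_g0 that])
  have int_k: "integrable ?M (\<lambda>x. k x * h p (u x) * v x)" if "u \<in> V.X" "v \<in> V.X" for u v
    by (rule V.integrable_growth[OF _ _ growth_k that]) (auto intro!: continuous_intros isCont_h p)
  have int_ln: "integrable ?M (\<lambda>x. h p (u x) * ln \<bar>u x\<bar> * v x)" if "u \<in> V.X" "v \<in> V.X" for u v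
    by (rule V.integrable_growth[OF _ _ growth_ln that]) (auto intro!: isCont_h_ln p)
  have g_g0: "(LINT x|?M. g x (u x) * v x) = (LINT x|?M. g0 x (u x) * v x)" if "u \<in> V.X" "v \<in> V.X" for u v
  proof (rule integral_cong_AE[OF _ borel_measurable_integrable[OF int_g[OF that]]])
    have ae: "AE x in ?M. g0 x (u x) * v x = g x (u x) * v x" using AE_Z by eventually_elim (simp add: g0_def)
    show "AE x in ?M. g x (u x) * v x = g0 x (u x) * v x" using AE_Z by eventually_elim (simp add: g0_def)
    show "(\<lambda>x. g x (u x) * v x) \<in> borel_measurable ?M"
      by (rule borel_measurable_lebesgue_on_AE[OF \<Omega>_sets borel_measurable_integrable[OF int_g[OF that]] ae])
  qed
  \<comment> \<open>The directional derivative of the abstract functional is the defect in the weak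
    equation: the potential inside \<open>f\<close> cancels the one split off the energy
    form.\<close>
  have weak_eq: "V.A u v - V.F u v = E_form p u v - ((LINT x|?M. g x (u x) * v x) + \<mu> * (LINT x|?M. h p (u x) * ln \<bar>u x\<bar> * v x))"
    if uv: "u \<in> V.X" "v \<in> V.X" for u v
  proof -
    have "V.F u v = (LINT x|?M. (g0 x (u x) * v x + k x * h p (u x) * v x) + \<mu> * (h p (u x) * ln \<bar>u x\<bar> * v x))"
      unfolding V.F_def by (rule Bochner_Integration.integral_cong) (auto simp: f_def algebra_simps)
    also have "\<dots> = (LINT x|?M. g0 x (u x) * v x) + (LINT x|?M. k x * h p (u x) * v x) + \<mu> * (LINT x|?M. h p (u x) * ln \<bar>u x\<bar> * v x)"
      using int_g[OF uv] int_k[OF uv] int_ln[OF uv]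
      by (subst Bochner_Integration.integral_add, simp, simp, subst Bochner_Integration.integral_add) auto
    finally have F: "V.F u v = \<dots>" .
    have "E_form p u v = V.A u v - (LINT x|?M. k x * (h p (u x) * v x))"
      using E_form_eq[OF fd, of u v] uv unfolding X V.A_def k_def by simp
    then show ?thesis unfolding F g_g0[OF uv] by (simp add: mult.assoc)
  qed
  have hu: "h p (u x) * ln \<bar>u x\<bar> * u x = \<bar>u x\<bar> powr p * ln \<bar>u x\<bar>" for u :: "real ^ 'n \<Rightarrow> real" and x
    using h_mult_self[of p "u x"] by (metis mult.assoc mult.commute)
  have Neh: "nehari p \<mu> \<Omega> g = V.Neh"
  proof -
    have "E_form p u u = (LINT x|?M. g x (u x) * u x) + \<mu> * (LINT x|?M. \<bar>u x\<bar> powr p * ln \<bar>u x\<bar>) \<longleftrightarrow> V.Nh u = 0"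
      if "u \<in> V.X" for u
      using weak_eq[OF that that] unfolding V.Nh_def V.A_self hu by linarith
    then show ?thesis unfolding nehari_def V.Neh_def X nontrivial_def by blast
  qed
  have J: "J_energy p \<mu> \<Omega> g u = V.J u" if u: "u \<in> V.X" for u
  proof -
    have iG: "integrable ?M (\<lambda>x. primitive g0 x (u x))"
      by (rule V.integrable_antiderivative[OF G0_meas G0_deriv primitive_zero growth_g0 u])
    have iK: "integrable ?M (\<lambda>x. k x / p * \<bar>u x\<bar> powr p)"
    proof -
      have "(\<lambda>x. k x / p * \<bar>u x\<bar> powr p) = (\<lambda>x. (k x * h p (u x) * u x) / p)"
        by (simp add: mult.assoc h_mult_self)
      then show ?thesis using integrable_divide[OF int_k[OF u u], of p] by (simp only:)
    qed
    have iL: "integrable ?M (\<lambda>x. \<bar>u x\<bar> powr p * (ln (\<bar>u x\<bar> powr p) - 1))"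
    proof -
      have "\<bar>u x\<bar> powr p * (ln (\<bar>u x\<bar> powr p) - 1) = p * (h p (u x) * ln \<bar>u x\<bar> * u x) - \<bar>u x\<bar> powr p" for x
        unfolding hu by (cases "u x = 0") (auto simp: ln_powr algebra_simps)
      then show ?thesis using int_ln[OF u u] V.X_Lp[OF u] by simp
    qed
    have e1: "(LINT x|?M. H x (u x)) = (LINT x|?M. primitive g0 x (u x)) + (LINT x|?M. k x / p * \<bar>u x\<bar> powr p)
       + \<mu> / p\<^sup>2 * (LINT x|?M. \<bar>u x\<bar> powr p * (ln (\<bar>u x\<bar> powr p) - 1))"
      unfolding H_def using iG iK iL
      by (subst Bochner_Integration.integral_add, simp, simp, subst Bochner_Integration.integral_add) auto
    have e2: "(LINT x|?M. k x / p * \<bar>u x\<bar> powr p) = 1 / p * (LINT x|?M. k x * (h p (u x) * u x))"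
      by (simp add: h_mult_self flip: integral_mult_right_zero)
    have e3: "(LINT x|?M. primitive g x (u x)) = (LINT x|?M. primitive g0 x (u x))"
    proof (rule integral_cong_AE[OF _ borel_measurable_integrable[OF iG]])
      have ae: "AE x in ?M. primitive g0 x (u x) = primitive g x (u x)"
        using AE_Z by eventually_elim (simp add: primitive_def g0_def)
      show "AE x in ?M. primitive g x (u x) = primitive g0 x (u x)"
        using AE_Z by eventually_elim (simp add: primitive_def g0_def)
      show "(\<lambda>x. primitive g x (u x)) \<in> borel_measurable ?M"
        by (rule borel_measurable_lebesgue_on_AE[OF \<Omega>_sets borel_measurable_integrable[OF iG] ae])
    qed
    have e4: "E_form p u u = V.Q u - (LINT x|?M. k x * (h p (u x) * u x))"
      using E_form_eq[OF fd, of u u] u unfolding X V.A_self[symmetric] V.A_def k_def by simp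
    have alg: "1 / p * (q - K) - G - L = q / p - (G + 1 / p * K + L)" for q K G L :: real
      by (simp add: diff_divide_distrib)
    show ?thesis
      unfolding J_energy_def V.J_def e1 e2 e3 e4 by (rule alg)
  qed
  have least: "least_energy_solution p \<mu> \<Omega> g u" if u: "u \<in> V.Neh" and min: "\<And>w. w \<in> V.Neh \<Longrightarrow> V.J u \<le> V.J w" for u
  proof -
    have uX: "u \<in> V.X" using u by (simp add: V.Neh_def)
    have NX: "w \<in> V.X" if "w \<in> V.Neh" for w using that by (simp add: V.Neh_def)
    have "weak_solution p \<mu> \<Omega> g u"
      unfolding weak_solution_def X
    proof (intro conjI ballI uX)
      fix v assume v: "v \<in> V.X"
      have "V.A u v = V.F u v" by (rule V.minimizer_weak[OF u min v])
      then show "E_form p u v = (LINT x|?M. g x (u x) * v x) + \<mu> * (LINT x|?M. h p (u x) * ln \<bar>u x\<bar> * v x)"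
        using weak_eq[OF uX v] by linarith
    qed
    moreover have "ereal (J_energy p \<mu> \<Omega> g u) = (INF v\<in>nehari p \<mu> \<Omega> g. ereal (J_energy p \<mu> \<Omega> g v))"
      unfolding Neh
    proof (rule antisym)
      show "ereal (J_energy p \<mu> \<Omega> g u) \<le> (INF v\<in>V.Neh. ereal (J_energy p \<mu> \<Omega> g v))"
        by (rule INF_greatest) (simp add: J uX NX min)
      show "(INF v\<in>V.Neh. ereal (J_energy p \<mu> \<Omega> g v)) \<le> ereal (J_energy p \<mu> \<Omega> g u)"
        by (rule INF_lower[OF u])
    qed
    ultimately show ?thesis by (simp add: least_energy_solution_def)
  qed
  have sign: "constant_sign \<Omega> u" if even: "AE x in ?M. even_bound x" and u: "least_energy_solution p \<mu> \<Omega> g u" for u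
  \<comment> \<open>The zero function has constant sign trivially. Any other least energy solution
    is a Nehari point, as testing the equation with \<open>u\<close> itself shows.\<close>
  proof (cases "AE x in lebesgue. u x = 0")
    case True
    then have "AE x in lebesgue. 0 \<le> u x" by eventually_elim simp
    then have "AE x in ?M. 0 \<le> u x" by (rule V.AE_M)
    then show ?thesis by (simp add: constant_sign_def)
  next
    case False
    have uX: "u \<in> V.X" and ws: "\<And>v. v \<in> V.X \<Longrightarrow> E_form p u v = (LINT x|?M. g x (u x) * v x) + \<mu> * (LINT x|?M. h p (u x) * ln \<bar>u x\<bar> * v x)"
      using u unfolding least_energy_solution_def weak_solution_def X by auto
    have "V.Nh u = 0" using weak_eq[OF uX uX] ws[OF uX] unfolding V.Nh_def V.A_self by linarith
    then have uN: "u \<in> V.Neh" using uX False by (simp add: V.Neh_def)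
    have min: "V.J u \<le> V.J w" if w: "w \<in> V.Neh" for w
    proof -
      have wX: "w \<in> V.X" using w by (simp add: V.Neh_def)
      have "ereal (J_energy p \<mu> \<Omega> g u) = (INF v\<in>V.Neh. ereal (J_energy p \<mu> \<Omega> g v))"
        using u unfolding least_energy_solution_def Neh by blast
      also have "\<dots> \<le> ereal (J_energy p \<mu> \<Omega> g w)" by (rule INF_lower[OF w])
      finally show ?thesis by (simp add: J uX wX)
    qed
    have "H x t \<le> H x \<bar>t\<bar>" if x: "x \<in> \<Omega>" for x t
    proof -
      have "primitive g0 x t \<le> primitive g0 x \<bar>t\<bar>"
      proof (cases "x \<in> Z")
        case True
        then show ?thesis by (simp add: primitive_def g0_def interval_lebesgue_integral_def)
      next
        case False
        then have "even_bound x" using good[OF x] even by (simp add: good_def)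
        then show ?thesis using False by (simp add: primitive_def g0_def even_bound_def)
      qed
      then show ?thesis by (simp add: H_def)
    qed
    from V.minimizer_sign[OF uN min this] show ?thesis by (simp add: constant_sign_def)
  qed
  \<comment> \<open>A nonzero element of the energy space; a Nehari point exists on its ray, so the
    minimization is over a nonempty set.\<close>
  obtain u0 c0 where u0: "u0 \<in> borel_measurable lebesgue" "\<And>x. \<bar>u0 x\<bar> \<le> c0" "\<And>x. x \<notin> \<Omega> \<Longrightarrow> u0 x = 0"
    "\<not> (AE x in lebesgue. u0 x = 0)"
    "near_energy p u0 < \<infinity>"
    using bump_function[OF p \<Omega>_props(1,2)] by blast
  have u0_int: "integrable ?M (\<lambda>x. \<bar>u0 x\<bar> powr p)"
  proof (rule V.M.integrable_const_bound[of _ "c0 powr p"])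
    show "AE x in ?M. norm (\<bar>u0 x\<bar> powr p) \<le> c0 powr p"
      using u0(2) p by (intro AE_I2) (simp add: powr_mono2)
    show "(\<lambda>x. \<bar>u0 x\<bar> powr p) \<in> borel_measurable ?M"
      by (rule measurable_restrict_space1) (use u0(1) in measurable)
  qed
  have "integrable lebesgue (\<lambda>x. \<bar>u0 x\<bar> powr p)"
    by (rule D.integrable_extend(1)[OF _ _ u0_int]) (use u0(1,3) in auto)
  then have "u0 \<in> V.X"
    unfolding V.X_def using u0 u0_int D.total_integrable_iff[OF u0(1)] by simp
  then obtain u where u: "u \<in> V.Neh" "\<And>w. w \<in> V.Neh \<Longrightarrow> V.J u \<le> V.J w"
    using V.minimizer_exists u0(4) by blast
  have "nontrivial u" using u(1) by (simp add: V.Neh_def nontrivial_def)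
  with least[OF u] have "\<exists>u. least_energy_solution p \<mu> \<Omega> g u \<and> nontrivial u" by blast
  moreover have "(AE x in ?M. \<forall>t. primitive g x t \<le> primitive g x \<bar>t\<bar>) \<longrightarrow> (\<forall>u. least_energy_solution p \<mu> \<Omega> g u \<longrightarrow> constant_sign \<Omega> u)"
    using sign unfolding even_bound_def by blast
  ultimately show ?thesis by (rule conjI)
qed

end
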